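(* Let $\mathfrak k$ be a semisimple bundle of ideals of a Lie algebroid $A\Rightarrow M$. Then: (i) The simplicial differential $\delta^0\colon\Omega^\bullet(M;\mathfrak k)\to\Omega^\bullet_{im}(A;\mathfrak k)^{\mathrm{Hor}}$ is an isomorphism. (ii) Any IM connection $(\mathcal C,v)$ for $\mathfrak k$ is uniquely primitive, with vanishing 3-curvature; that is, there is a unique $F\in\Omega^2(M;\mathfrak k)$ with $\Omega^{(\mathcal C,v)}=\delta^0F$, and it satisfies $\mathrm d^\nabla F=0$, where $\nabla=\mathcal C|_{\mathfrak k}$. (iii) There is a bijective correspondence, $(\mathcal C,v)\mapsto(v,\mathcal C|_{\mathfrak k})$, between the set $\mathcal A(A;\mathfrak k)$ of IM connections and the set of pairs $(v,\nabla)$, where $v\colon A\to\mathfrak k$ is a splitting (vector bundle map with $v|_{\mathfrak k}=\mathrm{id}$) and $\nabla$ is a bracket-preserving linear connection on $\mathfrak k$, such that $\nabla^A_{h(\alpha)}=\nabla_{\rho(\alpha)}$ for all $\alpha\in A$.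
   Context: $\rho$ is the anchor of $A$. A bundle of ideals is a vector subbundle $\mathfrak k\subset\ker\rho\subset A$ with $[\Gamma(A),\Gamma(\mathfrak k)]\subset\Gamma(\mathfrak k)$; it is a bundle of Lie algebras and a representation of $A$ via $\nabla^A_\alpha\xi=[\alpha,\xi]$. It is semisimple if it is a locally trivial bundle of Lie algebras with semisimple typical fibre. For a splitting $v$, $h=\mathrm{id}_A-v$. A connection $\nabla$ on $\mathfrak k$ is bracket-preserving if $\nabla_X[\xi,\eta]=[\nabla_X\xi,\eta]+[\xi,\nabla_X\eta]$. $W^{1,q}(A;\mathfrak k)$ consists of pairs $c=(c_0,c_1)$, $c_0\colon\Gamma(A)\to\Omega^q(M;\mathfrak k)$ $\mathbb R$-linear, $c_1\colon\Gamma(A)\to\Omega^{q-1}(M;\mathfrak k)$ $C^\infty(M)$-linear, with $c_0(f\alpha)=fc_0(\alpha)+\mathrm df\wedge c_1(\alpha)$. With $(\mathcal L^A_\alpha\gamma)(\underline X)=[\alpha,\gamma(\underline X)]-\sum_j\gamma(\dots,[\rho(\alpha),X_j],\dots)$ on $\Omega^\bullet(M;\mathfrak k)$, $c$ is an IM form, $c\in\Omega^q_{im}(A;\mathfrak k)$, if $c_0[\alpha,\beta]=\mathcal L^A_\alpha c_0(\beta)-\mathcal L^A_\beta c_0(\alpha)$, $c_1[\alpha,\beta]=\mathcal L^A_\alpha c_1(\beta)-\iota_{\rho(\beta)}c_0(\alpha)$, $\iota_{\rho(\alpha)}c_1(\beta)=-\iota_{\rho(\beta)}c_1(\alpha)$;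 it is horizontal (superscript $\mathrm{Hor}$) if $c_1|_{\mathfrak k}=0$. $\delta^0\gamma=(\alpha\mapsto\mathcal L^A_\alpha\gamma,\ \alpha\mapsto\iota_{\rho(\alpha)}\gamma)$. $\mathcal A(A;\mathfrak k)$ is the set of $(\mathcal C,v)\in\Omega^1_{im}(A;\mathfrak k)$ with $v|_{\mathfrak k}=\mathrm{id}$. The induced connection on $\mathfrak k$ is $\nabla_X\xi=\mathcal C(\xi)(X)$, and the curvature $\Omega^{(\mathcal C,v)}\in\Omega^2_{im}(A;\mathfrak k)^{\mathrm{Hor}}$ of $(\mathcal C,v)$ is $\Omega^{(\mathcal C,v)}(\alpha)=\big(\mathrm d^\nabla\mathcal C(\alpha),\mathcal C(h\alpha)\big)$. $(\mathcal C,v)$ is primitive if $\Omega^{(\mathcal C,v)}=\delta^0F$ for some $F\in\Omega^2(M;\mathfrak k)$, called a curving; its 3-curvature is $\mathrm d^\nabla F$. *)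

theory Defs
  imports "HOL-Analysis.Analysis"
begin

section \<open>Smooth manifolds\<close>

text \<open>The model space is the library's \<open>Euclidean_space n\<close>: sequences vanishing from index \<open>n\<close> on.
  In contrast to a type of class \<open>euclidean_space\<close> this includes \<open>n = 0\<close>. Functions of class
  \<open>C^k\<close> on an open subset are defined by iterated continuous partial derivatives.\<close>

primrec Ck_on :: "nat \<Rightarrow> nat \<Rightarrow> (nat \<Rightarrow> real) set \<Rightarrow> ((nat \<Rightarrow> real) \<Rightarrow> real) \<Rightarrow> bool" where
  "Ck_on n 0 U f \<longleftrightarrow> continuous_map (subtopology (Euclidean_space n) U) euclideanreal f"
| "Ck_on n (Suc k) U f \<longleftrightarrow>
     continuous_map (subtopology (Euclidean_space n) U) euclideanreal f \<and>
     (\<forall>i<n. \<exists>g. (\<forall>x\<in>U. ((\<lambda>t. f (x(i := t))) has_real_derivative g x) (at (x i))) \<and> Ck_on n k U g)"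

definition Cinf_on :: "nat \<Rightarrow> (nat \<Rightarrow> real) set \<Rightarrow> ((nat \<Rightarrow> real) \<Rightarrow> real) \<Rightarrow> bool" where
  "Cinf_on n U f \<longleftrightarrow> (\<forall>k. Ck_on n k U f)"

text \<open>The underlying topological space of a manifold is the whole type \<open>'m\<close>. A chart is an open
  set with a map to \<open>\<real>\<^sup>n\<close>; the atlas need not be maximal.\<close>

record 'm manifold_data =
  mdim :: nat
  atlas :: "('m set \<times> ('m \<Rightarrow> nat \<Rightarrow> real)) set"

definition smooth_manifold ::
    "('m::{t2_space,second_countable_topology}, 'x) manifold_data_scheme \<Rightarrow> bool" where
  "smooth_manifold M \<longleftrightarrow>
     (\<forall>(U, \<phi>)\<in>atlas M. open U \<and> openin (Euclidean_space (mdim M)) (\<phi> ` U) \<and>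
        homeomorphic_map (top_of_set U) (subtopology (Euclidean_space (mdim M)) (\<phi> ` U)) \<phi>) \<and>
     (\<Union>(U, \<phi>)\<in>atlas M. U) = UNIV \<and>
     (\<forall>(U, \<phi>)\<in>atlas M. \<forall>(V, \<psi>)\<in>atlas M. \<forall>i<mdim M.
        Cinf_on (mdim M) (\<phi> ` (U \<inter> V)) (\<lambda>y. \<psi> (inv_into U \<phi> y) i))"

definition smooth_on :: "('m, 'x) manifold_data_scheme \<Rightarrow> 'm set \<Rightarrow> ('m \<Rightarrow> real) \<Rightarrow> bool" where
  "smooth_on M W f \<longleftrightarrow> (\<forall>(U, \<phi>)\<in>atlas M. Cinf_on (mdim M) (\<phi> ` (U \<inter> W)) (f \<circ> inv_into U \<phi>))"

definition Cinf :: "('m, 'x) manifold_data_scheme \<Rightarrow> ('m \<Rightarrow> real) set" where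
  "Cinf M = {f. smooth_on M UNIV f}"

text \<open>Tangent vectors at \<open>p\<close> are the derivations at \<open>p\<close> of the algebra of smooth functions. As HOL
  functions are total, they are made to vanish on non-smooth functions, so that equality of
  tangent vectors is equality of derivations. The same convention (value zero outside the proper
  domain) is used below for vector fields, forms, cochains, connections and bundle maps.\<close>

definition tangent_space :: "('m, 'x) manifold_data_scheme \<Rightarrow> 'm \<Rightarrow> (('m \<Rightarrow> real) \<Rightarrow> real) set" where
  "tangent_space M p = {w.
     (\<forall>f\<in>Cinf M. \<forall>g\<in>Cinf M. \<forall>a b. w (\<lambda>x. a * f x + b * g x) = a * w f + b * w g) \<and>
     (\<forall>f\<in>Cinf M. \<forall>g\<in>Cinf M. w (\<lambda>x. f x * g x) = f p * w g + g p * w f) \<and>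
     (\<forall>f. f \<notin> Cinf M \<longrightarrow> w f = 0)}"

type_synonym 'm vfield = "'m \<Rightarrow> ('m \<Rightarrow> real) \<Rightarrow> real"

definition vector_fields :: "('m, 'x) manifold_data_scheme \<Rightarrow> 'm vfield set" where
  "vector_fields M =
     {X. (\<forall>p. X p \<in> tangent_space M p) \<and> (\<forall>f\<in>Cinf M. (\<lambda>p. X p f) \<in> Cinf M)}"

definition vf_bracket :: "('m, 'x) manifold_data_scheme \<Rightarrow> 'm vfield \<Rightarrow> 'm vfield \<Rightarrow> 'm vfield" where
  "vf_bracket M X Y = (\<lambda>p f. if f \<in> Cinf M
     then X p (\<lambda>x. Y x f) - Y p (\<lambda>x. X x f) else 0)"

section \<open>Vector bundles\<close>

text \<open>The fibres are linear subspaces of one ambient real vector space \<open>'a\<close>. This is no restriction,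
  since any family of vector spaces embeds into its direct sum; the fibres over distinct points
  are unrelated, the total space being the disjoint union. The smooth structure is given by
  local frames (equivalently, local trivialisations) with smooth transition functions.\<close>

record ('m, 'a) vbundle_data = "'m manifold_data" +
  fibre :: "'m \<Rightarrow> 'a set"
  bundle_rank :: nat
  frames :: "('m set \<times> (nat \<Rightarrow> 'm \<Rightarrow> 'a)) set"

definition is_basis :: "nat \<Rightarrow> (nat \<Rightarrow> 'a::real_vector) \<Rightarrow> 'a set \<Rightarrow> bool" where
  "is_basis r b V \<longleftrightarrow> inj_on b {..<r} \<and> independent (b ` {..<r}) \<and> span (b ` {..<r}) = V"

definition smooth_section_on ::
    "('m, 'a::real_vector, 'x) vbundle_data_scheme \<Rightarrow> 'm set \<Rightarrow> ('m \<Rightarrow> 'a) \<Rightarrow> bool" where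
  "smooth_section_on E W s \<longleftrightarrow> (\<forall>(U, e)\<in>frames E. \<exists>c.
     (\<forall>i<bundle_rank E. smooth_on E (U \<inter> W) (c i)) \<and>
     (\<forall>x\<in>U \<inter> W. s x = (\<Sum>i<bundle_rank E. c i x *\<^sub>R e i x)))"

definition vector_bundle ::
    "('m::{t2_space,second_countable_topology}, 'a::real_vector, 'x) vbundle_data_scheme \<Rightarrow> bool" where
  "vector_bundle E \<longleftrightarrow> smooth_manifold E \<and>
     (\<forall>p. subspace (fibre E p)) \<and>
     (\<forall>(U, e)\<in>frames E. open U \<and> (\<forall>x\<in>U. is_basis (bundle_rank E) (\<lambda>i. e i x) (fibre E x))) \<and>
     (\<Union>(U, e)\<in>frames E. U) = UNIV \<and>
     (\<forall>(U, e)\<in>frames E. \<forall>i<bundle_rank E. smooth_section_on E U (e i))"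

definition sections :: "('m, 'a::real_vector, 'x) vbundle_data_scheme \<Rightarrow> ('m \<Rightarrow> 'a) set" where
  "sections E = {s. smooth_section_on E UNIV s}"

definition subbundle ::
    "('m::topological_space, 'a::real_vector, 'x) vbundle_data_scheme \<Rightarrow> ('m \<Rightarrow> 'a set) \<Rightarrow> bool" where
  "subbundle E K \<longleftrightarrow> (\<forall>p. subspace (K p) \<and> K p \<subseteq> fibre E p) \<and>
     (\<exists>r. \<forall>p. \<exists>U e. open U \<and> p \<in> U \<and> (\<forall>i<r. smooth_section_on E U (e i)) \<and>
        (\<forall>x\<in>U. is_basis r (\<lambda>i. e i x) (K x)))"

definition sub_sections ::
    "('m, 'a::real_vector, 'x) vbundle_data_scheme \<Rightarrow> ('m \<Rightarrow> 'a set) \<Rightarrow> ('m \<Rightarrow> 'a) set" where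
  "sub_sections E K = {s \<in> sections E. \<forall>p. s p \<in> K p}"

section \<open>Lie algebroids and bundles of ideals\<close>

record ('m, 'a) algebroid_data = "('m, 'a) vbundle_data" +
  anchor :: "'m \<Rightarrow> 'a \<Rightarrow> ('m \<Rightarrow> real) \<Rightarrow> real"
  bracket :: "('m \<Rightarrow> 'a) \<Rightarrow> ('m \<Rightarrow> 'a) \<Rightarrow> 'm \<Rightarrow> 'a"

definition rho :: "('m, 'a, 'x) algebroid_data_scheme \<Rightarrow> ('m \<Rightarrow> 'a) \<Rightarrow> 'm vfield" where
  "rho A \<alpha> = (\<lambda>p. anchor A p (\<alpha> p))"

definition lie_algebroid ::
    "('m::{t2_space,second_countable_topology}, 'a::real_vector, 'x) algebroid_data_scheme \<Rightarrow> bool" where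
  "lie_algebroid A \<longleftrightarrow> vector_bundle A \<and>
     (\<forall>p. \<forall>u\<in>fibre A p. anchor A p u \<in> tangent_space A p) \<and>
     (\<forall>p. \<forall>u\<in>fibre A p. \<forall>w\<in>fibre A p. \<forall>a b f.
        anchor A p (a *\<^sub>R u + b *\<^sub>R w) f = a * anchor A p u f + b * anchor A p w f) \<and>
     (\<forall>\<alpha>\<in>sections A. rho A \<alpha> \<in> vector_fields A) \<and>
     (\<forall>\<alpha>\<in>sections A. \<forall>\<beta>\<in>sections A. bracket A \<alpha> \<beta> \<in> sections A) \<and>
     (\<forall>\<alpha>\<in>sections A. \<forall>\<beta>\<in>sections A. \<forall>\<delta>\<in>sections A. \<forall>a b.
        bracket A \<alpha> (\<lambda>p. a *\<^sub>R \<beta> p + b *\<^sub>R \<delta> p)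
          = (\<lambda>p. a *\<^sub>R bracket A \<alpha> \<beta> p + b *\<^sub>R bracket A \<alpha> \<delta> p)) \<and>
     (\<forall>\<alpha>\<in>sections A. \<forall>\<beta>\<in>sections A. bracket A \<alpha> \<beta> = (\<lambda>p. - bracket A \<beta> \<alpha> p)) \<and>
     (\<forall>\<alpha>\<in>sections A. \<forall>\<beta>\<in>sections A. \<forall>\<delta>\<in>sections A.
        bracket A \<alpha> (bracket A \<beta> \<delta>)
          = (\<lambda>p. bracket A (bracket A \<alpha> \<beta>) \<delta> p + bracket A \<beta> (bracket A \<alpha> \<delta>) p)) \<and>
     (\<forall>\<alpha>\<in>sections A. \<forall>\<beta>\<in>sections A. \<forall>f\<in>Cinf A.
        bracket A \<alpha> (\<lambda>p. f p *\<^sub>R \<beta> p)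
          = (\<lambda>p. f p *\<^sub>R bracket A \<alpha> \<beta> p + rho A \<alpha> p f *\<^sub>R \<beta> p))"

definition bundle_of_ideals ::
    "('m::topological_space, 'a::real_vector, 'x) algebroid_data_scheme \<Rightarrow> ('m \<Rightarrow> 'a set) \<Rightarrow> bool" where
  "bundle_of_ideals A K \<longleftrightarrow> subbundle A K \<and>
     (\<forall>p. \<forall>u\<in>K p. \<forall>f. anchor A p u f = 0) \<and>
     (\<forall>\<alpha>\<in>sections A. \<forall>\<xi>\<in>sub_sections A K. bracket A \<alpha> \<xi> \<in> sub_sections A K)"

text \<open>As \<open>K\<close> lies in the kernel of the anchor, the bracket of its sections is bilinear over smooth
  functions, so the value of \<open>bracket A \<xi> \<eta>\<close> at \<open>p\<close> depends only on the values of \<open>\<xi>\<close>, \<open>\<eta>\<close> at \<open>p\<close>;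
  any choice of sections through the given vectors yields the fibre bracket.\<close>

definition fibre_bracket ::
    "('m, 'a::real_vector, 'x) algebroid_data_scheme \<Rightarrow> ('m \<Rightarrow> 'a set) \<Rightarrow> 'm \<Rightarrow> 'a \<Rightarrow> 'a \<Rightarrow> 'a" where
  "fibre_bracket A K p u w =
     bracket A (SOME \<xi>. \<xi> \<in> sub_sections A K \<and> \<xi> p = u) (SOME \<eta>. \<eta> \<in> sub_sections A K \<and> \<eta> p = w) p"

section \<open>Semisimple Lie algebras and semisimple bundles of ideals\<close>

definition lie_algebra_on :: "'g::real_vector set \<Rightarrow> ('g \<Rightarrow> 'g \<Rightarrow> 'g) \<Rightarrow> bool" where
  "lie_algebra_on V br \<longleftrightarrow> subspace V \<and>
     (\<forall>x\<in>V. \<forall>y\<in>V. br x y \<in> V) \<and>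
     (\<forall>x\<in>V. \<forall>y\<in>V. \<forall>z\<in>V. \<forall>a b. br x (a *\<^sub>R y + b *\<^sub>R z) = a *\<^sub>R br x y + b *\<^sub>R br x z) \<and>
     (\<forall>x\<in>V. \<forall>y\<in>V. br x y = - br y x) \<and>
     (\<forall>x\<in>V. \<forall>y\<in>V. \<forall>z\<in>V. br x (br y z) = br (br x y) z + br y (br x z))"

definition lie_ideal :: "'g::real_vector set \<Rightarrow> ('g \<Rightarrow> 'g \<Rightarrow> 'g) \<Rightarrow> 'g set \<Rightarrow> bool" where
  "lie_ideal V br I \<longleftrightarrow> subspace I \<and> I \<subseteq> V \<and> (\<forall>x\<in>V. \<forall>y\<in>I. br x y \<in> I)"

definition derived_algebra :: "('g::real_vector \<Rightarrow> 'g \<Rightarrow> 'g) \<Rightarrow> 'g set \<Rightarrow> 'g set" where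
  "derived_algebra br I = span {br x y | x y. x \<in> I \<and> y \<in> I}"

definition solvable_on :: "('g::real_vector \<Rightarrow> 'g \<Rightarrow> 'g) \<Rightarrow> 'g set \<Rightarrow> bool" where
  "solvable_on br I \<longleftrightarrow> (\<exists>k. (derived_algebra br ^^ k) I = {0})"

definition semisimple_lie_algebra :: "'g::real_vector set \<Rightarrow> ('g \<Rightarrow> 'g \<Rightarrow> 'g) \<Rightarrow> bool" where
  "semisimple_lie_algebra V br \<longleftrightarrow> lie_algebra_on V br \<and>
     (\<forall>I. lie_ideal V br I \<and> solvable_on br I \<longrightarrow> I = {0})"

text \<open>The typical fibre is taken in the ambient space \<open>'a\<close>: being isomorphic to each fibre of \<open>K\<close>, it
  can always be realised there (and is finite-dimensional). A local trivialisation over \<open>U\<close> is a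
  family of Lie algebra isomorphisms from \<open>g\<close> to the fibres, smooth in the base point.\<close>

definition semisimple_bundle ::
    "('m::topological_space, 'a::real_vector, 'x) algebroid_data_scheme \<Rightarrow> ('m \<Rightarrow> 'a set) \<Rightarrow> bool" where
  "semisimple_bundle A K \<longleftrightarrow> (\<exists>(g :: 'a set) br. semisimple_lie_algebra g br \<and>
     (\<forall>p. \<exists>U \<psi>. open U \<and> p \<in> U \<and>
        (\<forall>u\<in>g. smooth_section_on A U (\<lambda>x. \<psi> x u)) \<and>
        (\<forall>x\<in>U. bij_betw (\<psi> x) g (K x) \<and>
           (\<forall>u\<in>g. \<forall>w\<in>g. \<forall>a b. \<psi> x (a *\<^sub>R u + b *\<^sub>R w) = a *\<^sub>R \<psi> x u + b *\<^sub>R \<psi> x w) \<and>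
           (\<forall>u\<in>g. \<forall>w\<in>g. \<psi> x (br u w) = fibre_bracket A K x (\<psi> x u) (\<psi> x w)))))"

section \<open>Differential forms with values in a bundle of ideals\<close>

text \<open>A \<open>q\<close>-form with values in \<open>K\<close> is an alternating map, multilinear over smooth functions, from
  \<open>q\<close> vector fields to sections of \<open>K\<close>. Arguments are lists; the value is zero on any list that
  does not consist of \<open>q\<close> vector fields. In particular a 0-form \<open>\<gamma>\<close> amounts to the section \<open>\<gamma> []\<close>.\<close>

type_synonym ('m, 'a) form = "'m vfield list \<Rightarrow> 'm \<Rightarrow> 'a"

definition zero_form :: "('m, 'a::real_vector) form" where
  "zero_form = (\<lambda>Xs p. 0)"

definition form_comb ::
    "real \<Rightarrow> ('m, 'a::real_vector) form \<Rightarrow> real \<Rightarrow> ('m, 'a) form \<Rightarrow> ('m, 'a) form" where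
  "form_comb a \<gamma> b \<eta> = (\<lambda>Xs p. a *\<^sub>R \<gamma> Xs p + b *\<^sub>R \<eta> Xs p)"

definition forms ::
    "('m, 'a::real_vector, 'x) algebroid_data_scheme \<Rightarrow> ('m \<Rightarrow> 'a set) \<Rightarrow> nat \<Rightarrow> ('m, 'a) form set" where
  "forms A K q = {\<gamma>.
     (\<forall>Xs. \<not> (set Xs \<subseteq> vector_fields A \<and> length Xs = q) \<longrightarrow> \<gamma> Xs = (\<lambda>p. 0)) \<and>
     (\<forall>Xs. set Xs \<subseteq> vector_fields A \<and> length Xs = q \<longrightarrow> \<gamma> Xs \<in> sub_sections A K \<and>
        (\<forall>i<q. \<forall>X\<in>vector_fields A. \<forall>Y\<in>vector_fields A. \<forall>f\<in>Cinf A. \<forall>g\<in>Cinf A.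
           \<gamma> (Xs[i := (\<lambda>p h. f p * X p h + g p * Y p h)])
             = (\<lambda>p. f p *\<^sub>R \<gamma> (Xs[i := X]) p + g p *\<^sub>R \<gamma> (Xs[i := Y]) p)) \<and>
        (\<forall>i<q. \<forall>j<q. i \<noteq> j \<and> Xs ! i = Xs ! j \<longrightarrow> \<gamma> Xs = (\<lambda>p. 0)))}"

text \<open>Forms of degree \<open>q - 1\<close>; there are no nonzero forms of degree \<open>-1\<close>.\<close>

definition forms_pred ::
    "('m, 'a::real_vector, 'x) algebroid_data_scheme \<Rightarrow> ('m \<Rightarrow> 'a set) \<Rightarrow> nat \<Rightarrow> ('m, 'a) form set" where
  "forms_pred A K q = (case q of 0 \<Rightarrow> {zero_form} | Suc p \<Rightarrow> forms A K p)"

definition contract :: "'m vfield \<Rightarrow> ('m, 'a) form \<Rightarrow> ('m, 'a) form" where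
  "contract X \<gamma> = (\<lambda>Xs. \<gamma> (X # Xs))"

definition omit :: "nat \<Rightarrow> 'b list \<Rightarrow> 'b list" where
  "omit i xs = take i xs @ drop (Suc i) xs"

text \<open>The wedge product of the 1-form \<open>df\<close> with a \<open>K\<close>-valued form.\<close>

definition d_wedge ::
    "('m, 'a::real_vector, 'x) algebroid_data_scheme \<Rightarrow> ('m \<Rightarrow> real) \<Rightarrow> ('m, 'a) form \<Rightarrow> ('m, 'a) form" where
  "d_wedge A f \<gamma> = (\<lambda>Xs p. if set Xs \<subseteq> vector_fields A
     then \<Sum>i<length Xs. ((-1) ^ i * (Xs ! i) p f) *\<^sub>R \<gamma> (omit i Xs) p else 0)"

definition lie_der ::
    "('m, 'a::real_vector, 'x) algebroid_data_scheme \<Rightarrow> ('m \<Rightarrow> 'a) \<Rightarrow> ('m, 'a) form \<Rightarrow> ('m, 'a) form" where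
  "lie_der A \<alpha> \<gamma> = (\<lambda>Xs p. if set Xs \<subseteq> vector_fields A
     then bracket A \<alpha> (\<gamma> Xs) p
       - (\<Sum>j<length Xs. \<gamma> (Xs[j := vf_bracket A (rho A \<alpha>) (Xs ! j)]) p)
     else 0)"

section \<open>Connections on a bundle of ideals\<close>

type_synonym ('m, 'a) connection = "'m vfield \<Rightarrow> ('m \<Rightarrow> 'a) \<Rightarrow> 'm \<Rightarrow> 'a"

definition linear_connection ::
    "('m, 'a::real_vector, 'x) algebroid_data_scheme \<Rightarrow> ('m \<Rightarrow> 'a set) \<Rightarrow> ('m, 'a) connection \<Rightarrow> bool" where
  "linear_connection A K D \<longleftrightarrow>
     (\<forall>X \<xi>. \<not> (X \<in> vector_fields A \<and> \<xi> \<in> sub_sections A K) \<longrightarrow> D X \<xi> = (\<lambda>p. 0)) \<and>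
     (\<forall>X\<in>vector_fields A. \<forall>\<xi>\<in>sub_sections A K. D X \<xi> \<in> sub_sections A K) \<and>
     (\<forall>X\<in>vector_fields A. \<forall>Y\<in>vector_fields A. \<forall>f\<in>Cinf A. \<forall>g\<in>Cinf A. \<forall>\<xi>\<in>sub_sections A K.
        D (\<lambda>p h. f p * X p h + g p * Y p h) \<xi> = (\<lambda>p. f p *\<^sub>R D X \<xi> p + g p *\<^sub>R D Y \<xi> p)) \<and>
     (\<forall>X\<in>vector_fields A. \<forall>\<xi>\<in>sub_sections A K. \<forall>\<eta>\<in>sub_sections A K.
        D X (\<lambda>p. \<xi> p + \<eta> p) = (\<lambda>p. D X \<xi> p + D X \<eta> p)) \<and>
     (\<forall>X\<in>vector_fields A. \<forall>\<xi>\<in>sub_sections A K. \<forall>f\<in>Cinf A.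
        D X (\<lambda>p. f p *\<^sub>R \<xi> p) = (\<lambda>p. f p *\<^sub>R D X \<xi> p + X p f *\<^sub>R \<xi> p))"

definition bracket_preserving ::
    "('m, 'a::real_vector, 'x) algebroid_data_scheme \<Rightarrow> ('m \<Rightarrow> 'a set) \<Rightarrow> ('m, 'a) connection \<Rightarrow> bool" where
  "bracket_preserving A K D \<longleftrightarrow>
     (\<forall>X\<in>vector_fields A. \<forall>\<xi>\<in>sub_sections A K. \<forall>\<eta>\<in>sub_sections A K.
        D X (bracket A \<xi> \<eta>) = (\<lambda>p. bracket A (D X \<xi>) \<eta> p + bracket A \<xi> (D X \<eta>) p))"

text \<open>The exterior covariant derivative, by the Koszul formula.\<close>

definition d_conn ::
    "('m, 'a::real_vector, 'x) algebroid_data_scheme \<Rightarrow> ('m, 'a) connection \<Rightarrow> ('m, 'a) form \<Rightarrow> ('m, 'a) form" where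
  "d_conn A D \<gamma> = (\<lambda>Xs p. if set Xs \<subseteq> vector_fields A
     then (\<Sum>i<length Xs. (-1) ^ i *\<^sub>R D (Xs ! i) (\<gamma> (omit i Xs)) p)
       + (\<Sum>j<length Xs. \<Sum>i<j. (-1) ^ (i + j) *\<^sub>R
            \<gamma> (vf_bracket A (Xs ! i) (Xs ! j) # omit i (omit j Xs)) p)
     else 0)"

section \<open>Infinitesimal multiplicative forms\<close>

type_synonym ('m, 'a) cochain =
  "(('m \<Rightarrow> 'a) \<Rightarrow> ('m, 'a) form) \<times> (('m \<Rightarrow> 'a) \<Rightarrow> ('m, 'a) form)"

definition W1 ::
    "('m, 'a::real_vector, 'x) algebroid_data_scheme \<Rightarrow> ('m \<Rightarrow> 'a set) \<Rightarrow> nat \<Rightarrow> ('m, 'a) cochain set" where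
  "W1 A K q = {(c0, c1).
     (\<forall>\<alpha>. \<alpha> \<notin> sections A \<longrightarrow> c0 \<alpha> = zero_form \<and> c1 \<alpha> = zero_form) \<and>
     (\<forall>\<alpha>\<in>sections A. c0 \<alpha> \<in> forms A K q \<and> c1 \<alpha> \<in> forms_pred A K q) \<and>
     (\<forall>\<alpha>\<in>sections A. \<forall>\<beta>\<in>sections A. \<forall>a b.
        c0 (\<lambda>p. a *\<^sub>R \<alpha> p + b *\<^sub>R \<beta> p) = form_comb a (c0 \<alpha>) b (c0 \<beta>)) \<and>
     (\<forall>\<alpha>\<in>sections A. \<forall>\<beta>\<in>sections A. \<forall>f\<in>Cinf A. \<forall>g\<in>Cinf A.
        c1 (\<lambda>p. f p *\<^sub>R \<alpha> p + g p *\<^sub>R \<beta> p) = (\<lambda>Xs p. f p *\<^sub>R c1 \<alpha> Xs p + g p *\<^sub>R c1 \<beta> Xs p)) \<and>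
     (\<forall>\<alpha>\<in>sections A. \<forall>f\<in>Cinf A.
        c0 (\<lambda>p. f p *\<^sub>R \<alpha> p) = (\<lambda>Xs p. f p *\<^sub>R c0 \<alpha> Xs p + d_wedge A f (c1 \<alpha>) Xs p))}"

definition IM_forms ::
    "('m, 'a::real_vector, 'x) algebroid_data_scheme \<Rightarrow> ('m \<Rightarrow> 'a set) \<Rightarrow> nat \<Rightarrow> ('m, 'a) cochain set" where
  "IM_forms A K q = {(c0, c1). (c0, c1) \<in> W1 A K q \<and>
     (\<forall>\<alpha>\<in>sections A. \<forall>\<beta>\<in>sections A.
        c0 (bracket A \<alpha> \<beta>)
          = (\<lambda>Xs p. lie_der A \<alpha> (c0 \<beta>) Xs p - lie_der A \<beta> (c0 \<alpha>) Xs p) \<and>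
        c1 (bracket A \<alpha> \<beta>)
          = (\<lambda>Xs p. lie_der A \<alpha> (c1 \<beta>) Xs p - contract (rho A \<beta>) (c0 \<alpha>) Xs p) \<and>
        contract (rho A \<alpha>) (c1 \<beta>) = (\<lambda>Xs p. - contract (rho A \<beta>) (c1 \<alpha>) Xs p))}"

definition IM_forms_hor ::
    "('m, 'a::real_vector, 'x) algebroid_data_scheme \<Rightarrow> ('m \<Rightarrow> 'a set) \<Rightarrow> nat \<Rightarrow> ('m, 'a) cochain set" where
  "IM_forms_hor A K q =
     {(c0, c1). (c0, c1) \<in> IM_forms A K q \<and> (\<forall>\<xi>\<in>sub_sections A K. c1 \<xi> = zero_form)}"

definition delta0 ::
    "('m, 'a::real_vector, 'x) algebroid_data_scheme \<Rightarrow> ('m, 'a) form \<Rightarrow> ('m, 'a) cochain" where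
  "delta0 A \<gamma> =
     ((\<lambda>\<alpha>. if \<alpha> \<in> sections A then lie_der A \<alpha> \<gamma> else zero_form),
      (\<lambda>\<alpha>. if \<alpha> \<in> sections A then contract (rho A \<alpha>) \<gamma> else zero_form))"

definition cochain_comb ::
    "real \<Rightarrow> ('m, 'a::real_vector) cochain \<Rightarrow> real \<Rightarrow> ('m, 'a) cochain \<Rightarrow> ('m, 'a) cochain" where
  "cochain_comb a c b d =
     ((\<lambda>\<alpha>. form_comb a (fst c \<alpha>) b (fst d \<alpha>)), (\<lambda>\<alpha>. form_comb a (snd c \<alpha>) b (snd d \<alpha>)))"

section \<open>IM connections\<close>

definition IM_connections ::
    "('m, 'a::real_vector, 'x) algebroid_data_scheme \<Rightarrow> ('m \<Rightarrow> 'a set) \<Rightarrow> ('m, 'a) cochain set" where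
  "IM_connections A K =
     {(C, v). (C, v) \<in> IM_forms A K 1 \<and> (\<forall>\<xi>\<in>sub_sections A K. v \<xi> [] = \<xi>)}"

definition induced_connection ::
    "('m, 'a::real_vector, 'x) algebroid_data_scheme \<Rightarrow> ('m \<Rightarrow> 'a set) \<Rightarrow>
     (('m \<Rightarrow> 'a) \<Rightarrow> ('m, 'a) form) \<Rightarrow> ('m, 'a) connection" where
  "induced_connection A K C = (\<lambda>X \<xi>. if \<xi> \<in> sub_sections A K then C \<xi> [X] else (\<lambda>p. 0))"

definition IM_curvature ::
    "('m, 'a::real_vector, 'x) algebroid_data_scheme \<Rightarrow> ('m \<Rightarrow> 'a set) \<Rightarrow>
     ('m, 'a) cochain \<Rightarrow> ('m, 'a) cochain" where
  "IM_curvature A K = (\<lambda>(C, v).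
     ((\<lambda>\<alpha>. if \<alpha> \<in> sections A then d_conn A (induced_connection A K C) (C \<alpha>) else zero_form),
      (\<lambda>\<alpha>. if \<alpha> \<in> sections A then C (\<lambda>p. \<alpha> p - v \<alpha> [] p) else zero_form)))"

definition is_curving ::
    "('m, 'a::real_vector, 'x) algebroid_data_scheme \<Rightarrow> ('m \<Rightarrow> 'a set) \<Rightarrow>
     ('m, 'a) cochain \<Rightarrow> ('m, 'a) form \<Rightarrow> bool" where
  "is_curving A K c F \<longleftrightarrow> F \<in> forms A K 2 \<and> IM_curvature A K c = delta0 A F"

definition three_curvature ::
    "('m, 'a::real_vector, 'x) algebroid_data_scheme \<Rightarrow> ('m \<Rightarrow> 'a set) \<Rightarrow>
     ('m, 'a) cochain \<Rightarrow> ('m, 'a) form \<Rightarrow> ('m, 'a) form" where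
  "three_curvature A K c F = d_conn A (induced_connection A K (fst c)) F"

section \<open>Splittings\<close>

definition splitting ::
    "('m, 'a::real_vector, 'x) algebroid_data_scheme \<Rightarrow> ('m \<Rightarrow> 'a set) \<Rightarrow> ('m \<Rightarrow> 'a \<Rightarrow> 'a) \<Rightarrow> bool" where
  "splitting A K v \<longleftrightarrow>
     (\<forall>p u. u \<notin> fibre A p \<longrightarrow> v p u = 0) \<and>
     (\<forall>p. \<forall>u\<in>fibre A p. v p u \<in> K p) \<and>
     (\<forall>p. \<forall>u\<in>fibre A p. \<forall>w\<in>fibre A p. \<forall>a b.
        v p (a *\<^sub>R u + b *\<^sub>R w) = a *\<^sub>R v p u + b *\<^sub>R v p w) \<and>
     (\<forall>\<alpha>\<in>sections A. (\<lambda>p. v p (\<alpha> p)) \<in> sub_sections A K) \<and>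
     (\<forall>p. \<forall>u\<in>K p. v p u = u)"

text \<open>The vector bundle map given by a map from sections of \<open>A\<close> to 0-forms that is linear over smooth
  functions; by tensoriality the choice of the section through \<open>u\<close> is irrelevant.\<close>

definition bundle_map_of ::
    "('m, 'a::real_vector, 'x) algebroid_data_scheme \<Rightarrow> (('m \<Rightarrow> 'a) \<Rightarrow> ('m, 'a) form) \<Rightarrow> 'm \<Rightarrow> 'a \<Rightarrow> 'a" where
  "bundle_map_of A v = (\<lambda>p u. if u \<in> fibre A p
     then v (SOME \<alpha>. \<alpha> \<in> sections A \<and> \<alpha> p = u) [] p else 0)"

text \<open>The condition that the \<open>A\<close>-connection \<open>[h \<alpha>, \<xi>]\<close> with \<open>h = id - v\<close> is the pullback of \<open>D\<close>
  along the anchor.\<close>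

definition compatible ::
    "('m, 'a::real_vector, 'x) algebroid_data_scheme \<Rightarrow> ('m \<Rightarrow> 'a set) \<Rightarrow>
     ('m \<Rightarrow> 'a \<Rightarrow> 'a) \<Rightarrow> ('m, 'a) connection \<Rightarrow> bool" where
  "compatible A K v D \<longleftrightarrow> (\<forall>\<alpha>\<in>sections A. \<forall>\<xi>\<in>sub_sections A K.
     bracket A (\<lambda>p. \<alpha> p - v p (\<alpha> p)) \<xi> = D (rho A \<alpha>) \<xi>)"

end

theory Submission
  imports Defs "Jordan_Normal_Form.Jordan_Normal_Form_Existence"
begin

text \<open>All derivations of a finite-dimensional semisimple Lie algebra are inner and its centre vanishes.
  Hence a derivation of \<open>\<Gamma>(\<kk>)\<close> that is linear over smooth functions is \<open>[\<zeta>, -]\<close> for a unique section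
  \<open>\<zeta>\<close>, and any identity between sections of \<open>\<kk>\<close> may be checked after bracketing with \<open>\<Gamma>(\<kk>)\<close>.
  For a horizontal IM form \<open>c\<close> the maps \<open>\<xi> \<mapsto> c\<^sub>0(\<xi>)(X)\<close> are such derivations, which yields \<open>\<gamma>\<close> with
  \<open>c = \<delta>\<^sup>0\<gamma>\<close>. For an IM connection with induced connection \<open>\<nabla>\<close> one has
  \<open>ad C(\<alpha>)(X) = [\<nabla>\<^sub>X, ad \<alpha>] + \<nabla>\<^bsub>[\<rho>(\<alpha>), X]\<^esub>\<close>. This formula recovers \<open>C\<close> from \<open>\<nabla>\<close> and defines \<open>C\<close> for a
  given compatible pair \<open>(v, \<nabla>)\<close>. The curving \<open>F\<close> is given by \<open>ad F = -R\<^sup>\<nabla>\<close>, and \<open>d\<^sup>\<nabla> F = 0\<close> is the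
  Bianchi identity.\<close>

text \<open>Semisimplicity is given only as the absence of nonzero solvable ideals of a real Lie
  algebra, so nondegeneracy of the Killing form must be proved before derivations can be treated.
  The argument needs eigenvalues, hence complex scalars. Only coordinates are complexified: being a
  derivation is a linear condition on a matrix in terms of the structure constants, which makes
  sense over either field. The derived algebra of the radical of the Killing form is
  trace-orthogonal to all derivations, not just to inner ones. This matters because the test
  derivation, the conjugate of a semisimple part, is not known to be inner. Pairing with it makes
  all eigenvalues vanish, and Engel's theorem finishes. Brackets, forms and connections act on
  global sections only. Local data therefore enters through cutoff functions, and tensoriality is
  what permits reasoning in single fibres. The minus sign in the equation for \<open>F\<close> is
  forced by the second component of the curvature: compatibility gives ad C(h \<alpha>)(X) = R(X,
  \<rho>(\<alpha>)), while the contraction of \<open>F\<close> has \<rho>(\<alpha>) in the first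
  slot.\<close>

hide_const (open) VectorSpace.subspace
hide_fact (open) VectorSpace.subspace_def

section \<open>Derivations and structure constants\<close>

text \<open>Vanishing outside the \<open>n\<close> by \<open>n\<close> block makes equality of
  matrices an equality of functions, so the calculus below carries no index bounds.\<close>

definition supported2 :: "nat \<Rightarrow> (nat \<Rightarrow> nat \<Rightarrow> 'b::zero) \<Rightarrow> bool" where
  "supported2 n M \<longleftrightarrow> (\<forall>i j. \<not> (i < n \<and> j < n) \<longrightarrow> M i j = 0)"

definition mmul :: "nat \<Rightarrow> (nat \<Rightarrow> nat \<Rightarrow> 'b::comm_ring_1) \<Rightarrow> (nat \<Rightarrow> nat \<Rightarrow> 'b) \<Rightarrow> nat \<Rightarrow> nat \<Rightarrow> 'b" where
  "mmul n M N i j = (\<Sum>l<n. M i l * N l j)"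

definition idm :: "nat \<Rightarrow> nat \<Rightarrow> nat \<Rightarrow> 'b::comm_ring_1" where
  "idm n i j = (if i = j \<and> i < n then 1 else 0)"

lemma mmul_assoc: "mmul n (mmul n L M) N = mmul n L (mmul n M N)"
proof (intro ext)
  fix i j
  have "mmul n (mmul n L M) N i j = (\<Sum>l<n. \<Sum>k<n. L i k * M k l * N l j)"
    by (simp add: mmul_def sum_distrib_right)
  also have "\<dots> = (\<Sum>k<n. \<Sum>l<n. L i k * M k l * N l j)" by (rule sum.swap)
  also have "\<dots> = mmul n L (mmul n M N) i j"
    by (simp add: mmul_def sum_distrib_left mult.assoc)
  finally show "mmul n (mmul n L M) N i j = mmul n L (mmul n M N) i j" .
qed

lemma sum_idm:
  "(\<Sum>l<n. idm n i l * f l) = (if i < n then f i else 0)"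
  "(\<Sum>l<n. idm n l i * f l) = (if i < n then f i else 0)"
  "(\<Sum>l<n. f l * idm n l i) = (if i < n then f i else 0)"
proof -
  have "(\<Sum>l<n. idm n i l * f l) = (\<Sum>l<n. if l = i then f i else 0)"
    by (rule sum.cong) (auto simp: idm_def)
  then show "(\<Sum>l<n. idm n i l * f l) = (if i < n then f i else 0)" by simp
  have "(\<Sum>l<n. idm n l i * f l) = (\<Sum>l<n. if l = i then f i else 0)"
    by (rule sum.cong) (auto simp: idm_def)
  then show "(\<Sum>l<n. idm n l i * f l) = (if i < n then f i else 0)" by simp
  then show "(\<Sum>l<n. f l * idm n l i) = (if i < n then f i else 0)" by (simp add: mult.commute)
qed

lemma mmul_idm_left: "supported2 n M \<Longrightarrow> mmul n (idm n) M = M"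
  by (intro ext) (simp add: mmul_def sum_idm supported2_def)

lemma mmul_idm_right: "supported2 n M \<Longrightarrow> mmul n M (idm n) = M"
  by (intro ext) (simp add: mmul_def sum_idm supported2_def)

lemma supported2_mmul: "supported2 n M \<Longrightarrow> supported2 n N \<Longrightarrow> supported2 n (mmul n M N)"
  by (auto simp: mmul_def supported2_def)

text \<open>A nonzero entry lies inside a single Jordan block, and a block is upper triangular with
  constant diagonal. The induction splits off the first block.\<close>

lemma jordan_matrix_entries:
  assumes "i < sum_list (map fst n_as)" "j < sum_list (map fst n_as)"
    "jordan_matrix n_as $$ (i, j) \<noteq> 0"
  shows "i \<le> j \<and> jordan_matrix n_as $$ (i, i) = jordan_matrix n_as $$ (j, j)"
  using assms
proof (induction n_as arbitrary: i j)
  case Nil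
  then show ?case by simp
next
  case (Cons na n_as)
  obtain n a where na: "na = (n, a)" by force
  let ?m = "sum_list (map fst n_as)"
  have eq: "jordan_matrix (na # n_as) = four_block_mat (jordan_block n a) (0\<^sub>m n ?m) (0\<^sub>m ?m n) (jordan_matrix n_as)"
    unfolding na by (rule jordan_matrix_Cons)
  have idx: "jordan_matrix (na # n_as) $$ (k, l) =
     (if k < n then if l < n then jordan_block n a $$ (k, l) else 0
      else if l < n then 0 else jordan_matrix n_as $$ (k - n, l - n))"
    if "k < n + ?m" "l < n + ?m" for k l
    unfolding eq using that by (subst index_mat_four_block) auto
  have ij: "i < n + ?m" "j < n + ?m" using Cons.prems(1,2) na by auto
  show ?case
  proof (cases "i < n")
    case True
    with Cons.prems(3) ij have j: "j < n" by (auto simp: idx split: if_splits)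
    with True ij Cons.prems(3) show ?thesis by (auto simp: idx split: if_splits)
  next
    case False
    with Cons.prems(3) ij have j: "\<not> j < n" by (auto simp: idx split: if_splits)
    with False ij Cons.prems(3) have "jordan_matrix n_as $$ (i - n, j - n) \<noteq> 0" by (simp add: idx)
    from Cons.IH[OF _ _ this] False j ij
    have "i - n \<le> j - n \<and> jordan_matrix n_as $$ (i - n, i - n) = jordan_matrix n_as $$ (j - n, j - n)"
      by auto
    moreover from this False j ij have "i \<le> j" by linarith
    ultimately show ?thesis using False j ij by (simp add: idx)
  qed
qed

text \<open>Over the complex numbers the characteristic polynomial splits, so a Jordan form exists.
  The last property is stronger than triangularity: off-diagonal entries join equal eigenvalues
  only, so the diagonal of \<open>J\<close> commutes with \<open>J\<close> and is its semisimple
  part.\<close>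

lemma triangularization:
  fixes a :: "nat \<Rightarrow> nat \<Rightarrow> complex"
  assumes a: "supported2 n a"
  obtains P Q J where "supported2 n P" "supported2 n Q" "supported2 n J"
    "mmul n P Q = idm n" "mmul n Q P = idm n" "mmul n Q a = mmul n J Q" "mmul n a P = mmul n P J"
    "\<And>i j. J i j \<noteq> 0 \<Longrightarrow> i \<le> j \<and> J i i = J j j"
proof -
  define A where "A = mat n n (\<lambda>(i,j). a i j)"
  have A: "A \<in> carrier_mat n n" by (simp add: A_def)
  obtain as where "char_poly A = (\<Prod>a\<leftarrow>as. [:- a, 1:])" using char_poly_factorized[OF A] by blast
  then obtain n_as where "jordan_nf A n_as" using jordan_nf_exists[OF A] by blast
  then obtain P Q where w: "similar_mat_wit A (jordan_matrix n_as) P Q"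
    unfolding jordan_nf_def similar_mat_def by blast
  note D = similar_mat_witD2[OF A w]
  have m: "sum_list (map fst n_as) = n" using D(5) by (metis carrier_matD(1) jordan_matrix_dim(1))
  define f where "f M i j = (if i < n \<and> j < n then M $$ (i, j) else 0)" for M :: "complex mat" and i j
  have fs: "supported2 n (f M)" for M by (auto simp: supported2_def f_def)
  have fm: "mmul n (f M) (f N) = f (M * N)" if "M \<in> carrier_mat n n" "N \<in> carrier_mat n n" for M N
    using that by (intro ext) (auto simp: mmul_def f_def scalar_prod_def atLeast0LessThan)
  have f1: "f (1\<^sub>m n) = idm n" by (intro ext) (auto simp: f_def idm_def)
  have fa: "f A = a" using a by (intro ext) (auto simp: f_def A_def supported2_def)
  let ?J = "jordan_matrix n_as"
  have "Q * A = Q * (P * (?J * Q))" by (subst D(3), subst assoc_mult_mat[OF D(6,5,7)]) simp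
  also have "\<dots> = (Q * P) * (?J * Q)"
    using D(5-7) by (subst assoc_mult_mat[of Q n n P n _ n]) auto
  also have "\<dots> = ?J * Q" unfolding D(2) by (rule left_mult_one_mat[OF mult_carrier_mat[OF D(5,7)]])
  finally have QA: "Q * A = ?J * Q" .
  have "A * P = P * ?J * (Q * P)"
    using assoc_mult_mat[OF mult_carrier_mat[OF D(6,5)] D(7,6)] by (subst D(3)) simp
  also have "\<dots> = P * ?J" unfolding D(2) by (rule right_mult_one_mat[OF mult_carrier_mat[OF D(6,5)]])
  finally have AP: "A * P = P * ?J" .
  show thesis
  proof (rule that[of "f P" "f Q" "f ?J"])
    show "mmul n (f P) (f Q) = idm n" "mmul n (f Q) (f P) = idm n"
      using D by (simp_all add: fm f1)
    show "mmul n (f Q) a = mmul n (f ?J) (f Q)" unfolding fa[symmetric] using D QA by (simp add: fm)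
    show "mmul n a (f P) = mmul n (f P) (f ?J)" unfolding fa[symmetric] using D AP by (simp add: fm)
    show "i \<le> j \<and> f ?J i i = f ?J j j" if "f ?J i j \<noteq> 0" for i j
      using that jordan_matrix_entries[of i n_as j] m by (auto simp: f_def split: if_splits)
  qed (rule fs)+
qed

text \<open>If \<open>c i j k\<close> is the \<open>k\<close>-th coordinate of the product of basis
  vectors \<open>i\<close> and \<open>j\<close>, and column \<open>i\<close> of \<open>M\<close> is
  the image of basis vector \<open>i\<close>, then the three actions give the coordinates of
  [M x, y], [x, M y] and M [x, y].\<close>

definition act_fst :: "nat \<Rightarrow> (nat \<Rightarrow> nat \<Rightarrow> 'b::comm_ring_1) \<Rightarrow> (nat \<Rightarrow> nat \<Rightarrow> nat \<Rightarrow> 'b) \<Rightarrow> nat \<Rightarrow> nat \<Rightarrow> nat \<Rightarrow> 'b" where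
  "act_fst n M c i j k = (\<Sum>l<n. M l i * c l j k)"
definition act_snd :: "nat \<Rightarrow> (nat \<Rightarrow> nat \<Rightarrow> 'b::comm_ring_1) \<Rightarrow> (nat \<Rightarrow> nat \<Rightarrow> nat \<Rightarrow> 'b) \<Rightarrow> nat \<Rightarrow> nat \<Rightarrow> nat \<Rightarrow> 'b" where
  "act_snd n M c i j k = (\<Sum>l<n. M l j * c i l k)"
definition act_out :: "nat \<Rightarrow> (nat \<Rightarrow> nat \<Rightarrow> 'b::comm_ring_1) \<Rightarrow> (nat \<Rightarrow> nat \<Rightarrow> nat \<Rightarrow> 'b) \<Rightarrow> nat \<Rightarrow> nat \<Rightarrow> nat \<Rightarrow> 'b" where
  "act_out n M c i j k = (\<Sum>l<n. M k l * c i j l)"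

definition is_der :: "nat \<Rightarrow> (nat \<Rightarrow> nat \<Rightarrow> nat \<Rightarrow> 'b::comm_ring_1) \<Rightarrow> (nat \<Rightarrow> nat \<Rightarrow> 'b) \<Rightarrow> bool" where
  "is_der n c M \<longleftrightarrow> (\<forall>i j k. act_out n M c i j k = act_fst n M c i j k + act_snd n M c i j k)"

text \<open>Actions on an input reverse the order of composition, the action on the output keeps it,
  and actions on different slots commute.\<close>

lemma t1_t1: "act_fst n P (act_fst n M c) = act_fst n (mmul n M P) c"
  unfolding act_fst_def mmul_def sum_distrib_left sum_distrib_right
  by (intro ext, subst sum.swap) (simp add: mult_ac)
lemma t2_t2: "act_snd n P (act_snd n M c) = act_snd n (mmul n M P) c"
  unfolding act_snd_def mmul_def sum_distrib_left sum_distrib_right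
  by (intro ext, subst sum.swap) (simp add: mult_ac)
lemma t3_t3: "act_out n P (act_out n M c) = act_out n (mmul n P M) c"
  unfolding act_out_def mmul_def sum_distrib_left sum_distrib_right
  by (intro ext, subst sum.swap) (simp add: mult_ac)
lemma t1_t2: "act_fst n P (act_snd n M c) = act_snd n M (act_fst n P c)"
  unfolding act_fst_def act_snd_def sum_distrib_left sum_distrib_right
  by (intro ext, subst sum.swap) (simp add: mult_ac)
lemma t1_t3: "act_fst n P (act_out n M c) = act_out n M (act_fst n P c)"
  unfolding act_fst_def act_out_def sum_distrib_left sum_distrib_right
  by (intro ext, subst sum.swap) (simp add: mult_ac)
lemma t2_t3: "act_snd n P (act_out n M c) = act_out n M (act_snd n P c)"
  unfolding act_snd_def act_out_def sum_distrib_left sum_distrib_right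
  by (intro ext, subst sum.swap) (simp add: mult_ac)
lemma t_add: "act_fst n P (\<lambda>i j k. c i j k + d i j k) = (\<lambda>i j k. act_fst n P c i j k + act_fst n P d i j k)"
  "act_snd n P (\<lambda>i j k. c i j k + d i j k) = (\<lambda>i j k. act_snd n P c i j k + act_snd n P d i j k)"
  "act_out n P (\<lambda>i j k. c i j k + d i j k) = (\<lambda>i j k. act_out n P c i j k + act_out n P d i j k)"
  by (simp_all add: act_fst_def act_snd_def act_out_def sum.distrib distrib_left fun_eq_iff)

lemma is_der_iff: "is_der n c M \<longleftrightarrow> act_out n M c = (\<lambda>i j k. act_fst n M c i j k + act_snd n M c i j k)"
  by (auto simp: is_der_def fun_eq_iff)

text \<open>Change of basis for a structure tensor: the inputs transform by \<open>P\<close>, the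
  output by \<open>Q\<close>. The two intertwining relations carry each action of \<open>M\<close>
  through the transformation. The lemma is used both to pass to the triangular basis and to return
  from it.\<close>

lemma is_der_transform:
  assumes d: "is_der n c M" and MP: "mmul n M P = mmul n P N" and QM: "mmul n Q M = mmul n N Q"
  shows "is_der n (act_fst n P (act_snd n P (act_out n Q c))) N"
proof -
  let ?F = "\<lambda>c. act_fst n P (act_snd n P (act_out n Q c))"
  have 3: "?F (act_out n M c) = act_out n N (?F c)"
    by (simp add: t3_t3 QM) (simp add: t3_t3[symmetric] t1_t3 t2_t3)
  have "?F (act_fst n M c) = act_fst n P (act_fst n M (act_snd n P (act_out n Q c)))" by (simp add: t1_t2 t1_t3)
  also have "\<dots> = act_fst n N (?F c)" by (simp only: t1_t1 MP)
  finally have 1: "?F (act_fst n M c) = act_fst n N (?F c)" .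
  have "?F (act_snd n M c) = act_fst n P (act_snd n P (act_snd n M (act_out n Q c)))" by (simp add: t2_t3)
  also have "\<dots> = act_fst n P (act_snd n N (act_snd n P (act_out n Q c)))" by (simp only: t2_t2 MP)
  also have "\<dots> = act_snd n N (?F c)" by (simp only: t1_t2)
  finally have 2: "?F (act_snd n M c) = act_snd n N (?F c)" .
  have "?F (act_out n M c) = (\<lambda>i j k. ?F (act_fst n M c) i j k + ?F (act_snd n M c) i j k)"
    using d[unfolded is_der_iff] by (simp add: t_add)
  then show ?thesis unfolding is_der_iff 1 2 3 .
qed

definition supported3 :: "nat \<Rightarrow> (nat \<Rightarrow> nat \<Rightarrow> nat \<Rightarrow> 'b::zero) \<Rightarrow> bool" where
  "supported3 n c \<longleftrightarrow> (\<forall>i j k. \<not> (i < n \<and> j < n \<and> k < n) \<longrightarrow> c i j k = 0)"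

lemma t_idm: assumes "supported3 n c"
  shows "act_fst n (idm n) c = c" "act_snd n (idm n) c = c" "act_out n (idm n) c = c"
  using assms
  by (auto simp: act_fst_def act_snd_def act_out_def sum_idm supported3_def fun_eq_iff)

lemma t_supported: assumes "supported3 n c" "supported2 n M"
  shows "supported3 n (act_fst n M c)" "supported3 n (act_snd n M c)" "supported3 n (act_out n M c)"
  using assms by (auto simp: act_fst_def act_snd_def act_out_def supported2_def supported3_def)

text \<open>In a basis adapted to the triangular form \<open>J\<close>, the structure constant \<open>c i j k\<close> can be nonzero only
  if the eigenvalues satisfy \<open>\<lambda>\<^sub>k = \<lambda>\<^sub>i + \<lambda>\<^sub>j\<close>; hence conjugating the diagonal gives a derivation.\<close>

lemma is_der_conj_diag:
  fixes J :: "nat \<Rightarrow> nat \<Rightarrow> complex"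
  assumes d: "is_der n c J" and c: "supported3 n c"
    and J: "\<And>i j. J i j \<noteq> 0 \<Longrightarrow> i \<le> j \<and> J i i = J j j"
  shows "is_der n c (\<lambda>i j. if i = j \<and> i < n then cnj (J i i) else 0)"
proof -
  have z: "c i j k = 0" if "J k k \<noteq> J i i + J j j" for i j k
    using that
  \<comment> \<open>An off-diagonal entry of \<open>J\<close> replaces an input by a smaller index
    and the output by a larger one, always with the same eigenvalue. So the measure drops while the
    inequality between eigenvalues persists.\<close>
  proof (induction "i + j + (n - k)" arbitrary: i j k rule: less_induct)
    case less
    show ?case
    proof (cases "i < n \<and> j < n \<and> k < n")
      case False then show ?thesis using c by (auto simp: supported3_def)
    next
      case True
      have "act_out n J c i j k = (\<Sum>l<n. if l = k then J k k * c i j k else 0)"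
        unfolding act_out_def
      proof (rule sum.cong)
        fix l assume l: "l \<in> {..<n}"
        show "J k l * c i j l = (if l = k then J k k * c i j k else 0)"
        proof (cases "l = k \<or> J k l = 0")
          case False
          then have "k < l" "J l l = J k k" using J[of k l] by auto
          then have "c i j l = 0" using less.hyps[of i j l] less.prems l True by auto
          then show ?thesis using False by simp
        qed auto
      qed simp
      then have 3: "act_out n J c i j k = J k k * c i j k" using True by simp
      have "act_fst n J c i j k = (\<Sum>l<n. if l = i then J i i * c i j k else 0)"
        unfolding act_fst_def
      proof (rule sum.cong)
        fix l assume l: "l \<in> {..<n}"
        show "J l i * c l j k = (if l = i then J i i * c i j k else 0)"
        proof (cases "l = i \<or> J l i = 0")
          case False
          then have "l < i" "J l l = J i i" using J[of l i] by auto
          then have "c l j k = 0" using less.hyps[of l j k] less.prems by auto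
          then show ?thesis using False by simp
        qed auto
      qed simp
      then have 1: "act_fst n J c i j k = J i i * c i j k" using True by simp
      have "act_snd n J c i j k = (\<Sum>l<n. if l = j then J j j * c i j k else 0)"
        unfolding act_snd_def
      proof (rule sum.cong)
        fix l assume l: "l \<in> {..<n}"
        show "J l j * c i l k = (if l = j then J j j * c i j k else 0)"
        proof (cases "l = j \<or> J l j = 0")
          case False
          then have "l < j" "J l l = J j j" using J[of l j] by auto
          then have "c i l k = 0" using less.hyps[of i l k] less.prems by auto
          then show ?thesis using False by simp
        qed auto
      qed simp
      then have 2: "act_snd n J c i j k = J j j * c i j k" using True by simp
      have "J k k * c i j k = (J i i + J j j) * c i j k"
        using d[unfolded is_der_def, rule_format, of i j k] unfolding 1 2 3 by (simp add: distrib_right)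
      then show ?thesis using less.prems by simp
    qed
  qed
  show ?thesis
    unfolding is_der_def
  proof (intro allI)
    fix i j k
    show "act_out n (\<lambda>i j. if i = j \<and> i < n then cnj (J i i) else 0) c i j k =
       act_fst n (\<lambda>i j. if i = j \<and> i < n then cnj (J i i) else 0) c i j k +
       act_snd n (\<lambda>i j. if i = j \<and> i < n then cnj (J i i) else 0) c i j k"
    proof (cases "i < n \<and> j < n \<and> k < n")
      case False
      then show ?thesis using c by (auto simp: act_fst_def act_snd_def act_out_def supported3_def intro!: sum.neutral)
    next
      case True
      have e: "(if x then u else 0) * w = (if x then u * w else 0)" for x and u w :: complex
        by auto
      \<comment> \<open>For a diagonal matrix the derivation identity is this relation for each
        single structure constant, and conjugation respects sums of eigenvalues.\<close>
      have "cnj (J k k) * c i j k = cnj (J i i) * c i j k + cnj (J j j) * c i j k"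
      proof (cases "c i j k = 0")
        case False
        then have "J k k = J i i + J j j" using z by blast
        then show ?thesis by (simp add: distrib_right)
      qed simp
      then show ?thesis using True
        by (simp add: act_fst_def act_snd_def act_out_def e cong: conj_cong)
    qed
  qed
qed

text \<open>The trace hypothesis is tested on a derivation whose eigenvalues are the conjugates of
  those of \<open>a\<close>. The trace of the product is then the sum of the squared absolute values
  of the eigenvalues of \<open>a\<close>, so all of them vanish and the triangular form becomes
  strict.\<close>

lemma nonnilpotent_derivation_trace:
  fixes a :: "nat \<Rightarrow> nat \<Rightarrow> complex"
  assumes a: "supported2 n a" and c: "supported3 n c" and d: "is_der n c a"
    and tr: "\<And>Y. is_der n c Y \<Longrightarrow> supported2 n Y \<Longrightarrow> (\<Sum>i<n. mmul n a Y i i) = 0"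
  obtains P Q J where "supported2 n P" "supported2 n Q" "supported2 n J"
    "mmul n P Q = idm n" "mmul n Q P = idm n" "mmul n Q a = mmul n J Q"
    "\<And>i j. J i j \<noteq> 0 \<Longrightarrow> i < j"
proof -
  obtain P Q J where PQJ: "supported2 n P" "supported2 n Q" "supported2 n J"
    "mmul n P Q = idm n" "mmul n Q P = idm n" "mmul n Q a = mmul n J Q" "mmul n a P = mmul n P J"
    and J: "\<And>i j. J i j \<noteq> 0 \<Longrightarrow> i \<le> j \<and> J i i = J j j"
    using triangularization[OF a] by blast
  define c' where "c' = act_fst n P (act_snd n P (act_out n Q c))"
  have d': "is_der n c' J" unfolding c'_def by (rule is_der_transform[OF d PQJ(7,6)])
  have c': "supported3 n c'" unfolding c'_def by (intro t_supported c PQJ)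
  define D where "D = (\<lambda>i j. if i = j \<and> i < n then cnj (J i i) else 0)"
  have D: "is_der n c' D" unfolding D_def by (rule is_der_conj_diag[OF d' c' J])
  have Ds: "supported2 n D" by (auto simp: D_def supported2_def)
  \<comment> \<open>The operator that acts by the conjugate eigenvalue on each generalised
    eigenspace of \<open>a\<close>, written in the original basis.\<close>
  define Y where "Y = mmul n P (mmul n D Q)"
  have Ys: "supported2 n Y" unfolding Y_def by (intro supported2_mmul PQJ Ds)
  \<comment> \<open>Transforming \<open>c'\<close> with the roles of \<open>P\<close> and
    \<open>Q\<close> exchanged restores \<open>c\<close>.\<close>
  have "is_der n (act_fst n Q (act_snd n Q (act_out n P c'))) Y"
  proof (rule is_der_transform[OF D])
    have "mmul n Q Y = mmul n (mmul n Q P) (mmul n D Q)" by (simp only: Y_def mmul_assoc)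
    then show "mmul n D Q = mmul n Q Y" by (simp add: PQJ mmul_idm_left supported2_mmul Ds)
    have "mmul n Y P = mmul n (mmul n P D) (mmul n Q P)" by (simp only: Y_def mmul_assoc)
    then show "mmul n P D = mmul n Y P" by (simp add: PQJ mmul_idm_right supported2_mmul Ds)
  qed
  also have "act_fst n Q (act_snd n Q (act_out n P c')) = act_fst n Q (act_fst n P (act_snd n Q (act_snd n P (act_out n P (act_out n Q c)))))"
    by (simp add: c'_def t1_t2 t1_t3 t2_t3)
  also have "\<dots> = c" by (simp add: t1_t1 t2_t2 t3_t3 PQJ t_idm c)
  finally have Y: "is_der n c Y" .
  have "(\<Sum>i<n. mmul n a Y i i) = (\<Sum>i<n. mmul n P (mmul n J (mmul n D Q)) i i)"
    by (simp add: Y_def mmul_assoc[symmetric] PQJ)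
  also have "\<dots> = (\<Sum>i<n. \<Sum>l<n. P i l * mmul n J (mmul n D Q) l i)" by (simp add: mmul_def)
  also have "\<dots> = (\<Sum>l<n. \<Sum>i<n. mmul n J (mmul n D Q) l i * P i l)"
    by (subst sum.swap) (simp add: mult.commute)
  also have "\<dots> = (\<Sum>l<n. mmul n (mmul n J (mmul n D Q)) P l l)" by (simp add: mmul_def)
  also have "mmul n (mmul n J (mmul n D Q)) P = mmul n J D"
    by (simp add: mmul_assoc PQJ mmul_idm_right Ds)
  also have "(\<Sum>l<n. mmul n J D l l) = (\<Sum>l<n. J l l * cnj (J l l))"
  proof (rule sum.cong)
    fix l assume l: "l \<in> {..<n}"
    have "mmul n J D l l = (\<Sum>i<n. if i = l then J l l * cnj (J l l) else 0)"
      unfolding mmul_def by (rule sum.cong) (auto simp: D_def)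
    then show "mmul n J D l l = J l l * cnj (J l l)" using l by simp
  qed simp
  also have "\<dots> = of_real (\<Sum>l<n. (cmod (J l l))\<^sup>2)"
    by (simp only: of_real_sum complex_norm_square)
  finally have "of_real (\<Sum>l<n. (cmod (J l l))\<^sup>2) = (0::complex)" using tr[OF Y Ys] by simp
  then have "(\<Sum>l<n. (cmod (J l l))\<^sup>2) = 0" by (simp only: of_real_eq_0_iff)
  then have "\<forall>l<n. (cmod (J l l))\<^sup>2 = 0" by (subst (asm) sum_nonneg_eq_0_iff) auto
  then have J0: "J l l = 0" for l using PQJ(3) by (cases "l < n") (auto simp: supported2_def)
  have "i < j" if "J i j \<noteq> 0" for i j using J[OF that] that J0 by (cases "i = j") auto
  then show thesis using that PQJ by blast
qed

section \<open>Linear maps on a finite-dimensional subspace\<close>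

text \<open>Linearity is confined to \<open>V\<close> because fibres are subspaces of the ambient
  type, and maps such as fibre brackets have no controlled values outside them.\<close>

definition lin_on :: "'g::real_vector set \<Rightarrow> ('g \<Rightarrow> 'h::real_vector) \<Rightarrow> bool" where
  "lin_on V f \<longleftrightarrow> (\<forall>u\<in>V. \<forall>w\<in>V. \<forall>x y. f (x *\<^sub>R u + y *\<^sub>R w) = x *\<^sub>R f u + y *\<^sub>R f w)"

lemma lin_onD: "lin_on V f \<Longrightarrow> u \<in> V \<Longrightarrow> w \<in> V \<Longrightarrow> f (x *\<^sub>R u + y *\<^sub>R w) = x *\<^sub>R f u + y *\<^sub>R f w"
  by (simp add: lin_on_def)

lemma lin_on_add: "lin_on V f \<Longrightarrow> u \<in> V \<Longrightarrow> w \<in> V \<Longrightarrow> f (u + w) = f u + f w"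
  using lin_onD[of V f u w 1 1] by simp

lemma lin_on_diff: "lin_on V f \<Longrightarrow> u \<in> V \<Longrightarrow> w \<in> V \<Longrightarrow> f (u - w) = f u - f w"
  using lin_onD[of V f u w 1 "-1"] by simp

lemma lin_on_scale: "lin_on V f \<Longrightarrow> u \<in> V \<Longrightarrow> f (x *\<^sub>R u) = x *\<^sub>R f u"
  using lin_onD[of V f u u x 0] by simp

lemma lin_on_zero: "lin_on V f \<Longrightarrow> subspace V \<Longrightarrow> f 0 = 0"
  using lin_on_scale[of V f 0 0] by (simp add: subspace_0)

lemma lin_on_sum:
  assumes "lin_on V f" "subspace V" "finite I" "\<And>i. i \<in> I \<Longrightarrow> u i \<in> V"
  shows "f (\<Sum>i\<in>I. x i *\<^sub>R u i) = (\<Sum>i\<in>I. x i *\<^sub>R f (u i))"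
  using assms(3,4)
proof (induction I rule: finite_induct)
  case empty
  then show ?case by (simp add: lin_on_zero[OF assms(1,2)])
next
  case (insert i I)
  then have "(\<Sum>i\<in>I. x i *\<^sub>R u i) \<in> V" by (intro subspace_sum assms(2) subspace_scale) auto
  with insert show ?case
    using lin_onD[OF assms(1), of "u i" "\<Sum>i\<in>I. x i *\<^sub>R u i" "x i" 1] by simp
qed

locale findim =
  fixes V :: "'g::real_vector set" and n :: nat and b :: "nat \<Rightarrow> 'g"
  assumes basis: "is_basis n b V"
begin

definition cr :: "nat \<Rightarrow> 'g \<Rightarrow> real" where
  "cr i v = representation (b ` {..<n}) v (b i)"

lemma subV: "subspace V" and bV: "i < n \<Longrightarrow> b i \<in> V" and indep: "independent (b ` {..<n})"
  and injb: "inj_on b {..<n}" and spanV: "span (b ` {..<n}) = V"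
  using basis unfolding is_basis_def by (auto simp: span_base)

lemma lin_cr: "lin_on V (cr i)"
  unfolding lin_on_def cr_def
  using indep spanV subV by (simp add: representation_add representation_scale subspace_scale)

lemma expand: assumes "v \<in> V" shows "(\<Sum>i<n. cr i v *\<^sub>R b i) = v"
proof -
  have "v = (\<Sum>w\<in>b ` {..<n}. representation (b ` {..<n}) v w *\<^sub>R w)"
    using assms indep by (subst sum_representation_eq) (auto simp: spanV)
  also have "\<dots> = (\<Sum>i<n. cr i v *\<^sub>R b i)"
    by (subst sum.reindex[OF injb]) (simp add: cr_def)
  finally show ?thesis ..
qed

lemma cr_b: assumes "i < n" "j < n" shows "cr i (b j) = (if i = j then 1 else 0)"
  using assms injb unfolding cr_def
  by (subst representation_basis[OF indep]) (auto simp: inj_on_eq_iff)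

lemma sum_in: "(\<Sum>i<n. f i *\<^sub>R b i) \<in> V"
  by (intro subspace_sum subV subspace_scale bV) auto

lemma cr_sum: assumes "j < n" shows "cr j (\<Sum>i<n. f i *\<^sub>R b i) = f j"
proof -
  have "cr j (\<Sum>i<n. f i *\<^sub>R b i) = (\<Sum>i<n. f i *\<^sub>R cr j (b i))"
    by (rule lin_on_sum[OF lin_cr subV]) (auto simp: bV)
  also have "\<dots> = (\<Sum>i<n. if i = j then f i else 0)"
    using assms by (intro sum.cong) (auto simp: cr_b)
  finally show ?thesis using assms by simp
qed

lemma cr_eqI: assumes "u \<in> V" "v \<in> V" "\<And>i. i < n \<Longrightarrow> cr i u = cr i v" shows "u = v"
proof -
  have "(\<Sum>i<n. cr i u *\<^sub>R b i) = (\<Sum>i<n. cr i v *\<^sub>R b i)" using assms(3) by simp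
  then show ?thesis using assms(1,2) by (simp add: expand)
qed

lemma lin_on_expand: assumes "lin_on V f" "v \<in> V" shows "f v = (\<Sum>i<n. cr i v *\<^sub>R f (b i))"
  using lin_on_sum[OF assms(1) subV, of "{..<n}" b "\<lambda>i. cr i v"] bV expand[OF assms(2)] by simp

lemma lin_on_eq: assumes "lin_on V f" "lin_on V g" "\<And>i. i < n \<Longrightarrow> f (b i) = g (b i)" "v \<in> V"
  shows "f v = g v"
  using assms by (simp add: lin_on_expand)

definition endo :: "('g \<Rightarrow> 'g) \<Rightarrow> bool" where
  "endo f \<longleftrightarrow> lin_on V f \<and> (\<forall>v\<in>V. f v \<in> V)"

definition tr :: "('g \<Rightarrow> 'g) \<Rightarrow> real" where
  "tr f = (\<Sum>i<n. cr i (f (b i)))"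

lemma tr_comp: assumes "endo f" "endo g"
  shows "tr (\<lambda>u. f (g u)) = (\<Sum>i<n. \<Sum>k<n. cr i (f (b k)) * cr k (g (b i)))"
  unfolding tr_def
proof (rule sum.cong)
  fix i assume "i \<in> {..<n}"
  then have g: "g (b i) \<in> V" using assms bV by (auto simp: endo_def)
  have l: "lin_on V (\<lambda>v. cr i (f v))"
    using assms(1) lin_cr unfolding endo_def lin_on_def by simp
  show "cr i (f (g (b i))) = (\<Sum>k<n. cr i (f (b k)) * cr k (g (b i)))"
    using lin_on_expand[OF l g] by (simp add: mult.commute)
qed simp

lemma tr_comm: assumes "endo f" "endo g" shows "tr (\<lambda>u. f (g u)) = tr (\<lambda>u. g (f u))"
  unfolding tr_comp[OF assms] tr_comp[OF assms(2,1)]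
  by (subst sum.swap) (simp add: mult.commute)

lemma tr_lin: assumes "\<And>v. v \<in> V \<Longrightarrow> f v \<in> V" "\<And>v. v \<in> V \<Longrightarrow> g v \<in> V"
  shows "tr (\<lambda>u. x *\<^sub>R f u + y *\<^sub>R g u) = x * tr f + y * tr g"
  unfolding tr_def using assms lin_onD[OF lin_cr]
  by (simp add: bV sum.distrib sum_distrib_left)

lemma tr_diff: assumes "\<And>v. v \<in> V \<Longrightarrow> f v \<in> V" "\<And>v. v \<in> V \<Longrightarrow> g v \<in> V"
  shows "tr (\<lambda>u. f u - g u) = tr f - tr g"
  using tr_lin[OF assms, where x=1 and y="-1"] by simp

lemma tr_cong: "(\<And>v. v \<in> V \<Longrightarrow> f v = g v) \<Longrightarrow> tr f = tr g"
  by (simp add: tr_def bV)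

lemma endo_comp: "endo f \<Longrightarrow> endo g \<Longrightarrow> endo (\<lambda>u. f (g u))"
  by (simp add: endo_def lin_on_def)

definition mat_op :: "(nat \<Rightarrow> nat \<Rightarrow> real) \<Rightarrow> 'g \<Rightarrow> 'g" where
  "mat_op M v = (\<Sum>k<n. (\<Sum>i<n. M k i * cr i v) *\<^sub>R b k)"

lemma endo_mat_op: "endo (mat_op M)"
proof -
  have "(\<Sum>i<n. M k i * cr i (x *\<^sub>R u + y *\<^sub>R w)) = x * (\<Sum>i<n. M k i * cr i u) + y * (\<Sum>i<n. M k i * cr i w)"
    if "u \<in> V" "w \<in> V" for x y u w k
    using lin_onD[OF lin_cr that] by (simp add: sum_distrib_left sum.distrib algebra_simps)
  then show ?thesis unfolding endo_def lin_on_def mat_op_def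
    by (simp add: sum_in scaleR_sum_right sum.distrib[symmetric] algebra_simps)
qed

lemma mat_op_b: assumes "i < n" shows "mat_op M (b i) = (\<Sum>k<n. M k i *\<^sub>R b k)"
proof -
  have "(\<Sum>l<n. M k l * cr l (b i)) = M k i" for k
  proof -
    have "(\<Sum>l<n. M k l * cr l (b i)) = (\<Sum>l<n. if l = i then M k i else 0)"
      using assms by (intro sum.cong) (auto simp: cr_b)
    then show ?thesis using assms by simp
  qed
  then show ?thesis by (simp add: mat_op_def)
qed

end

section \<open>Derivations of an algebra in terms of its structure constants\<close>

locale findim_algebra = findim +
  fixes br :: "'a::real_vector \<Rightarrow> 'a \<Rightarrow> 'a"
  assumes br_in: "u \<in> V \<Longrightarrow> w \<in> V \<Longrightarrow> br u w \<in> V"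
    and br_left: "w \<in> V \<Longrightarrow> lin_on V (\<lambda>u. br u w)"
    and br_right: "u \<in> V \<Longrightarrow> lin_on V (br u)"
begin

definition deriv :: "('a \<Rightarrow> 'a) \<Rightarrow> bool" where
  "deriv E \<longleftrightarrow> endo E \<and> (\<forall>u\<in>V. \<forall>w\<in>V. E (br u w) = br (E u) w + br u (E w))"

definition struct_const :: "nat \<Rightarrow> nat \<Rightarrow> nat \<Rightarrow> real" where
  "struct_const i j k = (if i < n \<and> j < n \<and> k < n then cr k (br (b i) (b j)) else 0)"

lemma bilinear_eq:
  assumes "\<And>w. w \<in> V \<Longrightarrow> lin_on V (\<lambda>u. F u w)" "\<And>u. u \<in> V \<Longrightarrow> lin_on V (F u)"
    "\<And>w. w \<in> V \<Longrightarrow> lin_on V (\<lambda>u. G u w)" "\<And>u. u \<in> V \<Longrightarrow> lin_on V (G u)"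
    "\<And>i j. i < n \<Longrightarrow> j < n \<Longrightarrow> F (b i) (b j) = G (b i) (b j)" "u \<in> V" "w \<in> V"
  shows "F u w = G u w"
proof -
  have 1: "F (b i) w = G (b i) w" if "i < n" for i
    by (rule lin_on_eq[of "F (b i)" "G (b i)", OF assms(2)[OF bV] assms(4)[OF bV] _ assms(7)])
      (auto simp: that assms(5))
  show ?thesis
    by (rule lin_on_eq[of "\<lambda>u. F u w" "\<lambda>u. G u w", OF assms(1)[OF assms(7)] assms(3)[OF assms(7)] 1 assms(6)])
qed

text \<open>Expanding the inner vector in the basis turns the coordinate of the product into the sum
  that defines the action. Both directions of the dictionary between \<open>deriv\<close> and
  \<open>is_der\<close> rest on this.\<close>

lemma is_der_coords:
  assumes E: "endo E" and M: "\<And>k i. M k i = (if k < n \<and> i < n then cr k (E (b i)) else 0)"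
    and i: "i < n" and j: "j < n" and k: "k < n"
  shows "act_out n M struct_const i j k = cr k (E (br (b i) (b j)))"
    "act_fst n M struct_const i j k = cr k (br (E (b i)) (b j))"
    "act_snd n M struct_const i j k = cr k (br (b i) (E (b j)))"
proof -
  have l: "lin_on V (\<lambda>v. cr k (f v))" if "lin_on V f" "\<And>v. v \<in> V \<Longrightarrow> f v \<in> V" for f
    using that lin_cr unfolding lin_on_def by simp
  have E': "lin_on V E" "\<And>v. v \<in> V \<Longrightarrow> E v \<in> V" using E by (auto simp: endo_def)
  show "act_out n M struct_const i j k = cr k (E (br (b i) (b j)))"
    using lin_on_expand[OF l[of E, OF E'], of "br (b i) (b j)"] i j k bV br_in
    by (simp add: act_out_def M struct_const_def mult.commute)
  show "act_fst n M struct_const i j k = cr k (br (E (b i)) (b j))"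
    using lin_on_expand[OF l[of "\<lambda>u. br u (b j)", OF br_left], of "E (b i)"] i j k bV br_in E'
    by (simp add: act_fst_def M struct_const_def mult.commute)
  show "act_snd n M struct_const i j k = cr k (br (b i) (E (b j)))"
    using lin_on_expand[OF l[of "br (b i)", OF br_right], of "E (b j)"] i j k bV br_in E'
    by (simp add: act_snd_def M struct_const_def mult.commute)
qed

lemma is_derI:
  assumes "supported3 n c" "supported2 n M"
    "\<And>i j k. i < n \<Longrightarrow> j < n \<Longrightarrow> k < n \<Longrightarrow> act_out n M c i j k = act_fst n M c i j k + act_snd n M c i j k"
  shows "is_der n c M"
  unfolding is_der_def
proof (intro allI)
  fix i j k
  show "act_out n M c i j k = act_fst n M c i j k + act_snd n M c i j k"
    using assms(3)[of i j k] t_supported[OF assms(1,2)]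
    by (cases "i < n \<and> j < n \<and> k < n") (auto simp: supported3_def)
qed

lemma struct_const_supported: "supported3 n struct_const" by (simp add: supported3_def struct_const_def)

lemma deriv_is_der:
  assumes "deriv E"
  shows "is_der n struct_const (\<lambda>k i. if k < n \<and> i < n then cr k (E (b i)) else 0)"
proof (rule is_derI[OF struct_const_supported])
  have E: "endo E" and d: "\<And>u w. u \<in> V \<Longrightarrow> w \<in> V \<Longrightarrow> E (br u w) = br (E u) w + br u (E w)"
    using assms by (auto simp: deriv_def)
  note c = is_der_coords[OF E refl]
  show "act_out n (\<lambda>k i. if k < n \<and> i < n then cr k (E (b i)) else 0) struct_const i j k =
    act_fst n (\<lambda>k i. if k < n \<and> i < n then cr k (E (b i)) else 0) struct_const i j k +
    act_snd n (\<lambda>k i. if k < n \<and> i < n then cr k (E (b i)) else 0) struct_const i j k"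
    if ijk: "i < n" "j < n" "k < n" for i j k
    unfolding c[OF ijk] using ijk E
    by (simp add: d bV lin_on_add[OF lin_cr] br_in endo_def)
qed (simp add: supported2_def)

text \<open>Both sides of the Leibniz rule are bilinear, so it is enough to compare them on basis
  vectors, where the coordinates give exactly the equations of \<open>is_der\<close>.\<close>

lemma deriv_mat_op:
  assumes d: "is_der n struct_const M" and M: "supported2 n M"
  shows "deriv (mat_op M)"
proof -
  let ?E = "mat_op M"
  have E: "endo ?E" by (rule endo_mat_op)
  then have Ein: "u \<in> V \<Longrightarrow> ?E u \<in> V" for u by (simp add: endo_def)
  have Elin: "lin_on V ?E" using E by (simp add: endo_def)
  have cf: "M k i = (if k < n \<and> i < n then cr k (?E (b i)) else 0)" for k i
    using M by (simp add: mat_op_b cr_sum supported2_def)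
  have "?E (br u w) = br (?E u) w + br u (?E w)" if "u \<in> V" "w \<in> V" for u w
  proof (rule bilinear_eq[of "\<lambda>u w. ?E (br u w)" "\<lambda>u w. br (?E u) w + br u (?E w)", OF _ _ _ _ _ that])
    fix w assume w: "w \<in> V"
    show "lin_on V (\<lambda>u. ?E (br u w))"
      using lin_onD[OF Elin] lin_onD[OF br_left[OF w]] br_in w unfolding lin_on_def by simp
    show "lin_on V (\<lambda>u. br (?E u) w + br u (?E w))"
      using lin_onD[OF Elin] lin_onD[OF br_left[OF w]] lin_onD[OF br_left[OF Ein[OF w]]] Ein br_in w
      unfolding lin_on_def by (simp add: algebra_simps)
  next
    fix u assume u: "u \<in> V"
    show "lin_on V (\<lambda>w. ?E (br u w))"
      using lin_onD[OF Elin] lin_onD[OF br_right[OF u]] br_in u unfolding lin_on_def by simp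
    show "lin_on V (\<lambda>w. br (?E u) w + br u (?E w))"
      using lin_onD[OF Elin] lin_onD[OF br_right[OF u]] lin_onD[OF br_right[OF Ein[OF u]]] Ein br_in u
      unfolding lin_on_def by (simp add: algebra_simps)
  next
    fix i j assume ij: "i < n" "j < n"
    show "?E (br (b i) (b j)) = br (?E (b i)) (b j) + br (b i) (?E (b j))"
    proof (rule cr_eqI)
      fix k assume k: "k < n"
      note c = is_der_coords[OF E cf ij k]
      show "cr k (?E (br (b i) (b j))) = cr k (br (?E (b i)) (b j) + br (b i) (?E (b j)))"
        using d ij c lin_on_add[OF lin_cr] Ein br_in bV by (simp add: is_der_def)
    qed (use ij Ein br_in bV subV in \<open>auto intro!: subspace_add\<close>)
  qed
  with E show ?thesis by (simp add: deriv_def)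
qed

text \<open>The orthogonality hypothesis is tested on the real and imaginary parts of the complex derivation
  \<open>conj A\<^sub>s\<close>, where \<open>A\<^sub>s\<close> is the semisimple part of the derivation \<open>A\<close>.\<close>

lemma orthogonal_derivation_nilpotent:
  assumes A: "deriv A" and orth: "\<And>E. deriv E \<Longrightarrow> tr (\<lambda>u. A (E u)) = 0" and u: "u \<in> V"
  shows "(A ^^ n) u = 0"
proof -
  have eA: "endo A" and Ain: "\<And>v. v \<in> V \<Longrightarrow> A v \<in> V" using A by (auto simp: deriv_def endo_def)
  define ar where "ar = (\<lambda>k i. if k < n \<and> i < n then cr k (A (b i)) else 0)"
  define a where "a = (\<lambda>k i. complex_of_real (ar k i))"
  define c where "c = (\<lambda>i j k. complex_of_real (struct_const i j k))"
  have as: "supported2 n a" by (simp add: a_def ar_def supported2_def)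
  have cs: "supported3 n c" using struct_const_supported by (simp add: c_def supported3_def)
  \<comment> \<open>The structure constants are real, so the actions split into real and imaginary
    parts. A complex derivation is thus a pair of real ones, and \<open>orth\<close> applies to
    each.\<close>
  have t_real: "act_fst n M c i j k = Complex (act_fst n (\<lambda>i j. Re (M i j)) struct_const i j k) (act_fst n (\<lambda>i j. Im (M i j)) struct_const i j k)"
    "act_snd n M c i j k = Complex (act_snd n (\<lambda>i j. Re (M i j)) struct_const i j k) (act_snd n (\<lambda>i j. Im (M i j)) struct_const i j k)"
    "act_out n M c i j k = Complex (act_out n (\<lambda>i j. Re (M i j)) struct_const i j k) (act_out n (\<lambda>i j. Im (M i j)) struct_const i j k)"
    for M i j k
    by (simp_all add: complex_eq_iff act_fst_def act_snd_def act_out_def c_def)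
  have der: "is_der n c M \<longleftrightarrow> is_der n struct_const (\<lambda>i j. Re (M i j)) \<and> is_der n struct_const (\<lambda>i j. Im (M i j))" for M
    unfolding is_der_def t_real by (auto simp: complex_eq_iff)
  have da: "is_der n c a"
    unfolding der using deriv_is_der[OF A]
    by (simp add: a_def ar_def[symmetric]) (simp add: is_der_def act_fst_def act_snd_def act_out_def)
  have trM: "(\<Sum>i<n. \<Sum>k<n. ar i k * M k i) = 0" if "is_der n struct_const M" "supported2 n M" for M
  proof -
    have "0 = tr (\<lambda>u. A (mat_op M u))" using orth[OF deriv_mat_op[OF that]] by simp
    also have "\<dots> = (\<Sum>i<n. \<Sum>k<n. ar i k * M k i)"
      unfolding tr_comp[OF eA endo_mat_op] by (simp add: mat_op_b cr_sum ar_def)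
    finally show ?thesis by simp
  qed
  have "(\<Sum>i<n. mmul n a Y i i) = 0" if Y: "is_der n c Y" "supported2 n Y" for Y
  proof -
    have "(\<Sum>i<n. mmul n a Y i i) =
      Complex (\<Sum>i<n. \<Sum>k<n. ar i k * Re (Y k i)) (\<Sum>i<n. \<Sum>k<n. ar i k * Im (Y k i))"
      by (simp add: complex_eq_iff mmul_def a_def)
    also have "\<dots> = 0"
      using trM[of "\<lambda>i j. Re (Y i j)"] trM[of "\<lambda>i j. Im (Y i j)"] Y unfolding der
      by (simp add: supported2_def zero_complex.code)
    finally show ?thesis .
  qed
  then obtain P Q J where PQJ: "supported2 n P" "supported2 n Q" "supported2 n J"
    "mmul n P Q = idm n" "mmul n Q P = idm n" "mmul n Q a = mmul n J Q"
    and J: "\<And>i j. J i j \<noteq> 0 \<Longrightarrow> i < j"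
    using nonnilpotent_derivation_trace[OF as cs da] by blast
  \<comment> \<open>The complex coordinates of \<open>v\<close> in the basis in which
    \<open>A\<close> is strictly upper triangular.\<close>
  define w where "w = (\<lambda>i v. \<Sum>k<n. Q i k * complex_of_real (cr k v))"
  have cA: "cr k (A v) = (\<Sum>l<n. ar k l * cr l v)" if "k < n" "v \<in> V" for k v
  proof -
    have "lin_on V (\<lambda>v. cr k (A v))" using eA lin_cr unfolding endo_def lin_on_def by simp
    from lin_on_expand[OF this that(2)] show ?thesis using that by (simp add: ar_def mult.commute)
  qed
  have wA: "w i (A v) = (\<Sum>l<n. J i l * w l v)" if "v \<in> V" for i v
  proof -
    have "w i (A v) = (\<Sum>k<n. \<Sum>l<n. Q i k * a k l * complex_of_real (cr l v))"
      by (simp add: w_def cA that a_def sum_distrib_left mult.assoc)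
    also have "\<dots> = (\<Sum>l<n. mmul n Q a i l * complex_of_real (cr l v))"
      by (subst sum.swap) (simp add: mmul_def sum_distrib_right)
    also have "\<dots> = (\<Sum>l<n. \<Sum>k<n. J i k * Q k l * complex_of_real (cr l v))"
      unfolding PQJ(6) by (simp add: mmul_def sum_distrib_right)
    also have "\<dots> = (\<Sum>l<n. J i l * w l v)"
      by (subst sum.swap) (simp add: w_def sum_distrib_left mult.assoc)
    finally show ?thesis .
  qed
  have AN: "(A ^^ N) u \<in> V" for N by (induction N) (auto simp: u Ain)
  \<comment> \<open>Each application of \<open>A\<close> makes at least one further coordinate
    vanish, counted from the last.\<close>
  have "w i ((A ^^ N) u) = 0" if "i + N \<ge> n" for i N
    using that
  proof (induction N arbitrary: i)
    case 0
    then have "Q i k = 0" for k using PQJ(2) by (auto simp: supported2_def)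
    then show ?case by (simp add: w_def)
  next
    case (Suc N)
    have "J i l * w l ((A ^^ N) u) = 0" for l
      using Suc.IH[of l] Suc.prems J[of i l] by (cases "J i l = 0") auto
    then show ?case using wA[OF AN] by simp
  qed
  then have w0: "w i ((A ^^ n) u) = 0" for i by simp
  have "cr k ((A ^^ n) u) = 0" if "k < n" for k
  proof -
    let ?v = "(A ^^ n) u"
    \<comment> \<open>\<open>P\<close> undoes the change of basis, so vanishing of the complex
      coordinates gives back vanishing of the real ones.\<close>
    have "0 = (\<Sum>i<n. P k i * w i ?v)" by (simp add: w0)
    also have "\<dots> = (\<Sum>i<n. \<Sum>l<n. P k i * Q i l * complex_of_real (cr l ?v))"
      by (simp add: w_def sum_distrib_left mult.assoc)
    also have "\<dots> = (\<Sum>l<n. mmul n P Q k l * complex_of_real (cr l ?v))"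
      by (subst sum.swap) (simp add: mmul_def sum_distrib_right)
    also have "\<dots> = complex_of_real (cr k ?v)" using that by (simp add: PQJ sum_idm)
    finally show ?thesis by simp
  qed
  then show ?thesis
    using cr_eqI[OF AN, of 0 n] subV lin_on_zero[OF lin_cr subV] by (simp add: subspace_0)
qed

end

section \<open>Determinants, adjugates and Cramer's rule\<close>

definition gdet :: "nat \<Rightarrow> (nat \<Rightarrow> nat \<Rightarrow> real) \<Rightarrow> real" where
  "gdet n G = Determinant.det (mat n n (\<lambda>(i, j). G i j))"

definition gadj :: "nat \<Rightarrow> (nat \<Rightarrow> nat \<Rightarrow> real) \<Rightarrow> nat \<Rightarrow> nat \<Rightarrow> real" where
  "gadj n G i j = adj_mat (mat n n (\<lambda>(i, j). G i j)) $$ (i, j)"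

text \<open>The determinant as a polynomial in the entries: this form later shows that smooth
  entries have a smooth determinant.\<close>

lemma gdet_expand:
  "gdet n G = (\<Sum>p | p permutes {0..<n}. signof p * (\<Prod>i = 0..<n. G i (p i)))"
proof -
  have "p i < n" if "p permutes {0..<n}" "i < n" for p i
    using that permutes_in_image[of p "{0..<n}" i] by simp
  then show ?thesis
    unfolding gdet_def by (subst det_def'[of _ n]) (auto intro!: sum.cong prod.cong)
qed

text \<open>The shifted indices skip row \<open>j\<close> and column \<open>i\<close>. The adjugate,
  too, is thereby polynomial in the entries.\<close>

lemma gadj_expand:
  assumes "i < n" "j < n"
  shows "gadj n G i j = (-1) ^ (j + i) *
    gdet (n - 1) (\<lambda>k l. G (if k < j then k else Suc k) (if l < i then l else Suc l))"
proof -
  have "mat_delete (mat n n (\<lambda>(i, j). G i j)) j i =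
     mat (n - 1) (n - 1) (\<lambda>(k, l). G (if k < j then k else Suc k) (if l < i then l else Suc l))"
    unfolding mat_delete_def using assms by (intro eq_matI) auto
  then show ?thesis using assms by (simp add: gadj_def adj_mat_def cofactor_def gdet_def)
qed

lemma gadj_mult:
  assumes "i < n" "k < n"
  shows "(\<Sum>j<n. gadj n G i j * G j k) = (if i = k then gdet n G else 0)"
    "(\<Sum>j<n. G i j * gadj n G j k) = (if i = k then gdet n G else 0)"
proof -
  let ?A = "mat n n (\<lambda>(i, j). G i j)"
  have A: "?A \<in> carrier_mat n n" by simp
  have "(adj_mat ?A * ?A) $$ (i, k) = (Determinant.det ?A \<cdot>\<^sub>m 1\<^sub>m n) $$ (i, k)"
    by (simp only: adj_mat(3)[OF A])
  then show "(\<Sum>j<n. gadj n G i j * G j k) = (if i = k then gdet n G else 0)"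
    using assms adj_mat(1)[OF A] by (simp add: gadj_def gdet_def scalar_prod_def atLeast0LessThan)
  have "(?A * adj_mat ?A) $$ (i, k) = (Determinant.det ?A \<cdot>\<^sub>m 1\<^sub>m n) $$ (i, k)"
    by (simp only: adj_mat(2)[OF A])
  then show "(\<Sum>j<n. G i j * gadj n G j k) = (if i = k then gdet n G else 0)"
    using assms adj_mat(1)[OF A] by (simp add: gadj_def gdet_def scalar_prod_def atLeast0LessThan)
qed

lemma gdet_nonzero:
  assumes "\<And>v. (\<And>j. j < n \<Longrightarrow> (\<Sum>i<n. G j i * v i) = 0) \<Longrightarrow> (\<And>i. i < n \<Longrightarrow> v i = 0)"
  shows "gdet n G \<noteq> 0"
proof
  let ?A = "mat n n (\<lambda>(i, j). G i j)"
  assume "gdet n G = 0"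
  then obtain v where v: "v \<in> carrier_vec n" "v \<noteq> 0\<^sub>v n" "?A *\<^sub>v v = 0\<^sub>v n"
    using det_0_iff_vec_prod_zero[of ?A n] by (auto simp: gdet_def)
  have "(\<Sum>i<n. G j i * v $ i) = 0" if "j < n" for j
  proof -
    have "(?A *\<^sub>v v) $ j = 0" unfolding v(3) using that by simp
    then show ?thesis using that v(1) by (simp add: scalar_prod_def atLeast0LessThan)
  qed
  then have "v $ i = 0" if "i < n" for i using assms[of "\<lambda>i. v $ i"] that by blast
  then have "v = 0\<^sub>v n" using v(1) by (intro eq_vecI) auto
  with v(2) show False by blast
qed

text \<open>Cramer's rule as an existence statement. Its companion \<open>gadj_unique\<close>
  concerns a solution already at hand, for which the formula supplies smoothness.\<close>

lemma gadj_solve: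
  assumes "gdet n G \<noteq> 0" "j < n"
  shows "(\<Sum>i<n. G j i * ((\<Sum>k<n. gadj n G i k * s k) / gdet n G)) = s j"
proof -
  have "(\<Sum>i<n. G j i * ((\<Sum>k<n. gadj n G i k * s k) / gdet n G))
      = (\<Sum>i<n. \<Sum>k<n. G j i * gadj n G i k * s k) / gdet n G"
    by (simp add: sum_distrib_left sum_divide_distrib mult.assoc)
  also have "\<dots> = (\<Sum>k<n. (\<Sum>i<n. G j i * gadj n G i k) * s k) / gdet n G"
    by (subst sum.swap) (simp add: sum_distrib_right)
  also have "\<dots> = (\<Sum>k<n. if k = j then gdet n G * s j else 0) / gdet n G"
    using assms(2) by (intro arg_cong[of _ _ "\<lambda>x. x / gdet n G"] sum.cong) (auto simp: gadj_mult)
  also have "\<dots> = s j" using assms by simp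
  finally show ?thesis .
qed

lemma gadj_unique:
  assumes "gdet n G \<noteq> 0" "\<And>j. j < n \<Longrightarrow> (\<Sum>i<n. G j i * z i) = s j" "i < n"
  shows "z i = (\<Sum>j<n. gadj n G i j * s j) / gdet n G"
proof -
  have "(\<Sum>j<n. gadj n G i j * s j) = (\<Sum>j<n. \<Sum>k<n. gadj n G i j * G j k * z k)"
    by (simp add: sum_distrib_left mult.assoc flip: assms(2))
  also have "\<dots> = (\<Sum>k<n. (\<Sum>j<n. gadj n G i j * G j k) * z k)"
    by (subst sum.swap) (simp add: sum_distrib_right)
  also have "\<dots> = (\<Sum>k<n. if k = i then gdet n G * z i else 0)"
    using assms(3) by (intro sum.cong) (auto simp: gadj_mult)
  finally show ?thesis using assms by simp
qed

context findim
begin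

text \<open>The ambient space may have infinite dimension; all finiteness comes from containment in
  the span of \<open>n\<close> vectors.\<close>

lemma subspace_basis:
  assumes "subspace S" "S \<subseteq> V"
  obtains B where "B \<subseteq> S" "independent B" "span B = S" "finite B" "card B = dim S" "card B \<le> n"
proof -
  obtain B where B: "B \<subseteq> S" "independent B" "S \<subseteq> span B" "card B = dim S"
    using basis_exists by blast
  have "B \<subseteq> span (b ` {..<n})" using B assms spanV by blast
  from independent_span_bound[OF _ B(2) this]
  have "finite B" "card B \<le> card (b ` {..<n})" by auto
  moreover have "card (b ` {..<n}) = n" using injb by (simp add: card_image)
  moreover have "span B = S" using B assms(1) by (metis span_minimal subset_antisym)
  ultimately show thesis using that B by simp
qed

text \<open>A vector of \<open>T\<close> outside \<open>S\<close> enlarges a basis of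
  \<open>S\<close>. The strict inequality drives the induction and the maximality argument in
  Engel's theorem.\<close>

lemma dim_psubset:
  assumes "subspace S" "subspace T" "S \<subset> T" "T \<subseteq> V"
  shows "dim S < dim T"
proof -
  have "S \<subseteq> V" using assms(3,4) by blast
  obtain B where B: "B \<subseteq> S" "independent B" "span B = S" "finite B" "card B = dim S"
    using subspace_basis[OF assms(1) \<open>S \<subseteq> V\<close>] by metis
  obtain C where C: "span C = T" "finite C" "card C = dim T"
    using subspace_basis[OF assms(2,4)] by metis
  obtain x where x: "x \<in> T" "x \<notin> S" using assms by blast
  have "independent (insert x B)" using B x by (simp add: independent_insertI)
  then have "card (insert x B) \<le> card C"
    using independent_span_bound[OF C(2), of "insert x B"] B C x assms by auto
  moreover have "x \<notin> B" using x B by blast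
  ultimately show ?thesis using B C by simp
qed

lemma dim_le: "subspace S \<Longrightarrow> S \<subseteq> V \<Longrightarrow> dim S \<le> n"
  using subspace_basis by metis

end

section \<open>Killing form, Engel's theorem and derivations of semisimple Lie algebras\<close>

locale findim_lie = findim_algebra +
  assumes anti: "u \<in> V \<Longrightarrow> w \<in> V \<Longrightarrow> br u w = - br w u"
    and jacobi: "u \<in> V \<Longrightarrow> v \<in> V \<Longrightarrow> w \<in> V \<Longrightarrow> br u (br v w) = br (br u v) w + br v (br u w)"
begin

lemma deriv_ad: "x \<in> V \<Longrightarrow> deriv (br x)"
  using br_right br_in by (auto simp: deriv_def endo_def intro: jacobi)

lemma endo_ad: "x \<in> V \<Longrightarrow> endo (br x)"
  using deriv_ad by (simp add: deriv_def)

lemma br_0: "u \<in> V \<Longrightarrow> br u 0 = 0" "u \<in> V \<Longrightarrow> br 0 u = 0"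
  using lin_on_zero[OF br_right subV] lin_on_zero[OF br_left subV] by auto

definition killing :: "'a \<Rightarrow> 'a \<Rightarrow> real" where
  "killing x y = tr (\<lambda>u. br x (br y u))"

lemma killing_commute: "x \<in> V \<Longrightarrow> y \<in> V \<Longrightarrow> killing x y = killing y x"
  unfolding killing_def by (rule tr_comm[OF endo_ad endo_ad])

lemma lin_tr_left: assumes "\<And>v. v \<in> V \<Longrightarrow> E v \<in> V"
  shows "lin_on V (\<lambda>x. tr (\<lambda>u. br x (E u)))"
  unfolding lin_on_def
proof (intro ballI allI)
  fix x y a c assume xy: "x \<in> V" "y \<in> V"
  have "tr (\<lambda>u. br (a *\<^sub>R x + c *\<^sub>R y) (E u)) = tr (\<lambda>u. a *\<^sub>R br x (E u) + c *\<^sub>R br y (E u))"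
    by (rule tr_cong) (simp add: lin_onD[OF br_left] assms xy)
  also have "\<dots> = a * tr (\<lambda>u. br x (E u)) + c * tr (\<lambda>u. br y (E u))"
    by (rule tr_lin) (auto intro: br_in assms xy)
  finally show "tr (\<lambda>u. br (a *\<^sub>R x + c *\<^sub>R y) (E u)) = a *\<^sub>R tr (\<lambda>u. br x (E u)) + c *\<^sub>R tr (\<lambda>u. br y (E u))"
    by simp
qed

lemma lin_killing: "y \<in> V \<Longrightarrow> lin_on V (\<lambda>x. killing x y)"
  unfolding killing_def by (rule lin_tr_left) (rule br_in)

text \<open>Invariance of the Killing form, extended from inner to arbitrary derivations. It shows
  that the radical is an ideal, that its derived algebra is orthogonal to every derivation, and that
  a derivation orthogonal to all inner ones vanishes.\<close>

lemma tr_ad_deriv: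
  assumes uv: "u \<in> V" "v \<in> V" and E: "deriv E"
  shows "tr (\<lambda>w. br (br u v) (E w)) = - killing u (E v)"
proof -
  have Ein: "w \<in> V \<Longrightarrow> E w \<in> V" for w using E by (simp add: deriv_def endo_def)
  have eE: "endo E" using E by (simp add: deriv_def)
  have "tr (\<lambda>w. br (br u v) (E w)) = tr (\<lambda>w. br u (br v (E w)) - br v (br u (E w)))"
    by (rule tr_cong) (simp add: jacobi[OF uv Ein])
  also have "\<dots> = tr (\<lambda>w. br u (br v (E w))) - tr (\<lambda>w. br v (br u (E w)))"
    by (rule tr_diff) (auto intro: br_in uv Ein)
  \<comment> \<open>Cyclicity of the trace brings \<open>br v\<close> to the right; what remains is
    the commutator of \<open>br v\<close> and \<open>E\<close>, which is the negative of bracketing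
    with \<open>E v\<close>.\<close>
  also have "tr (\<lambda>w. br v (br u (E w))) = tr (\<lambda>w. br u (E (br v w)))"
    by (rule tr_comm[OF endo_ad[OF uv(2)] endo_comp[OF endo_ad[OF uv(1)] eE]])
  also have "tr (\<lambda>w. br u (br v (E w))) - tr (\<lambda>w. br u (E (br v w)))
      = tr (\<lambda>w. br u (br v (E w)) - br u (E (br v w)))"
    by (rule tr_diff[symmetric]) (auto intro: br_in uv Ein)
  \<comment> \<open>The summand with factor zero only puts the map into the shape to which
    \<open>tr_lin\<close> applies.\<close>
  also have "\<dots> = tr (\<lambda>w. 0 *\<^sub>R br u (br (E v) w) + (-1) *\<^sub>R br u (br (E v) w))"
    using E by (intro tr_cong)
      (simp add: deriv_def uv lin_on_add[OF br_right] br_in Ein)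
  also have "\<dots> = - killing u (E v)"
    unfolding killing_def by (subst tr_lin) (auto intro: br_in uv Ein)
  finally show ?thesis .
qed

text \<open>Engel's theorem, with a pair of invariant subspaces \<open>W \<subset> U\<close> in place of a quotient module, so that
  the induction hypothesis also applies to \<open>S\<close> acting on itself modulo a subalgebra.\<close>

lemma engel:
  assumes J: "J \<subseteq> V" and nil: "\<And>x u. x \<in> J \<Longrightarrow> u \<in> J \<Longrightarrow> \<exists>N. (br x ^^ N) u = 0"
    and S: "subspace S" "S \<subseteq> J" "\<And>x y. x \<in> S \<Longrightarrow> y \<in> S \<Longrightarrow> br x y \<in> S"
    and W: "subspace W" "\<And>x y. x \<in> S \<Longrightarrow> y \<in> W \<Longrightarrow> br x y \<in> W"
    and U: "subspace U" "\<And>x y. x \<in> S \<Longrightarrow> y \<in> U \<Longrightarrow> br x y \<in> U"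
    and WU: "W \<subset> U" "U \<subseteq> J"
  shows "\<exists>v\<in>U - W. \<forall>s\<in>S. br s v \<in> W"
  using S W U WU
proof (induction "dim S" arbitrary: S W U rule: less_induct)
  case less
  note S = less.prems(1-3) and W = less.prems(4,5) and U = less.prems(6,7) and WU = less.prems(8,9)
  show ?case
  proof (cases "S = {0}")
    case True
    obtain v where v: "v \<in> U - W" using WU by blast
    then have "br 0 v = 0" using WU J by (intro br_0) blast
    with v True subspace_0[OF W(1)] show ?thesis by (auto intro!: bexI[of _ v])
  next
    case False
    \<comment> \<open>A proper subalgebra \<open>T\<close> of largest dimension is chosen; the zero
      subalgebra starts the search and the dimensions are bounded by \<open>n\<close>.\<close>
    define P where "P T \<longleftrightarrow> subspace T \<and> T \<subset> S \<and> (\<forall>x\<in>T. \<forall>y\<in>T. br x y \<in> T)" for T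
    have SV: "S \<subseteq> V" using S J by blast
    have "P {0}" using False S subspace_0[OF S(1)] by (auto simp: P_def br_0 subV subspace_0)
    moreover have "dim T \<le> n" if "P T" for T using that SV by (intro dim_le) (auto simp: P_def)
    ultimately obtain T where T: "P T" and Tmax: "\<And>T'. P T' \<Longrightarrow> dim T' \<le> dim T"
      using ex_has_greatest_nat[of P "{0}" dim "Suc n"] by (auto simp: less_Suc_eq_le)
    have T': "subspace T" "T \<subset> S" "T \<subseteq> J" "\<And>x y. x \<in> T \<Longrightarrow> y \<in> T \<Longrightarrow> br x y \<in> T"
      using T S by (auto simp: P_def)
    have dT: "dim T < dim S" using dim_psubset[OF T'(1) S(1) T'(2) SV] .
    \<comment> \<open>The induction hypothesis is applied to \<open>T\<close> acting on
      \<open>S\<close> modulo \<open>T\<close>. It yields an element outside \<open>T\<close> that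
      normalises \<open>T\<close>.\<close>
    have "\<exists>v\<in>S - T. \<forall>s\<in>T. br s v \<in> T"
      by (rule less.hyps[OF dT]) (use T' S in blast)+
    then obtain y where y: "y \<in> S" "y \<notin> T" "\<And>s. s \<in> T \<Longrightarrow> br s y \<in> T" by blast
    have yV: "y \<in> V" using y SV by blast
    define T2 where "T2 = span (insert y T)"
    have T2: "x \<in> T2 \<longleftrightarrow> (\<exists>k. x - k *\<^sub>R y \<in> T)" for x
      unfolding T2_def span_insert using T'(1) by (simp add: span_eq_iff[THEN iffD2])
    have T2S: "T2 \<subseteq> S" unfolding T2_def by (rule span_minimal) (use y T' S in auto)
    \<comment> \<open>As \<open>y\<close> normalises \<open>T\<close>, adjoining it gives a
      subalgebra strictly larger than \<open>T\<close>, which maximality forces to be all of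
      \<open>S\<close>.\<close>
    have "S = T2"
    proof (rule ccontr)
      assume "S \<noteq> T2"
      have "P T2"
        unfolding P_def
      proof (intro conjI ballI)
        show "subspace T2" by (simp add: T2_def)
        show "T2 \<subset> S" using T2S \<open>S \<noteq> T2\<close> by blast
        fix u w assume "u \<in> T2" "w \<in> T2"
        then obtain k l where k: "u - k *\<^sub>R y \<in> T" and l: "w - l *\<^sub>R y \<in> T" using T2 by blast
        define u' where "u' = u - k *\<^sub>R y"
        define w' where "w' = w - l *\<^sub>R y"
        have uw': "u' \<in> T" "w' \<in> T" "u = u' + k *\<^sub>R y" "w = w' + l *\<^sub>R y"
          using k l by (auto simp: u'_def w'_def)
        then have V: "u' \<in> V" "w' \<in> V" using T' SV by auto
        have yy: "br y y = 0"
        proof -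
          have "br y y + br y y = 0" using anti[OF yV yV] by (simp only: eq_neg_iff_add_eq_0)
          then have "2 *\<^sub>R br y y = 0" by (simp add: scaleR_2)
          then show ?thesis by simp
        qed
        have "br u w = br u' w' + (l *\<^sub>R br u' y - k *\<^sub>R br w' y)"
          unfolding uw'(3,4) using V yV subV anti[OF yV V(2)]
          by (simp add: lin_on_add[OF br_left] lin_on_add[OF br_right] lin_on_scale[OF br_left]
              lin_on_scale[OF br_right] subspace_add subspace_scale yy)
        then have "br u w \<in> T"
          using uw' T' y by (auto intro!: subspace_add subspace_diff subspace_scale)
        then show "br u w \<in> T2" unfolding T2_def by (intro span_base) simp
      qed
      moreover have "T \<subset> T2" using y T2_def span_superset[of "insert y T"] by blast
      ultimately show False
        using Tmax[of T2] dim_psubset[OF T'(1) _ _ subset_trans[OF T2S SV]] by (simp add: T2_def)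
    qed
    \<comment> \<open>The vectors annihilated by \<open>T\<close> modulo \<open>W\<close>. The
      induction hypothesis shows that they are not all in \<open>W\<close>, and they are stable
      under \<open>y\<close> because \<open>y\<close> normalises \<open>T\<close>.\<close>
    define U' where "U' = {v \<in> U. \<forall>s\<in>T. br s v \<in> W}"
    have UV: "U \<subseteq> V" and TV: "T \<subseteq> V" using WU T' J by auto
    have WV: "W \<subseteq> V" using WU UV by blast
    have "\<exists>v\<in>U - W. \<forall>s\<in>T. br s v \<in> W"
      by (rule less.hyps[OF dT]) (use T' W U WU in blast)+
    then obtain u where u: "u \<in> U'" "u \<notin> W" by (auto simp: U'_def)
    have yU': "br y v \<in> U'" if v: "v \<in> U'" for v
    proof -
      have "br s (br y v) \<in> W" if s: "s \<in> T" for s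
      proof -
        have "br s (br y v) = br (br s y) v + br y (br s v)"
          using s v TV UV yV by (intro jacobi) (auto simp: U'_def)
        moreover have "br (br s y) v \<in> W" using y(3)[OF s] v by (simp add: U'_def)
        moreover have "br y (br s v) \<in> W" using W(2)[OF y(1)] s v by (simp add: U'_def)
        ultimately show ?thesis using W(1) by (simp add: subspace_add)
      qed
      moreover have "br y v \<in> U" using U(2) y v by (simp add: U'_def)
      ultimately show ?thesis by (simp add: U'_def)
    qed
    have it: "(br y ^^ N) u \<in> U'" for N by (induction N) (auto simp: u yU')
    have "u \<in> J" "y \<in> J" using u WU y S by (auto simp: U'_def)
    then obtain N where "(br y ^^ N) u = 0" using nil by blast
    then have ex: "(br y ^^ N) u \<in> W" using W by (simp add: subspace_0)
    \<comment> \<open>By nilpotency the iterates of \<open>u\<close> under \<open>y\<close> reach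
      \<open>W\<close>. The last one before entry is annihilated modulo \<open>W\<close> by
      \<open>y\<close> and by \<open>T\<close>, hence by all of \<open>S\<close>.\<close>
    define k where "k = (LEAST N. (br y ^^ N) u \<in> W)"
    have k: "(br y ^^ k) u \<in> W" unfolding k_def using ex by (rule LeastI)
    then obtain m where m: "k = Suc m" using u by (cases k) auto
    define v where "v = (br y ^^ m) u"
    have v: "v \<notin> W" using not_less_Least[of m "\<lambda>N. (br y ^^ N) u \<in> W"] m by (auto simp: v_def k_def)
    have vU': "v \<in> U'" unfolding v_def by (rule it)
    have yv: "br y v \<in> W" using k by (simp add: m v_def)
    have vV: "v \<in> V" using vU' UV by (auto simp: U'_def)
    have "br s v \<in> W" if "s \<in> S" for s
    proof -
      have "s \<in> T2" using that \<open>S = T2\<close> by simp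
      then obtain c where c: "s - c *\<^sub>R y \<in> T" unfolding T2 ..
      then have "br ((s - c *\<^sub>R y) + c *\<^sub>R y) v = br (s - c *\<^sub>R y) v + c *\<^sub>R br y v"
        using TV yV vV subV lin_onD[OF br_left[OF vV], of "s - c *\<^sub>R y" y 1 c] by auto
      moreover have "br (s - c *\<^sub>R y) v \<in> W" using c vU' by (simp add: U'_def)
      ultimately show ?thesis using yv W(1) by (simp add: subspace_add subspace_scale)
    qed
    then show ?thesis using v vU' by (auto simp: U'_def)
  qed
qed

text \<open>The derived algebra is already zero, so such an ideal is solvable in one step.\<close>

lemma abelian_ideal_trivial:
  assumes ss: "semisimple_lie_algebra V br" and I: "lie_ideal V br I"
    and ab: "\<And>x y. x \<in> I \<Longrightarrow> y \<in> I \<Longrightarrow> br x y = 0"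
  shows "I = {0}"
proof -
  have 0: "0 \<in> I" using I by (simp add: lie_ideal_def subspace_0)
  then have "{br x y |x y. x \<in> I \<and> y \<in> I} = {0}"
    using 0 ab by (auto intro!: exI[of _ 0])
  then have "(derived_algebra br ^^ 1) I = {0}" by (simp add: derived_algebra_def)
  then show ?thesis using ss I unfolding semisimple_lie_algebra_def solvable_on_def by blast
qed

text \<open>The centre is an abelian ideal.\<close>

lemma centre_trivial:
  assumes ss: "semisimple_lie_algebra V br" and z: "z \<in> V" "\<And>u. u \<in> V \<Longrightarrow> br z u = 0"
  shows "z = 0"
proof -
  let ?Z = "{z\<in>V. \<forall>u\<in>V. br z u = 0}"
  have "subspace ?Z"
    using subV br_0(2) lin_on_add[OF br_left] lin_on_scale[OF br_left]
    by (auto simp: subspace_def)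
  moreover have "br x y \<in> ?Z" if "x \<in> V" "y \<in> ?Z" for x y
    using that anti[of x y] subV by (auto simp: subspace_0 br_0)
  ultimately have "lie_ideal V br ?Z" by (auto simp: lie_ideal_def)
  then have "?Z = {0}" using abelian_ideal_trivial[OF ss] by blast
  then show ?thesis using z by blast
qed

text \<open>Cartan's criterion for semisimplicity: \<open>I\<close> is the radical of the Killing form and \<open>J = [I, I]\<close>.\<close>

lemma killing_nondegenerate:
  assumes ss: "semisimple_lie_algebra V br"
    and x: "x \<in> V" "\<And>y. y \<in> V \<Longrightarrow> killing x y = 0"
  shows "x = 0"
proof -
  define I where "I = {x\<in>V. \<forall>y\<in>V. killing x y = 0}"
  have IV: "I \<subseteq> V" by (auto simp: I_def)
  have sI: "subspace I"
    using subV lin_on_zero[OF lin_killing subV] lin_on_add[OF lin_killing] lin_on_scale[OF lin_killing]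
    by (auto simp: subspace_def I_def)
  have ideal1: "br u v \<in> I" if "u \<in> I" "v \<in> V" for u v
  proof -
    have "killing (br u v) y = 0" if "y \<in> V" for y
    proof -
      have "killing (br u v) y = - killing u (br y v)"
        unfolding killing_def[of "br u v"]
        using tr_ad_deriv[OF _ _ deriv_ad] \<open>u \<in> I\<close> \<open>v \<in> V\<close> IV that by blast
      then show ?thesis using \<open>u \<in> I\<close> \<open>v \<in> V\<close> that br_in by (simp add: I_def)
    qed
    then show ?thesis using that IV br_in by (auto simp: I_def)
  qed
  have ideal: "br v u \<in> I" if "u \<in> I" "v \<in> V" for u v
    using anti[of v u] ideal1[OF that] subspace_neg[OF sI] that IV by auto
  define J where "J = span {br u v | u v. u \<in> I \<and> v \<in> I}"
  have sJ: "subspace J" by (simp add: J_def)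
  have JI: "J \<subseteq> I" unfolding J_def by (rule span_minimal[OF _ sI]) (use ideal1 IV in auto)
  then have JV: "J \<subseteq> V" using IV by blast
  have brJ: "br u v \<in> J" if "u \<in> I" "v \<in> I" for u v unfolding J_def using that by (auto intro: span_base)
  have idealJ: "br w x \<in> J" if w: "w \<in> V" and x: "x \<in> J" for w x
  proof -
    have "J \<subseteq> {x\<in>V. br w x \<in> J}"
      unfolding J_def
    proof (rule span_minimal, safe)
      fix u v assume uv: "u \<in> I" "v \<in> I"
      then have "br w (br u v) = br (br w u) v + br u (br w v)" using jacobi w IV by blast
      also have "\<dots> \<in> J" using ideal w uv brJ sJ by (intro subspace_add) auto
      finally show "br w (br u v) \<in> span {br u v |u v. u \<in> I \<and> v \<in> I}" by (simp add: J_def)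
      show "br u v \<in> V" using uv IV br_in by blast
    next
      show "subspace {x\<in>V. br w x \<in> span {br u v |u v. u \<in> I \<and> v \<in> I}}"
        using subV sJ br_0(1)[OF w] lin_on_add[OF br_right[OF w]] lin_on_scale[OF br_right[OF w]]
        unfolding J_def subspace_def by simp
    qed
    then show ?thesis using x by blast
  qed
  \<comment> \<open>For \<open>u\<close> in the radical, the trace for [u, v] is the negative of the
    Killing form of \<open>u\<close> with \<open>E v\<close>, which is zero whatever the derivation
    \<open>E\<close> is. Orthogonality to inner derivations alone would not feed
    \<open>orthogonal_derivation_nilpotent\<close>.\<close>
  have trJ: "tr (\<lambda>u. br x (E u)) = 0" if x: "x \<in> J" and E: "deriv E" for x E
  proof -
    have Ein: "w \<in> V \<Longrightarrow> E w \<in> V" for w using E by (simp add: deriv_def endo_def)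
    note L = lin_tr_left[of E, OF Ein]
    have "J \<subseteq> {x\<in>V. tr (\<lambda>u. br x (E u)) = 0}"
      unfolding J_def
    proof (rule span_minimal, safe)
      fix u v assume uv: "u \<in> I" "v \<in> I"
      then have uvV: "u \<in> V" "v \<in> V" using IV by auto
      show "tr (\<lambda>w. br (br u v) (E w)) = 0"
        using tr_ad_deriv[OF uvV E] uv(1) Ein[OF uvV(2)] by (simp add: I_def)
      show "br u v \<in> V" using uvV br_in by blast
    next
      show "subspace {x\<in>V. tr (\<lambda>u. br x (E u)) = 0}"
        using subV lin_on_zero[OF L subV] lin_on_add[OF L] lin_on_scale[OF L]
        unfolding subspace_def by simp
    qed
    then show ?thesis using x by blast
  qed
  have nil: "\<exists>N. (br x ^^ N) u = 0" if "x \<in> J" "u \<in> J" for x u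
    using orthogonal_derivation_nilpotent[of "br x" u] deriv_ad trJ that JV by blast
  \<comment> \<open>The centre of \<open>J\<close> is an ideal of the whole algebra because
    \<open>J\<close> is one; being abelian, it vanishes.\<close>
  define Z where "Z = {x\<in>J. \<forall>y\<in>J. br x y = 0}"
  have "lie_ideal V br Z"
    unfolding lie_ideal_def
  proof (intro conjI ballI)
    show "subspace Z"
      using sJ JV br_0(2) lin_on_add[OF br_left] lin_on_scale[OF br_left]
      by (auto simp: subspace_def Z_def subset_iff)
    show "Z \<subseteq> V" using JV by (auto simp: Z_def)
    fix w x assume w: "w \<in> V" and x: "x \<in> Z"
    have "br (br w x) y = 0" if y: "y \<in> J" for y
    proof -
      have "br w (br x y) = br (br w x) y + br x (br w y)" 
        by (rule jacobi) (use w x y JV in \<open>auto simp: Z_def\<close>)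
      then show ?thesis using x y idealJ[OF w] br_0 w by (simp add: Z_def)
    qed
    then show "br w x \<in> Z" using idealJ[OF w] x by (simp add: Z_def)
  qed
  then have Z: "Z = {0}" by (rule abelian_ideal_trivial[OF ss]) (auto simp: Z_def)
  \<comment> \<open>If \<open>J\<close> were nonzero, Engel's theorem would give a nonzero element
    annihilated by \<open>J\<close>, that is, a nonzero element of \<open>Z\<close>.\<close>
  have "J = {0}"
  proof (rule ccontr)
    assume "J \<noteq> {0}"
    then have "{0} \<subset> J" using subspace_0[OF sJ] by blast
    then have "\<exists>v\<in>J - {0}. \<forall>s\<in>J. br s v \<in> {0}"
      using engel[OF JV nil, of J "{0}" J] sJ idealJ JV br_0(1) by auto
    then obtain v where v: "v \<in> J" "v \<noteq> 0" "\<And>s. s \<in> J \<Longrightarrow> br s v = 0" by blast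
    then have "br v s = 0" if "s \<in> J" for s using anti[of v s] that JV by auto
    then have "v \<in> Z" using v by (simp add: Z_def)
    then show False using v Z by blast
  qed
  then have ab: "br u v = 0" if "u \<in> I" "v \<in> I" for u v using brJ[OF that] by blast
  have "lie_ideal V br I" using sI IV ideal by (auto simp: lie_ideal_def)
  then have "I = {0}" by (rule abelian_ideal_trivial[OF ss]) (rule ab)
  then show ?thesis using x by (auto simp: I_def)
qed

text \<open>Nondegeneracy represents the functional y \<mapsto> tr(\<delta> ad y) as the Killing
  form with some \<open>x\<close>. The difference of \<delta> and \<open>br x\<close> is then a
  derivation orthogonal to all inner ones, so by \<open>tr_ad_deriv\<close> its values lie in the
  radical of the Killing form.\<close>

lemma derivation_inner:
  assumes ss: "semisimple_lie_algebra V br" and d: "deriv \<delta>"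
  obtains x where "x \<in> V" "\<And>u. u \<in> V \<Longrightarrow> \<delta> u = br x u"
proof -
  have ed: "endo \<delta>" and din: "\<And>u. u \<in> V \<Longrightarrow> \<delta> u \<in> V" using d by (auto simp: deriv_def endo_def)
  define G where "G j i = killing (b i) (b j)" for j i
  have kill_sum: "killing (\<Sum>i<n. v i *\<^sub>R b i) (b j) = (\<Sum>i<n. G j i * v i)" if "j < n" for v j
    using lin_on_sum[OF lin_killing subV, of "b j" "{..<n}" b v] bV that by (simp add: G_def mult.commute)
  have killing0: "x = 0" if "x \<in> V" "\<And>j. j < n \<Longrightarrow> killing x (b j) = 0" for x
  proof (rule killing_nondegenerate[OF ss that(1)])
    fix y assume y: "y \<in> V"
    have "killing y x = (\<Sum>j<n. cr j y *\<^sub>R killing (b j) x)"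
      by (rule lin_on_expand[OF lin_killing[OF that(1)] y])
    then show "killing x y = 0" using that y by (simp add: killing_commute bV)
  qed
  have "gdet n G \<noteq> 0"
  proof (rule gdet_nonzero)
    fix v i assume v: "\<And>j. j < n \<Longrightarrow> (\<Sum>i<n. G j i * v i) = 0" and i: "i < n"
    have "(\<Sum>i<n. v i *\<^sub>R b i) = 0" by (rule killing0) (auto simp: sum_in kill_sum v)
    then have "cr i (\<Sum>i<n. v i *\<^sub>R b i) = 0" using lin_on_zero[OF lin_cr subV] by simp
    then show "v i = 0" using cr_sum[OF i] by simp
  qed
  define s where "s j = tr (\<lambda>u. \<delta> (br (b j) u))" for j
  define x where "x = (\<Sum>i<n. ((\<Sum>k<n. gadj n G i k * s k) / gdet n G) *\<^sub>R b i)"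
  have x: "x \<in> V" unfolding x_def by (rule sum_in)
  have ks: "killing x (b j) = s j" if "j < n" for j
    unfolding x_def kill_sum[OF that] by (rule gadj_solve[OF \<open>gdet n G \<noteq> 0\<close> that])
  \<comment> \<open>The goal becomes the vanishing of this derivation.\<close>
  define E where "E u = \<delta> u - br x u" for u
  have E: "deriv E"
    using d deriv_ad[OF x] lin_on_diff[OF br_left] lin_on_diff[OF br_right] br_in subV
    by (auto simp: deriv_def endo_def E_def lin_on_def subspace_diff scaleR_diff_right)
  have Ein: "u \<in> V \<Longrightarrow> E u \<in> V" for u using E by (simp add: deriv_def endo_def)
  have "tr (\<lambda>u. br y (E u)) = 0" if y: "y \<in> V" for y
  proof -
    have "tr (\<lambda>u. br (b j) (E u)) = 0" if j: "j < n" for j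
    proof -
      have "tr (\<lambda>u. br (b j) (E u)) = tr (\<lambda>u. E (br (b j) u))"
        using tr_comm[OF endo_ad, of "b j" E] E j bV by (simp add: deriv_def)
      also have "\<dots> = s j - killing x (b j)"
        unfolding E_def s_def killing_def using j bV br_in din x by (intro tr_diff) auto
      finally show ?thesis using ks[OF j] by simp
    qed
    then show ?thesis using lin_on_expand[OF lin_tr_left[of E, OF Ein] y] by simp
  qed
  then have k0: "killing u (E v) = 0" if "u \<in> V" "v \<in> V" for u v
    using tr_ad_deriv[OF that E] br_in[OF that] by simp
  have "E v = 0" if "v \<in> V" for v
    using killing_nondegenerate[OF ss Ein[OF that]] k0[OF _ that] killing_commute[OF Ein[OF that]] by simp
  then show thesis using that x by (simp add: E_def)
qed

end

section \<open>Smooth functions on open subsets of the model space\<close>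

lemma Euclidean_space_eq: "Euclidean_space n = top_of_set {x. \<forall>i\<ge>n. x i = 0}"
  by (simp add: Euclidean_space_def euclidean_product_topology)

lemma Ck_on_0: "Ck_on n 0 U f \<longleftrightarrow> continuous_on ({x. \<forall>i\<ge>n. x i = 0} \<inter> U) f"
  by (simp add: Euclidean_space_eq subtopology_subtopology)

lemma continuous_on_fun_upd: "continuous_on S (\<lambda>t::real. x(i := t))"
proof (rule continuous_on_coordinatewise_then_product)
  fix j
  show "continuous_on S (\<lambda>t. (x(i := t)) j)" by (cases "j = i") auto
qed

text \<open>Partial derivatives at a point of an open set involve only nearby values on a coordinate
  line, and those stay in the set. Hence functions that agree only on \<open>U\<close> have the same
  derivatives there.\<close>

lemma eventually_line:
  assumes U: "openin (Euclidean_space n) U" and x: "x \<in> U" and i: "i < n"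
  shows "\<forall>\<^sub>F t in nhds (x i). x(i := t) \<in> U"
proof -
  obtain T where T: "open T" "U = {x. \<forall>i\<ge>n. x i = 0} \<inter> T"
    using U by (auto simp: Euclidean_space_eq openin_open)
  have "open ((\<lambda>t. x(i := t)) -` T)"
    using continuous_on_fun_upd[of UNIV x i] T(1) by (metis open_vimage)
  moreover have "x i \<in> (\<lambda>t. x(i := t)) -` T" using x T by simp
  ultimately have "\<forall>\<^sub>F t in nhds (x i). t \<in> (\<lambda>t. x(i := t)) -` T" by (rule eventually_nhds_in_open)
  then show ?thesis using x i T by (auto elim!: eventually_mono)
qed

lemma line_deriv_cong:
  assumes "openin (Euclidean_space n) U" "x \<in> U" "i < n" "\<And>x. x \<in> U \<Longrightarrow> f x = f' x"
  shows "((\<lambda>t. f (x(i := t))) has_real_derivative d) (at (x i)) \<longleftrightarrow>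
         ((\<lambda>t. f' (x(i := t))) has_real_derivative d) (at (x i))"
  by (rule DERIV_cong_ev) (use eventually_line[OF assms(1-3)] assms(4) in \<open>auto elim!: eventually_mono\<close>)

lemma Ck_on_cong:
  assumes U: "openin (Euclidean_space n) U" and eq: "\<And>x. x \<in> U \<Longrightarrow> f x = f' x" and f: "Ck_on n k U f"
  shows "Ck_on n k U f'"
proof -
  have c: "continuous_map (subtopology (Euclidean_space n) U) euclideanreal f'"
    if "continuous_map (subtopology (Euclidean_space n) U) euclideanreal f"
    by (rule continuous_map_eq[OF that]) (simp add: eq)
  show ?thesis
  proof (cases k)
    case 0
    with f c show ?thesis by simp
  next
    case (Suc m)
    show ?thesis
      using f c line_deriv_cong[where f=f and f'=f', OF U _ _ eq] unfolding Suc by simp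
  qed
qed

lemma Ck_on_subset: "Ck_on n k U f \<Longrightarrow> V \<subseteq> U \<Longrightarrow> Ck_on n k V f"
proof (induction k arbitrary: f)
  case 0
  then show ?case by (simp add: continuous_map_from_subtopology_mono)
next
  case (Suc k)
  then have "continuous_map (subtopology (Euclidean_space n) V) euclideanreal f"
    by (auto intro: continuous_map_from_subtopology_mono)
  moreover have "\<exists>g. (\<forall>x\<in>V. ((\<lambda>t. f (x(i := t))) has_real_derivative g x) (at (x i))) \<and> Ck_on n k V g"
    if "i < n" for i
    using Suc that by (simp only: Ck_on.simps) (meson subsetD)
  ultimately show ?case by simp
qed

lemma Ck_on_SucD: "Ck_on n (Suc k) U f \<Longrightarrow> Ck_on n k U f"
proof (induction k arbitrary: f)
  case 0
  then show ?case by simp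
next
  case (Suc k)
  then show ?case unfolding Ck_on.simps(2)[of n k] Ck_on.simps(2)[of n "Suc k"] by blast
qed

lemma Ck_on_const: "Ck_on n k U (\<lambda>x. c)"
proof (induction k arbitrary: c)
  case (Suc k)
  then show ?case by (auto intro!: exI[of _ "\<lambda>x. 0"])
qed simp

lemma Ck_on_add: "Ck_on n k U f \<Longrightarrow> Ck_on n k U g \<Longrightarrow> Ck_on n k U (\<lambda>x. f x + g x)"
proof (induction k arbitrary: f g)
  case 0
  then show ?case by (simp add: continuous_map_add)
next
  case (Suc k)
  have "\<exists>h. (\<forall>x\<in>U. ((\<lambda>t. f (x(i := t)) + g (x(i := t))) has_real_derivative h x) (at (x i))) \<and> Ck_on n k U h"
    if i: "i < n" for i
  proof -
    obtain f' g' where d: "\<forall>x\<in>U. ((\<lambda>t. f (x(i := t))) has_real_derivative f' x) (at (x i))" "Ck_on n k U f'"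
      "\<forall>x\<in>U. ((\<lambda>t. g (x(i := t))) has_real_derivative g' x) (at (x i))" "Ck_on n k U g'"
      using Suc.prems i by fastforce
    then show ?thesis
      by (intro exI[of _ "\<lambda>x. f' x + g' x"]) (auto intro!: DERIV_add Suc.IH)
  qed
  then show ?case using Suc.prems by (simp add: continuous_map_add)
qed

lemma Ck_on_mult: "Ck_on n k U f \<Longrightarrow> Ck_on n k U g \<Longrightarrow> Ck_on n k U (\<lambda>x. f x * g x)"
proof (induction k arbitrary: f g)
  case 0
  then show ?case by (simp add: continuous_map_real_mult)
next
  case (Suc k)
  have "\<exists>h. (\<forall>x\<in>U. ((\<lambda>t. f (x(i := t)) * g (x(i := t))) has_real_derivative h x) (at (x i))) \<and> Ck_on n k U h"
    if i: "i < n" for i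
  proof -
    obtain f' g' where d: "\<forall>x\<in>U. ((\<lambda>t. f (x(i := t))) has_real_derivative f' x) (at (x i))" "Ck_on n k U f'"
      "\<forall>x\<in>U. ((\<lambda>t. g (x(i := t))) has_real_derivative g' x) (at (x i))" "Ck_on n k U g'"
      using Suc.prems i by fastforce
    have "((\<lambda>t. f (x(i := t)) * g (x(i := t))) has_real_derivative f' x * g x + g' x * f x) (at (x i))"
      if "x \<in> U" for x
      using DERIV_mult[OF d(1)[rule_format, OF that] d(3)[rule_format, OF that]] by simp
    then show ?thesis
      using d Suc.prems[THEN Ck_on_SucD]
      by (intro exI[of _ "\<lambda>x. f' x * g x + g' x * f x"]) (auto intro!: Ck_on_add Suc.IH)
  qed
  then show ?case using Suc.prems by (simp add: continuous_map_real_mult)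
qed

lemma Ck_on_inverse:
  assumes "\<And>x. x \<in> U \<Longrightarrow> f x \<noteq> 0" "Ck_on n k U f"
  shows "Ck_on n k U (\<lambda>x. inverse (f x))"
  using assms(2)
proof (induction k)
  case 0
  then show ?case using assms(1) unfolding Ck_on_0 by (auto intro!: continuous_on_inverse)
next
  case (Suc k)
  note k = Suc.prems[THEN Ck_on_SucD]
  have "\<exists>h. (\<forall>x\<in>U. ((\<lambda>t. inverse (f (x(i := t)))) has_real_derivative h x) (at (x i))) \<and> Ck_on n k U h"
    if i: "i < n" for i
  proof -
    obtain f' where d: "\<forall>x\<in>U. ((\<lambda>t. f (x(i := t))) has_real_derivative f' x) (at (x i))" "Ck_on n k U f'"
      using Suc.prems i by fastforce
    have "((\<lambda>t. inverse (f (x(i := t)))) has_real_derivative (-1) * (inverse (f x) * f' x * inverse (f x))) (at (x i))"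
      if "x \<in> U" for x
      using DERIV_inverse'[OF d(1)[rule_format, OF that]] assms(1)[OF that] by simp
    then show ?thesis
      using d Suc.IH[OF k]
      by (intro exI[of _ "\<lambda>x. (-1) * (inverse (f x) * f' x * inverse (f x))"]
          conjI ballI Ck_on_mult Ck_on_const) auto
  qed
  moreover have "continuous_map (subtopology (Euclidean_space n) U) euclideanreal (\<lambda>x. inverse (f x))"
  proof -
    have "Ck_on n 0 U f" using Suc.prems by simp
    then have "Ck_on n 0 U (\<lambda>x. inverse (f x))"
      unfolding Ck_on_0 using assms(1) by (auto intro!: continuous_on_inverse)
    then show ?thesis by simp
  qed
  ultimately show ?case by simp
qed

text \<open>Up to multiplication with smooth functions the family is closed under differentiation, so
  smoothness is shown for all its members at once.\<close>

definition flat :: "nat \<Rightarrow> real \<Rightarrow> real" where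
  "flat m x = (if x > 0 then inverse x ^ m * exp (- inverse x) else 0)"

text \<open>Passing to the reciprocal turns this into the decay of \<open>x ^ m / exp x\<close> at
  infinity.\<close>

lemma flat_at_0: "((\<lambda>x. inverse x ^ m * exp (- inverse x)) \<longlongrightarrow> 0) (at_right (0::real))"
proof -
  have "((\<lambda>x::real. x ^ m / exp x) \<longlongrightarrow> 0) at_top" by (rule tendsto_power_div_exp_0)
  from filterlim_compose[OF this filterlim_inverse_at_top_right]
  show ?thesis by (simp add: exp_minus divide_inverse)
qed

lemma flat_deriv: "(flat m has_real_derivative (- real m * flat (Suc m) x + flat (Suc (Suc m)) x)) (at x)"
proof (cases x "0::real" rule: linorder_cases)
  case less
  have "((\<lambda>x. 0) has_real_derivative 0) (at x)" by simp
  moreover have "\<forall>\<^sub>F y in nhds x. flat m y = 0"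
    using eventually_nhds_in_open[OF open_lessThan, of x 0] less
    by (auto elim!: eventually_mono simp: flat_def)
  ultimately show ?thesis using less DERIV_cong_ev[of x x "flat m" "\<lambda>x. 0" 0 0] by (simp add: flat_def)
next
  case greater
  have "((\<lambda>x. inverse x ^ m * exp (- inverse x)) has_real_derivative
     (- real m * (inverse x ^ Suc m * exp (- inverse x)) + inverse x ^ Suc (Suc m) * exp (- inverse x))) (at x)"
  proof (cases m)
    case 0
    then show ?thesis using greater
      by (auto intro!: derivative_eq_intros simp: power2_eq_square field_simps)
  next
    case (Suc k)
    have "((\<lambda>x. inverse x ^ Suc k * exp (- inverse x)) has_real_derivative
      (of_nat (Suc k) * (- (inverse x * 1 * inverse x) * inverse x ^ k)) * exp (- inverse x)
       + (exp (- inverse x) * (inverse x * 1 * inverse x)) * inverse x ^ Suc k) (at x)"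
      using greater
      by (intro DERIV_mult DERIV_power_Suc DERIV_inverse' DERIV_ident derivative_eq_intros) auto
    then show ?thesis unfolding Suc by (rule DERIV_cong) (simp add: algebra_simps)
  qed
  moreover have "\<forall>\<^sub>F y in nhds x. flat m y = inverse y ^ m * exp (- inverse y)"
    using eventually_nhds_in_open[OF open_greaterThan, of x 0] greater
    by (auto elim!: eventually_mono simp: flat_def)
  ultimately show ?thesis using greater
    DERIV_cong_ev[of x x "flat m" "\<lambda>y. inverse y ^ m * exp (- inverse y)", OF refl _ refl] by (simp add: flat_def)
next
  \<comment> \<open>At the origin the difference quotient equals \<open>flat (Suc m)\<close> on the
    right, which tends to 0, and vanishes on the left.\<close>
  case equal
  have r: "((\<lambda>y. flat m y / y) \<longlongrightarrow> 0) (at_right 0)"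
    by (rule Lim_transform_eventually[OF flat_at_0[of "Suc m"]])
      (auto simp: eventually_at_right_field flat_def divide_inverse mult_ac intro!: exI[of _ 1])
  have l: "((\<lambda>y. flat m y / y) \<longlongrightarrow> 0) (at_left 0)"
    by (rule Lim_transform_eventually[OF tendsto_const])
      (auto simp: eventually_at_left_field flat_def intro!: exI[of _ "-1"])
  have "((\<lambda>y. (flat m y - flat m 0) / (y - 0)) \<longlongrightarrow> 0) (at 0)"
    using filterlim_split_at_real[OF l r] by (simp add: flat_def)
  then show ?thesis unfolding equal by (simp add: has_field_derivative_iff flat_def)
qed

lemma Ck_on_flat: "Ck_on n k U f \<Longrightarrow> Ck_on n k U (\<lambda>x. flat m (f x))"
proof (induction k arbitrary: m)
  case 0
  have "continuous_on UNIV (flat m)"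
    using flat_deriv by (intro DERIV_continuous_on[of UNIV "flat m"]) auto
  then show ?case using 0 unfolding Ck_on_0 by (auto intro: continuous_on_compose2)
next
  case (Suc k)
  note k = Suc.prems[THEN Ck_on_SucD]
  have "\<exists>h. (\<forall>x\<in>U. ((\<lambda>t. flat m (f (x(i := t)))) has_real_derivative h x) (at (x i))) \<and> Ck_on n k U h"
    if i: "i < n" for i
  proof -
    obtain f' where d: "\<forall>x\<in>U. ((\<lambda>t. f (x(i := t))) has_real_derivative f' x) (at (x i))" "Ck_on n k U f'"
      using Suc.prems i by fastforce
    have "((\<lambda>t. flat m (f (x(i := t)))) has_real_derivative
        (- real m * flat (Suc m) (f x) + flat (Suc (Suc m)) (f x)) * f' x) (at (x i))"
      if "x \<in> U" for x
      using DERIV_chain2[OF flat_deriv d(1)[rule_format, OF that], of m] by simp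
    then show ?thesis
      using d Suc.IH[OF k]
      by (intro exI[of _ "\<lambda>x. (- real m * flat (Suc m) (f x) + flat (Suc (Suc m)) (f x)) * f' x"]
          conjI ballI Ck_on_mult Ck_on_add Ck_on_const) auto
  qed
  moreover have "continuous_map (subtopology (Euclidean_space n) U) euclideanreal (\<lambda>x. flat m (f x))"
  proof -
    have c: "continuous_on UNIV (flat m)"
      using flat_deriv by (intro DERIV_continuous_on[of UNIV "flat m"]) auto
    have "Ck_on n 0 U f" using Suc.prems by simp
    then have "Ck_on n 0 U (\<lambda>x. flat m (f x))"
      unfolding Ck_on_0 using c by (auto intro: continuous_on_compose2)
    then show ?thesis by simp
  qed
  ultimately show ?case by simp
qed

text \<open>Partial derivatives are asserted only to exist, so local choices have to be glued. The
  operator \<open>deriv\<close> supplies a candidate independent of the neighbourhood, and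
  uniqueness of derivatives identifies it with each local choice.\<close>

lemma Ck_on_local:
  assumes U: "openin (Euclidean_space n) U"
    and loc: "\<And>x. x \<in> U \<Longrightarrow> \<exists>V. openin (Euclidean_space n) V \<and> x \<in> V \<and> Ck_on n k V f"
  shows "Ck_on n k U f"
proof -
  let ?E = "{x::nat \<Rightarrow> real. \<forall>i\<ge>n. x i = 0}"
  have UE: "U \<subseteq> ?E" using openin_subset[OF U] by (simp add: topspace_Euclidean_space)
  have cont: "continuous_on (?E \<inter> U) f"
    if loc: "\<And>x. x \<in> U \<Longrightarrow> \<exists>V. openin (Euclidean_space n) V \<and> x \<in> V \<and> continuous_on (?E \<inter> V) f" for f :: "_ \<Rightarrow> real"
  proof (rule continuous_on_subset)
    show "continuous_on U f"
      unfolding continuous_on_eq_continuous_within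
    proof
      fix x assume x: "x \<in> U"
      then obtain V where V: "openin (Euclidean_space n) V" "x \<in> V" "continuous_on (?E \<inter> V) f" using loc by blast
      obtain T where T: "open T" "V = ?E \<inter> T" using V by (auto simp: Euclidean_space_eq openin_open)
      have "continuous (at x within ?E \<inter> V) f"
        using V x UE by (auto simp: continuous_on_eq_continuous_within)
      \<comment> \<open>\<open>V\<close> is open in the model space, so continuity on
        \<open>V\<close> is continuity in the model space near \<open>x\<close>.\<close>
      moreover have "at x within ?E \<inter> V = at x within ?E"
        by (rule at_within_nhd[of x T]) (use T V in auto)
      ultimately have "continuous (at x within ?E) f" by simp
      then show "continuous (at x within U) f" by (rule continuous_within_subset[OF _ UE])
    qed
  qed simp
  show ?thesis using loc
  proof (induction k arbitrary: f)
    case 0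
    then show ?case unfolding Ck_on_0 by (intro cont) blast
  next
    case (Suc k)
    define g where "g i x = deriv (\<lambda>t. f (x(i := t))) (x i)" for i x
    have "(\<forall>x\<in>U. ((\<lambda>t. f (x(i := t))) has_real_derivative g i x) (at (x i))) \<and> Ck_on n k U (g i)" if i: "i < n" for i
    proof (intro conjI ballI)
      fix x assume "x \<in> U"
      then obtain V where V: "x \<in> V" "Ck_on n (Suc k) V f" using Suc.prems by blast
      then show "((\<lambda>t. f (x(i := t))) has_real_derivative g i x) (at (x i))"
        using i unfolding g_def Ck_on.simps by (metis DERIV_imp_deriv)
    next
      show "Ck_on n k U (g i)"
      proof (rule Suc.IH)
        fix x assume "x \<in> U"
        then obtain V where V: "openin (Euclidean_space n) V" "x \<in> V" "Ck_on n (Suc k) V f"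
          using Suc.prems by blast
        then obtain g' where g': "\<forall>x\<in>V. ((\<lambda>t. f (x(i := t))) has_real_derivative g' x) (at (x i))" "Ck_on n k V g'"
          using i by auto
        then have "Ck_on n k V (g i)"
          by (intro Ck_on_cong[OF V(1) _ g'(2)]) (auto simp: g_def DERIV_imp_deriv)
        with V show "\<exists>V. openin (Euclidean_space n) V \<and> x \<in> V \<and> Ck_on n k V (g i)" by blast
      qed
    qed
    moreover have "continuous_on (?E \<inter> U) f"
    proof (rule cont)
      fix x assume "x \<in> U"
      then obtain V where V: "openin (Euclidean_space n) V" "x \<in> V" "Ck_on n (Suc k) V f"
        using Suc.prems by blast
      then have "Ck_on n 0 V f" by simp
      with V show "\<exists>V. openin (Euclidean_space n) V \<and> x \<in> V \<and> continuous_on (?E \<inter> V) f"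
        unfolding Ck_on_0 by blast
    qed
    then have "Ck_on n 0 U f" by (simp only: Ck_on_0)
    ultimately show ?case by auto
  qed
qed

lemma Ck_on_sum: "finite I \<Longrightarrow> (\<And>i. i \<in> I \<Longrightarrow> Ck_on n k U (f i)) \<Longrightarrow> Ck_on n k U (\<lambda>x. \<Sum>i\<in>I. f i x)"
  by (induction I rule: finite_induct) (auto intro: Ck_on_const Ck_on_add)


lemmas Ck_on_intros = Ck_on_const Ck_on_add Ck_on_mult Ck_on_flat Ck_on_sum

section \<open>Smooth functions on open subsets of a manifold\<close>

locale smooth_mfd =
  fixes M :: "('m::{t2_space,second_countable_topology}, 'x) manifold_data_scheme"
  assumes mfd: "smooth_manifold M"
begin

lemma chart_open: "(U, \<phi>) \<in> atlas M \<Longrightarrow> open U"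
  using mfd unfolding smooth_manifold_def by blast

lemma chart_homeo: "(U, \<phi>) \<in> atlas M \<Longrightarrow>
    homeomorphic_map (top_of_set U) (subtopology (Euclidean_space (mdim M)) (\<phi> ` U)) \<phi>"
  using mfd unfolding smooth_manifold_def by blast

lemma chart_image_open: "(U, \<phi>) \<in> atlas M \<Longrightarrow> openin (Euclidean_space (mdim M)) (\<phi> ` U)"
  using mfd unfolding smooth_manifold_def by blast

lemma chart_cover: obtains U \<phi> where "(U, \<phi>) \<in> atlas M" "p \<in> U"
  using mfd unfolding smooth_manifold_def by blast

lemma chart_inj: "(U, \<phi>) \<in> atlas M \<Longrightarrow> inj_on \<phi> U"
  using homeomorphic_imp_injective_map[OF chart_homeo] by simp

lemma chart_transition: "(U, \<phi>) \<in> atlas M \<Longrightarrow> (V, \<psi>) \<in> atlas M \<Longrightarrow> i < mdim M \<Longrightarrow>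
    Ck_on (mdim M) k (\<phi> ` (U \<inter> V)) (\<lambda>y. \<psi> (inv_into U \<phi> y) i)"
  using mfd unfolding smooth_manifold_def Cinf_on_def by blast

lemma chart_openin:
  assumes U: "(U, \<phi>) \<in> atlas M" and W: "open W"
  shows "openin (Euclidean_space (mdim M)) (\<phi> ` (U \<inter> W))"
proof -
  have "openin (top_of_set U) (U \<inter> W)" using W by auto
  then have "openin (subtopology (Euclidean_space (mdim M)) (\<phi> ` U)) (\<phi> ` (U \<inter> W))"
    using homeomorphic_map_openness[OF chart_homeo[OF U], of "U \<inter> W"] by simp
  then show ?thesis using chart_image_open[OF U] openin_trans_full by blast
qed

lemma inv_chart: assumes "(U, \<phi>) \<in> atlas M" "x \<in> U" shows "inv_into U \<phi> (\<phi> x) = x"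
  using chart_inj[OF assms(1)] assms(2) by simp

lemma smooth_on_iff: "smooth_on M W f \<longleftrightarrow>
    (\<forall>(U, \<phi>)\<in>atlas M. \<forall>k. Ck_on (mdim M) k (\<phi> ` (U \<inter> W)) (\<lambda>y. f (inv_into U \<phi> y)))"
  by (simp add: smooth_on_def Cinf_on_def o_def)

lemma smooth_onI:
  assumes "\<And>U \<phi> k. (U, \<phi>) \<in> atlas M \<Longrightarrow> Ck_on (mdim M) k (\<phi> ` (U \<inter> W)) (\<lambda>y. f (inv_into U \<phi> y))"
  shows "smooth_on M W f"
  using assms unfolding smooth_on_iff by blast

lemma smooth_onD: "smooth_on M W f \<Longrightarrow> (U, \<phi>) \<in> atlas M \<Longrightarrow>
    Ck_on (mdim M) k (\<phi> ` (U \<inter> W)) (\<lambda>y. f (inv_into U \<phi> y))"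
  unfolding smooth_on_iff by blast

lemma smooth_on_subset: "smooth_on M W f \<Longrightarrow> W' \<subseteq> W \<Longrightarrow> smooth_on M W' f"
  by (intro smooth_onI) (rule Ck_on_subset[OF smooth_onD], auto)

lemma smooth_on_cong:
  assumes W: "open W" and eq: "\<And>x. x \<in> W \<Longrightarrow> f x = g x" and f: "smooth_on M W f"
  shows "smooth_on M W g"
proof (rule smooth_onI)
  fix U \<phi> k assume U: "(U, \<phi>) \<in> atlas M"
  show "Ck_on (mdim M) k (\<phi> ` (U \<inter> W)) (\<lambda>y. g (inv_into U \<phi> y))"
    by (rule Ck_on_cong[OF chart_openin[OF U W] _ smooth_onD[OF f U]]) (auto simp: inv_chart[OF U] eq)
qed

lemma smooth_on_local:
  assumes W: "open W" and loc: "\<And>x. x \<in> W \<Longrightarrow> \<exists>V. open V \<and> x \<in> V \<and> smooth_on M V f"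
  shows "smooth_on M W f"
proof (rule smooth_onI)
  fix U \<phi> k assume U: "(U, \<phi>) \<in> atlas M"
  show "Ck_on (mdim M) k (\<phi> ` (U \<inter> W)) (\<lambda>y. f (inv_into U \<phi> y))"
  proof (rule Ck_on_local[OF chart_openin[OF U W]])
    fix y assume "y \<in> \<phi> ` (U \<inter> W)"
    then obtain x where x: "x \<in> U" "x \<in> W" "y = \<phi> x" by blast
    then obtain V where V: "open V" "x \<in> V" "smooth_on M V f" using loc by blast
    show "\<exists>V. openin (Euclidean_space (mdim M)) V \<and> y \<in> V \<and> Ck_on (mdim M) k V (\<lambda>y. f (inv_into U \<phi> y))"
      using chart_openin[OF U V(1)] smooth_onD[OF V(3) U] x V by blast
  qed
qed

lemma smooth_on_const: "smooth_on M W (\<lambda>x. c)"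
  by (intro smooth_onI Ck_on_const)

lemma smooth_on_add: "smooth_on M W f \<Longrightarrow> smooth_on M W g \<Longrightarrow> smooth_on M W (\<lambda>x. f x + g x)"
  by (rule smooth_onI, rule Ck_on_add; rule smooth_onD)

lemma smooth_on_mult: "smooth_on M W f \<Longrightarrow> smooth_on M W g \<Longrightarrow> smooth_on M W (\<lambda>x. f x * g x)"
  by (rule smooth_onI, rule Ck_on_mult; rule smooth_onD)

lemma smooth_on_minus: "smooth_on M W f \<Longrightarrow> smooth_on M W (\<lambda>x. - f x)"
  using smooth_on_mult[OF smooth_on_const[of W "-1"], of f] by simp

lemma smooth_on_diff: "smooth_on M W f \<Longrightarrow> smooth_on M W g \<Longrightarrow> smooth_on M W (\<lambda>x. f x - g x)"
  using smooth_on_add[OF _ smooth_on_minus, of W f g] by simp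

lemma smooth_on_inverse:
  assumes "\<And>x. x \<in> W \<Longrightarrow> f x \<noteq> 0" "smooth_on M W f"
  shows "smooth_on M W (\<lambda>x. inverse (f x))"
proof (rule smooth_onI)
  fix U \<phi> k assume U: "(U, \<phi>) \<in> atlas M"
  show "Ck_on (mdim M) k (\<phi> ` (U \<inter> W)) (\<lambda>y. inverse (f (inv_into U \<phi> y)))"
    by (rule Ck_on_inverse[OF _ smooth_onD[OF assms(2) U]]) (auto simp: inv_chart[OF U] assms(1))
qed

lemma smooth_on_divide:
  assumes "\<And>x. x \<in> W \<Longrightarrow> g x \<noteq> 0" "smooth_on M W f" "smooth_on M W g"
  shows "smooth_on M W (\<lambda>x. f x / g x)"
  unfolding divide_inverse by (intro smooth_on_mult smooth_on_inverse assms)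

lemma smooth_on_sum: "finite I \<Longrightarrow> (\<And>i. i \<in> I \<Longrightarrow> smooth_on M W (f i)) \<Longrightarrow> smooth_on M W (\<lambda>x. \<Sum>i\<in>I. f i x)"
  by (induction I rule: finite_induct) (auto intro: smooth_on_const smooth_on_add)

lemma smooth_on_prod: "finite I \<Longrightarrow> (\<And>i. i \<in> I \<Longrightarrow> smooth_on M W (f i)) \<Longrightarrow> smooth_on M W (\<lambda>x. \<Prod>i\<in>I. f i x)"
  by (induction I rule: finite_induct) (auto intro: smooth_on_const smooth_on_mult)

lemma Cinf_iff: "f \<in> Cinf M \<longleftrightarrow> smooth_on M UNIV f"
  by (simp add: Cinf_def)

lemma Cinf_const: "(\<lambda>x. c) \<in> Cinf M"
  and Cinf_add: "f \<in> Cinf M \<Longrightarrow> g \<in> Cinf M \<Longrightarrow> (\<lambda>x. f x + g x) \<in> Cinf M"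
  and Cinf_diff: "f \<in> Cinf M \<Longrightarrow> g \<in> Cinf M \<Longrightarrow> (\<lambda>x. f x - g x) \<in> Cinf M"
  and Cinf_mult: "f \<in> Cinf M \<Longrightarrow> g \<in> Cinf M \<Longrightarrow> (\<lambda>x. f x * g x) \<in> Cinf M"
  unfolding Cinf_iff by (intro smooth_on_const smooth_on_add smooth_on_mult smooth_on_diff; assumption)+

lemma Cinf_smooth_on: "f \<in> Cinf M \<Longrightarrow> smooth_on M W f"
  unfolding Cinf_iff by (rule smooth_on_subset) auto

lemma smooth_on_gdet:
  assumes "\<And>i j. i < n \<Longrightarrow> j < n \<Longrightarrow> smooth_on M W (G i j)"
  shows "smooth_on M W (\<lambda>x. gdet n (\<lambda>i j. G i j x))"
  unfolding gdet_expand
proof (rule smooth_on_sum)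
  show "finite {p. p permutes {0..<n}}" by (simp add: finite_permutations)
  fix p assume p: "p \<in> {p. p permutes {0..<n}}"
  have "smooth_on M W (\<lambda>x. \<Prod>i = 0..<n. G i (p i) x)"
  proof (rule smooth_on_prod)
    fix i assume i: "i \<in> {0..<n}"
    then have "p i < n" using p permutes_in_image[of p "{0..<n}" i] by simp
    then show "smooth_on M W (G i (p i))" using assms i by simp
  qed simp
  then show "smooth_on M W (\<lambda>x. signof p * (\<Prod>i = 0..<n. G i (p i) x))"
    by (rule smooth_on_mult[OF smooth_on_const])
qed

lemma smooth_on_gadj:
  assumes G: "\<And>i j. i < n \<Longrightarrow> j < n \<Longrightarrow> smooth_on M W (G i j)" and ij: "i < n" "j < n"
  shows "smooth_on M W (\<lambda>x. gadj n (\<lambda>i j. G i j x) i j)"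
  unfolding gadj_expand[OF ij]
  by (intro smooth_on_mult smooth_on_const smooth_on_gdet G) (use ij in auto)

text \<open>The solution is expressed by Cramer's rule applied to the Gram matrix \<open>P\<^sup>T P\<close>.\<close>

lemma smooth_on_solution:
  fixes P :: "'i \<Rightarrow> nat \<Rightarrow> 'm \<Rightarrow> real"
  assumes I: "finite I" and W: "open W"
    and P: "\<And>a k. a \<in> I \<Longrightarrow> k < r \<Longrightarrow> smooth_on M W (P a k)"
    and s: "\<And>a. a \<in> I \<Longrightarrow> smooth_on M W (s a)"
    and eq: "\<And>a x. a \<in> I \<Longrightarrow> x \<in> W \<Longrightarrow> s a x = (\<Sum>k<r. z k x * P a k x)"
    and indep: "\<And>x v k. x \<in> W \<Longrightarrow> (\<And>a. a \<in> I \<Longrightarrow> (\<Sum>k<r. v k * P a k x) = 0) \<Longrightarrow> k < r \<Longrightarrow> v k = 0"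
    and k: "k < r"
  shows "smooth_on M W (z k)"
proof -
  define G where "G i j x = (\<Sum>a\<in>I. P a i x * P a j x)" for i j x
  define t where "t i x = (\<Sum>a\<in>I. P a i x * s a x)" for i x
  have G: "smooth_on M W (G i j)" if "i < r" "j < r" for i j
    unfolding G_def using that by (intro smooth_on_sum smooth_on_mult I P) auto
  have ts: "smooth_on M W (t i)" if "i < r" for i
    unfolding t_def using that by (intro smooth_on_sum smooth_on_mult I P s) auto
  have Gv: "(\<Sum>i<r. G j i x * v i) = (\<Sum>a\<in>I. P a j x * (\<Sum>i<r. v i * P a i x))" for j x v
    unfolding G_def sum_distrib_left sum_distrib_right by (subst sum.swap) (simp add: mult_ac)
  have nz: "gdet r (\<lambda>i j. G i j x) \<noteq> 0" if x: "x \<in> W" for x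
  proof (rule gdet_nonzero)
    fix v k assume v: "\<And>j. j < r \<Longrightarrow> (\<Sum>i<r. G j i x * v i) = 0" and k: "k < r"
    \<comment> \<open>The quadratic form of the Gram matrix at \<open>v\<close> is the sum of the
      squares of \<open>q\<close>. A kernel vector therefore solves all the homogeneous equations,
      and \<open>indep\<close> applies.\<close>
    define q where "q a = (\<Sum>i<r. v i * P a i x)" for a
    have "(\<Sum>a\<in>I. q a * q a) = (\<Sum>j<r. v j * (\<Sum>a\<in>I. P a j x * q a))"
      unfolding q_def[of "_"] sum_distrib_left sum_distrib_right
      by (subst sum.swap) (simp add: mult_ac sum_distrib_left)
    also have "\<dots> = 0" using v unfolding Gv q_def by simp
    finally have "\<forall>a\<in>I. q a * q a = 0" by (subst (asm) sum_nonneg_eq_0_iff[OF I]) auto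
    then have "\<And>a. a \<in> I \<Longrightarrow> (\<Sum>i<r. v i * P a i x) = 0" by (simp add: q_def)
    from indep[OF x this k] show "v k = 0" .
  qed
  have "z k x = (\<Sum>j<r. gadj r (\<lambda>i j. G i j x) k j * t j x) / gdet r (\<lambda>i j. G i j x)" if x: "x \<in> W" for x
  proof (rule gadj_unique[OF nz[OF x] _ k])
    fix j assume "j < r"
    show "(\<Sum>i<r. G j i x * z i x) = t j x" unfolding Gv t_def using eq[OF _ x] by simp
  qed
  moreover have "smooth_on M W (\<lambda>x. (\<Sum>j<r. gadj r (\<lambda>i j. G i j x) k j * t j x) / gdet r (\<lambda>i j. G i j x))"
    by (intro smooth_on_divide nz smooth_on_sum smooth_on_mult smooth_on_gadj smooth_on_gdet G ts k) auto
  ultimately show ?thesis using smooth_on_cong[OF W] by (metis (no_types, lifting))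
qed

text \<open>The cutoff is built from \<open>flat\<close> in one chart and extended by zero. The
  closed set \<open>C\<close>, which lies in the chart and contains the support, is what makes this
  extension smooth; it also serves to extend sections given on \<open>W\<close> only.\<close>

lemma bump:
  assumes W: "open W" and p: "p \<in> W"
  obtains \<eta> N C where "\<eta> \<in> Cinf M" "open N" "p \<in> N" "closed C" "N \<subseteq> C" "C \<subseteq> W"
    "\<And>x. x \<in> N \<Longrightarrow> \<eta> x = 1" "\<And>x. x \<notin> C \<Longrightarrow> \<eta> x = 0"
proof -
  let ?n = "mdim M"
  let ?E = "{x::nat \<Rightarrow> real. \<forall>i\<ge>?n. x i = 0}"
  obtain U \<phi> where U: "(U, \<phi>) \<in> atlas M" "p \<in> U" using chart_cover by blast
  define O1 where "O1 = \<phi> ` (U \<inter> W)"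
  define a where "a = \<phi> p"
  have O1: "openin (Euclidean_space ?n) O1" "a \<in> O1"
    using chart_openin[OF U(1) W] U(2) p by (auto simp: O1_def a_def)
  have aE: "a \<in> ?E" using O1 openin_subset by (force simp: topspace_Euclidean_space)
  obtain T where T: "open T" "O1 = ?E \<inter> T" using O1 by (auto simp: Euclidean_space_eq openin_open)
  have "openin (product_topology (\<lambda>i. euclideanreal) UNIV) T" using T(1) by (simp add: euclidean_product_topology)
  then obtain X where X: "a \<in> Pi\<^sub>E UNIV X" "\<And>i. open (X i)" "Pi\<^sub>E UNIV X \<subseteq> T"
    using product_topology_open_contains_basis[of "\<lambda>i. euclideanreal" UNIV T a] O1 T by auto
  have "\<exists>e>0. \<forall>y. \<bar>y - a i\<bar> \<le> e \<longrightarrow> y \<in> X i" for i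
  proof -
    have "a i \<in> X i" using X(1) by auto
    then obtain e where "e > 0" "cball (a i) e \<subseteq> X i" using X(2) open_contains_cball by blast
    then show ?thesis by (auto simp: cball_def dist_real_def subset_iff abs_minus_commute)
  qed
  then obtain e where e: "\<And>i. e i > 0" "\<And>i y. \<bar>y - a i\<bar> \<le> e i \<Longrightarrow> y \<in> X i" by metis
  \<comment> \<open>The element 1 keeps the minimum meaningful in dimension 0.\<close>
  define d where "d = Min (insert 1 (e ` {..<?n}))"
  have d: "d > 0" "\<And>i. i < ?n \<Longrightarrow> d \<le> e i" using e(1) by (auto simp: d_def)
  \<comment> \<open>Compact by Tychonoff's theorem: the coordinates beyond the dimension are pinned
    to 0, as in the model space.\<close>
  define Box where "Box = Pi\<^sub>E UNIV (\<lambda>i. if i < ?n then {a i - d..a i + d} else {0})"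
  have Box: "y \<in> Box \<longleftrightarrow> (\<forall>i. if i < ?n then \<bar>y i - a i\<bar> \<le> d else y i = 0)" for y
  proof -
    have "\<bar>y i - a i\<bar> \<le> d \<longleftrightarrow> y i \<in> {a i - d..a i + d}" for i by auto
    then show ?thesis unfolding Box_def PiE_UNIV_domain Pi_iff by simp
  qed
  have BoxO: "Box \<subseteq> O1"
  proof
    fix y assume y: "y \<in> Box"
    have "y \<in> ?E" using y by (auto simp: Box not_less[symmetric])
    moreover have "y i \<in> X i" for i
    proof (cases "i < ?n")
      case True
      then have "\<bar>y i - a i\<bar> \<le> d" using y unfolding Box by metis
      then show ?thesis using d(2)[OF True] e(2) by force
    next
      case False
      then have "y i = a i" using \<open>y \<in> ?E\<close> aE by simp
      then show ?thesis using X(1) by auto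
    qed
    then have "y \<in> T" using X(3) by auto
    ultimately show "y \<in> O1" using T by blast
  qed
  have "compactin (product_topology (\<lambda>i. euclideanreal) UNIV) Box"
    unfolding Box_def compactin_PiE by auto
  then have cBox: "compact Box" by (simp add: euclidean_product_topology)
  obtain \<psi> where hm: "homeomorphic_maps (top_of_set U) (subtopology (Euclidean_space ?n) (\<phi> ` U)) \<phi> \<psi>"
    using chart_homeo[OF U(1)] homeomorphic_map_maps by blast
  have EU: "subtopology (Euclidean_space ?n) (\<phi> ` U) = top_of_set (\<phi> ` U)"
    using openin_subset[OF chart_image_open[OF U(1)]]
    by (simp add: Euclidean_space_eq subtopology_subtopology Int_absorb1)
  have c\<phi>: "continuous_on U \<phi>" and c\<psi>: "continuous_on (\<phi> ` U) \<psi>" and \<psi>\<phi>: "\<And>x. x \<in> U \<Longrightarrow> \<psi> (\<phi> x) = x"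
    using hm unfolding homeomorphic_maps_def EU by auto
  define C where "C = \<psi> ` Box"
  have BU: "Box \<subseteq> \<phi> ` U" using BoxO by (auto simp: O1_def)
  have "compact C" unfolding C_def by (rule compact_continuous_image[OF continuous_on_subset[OF c\<psi> BU] cBox])
  \<comment> \<open>This is where the Hausdorff property of the manifold enters.\<close>
  then have clC: "closed C" by (rule compact_imp_closed)
  have C: "x \<in> C \<longleftrightarrow> x \<in> U \<and> \<phi> x \<in> Box" for x
    using BU \<psi>\<phi> by (force simp: C_def)
  have CW: "C \<subseteq> W" 
  proof
    fix x assume x: "x \<in> C"
    then obtain x' where "x' \<in> U" "x' \<in> W" "\<phi> x = \<phi> x'" using BoxO by (auto simp: C O1_def)
    then show "x \<in> W" using chart_inj[OF U(1)] x by (auto simp: C inj_on_def)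
  qed
  \<comment> \<open>\<open>q\<close> is the squared distance from \<open>a\<close>. The function
    \<open>h\<close> is positive where \<open>q\<close> is below \<open>d * d\<close>, and
    \<open>g\<close> where it exceeds half of that, so their sum never vanishes. The quotient is 1
    close to \<open>a\<close> and 0 once \<open>q\<close> reaches \<open>d * d\<close>.\<close>
  define q where "q y = (\<Sum>i<?n. (y i + (- a i)) * (y i + (- a i)))" for y :: "nat \<Rightarrow> real"
  define h where "h y = flat 0 (d * d + (-1) * q y)" for y
  define g where "g y = flat 0 (q y + (- (d * d / 2)))" for y
  define \<beta> where "\<beta> y = h y * inverse (h y + g y)" for y
  have hg: "h y + g y \<noteq> 0" for y
  proof -
    have "d * d > 0" using d by simp
    then have "d * d + (-1) * q y > 0 \<or> q y + (- (d * d / 2)) > 0" by auto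
    then show ?thesis unfolding h_def g_def flat_def
      by (auto simp: add_pos_pos less_imp_neq[symmetric])
  qed
  have \<beta>1: "\<beta> y = 1" if "q y < d * d / 2" for y
  proof -
    have "g y = 0" using that by (simp add: g_def flat_def)
    then show ?thesis using hg[of y] by (simp add: \<beta>_def)
  qed
  have \<beta>0: "\<beta> y = 0" if yE: "y \<in> ?E" "y \<notin> Box" for y
  proof -
    obtain i where i': "\<not> (if i < ?n then \<bar>y i - a i\<bar> \<le> d else y i = 0)"
      using yE(2) unfolding Box by blast
    then have i: "i < ?n" "\<bar>y i - a i\<bar> > d" using yE(1) by (auto split: if_splits)
    have "d * d \<le> \<bar>y i - a i\<bar> * \<bar>y i - a i\<bar>" using i d by (intro mult_mono) auto
    also have "\<dots> = (y i + (- a i)) * (y i + (- a i))" by (simp add: abs_mult_self_eq)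
    also have "\<dots> \<le> q y" unfolding q_def using i by (intro member_le_sum) auto
    finally show ?thesis by (simp add: \<beta>_def h_def flat_def)
  qed
  define \<eta> where "\<eta> x = (if x \<in> U then \<beta> (\<phi> x) else 0)" for x
  have sm: "smooth_on M U (\<lambda>x. \<beta> (\<phi> x))"
  proof (rule smooth_onI)
    fix V \<theta> k assume V: "(V, \<theta>) \<in> atlas M"
    have c: "Ck_on ?n k (\<theta> ` (V \<inter> U)) (\<lambda>y. \<phi> (inv_into V \<theta> y) i)" if "i < ?n" for i
      by (rule chart_transition[OF V U(1) that])
    have q: "Ck_on ?n k (\<theta> ` (V \<inter> U)) (\<lambda>y. q (\<phi> (inv_into V \<theta> y)))"
      unfolding q_def by (intro Ck_on_intros c) auto
    show "Ck_on ?n k (\<theta> ` (V \<inter> U)) (\<lambda>y. \<beta> (\<phi> (inv_into V \<theta> y)))"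
      unfolding \<beta>_def using hg unfolding h_def g_def
      by (intro Ck_on_mult Ck_on_inverse Ck_on_add Ck_on_flat Ck_on_const q)
  qed
  have \<phi>E: "\<phi> x \<in> ?E" if "x \<in> U" for x
    using openin_subset[OF chart_image_open[OF U(1)]] that by (auto simp: topspace_Euclidean_space)
  have \<eta>0: "\<eta> x = 0" if "x \<notin> C" for x
    using that \<beta>0 \<phi>E by (auto simp: \<eta>_def C)
  \<comment> \<open>Smooth on \<open>U\<close> by the chart formula and identically zero on the open
    complement of \<open>C\<close>; these two open sets cover the manifold.\<close>
  have "\<eta> \<in> Cinf M"
    unfolding Cinf_iff
  proof (rule smooth_on_local[OF open_UNIV])
    fix x
    show "\<exists>V. open V \<and> x \<in> V \<and> smooth_on M V \<eta>"
    proof (cases "x \<in> U")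
      case True
      have "smooth_on M U \<eta>" by (rule smooth_on_cong[OF chart_open[OF U(1)] _ sm]) (simp add: \<eta>_def)
      then show ?thesis using True chart_open[OF U(1)] by blast
    next
      case False
      have "smooth_on M (- C) \<eta>"
        by (rule smooth_on_cong[OF _ _ smooth_on_const[of _ 0]]) (use clC \<eta>0 in auto)
      then show ?thesis using False clC C by (intro exI[of _ "- C"]) auto
    qed
  qed
  define N where "N = U \<inter> (\<lambda>x. q (\<phi> x)) -` {..<d * d / 2}"
  have "continuous_on U (\<lambda>x. q (\<phi> x))"
  proof -
    have "continuous_on U (\<lambda>x. \<phi> x i)" for i
      by (rule continuous_on_compose2[OF continuous_on_product_coordinates c\<phi>]) auto
    then show ?thesis unfolding q_def by (intro continuous_intros)
  qed
  then have oN: "open N" unfolding N_def by (rule continuous_open_preimage[OF _ chart_open[OF U(1)]]) simp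
  have pN: "p \<in> N" using U(2) d by (simp add: N_def q_def a_def)
  have N1: "\<eta> x = 1" if "x \<in> N" for x using that by (simp add: N_def \<eta>_def \<beta>1)
  have "N \<subseteq> C" using N1 \<eta>0 by force
  from that[OF \<open>\<eta> \<in> Cinf M\<close> oN pN clC this CW N1 \<eta>0] show thesis .
qed

end

section \<open>Sections of vector bundles\<close>

lemma is_basisI:
  assumes V: "subspace V" and b: "\<And>i. i < r \<Longrightarrow> b i \<in> V"
    and ind: "\<And>v i. (\<Sum>i<r. v i *\<^sub>R b i) = 0 \<Longrightarrow> i < r \<Longrightarrow> v i = 0"
    and sp: "\<And>u. u \<in> V \<Longrightarrow> \<exists>v. u = (\<Sum>i<r. v i *\<^sub>R b i)"
  shows "is_basis r b V"
proof -
  have inj: "inj_on b {..<r}"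
  proof (rule inj_onI, rule ccontr)
    fix i j assume ij: "i \<in> {..<r}" "j \<in> {..<r}" "b i = b j" "i \<noteq> j"
    have "(\<Sum>k<r. ((if k = i then 1 else 0) - (if k = j then 1 else 0)) *\<^sub>R b k)
        = (\<Sum>k<r. if k = i then b i else 0) - (\<Sum>k<r. if k = j then b j else 0)"
      unfolding sum_subtractf[symmetric] by (rule sum.cong) auto
    also have "\<dots> = 0" using ij by simp
    finally show False using ind[of "\<lambda>k. (if k = i then 1 else 0) - (if k = j then 1 else 0)" i] ij by auto
  qed
  have "independent (b ` {..<r})"
  proof (subst dependent_finite, simp, safe)
    fix u i assume u: "(\<Sum>v\<in>b ` {..<r}. u v *\<^sub>R v) = 0" "u (b i) \<noteq> 0" "i < r"
    then have "(\<Sum>k<r. u (b k) *\<^sub>R b k) = 0" by (simp add: sum.reindex[OF inj])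
    from ind[OF this u(3)] u(2) show False by simp
  qed
  moreover have "span (b ` {..<r}) = V"
  proof
    show "span (b ` {..<r}) \<subseteq> V" by (rule span_minimal[OF _ V]) (use b in auto)
    show "V \<subseteq> span (b ` {..<r})"
    proof
      fix u assume "u \<in> V"
      then obtain v where "u = (\<Sum>i<r. v i *\<^sub>R b i)" using sp by blast
      then show "u \<in> span (b ` {..<r})" by (auto intro: span_sum span_scale span_base)
    qed
  qed
  ultimately show ?thesis using inj by (simp add: is_basis_def)
qed

lemma is_basis_indep:
  assumes b: "is_basis r b V" and "(\<Sum>i<r. v i *\<^sub>R b i) = 0" "i < r"
  shows "v i = 0"
proof -
  interpret findim V r b by (rule findim.intro[OF b])
  show ?thesis using cr_sum[of i v] assms lin_on_zero[OF lin_cr subV] by simp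
qed

locale vbundle =
  fixes E :: "('m::{t2_space,second_countable_topology}, 'a::real_vector, 'x) vbundle_data_scheme"
  assumes vb: "vector_bundle E"

sublocale vbundle \<subseteq> smooth_mfd E
  using vb by unfold_locales (simp add: vector_bundle_def)

context vbundle
begin

lemma fibre_subspace: "subspace (fibre E p)"
  using vb by (simp add: vector_bundle_def)

lemma frame_open: "(U, e) \<in> frames E \<Longrightarrow> open U"
  and frame_basis: "(U, e) \<in> frames E \<Longrightarrow> x \<in> U \<Longrightarrow> is_basis (bundle_rank E) (\<lambda>i. e i x) (fibre E x)"
  and frame_smooth: "(U, e) \<in> frames E \<Longrightarrow> i < bundle_rank E \<Longrightarrow> smooth_section_on E U (e i)"
  using vb unfolding vector_bundle_def by blast+

lemma frame_cover: obtains U e where "(U, e) \<in> frames E" "p \<in> U"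
proof -
  have "p \<in> (\<Union>(U, e)\<in>frames E. U)" using vb by (simp add: vector_bundle_def)
  then show thesis using that by blast
qed

definition coef :: "(nat \<Rightarrow> 'm \<Rightarrow> 'a) \<Rightarrow> ('m \<Rightarrow> 'a) \<Rightarrow> nat \<Rightarrow> 'm \<Rightarrow> real" where
  "coef e s i x = findim.cr (bundle_rank E) (\<lambda>i. e i x) i (s x)"

lemma coef_unique:
  assumes "(U, e) \<in> frames E" "x \<in> U" "s x = (\<Sum>i<bundle_rank E. c i *\<^sub>R e i x)" "i < bundle_rank E"
  shows "coef e s i x = c i"
proof -
  interpret findim "fibre E x" "bundle_rank E" "\<lambda>i. e i x"
    by (rule findim.intro[OF frame_basis[OF assms(1,2)]])
  show ?thesis unfolding coef_def assms(3) by (rule cr_sum[OF assms(4)])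
qed

lemma coef_expand:
  assumes "(U, e) \<in> frames E" "x \<in> U" "s x \<in> fibre E x"
  shows "s x = (\<Sum>i<bundle_rank E. coef e s i x *\<^sub>R e i x)"
proof -
  interpret findim "fibre E x" "bundle_rank E" "\<lambda>i. e i x"
    by (rule findim.intro[OF frame_basis[OF assms(1,2)]])
  show ?thesis unfolding coef_def by (rule expand[OF assms(3), symmetric])
qed

lemma smooth_section_onI:
  assumes "\<And>x. x \<in> W \<Longrightarrow> s x \<in> fibre E x"
    and "\<And>U e i. (U, e) \<in> frames E \<Longrightarrow> i < bundle_rank E \<Longrightarrow> smooth_on E (U \<inter> W) (coef e s i)"
  shows "smooth_section_on E W s"
  unfolding smooth_section_on_def
proof (intro ballI, clarify)
  fix U e assume Ue: "(U, e) \<in> frames E"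
  show "\<exists>c. (\<forall>i<bundle_rank E. smooth_on E (U \<inter> W) (c i)) \<and>
          (\<forall>x\<in>U \<inter> W. s x = (\<Sum>i<bundle_rank E. c i x *\<^sub>R e i x))"
    by (rule exI[of _ "coef e s"]) (use assms Ue coef_expand[OF Ue] in auto)
qed

lemma smooth_section_on_fibre:
  assumes "smooth_section_on E W s" "x \<in> W" shows "s x \<in> fibre E x"
proof -
  obtain U e where Ue: "(U, e) \<in> frames E" "x \<in> U" using frame_cover by blast
  interpret findim "fibre E x" "bundle_rank E" "\<lambda>i. e i x"
    by (rule findim.intro[OF frame_basis[OF Ue]])
  obtain c where "\<forall>x\<in>U \<inter> W. s x = (\<Sum>i<bundle_rank E. c i x *\<^sub>R e i x)"
    using assms(1) Ue(1) unfolding smooth_section_on_def by blast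
  then show ?thesis using sum_in Ue(2) assms(2) by simp
qed

text \<open>A smooth section merely has some smooth coefficients in each frame; uniqueness of
  coordinates identifies them with \<open>coef\<close> on the overlap.\<close>

lemma smooth_section_on_coef:
  assumes W: "open W" and s: "smooth_section_on E W s" and Ue: "(U, e) \<in> frames E" and i: "i < bundle_rank E"
  shows "smooth_on E (U \<inter> W) (coef e s i)"
proof -
  obtain c where c: "\<And>i. i < bundle_rank E \<Longrightarrow> smooth_on E (U \<inter> W) (c i)"
    "\<And>x. x \<in> U \<inter> W \<Longrightarrow> s x = (\<Sum>i<bundle_rank E. c i x *\<^sub>R e i x)"
    using s Ue unfolding smooth_section_on_def by blast
  have "coef e s i x = c i x" if "x \<in> U \<inter> W" for x
    using coef_unique[of U e x s "\<lambda>i. c i x" i, OF Ue _ c(2)[OF that] i] that by blast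
  then show ?thesis
    using W frame_open[OF Ue] by (intro smooth_on_cong[OF _ _ c(1)[OF i]]) auto
qed

lemma smooth_section_on_subset_cong:
  assumes s: "smooth_section_on E W s" and W': "W' \<subseteq> W" and eq: "\<And>x. x \<in> W' \<Longrightarrow> s x = t x"
  shows "smooth_section_on E W' t"
  unfolding smooth_section_on_def
proof (intro ballI, clarify)
  fix U e assume Ue: "(U, e) \<in> frames E"
  then obtain c where c: "\<And>i. i < bundle_rank E \<Longrightarrow> smooth_on E (U \<inter> W) (c i)"
    "\<And>x. x \<in> U \<inter> W \<Longrightarrow> s x = (\<Sum>i<bundle_rank E. c i x *\<^sub>R e i x)"
    using s unfolding smooth_section_on_def by blast
  have "smooth_on E (U \<inter> W') (c i)" if "i < bundle_rank E" for i
    by (rule smooth_on_subset[OF c(1)[OF that]]) (use W' in blast)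
  moreover have "t x = (\<Sum>i<bundle_rank E. c i x *\<^sub>R e i x)" if "x \<in> U \<inter> W'" for x
    using c(2)[of x] eq[of x] that W' by auto
  ultimately show "\<exists>c. (\<forall>i<bundle_rank E. smooth_on E (U \<inter> W') (c i)) \<and>
      (\<forall>x\<in>U \<inter> W'. t x = (\<Sum>i<bundle_rank E. c i x *\<^sub>R e i x))" by blast
qed

lemma smooth_section_on_subset: "smooth_section_on E W s \<Longrightarrow> W' \<subseteq> W \<Longrightarrow> smooth_section_on E W' s"
  by (erule smooth_section_on_subset_cong) auto

lemma smooth_section_on_cong:
  "smooth_section_on E W s \<Longrightarrow> (\<And>x. x \<in> W \<Longrightarrow> s x = t x) \<Longrightarrow> smooth_section_on E W t"
  by (erule smooth_section_on_subset_cong) auto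

lemma smooth_section_on_local:
  assumes W: "open W" and loc: "\<And>x. x \<in> W \<Longrightarrow> \<exists>V. open V \<and> x \<in> V \<and> smooth_section_on E V s"
  shows "smooth_section_on E W s"
proof (rule smooth_section_onI)
  show "s x \<in> fibre E x" if "x \<in> W" for x using loc[OF that] smooth_section_on_fibre by blast
  fix U e i assume Ue: "(U, e) \<in> frames E" and i: "i < bundle_rank E"
  show "smooth_on E (U \<inter> W) (coef e s i)"
  proof (rule smooth_on_local)
    fix x assume x: "x \<in> U \<inter> W"
    then obtain V where V: "open V" "x \<in> V" "smooth_section_on E V s" using loc by blast
    then show "\<exists>V. open V \<and> x \<in> V \<and> smooth_on E V (coef e s i)"
      using smooth_section_on_coef[OF V(1,3) Ue i] frame_open[OF Ue] x by (intro exI[of _ "U \<inter> V"]) auto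
  qed (use W frame_open[OF Ue] in auto)
qed

lemma smooth_section_on_comb:
  assumes "smooth_on E W f" "smooth_on E W g" "smooth_section_on E W s" "smooth_section_on E W t"
  shows "smooth_section_on E W (\<lambda>x. f x *\<^sub>R s x + g x *\<^sub>R t x)"
  unfolding smooth_section_on_def
proof (intro ballI, clarify)
  fix U e assume Ue: "(U, e) \<in> frames E"
  obtain c where c: "\<And>i. i < bundle_rank E \<Longrightarrow> smooth_on E (U \<inter> W) (c i)"
    "\<And>x. x \<in> U \<inter> W \<Longrightarrow> s x = (\<Sum>i<bundle_rank E. c i x *\<^sub>R e i x)"
    using assms(3) Ue unfolding smooth_section_on_def by blast
  obtain d where d: "\<And>i. i < bundle_rank E \<Longrightarrow> smooth_on E (U \<inter> W) (d i)"
    "\<And>x. x \<in> U \<inter> W \<Longrightarrow> t x = (\<Sum>i<bundle_rank E. d i x *\<^sub>R e i x)"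
    using assms(4) Ue unfolding smooth_section_on_def by blast
  have fg: "smooth_on E (U \<inter> W) f" "smooth_on E (U \<inter> W) g"
    using assms(1,2) by (auto intro: smooth_on_subset)
  show "\<exists>c. (\<forall>i<bundle_rank E. smooth_on E (U \<inter> W) (c i)) \<and>
          (\<forall>x\<in>U \<inter> W. f x *\<^sub>R s x + g x *\<^sub>R t x = (\<Sum>i<bundle_rank E. c i x *\<^sub>R e i x))"
  proof (intro exI[of _ "\<lambda>i x. f x * c i x + g x * d i x"] conjI allI impI ballI)
    fix i assume "i < bundle_rank E"
    then show "smooth_on E (U \<inter> W) (\<lambda>x. f x * c i x + g x * d i x)"
      by (intro smooth_on_add smooth_on_mult fg c d)
  next
    fix x assume "x \<in> U \<inter> W"
    then show "f x *\<^sub>R s x + g x *\<^sub>R t x = (\<Sum>i<bundle_rank E. (f x * c i x + g x * d i x) *\<^sub>R e i x)"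
      using c(2) d(2) by (simp add: scaleR_add_left sum.distrib scaleR_sum_right)
  qed
qed

lemma smooth_section_on_zero: "smooth_section_on E W (\<lambda>x. 0)"
  unfolding smooth_section_on_def
  by (auto intro!: exI[of _ "\<lambda>i x. 0"] smooth_on_const)

lemma smooth_section_on_scale: "smooth_on E W f \<Longrightarrow> smooth_section_on E W s \<Longrightarrow> smooth_section_on E W (\<lambda>x. f x *\<^sub>R s x)"
  using smooth_section_on_comb[of W f "\<lambda>x. 0" s s] smooth_on_const[of W 0] by simp

lemma smooth_section_on_sum:
  "finite I \<Longrightarrow> (\<And>i. i \<in> I \<Longrightarrow> smooth_on E W (f i)) \<Longrightarrow> (\<And>i. i \<in> I \<Longrightarrow> smooth_section_on E W (s i)) \<Longrightarrow>
   smooth_section_on E W (\<lambda>x. \<Sum>i\<in>I. f i x *\<^sub>R s i x)"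
proof (induction I rule: finite_induct)
  case empty
  then show ?case by (simp add: smooth_section_on_zero)
next
  case (insert i I)
  then have "smooth_section_on E W (\<lambda>x. f i x *\<^sub>R s i x + 1 *\<^sub>R (\<Sum>i\<in>I. f i x *\<^sub>R s i x))"
    by (intro smooth_section_on_comb smooth_on_const) auto
  then show ?case using insert by simp
qed

text \<open>Writing all sections in a frame of \<open>E\<close> gives a finite linear system with
  smooth data, indexed by pairs of an equation and a frame component, to which
  \<open>smooth_on_solution\<close> applies. It serves with one equation for coefficients in a frame
  of a subbundle, and with \<open>r\<close> equations for sections known through their
  brackets.\<close>

lemma smooth_coefficients:
  fixes S :: "nat \<Rightarrow> 'm \<Rightarrow> 'a" and P :: "nat \<Rightarrow> nat \<Rightarrow> 'm \<Rightarrow> 'a"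
  assumes W: "open W" and S: "\<And>j. j < m \<Longrightarrow> smooth_section_on E W (S j)"
    and P: "\<And>j k. j < m \<Longrightarrow> k < r \<Longrightarrow> smooth_section_on E W (P j k)"
    and eq: "\<And>j x. j < m \<Longrightarrow> x \<in> W \<Longrightarrow> S j x = (\<Sum>k<r. z k x *\<^sub>R P j k x)"
    and ind: "\<And>x v k. x \<in> W \<Longrightarrow> (\<And>j. j < m \<Longrightarrow> (\<Sum>k<r. v k *\<^sub>R P j k x) = 0) \<Longrightarrow> k < r \<Longrightarrow> v k = 0"
    and k: "k < r"
  shows "smooth_on E W (z k)"
proof (rule smooth_on_local[OF W])
  fix x assume x: "x \<in> W"
  obtain U e where Ue: "(U, e) \<in> frames E" "x \<in> U" using frame_cover by blast
  let ?R = "bundle_rank E" and ?I = "{..<m} \<times> {..<bundle_rank E}"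
  have o: "open (U \<inter> W)" using W frame_open[OF Ue(1)] by auto
  have sumP: "(\<Sum>k<r. v k *\<^sub>R P j k x) = (\<Sum>i<?R. (\<Sum>k<r. v k * coef e (P j k) i x) *\<^sub>R e i x)"
    if "j < m" "x \<in> U \<inter> W" for j x v
  proof -
    have "(\<Sum>k<r. v k *\<^sub>R P j k x) = (\<Sum>k<r. \<Sum>i<?R. (v k * coef e (P j k) i x) *\<^sub>R e i x)"
    proof (rule sum.cong)
      fix k assume "k \<in> {..<r}"
      then have "P j k x \<in> fibre E x" using that smooth_section_on_fibre[OF P] by auto
      then show "v k *\<^sub>R P j k x = (\<Sum>i<?R. (v k * coef e (P j k) i x) *\<^sub>R e i x)"
        using that by (subst coef_expand[OF Ue(1)]) (auto simp: scaleR_sum_right)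
    qed simp
    then show ?thesis by (subst (asm) sum.swap) (simp add: scaleR_sum_left)
  qed
  have "smooth_on E (U \<inter> W) (z k)"
  proof (rule smooth_on_solution[where I = ?I and P = "\<lambda>a k. coef e (P (fst a) k) (snd a)" and
        s = "\<lambda>a. coef e (S (fst a)) (snd a)" and r = r, OF _ o _ _ _ _ k])
    show "smooth_on E (U \<inter> W) (coef e (P (fst a) k) (snd a))" if "a \<in> ?I" "k < r" for a k
      using that by (intro smooth_section_on_coef[OF W P Ue(1)]) auto
    show "smooth_on E (U \<inter> W) (coef e (S (fst a)) (snd a))" if "a \<in> ?I" for a
      using that by (intro smooth_section_on_coef[OF W S Ue(1)]) auto
    show "coef e (S (fst a)) (snd a) x = (\<Sum>k<r. z k x * coef e (P (fst a) k) (snd a) x)"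
      if a: "a \<in> ?I" and x: "x \<in> U \<inter> W" for a x
    proof (rule coef_unique[OF Ue(1)])
      show "S (fst a) x = (\<Sum>i<?R. (\<Sum>k<r. z k x * coef e (P (fst a) k) i x) *\<^sub>R e i x)"
        using a x by (subst eq) (auto simp: sumP)
    qed (use a x in auto)
    fix x v k assume x: "x \<in> U \<inter> W" and v: "\<And>a. a \<in> ?I \<Longrightarrow> (\<Sum>k<r. v k * coef e (P (fst a) k) (snd a) x) = 0"
      and k: "k < r"
    have "(\<Sum>k<r. v k *\<^sub>R P j k x) = 0" if j: "j < m" for j
      unfolding sumP[OF j x] by (rule sum.neutral) (use v[of "(j, _)"] j in auto)
    then show "v k = 0" using ind[of x v k] x k by blast
  qed simp
  then show "\<exists>V. open V \<and> x \<in> V \<and> smooth_on E V (z k)" using o x Ue by blast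
qed

lemma sections_iff: "s \<in> sections E \<longleftrightarrow> smooth_section_on E UNIV s"
  by (simp add: sections_def)

lemma sections_smooth: "s \<in> sections E \<Longrightarrow> smooth_section_on E W s"
  unfolding sections_iff by (rule smooth_section_on_subset) auto

lemma sections_fibre: "s \<in> sections E \<Longrightarrow> s x \<in> fibre E x"
  unfolding sections_iff by (rule smooth_section_on_fibre) auto

lemma sections_comb: "f \<in> Cinf E \<Longrightarrow> g \<in> Cinf E \<Longrightarrow> s \<in> sections E \<Longrightarrow> t \<in> sections E \<Longrightarrow>
    (\<lambda>x. f x *\<^sub>R s x + g x *\<^sub>R t x) \<in> sections E"
  unfolding sections_iff Cinf_iff by (rule smooth_section_on_comb)

text \<open>A local section or function becomes global after multiplication with a cutoff. This is
  needed because operators such as the bracket accept global sections only.\<close>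

definition ext0 :: "('m \<Rightarrow> real) \<Rightarrow> 'm set \<Rightarrow> ('m \<Rightarrow> 'b::real_vector) \<Rightarrow> 'm \<Rightarrow> 'b" where
  "ext0 \<eta> W s x = (if x \<in> W then \<eta> x *\<^sub>R s x else 0)"

lemma ext0_section:
  assumes "\<eta> \<in> Cinf E" "closed C" "C \<subseteq> W" "open W" "\<And>x. x \<notin> C \<Longrightarrow> \<eta> x = 0" "smooth_section_on E W s"
  shows "ext0 \<eta> W s \<in> sections E"
  unfolding sections_iff
proof (rule smooth_section_on_local)
  fix x
  show "\<exists>V. open V \<and> x \<in> V \<and> smooth_section_on E V (ext0 \<eta> W s)"
  proof (cases "x \<in> W")
    case True
    have "smooth_section_on E W (ext0 \<eta> W s)"
      by (rule smooth_section_on_cong[OF smooth_section_on_scale[OF Cinf_smooth_on[OF assms(1)] assms(6)]])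
        (simp add: ext0_def)
    then show ?thesis using True assms by blast
  next
    case False
    have "smooth_section_on E (- C) (ext0 \<eta> W s)"
      by (rule smooth_section_on_cong[OF smooth_section_on_zero]) (use assms(5) in \<open>auto simp: ext0_def\<close>)
    then show ?thesis using False assms by (intro exI[of _ "- C"]) auto
  qed
qed simp

lemma ext0_Cinf:
  fixes f :: "'m \<Rightarrow> real"
  assumes "\<eta> \<in> Cinf E" "closed C" "C \<subseteq> W" "open W" "\<And>x. x \<notin> C \<Longrightarrow> \<eta> x = 0" "smooth_on E W f"
  shows "ext0 \<eta> W f \<in> Cinf E"
  unfolding Cinf_iff
proof (rule smooth_on_local)
  fix x
  show "\<exists>V. open V \<and> x \<in> V \<and> smooth_on E V (ext0 \<eta> W f)"
  proof (cases "x \<in> W")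
    case True
    have "smooth_on E W (ext0 \<eta> W f)"
      by (rule smooth_on_cong[OF assms(4) _ smooth_on_mult[OF Cinf_smooth_on[OF assms(1)] assms(6)]])
        (simp add: ext0_def)
    then show ?thesis using True assms by blast
  next
    case False
    have "smooth_on E (- C) (ext0 \<eta> W f)"
      by (rule smooth_on_cong[OF _ _ smooth_on_const[of _ 0]]) (use assms in \<open>auto simp: ext0_def\<close>)
    then show ?thesis using False assms by (intro exI[of _ "- C"]) auto
  qed
qed simp

text \<open>Regarding the whole bundle as its own subbundle makes sections through given vectors and
  tensoriality available for \<open>A\<close> as well as for \<open>K\<close>.\<close>

lemma subbundle_fibre: "subbundle E (fibre E)"
  unfolding subbundle_def
proof (intro conjI allI exI[of _ "bundle_rank E"])
  fix p
  obtain U e where Ue: "(U, e) \<in> frames E" "p \<in> U" using frame_cover by blast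
  then show "\<exists>U e. open U \<and> p \<in> U \<and> (\<forall>i<bundle_rank E. smooth_section_on E U (e i)) \<and>
      (\<forall>x\<in>U. is_basis (bundle_rank E) (\<lambda>i. e i x) (fibre E x))"
    by (intro exI[of _ U] exI[of _ e]) (auto intro: frame_open frame_basis frame_smooth)
qed (auto simp: fibre_subspace)

lemma sub_sections_fibre: "sub_sections E (fibre E) = sections E"
  by (auto simp: sub_sections_def sections_fibre)

end

section \<open>Sections of a subbundle and tensoriality\<close>

locale vsubbundle = vbundle E
  for E :: "('m::{t2_space,second_countable_topology}, 'a::real_vector, 'x) vbundle_data_scheme" +
  fixes K :: "'m \<Rightarrow> 'a set"
  assumes subb: "subbundle E K"
begin

lemma K_subspace: "subspace (K p)" and K_fibre: "K p \<subseteq> fibre E p"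
  using subb by (auto simp: subbundle_def)

lemma sub_frame:
  obtains r U e where "open U" "p \<in> U" "\<And>i. i < r \<Longrightarrow> smooth_section_on E U (e i)"
    "\<And>x. x \<in> U \<Longrightarrow> is_basis r (\<lambda>i. e i x) (K x)"
  using subb unfolding subbundle_def by metis

abbreviation "\<Gamma> \<equiv> sub_sections E K"

lemma \<Gamma>_sections: "\<xi> \<in> \<Gamma> \<Longrightarrow> \<xi> \<in> sections E" and \<Gamma>_K: "\<xi> \<in> \<Gamma> \<Longrightarrow> \<xi> p \<in> K p"
  by (auto simp: sub_sections_def)

lemma \<Gamma>_comb: "f \<in> Cinf E \<Longrightarrow> g \<in> Cinf E \<Longrightarrow> \<xi> \<in> \<Gamma> \<Longrightarrow> \<eta> \<in> \<Gamma> \<Longrightarrow> (\<lambda>x. f x *\<^sub>R \<xi> x + g x *\<^sub>R \<eta> x) \<in> \<Gamma>"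
  by (auto simp: sub_sections_def sections_comb K_subspace intro!: subspace_add subspace_scale)

lemma \<Gamma>_rcomb: "\<xi> \<in> \<Gamma> \<Longrightarrow> \<eta> \<in> \<Gamma> \<Longrightarrow> (\<lambda>x. a *\<^sub>R \<xi> x + b *\<^sub>R \<eta> x) \<in> \<Gamma>"
  by (rule \<Gamma>_comb[OF Cinf_const Cinf_const])

lemma \<Gamma>_zero: "(\<lambda>x. 0) \<in> \<Gamma>"
  by (auto simp: sub_sections_def sections_iff smooth_section_on_zero K_subspace subspace_0)

lemma \<Gamma>_scale: "f \<in> Cinf E \<Longrightarrow> \<xi> \<in> \<Gamma> \<Longrightarrow> (\<lambda>x. f x *\<^sub>R \<xi> x) \<in> \<Gamma>"
  using \<Gamma>_comb[of f "\<lambda>x. 0" \<xi> \<xi>] Cinf_const[of 0] by simp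

lemma \<Gamma>_add: "\<xi> \<in> \<Gamma> \<Longrightarrow> \<eta> \<in> \<Gamma> \<Longrightarrow> (\<lambda>x. \<xi> x + \<eta> x) \<in> \<Gamma>"
  using \<Gamma>_rcomb[of \<xi> \<eta> 1 1] by simp

lemma \<Gamma>_diff: "\<xi> \<in> \<Gamma> \<Longrightarrow> \<eta> \<in> \<Gamma> \<Longrightarrow> (\<lambda>x. \<xi> x - \<eta> x) \<in> \<Gamma>"
  using \<Gamma>_rcomb[of \<xi> \<eta> 1 "-1"] by simp

lemma \<Gamma>_minus: "\<xi> \<in> \<Gamma> \<Longrightarrow> (\<lambda>x. - \<xi> x) \<in> \<Gamma>"
  using \<Gamma>_diff[OF \<Gamma>_zero] by simp

lemma \<Gamma>_sum: "finite I \<Longrightarrow> (\<And>i. i \<in> I \<Longrightarrow> \<xi> i \<in> \<Gamma>) \<Longrightarrow> (\<lambda>x. \<Sum>i\<in>I. \<xi> i x) \<in> \<Gamma>"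
  by (induction I rule: finite_induct) (auto intro: \<Gamma>_zero \<Gamma>_add)

lemma ext0_\<Gamma>:
  assumes "\<eta> \<in> Cinf E" "closed C" "C \<subseteq> W" "open W" "\<And>x. x \<notin> C \<Longrightarrow> \<eta> x = 0" "smooth_section_on E W s"
    "\<And>x. x \<in> W \<Longrightarrow> s x \<in> K x"
  shows "ext0 \<eta> W s \<in> \<Gamma>"
  using ext0_section[OF assms(1-6)] assms(7)
  by (auto simp: sub_sections_def ext0_def K_subspace subspace_0 subspace_scale)

text \<open>Constant coefficients in a local frame, multiplied by a cutoff that is 1 near
  \<open>p\<close>.\<close>

lemma section_through:
  assumes "u \<in> K p" obtains \<xi> where "\<xi> \<in> \<Gamma>" "\<xi> p = u"
proof -
  obtain r U e where U: "open U" "p \<in> U" "\<And>i. i < r \<Longrightarrow> smooth_section_on E U (e i)"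
    "\<And>x. x \<in> U \<Longrightarrow> is_basis r (\<lambda>i. e i x) (K x)" by (rule sub_frame[of p]) blast
  interpret findim "K p" r "\<lambda>i. e i p" by (rule findim.intro[OF U(4)[OF U(2)]])
  obtain \<eta> N C where \<eta>: "\<eta> \<in> Cinf E" "open N" "p \<in> N" "closed C" "N \<subseteq> C" "C \<subseteq> U"
    "\<And>x. x \<in> N \<Longrightarrow> \<eta> x = 1" "\<And>x. x \<notin> C \<Longrightarrow> \<eta> x = 0" by (rule bump[OF U(1,2)]) blast
  let ?s = "\<lambda>x. \<Sum>i<r. cr i u *\<^sub>R e i x"
  have "ext0 \<eta> U ?s \<in> \<Gamma>"
  proof (rule ext0_\<Gamma>[OF \<eta>(1,4,6) U(1) \<eta>(8)])
    show "smooth_section_on E U ?s" by (intro smooth_section_on_sum smooth_on_const U(3)) auto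
    fix x assume x: "x \<in> U"
    interpret x: findim "K x" r "\<lambda>i. e i x" by (rule findim.intro[OF U(4)[OF x]])
    show "?s x \<in> K x" by (rule x.sum_in)
  qed
  moreover have "ext0 \<eta> U ?s p = u" using \<eta> U expand[OF assms] by (simp add: ext0_def)
  ultimately show thesis by (rule that)
qed

text \<open>By linearity it suffices that the value at \<open>p\<close> vanishes for a section
  vanishing at \<open>p\<close>. Such a section is, after multiplication by a cutoff, a combination
  of global sections whose coefficients vanish at \<open>p\<close>.\<close>

lemma tensorial:
  fixes T :: "('m \<Rightarrow> 'a) \<Rightarrow> 'm \<Rightarrow> 'b::real_vector"
  assumes lin: "\<And>\<xi> \<eta> f g. \<xi> \<in> \<Gamma> \<Longrightarrow> \<eta> \<in> \<Gamma> \<Longrightarrow> f \<in> Cinf E \<Longrightarrow> g \<in> Cinf E \<Longrightarrow>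
      T (\<lambda>p. f p *\<^sub>R \<xi> p + g p *\<^sub>R \<eta> p) = (\<lambda>p. f p *\<^sub>R T \<xi> p + g p *\<^sub>R T \<eta> p)"
    and \<xi>: "\<xi> \<in> \<Gamma>" "\<xi>' \<in> \<Gamma>" "\<xi> p = \<xi>' p"
  shows "T \<xi> p = T \<xi>' p"
proof -
  have 0: "T (\<lambda>x. 0) = (\<lambda>x. 0)" using lin[OF \<Gamma>_zero \<Gamma>_zero Cinf_const[of 0] Cinf_const[of 0]] by simp
  have sc: "T (\<lambda>p. f p *\<^sub>R \<xi> p) = (\<lambda>p. f p *\<^sub>R T \<xi> p)" if "f \<in> Cinf E" "\<xi> \<in> \<Gamma>" for f \<xi>
    using lin[OF that(2) that(2) that(1) Cinf_const[of 0]] by simp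
  have sum: "T (\<lambda>p. \<Sum>i\<in>I. f i p *\<^sub>R \<xi> i p) = (\<lambda>p. \<Sum>i\<in>I. f i p *\<^sub>R T (\<xi> i) p)"
    if "finite I" "\<And>i. i \<in> I \<Longrightarrow> f i \<in> Cinf E" "\<And>i. i \<in> I \<Longrightarrow> \<xi> i \<in> \<Gamma>" for I :: "nat set" and f \<xi>
    using that
  proof (induction I rule: finite_induct)
    case (insert i I)
    then have "(\<lambda>p. \<Sum>i\<in>I. f i p *\<^sub>R \<xi> i p) \<in> \<Gamma>" by (intro \<Gamma>_sum \<Gamma>_scale) auto
    then show ?case using insert lin[of "\<xi> i" "\<lambda>p. \<Sum>i\<in>I. f i p *\<^sub>R \<xi> i p" "f i" "\<lambda>x. 1"] Cinf_const[of 1]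
      by simp
  qed (simp add: 0)
  have van: "T \<xi> p = 0" if \<xi>: "\<xi> \<in> \<Gamma>" "\<xi> p = 0" for \<xi>
  proof -
    obtain r U e where U: "open U" "p \<in> U" "\<And>i. i < r \<Longrightarrow> smooth_section_on E U (e i)"
      "\<And>x. x \<in> U \<Longrightarrow> is_basis r (\<lambda>i. e i x) (K x)" by (rule sub_frame[of p]) blast
    obtain \<eta> N C where \<eta>: "\<eta> \<in> Cinf E" "open N" "p \<in> N" "closed C" "N \<subseteq> C" "C \<subseteq> U"
      "\<And>x. x \<in> N \<Longrightarrow> \<eta> x = 1" "\<And>x. x \<notin> C \<Longrightarrow> \<eta> x = 0" by (rule bump[OF U(1,2)]) blast
    define c where "c i x = findim.cr r (\<lambda>i. e i x) i (\<xi> x)" for i x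
    have ex: "\<xi> x = (\<Sum>i<r. c i x *\<^sub>R e i x)" if x: "x \<in> U" for x
    proof -
      interpret x: findim "K x" r "\<lambda>i. e i x" by (rule findim.intro[OF U(4)[OF x]])
      show ?thesis unfolding c_def by (rule x.expand[OF \<Gamma>_K[OF \<xi>(1)], symmetric])
    qed
    have cs: "smooth_on E U (c k)" if "k < r" for k
    proof (rule smooth_coefficients[where m = 1 and S = "\<lambda>_. \<xi>" and P = "\<lambda>_. e" and r = r and z = c, OF U(1)])
      show "smooth_section_on E U \<xi>" using \<xi>(1) sections_smooth \<Gamma>_sections by blast
      show "v k = 0" if "x \<in> U" "\<And>j. j < (1::nat) \<Longrightarrow> (\<Sum>k<r. v k *\<^sub>R e k x) = 0" "k < r" for x v k
        using is_basis_indep[OF U(4)[OF that(1)] that(2)[of 0] that(3)] by simp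
    qed (use U ex that in auto)
    have eU: "e i x \<in> K x" if "i < r" "x \<in> U" for i x
    proof -
      interpret x: findim "K x" r "\<lambda>i. e i x" by (rule findim.intro[OF U(4)[OF that(2)]])
      show ?thesis by (rule x.bV[OF that(1)])
    qed
    have e': "ext0 \<eta> U (e i) \<in> \<Gamma>" if "i < r" for i
      using that by (intro ext0_\<Gamma>[OF \<eta>(1,4,6) U(1) \<eta>(8)] U(3) eU)
    have c': "ext0 \<eta> U (c i) \<in> Cinf E" if "i < r" for i
      using that by (intro ext0_Cinf[OF \<eta>(1,4,6) U(1) \<eta>(8)] cs)
    \<comment> \<open>The cutoff appears squared because coefficients and frame sections must each
      be extended; its value at \<open>p\<close> is 1, so nothing is lost there.\<close>
    have "(\<lambda>x. (\<eta> x * \<eta> x) *\<^sub>R \<xi> x) = (\<lambda>x. \<Sum>i<r. ext0 \<eta> U (c i) x *\<^sub>R ext0 \<eta> U (e i) x)"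
    proof
      fix x
      show "(\<eta> x * \<eta> x) *\<^sub>R \<xi> x = (\<Sum>i<r. ext0 \<eta> U (c i) x *\<^sub>R ext0 \<eta> U (e i) x)"
      proof (cases "x \<in> U")
        case True
        then show ?thesis by (simp add: ext0_def ex scaleR_sum_right mult_ac)
      next
        case False
        then show ?thesis using \<eta>(6,8) by (auto simp: ext0_def)
      qed
    qed
    then have "T (\<lambda>x. (\<eta> x * \<eta> x) *\<^sub>R \<xi> x) p = (\<Sum>i<r. ext0 \<eta> U (c i) p *\<^sub>R T (ext0 \<eta> U (e i)) p)"
      using sum[of "{..<r}" "\<lambda>i. ext0 \<eta> U (c i)" "\<lambda>i. ext0 \<eta> U (e i)"] e' c' by simp
    also have "\<dots> = 0"
    proof (rule sum.neutral, safe)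
      fix i assume i: "i < r"
      have "c i p = 0" using is_basis_indep[OF U(4)[OF U(2)] _ i, of "\<lambda>i. c i p"] ex[OF U(2)] \<xi>(2) by simp
      then show "ext0 \<eta> U (c i) p *\<^sub>R T (ext0 \<eta> U (e i)) p = 0" by (simp add: ext0_def)
    qed
    finally show ?thesis using sc[OF Cinf_mult[OF \<eta>(1) \<eta>(1)] \<xi>(1)] \<eta>(3,7) by simp
  qed
  have d: "(\<lambda>x. 1 *\<^sub>R \<xi> x + (-1) *\<^sub>R \<xi>' x) \<in> \<Gamma>" by (rule \<Gamma>_rcomb[OF \<xi>(1,2)])
  have "1 *\<^sub>R T \<xi> p + (-1) *\<^sub>R T \<xi>' p = 0"
    using van[OF d] \<xi>(3) unfolding lin[OF \<xi>(1,2) Cinf_const Cinf_const] by simp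
  then show ?thesis by simp
qed

end

section \<open>Derivations along an isomorphism with a semisimple Lie algebra\<close>

lemma findim_lieI:
  assumes b: "is_basis n b V" and l: "lie_algebra_on V br"
  shows "findim_lie V n b br"
proof -
  have sub: "subspace V" and cl: "\<And>x y. x \<in> V \<Longrightarrow> y \<in> V \<Longrightarrow> br x y \<in> V"
    and lin: "\<And>x y z a c. x \<in> V \<Longrightarrow> y \<in> V \<Longrightarrow> z \<in> V \<Longrightarrow> br x (a *\<^sub>R y + c *\<^sub>R z) = a *\<^sub>R br x y + c *\<^sub>R br x z"
    and anti: "\<And>x y. x \<in> V \<Longrightarrow> y \<in> V \<Longrightarrow> br x y = - br y x"
    and jac: "\<And>x y z. x \<in> V \<Longrightarrow> y \<in> V \<Longrightarrow> z \<in> V \<Longrightarrow> br x (br y z) = br (br x y) z + br y (br x z)"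
    using l unfolding lie_algebra_on_def by blast+
  show ?thesis
  proof unfold_locales
    fix w assume w: "w \<in> V"
    show "lin_on V (\<lambda>u. br u w)"
      unfolding lin_on_def
    proof (intro ballI allI)
      fix u v x y assume uv: "u \<in> V" "v \<in> V"
      then have "x *\<^sub>R u + y *\<^sub>R v \<in> V" using sub by (simp add: subspace_add subspace_scale)
      then have "br (x *\<^sub>R u + y *\<^sub>R v) w = - (x *\<^sub>R br w u + y *\<^sub>R br w v)"
        using anti[of _ w] lin[OF w uv] w by simp
      also have "\<dots> = x *\<^sub>R br u w + y *\<^sub>R br v w" using anti[OF uv(1) w] anti[OF uv(2) w] by simp
      finally show "br (x *\<^sub>R u + y *\<^sub>R v) w = x *\<^sub>R br u w + y *\<^sub>R br v w" .
    qed
  qed (use b lin in \<open>auto simp: lin_on_def intro: cl anti jac\<close>)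
qed

text \<open>The Lie algebra axioms and semisimplicity are assumed for the typical fibre
  \<open>g\<close>, whereas the bracket \<open>fb\<close> on \<open>V\<close> is known only through
  \<psi>. Conversely, finite dimension is known for \<open>V\<close> and carried to \<open>g\<close>
  by pulling back a basis.\<close>

locale semisimple_iso =
  fixes g :: "'a::real_vector set" and br0 :: "'a \<Rightarrow> 'a \<Rightarrow> 'a" and V :: "'a set" and fb :: "'a \<Rightarrow> 'a \<Rightarrow> 'a"
    and r :: nat and b :: "nat \<Rightarrow> 'a" and \<psi> :: "'a \<Rightarrow> 'a"
  assumes ss: "semisimple_lie_algebra g br0" and b: "is_basis r b V" and bij: "bij_betw \<psi> g V"
    and lin: "\<And>u w x y. u \<in> g \<Longrightarrow> w \<in> g \<Longrightarrow> \<psi> (x *\<^sub>R u + y *\<^sub>R w) = x *\<^sub>R \<psi> u + y *\<^sub>R \<psi> w"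
    and hom: "\<And>u w. u \<in> g \<Longrightarrow> w \<in> g \<Longrightarrow> \<psi> (br0 u w) = fb (\<psi> u) (\<psi> w)"
begin

definition \<phi> where "\<phi> = inv_into g \<psi>"
definition c where "c i = \<phi> (b i)"

lemma gsub: "subspace g" using ss by (simp add: semisimple_lie_algebra_def lie_algebra_on_def)
lemma lin\<psi>: "lin_on g \<psi>" using lin by (simp add: lin_on_def)
lemma \<phi>g: "u \<in> V \<Longrightarrow> \<phi> u \<in> g" using bij by (auto simp: \<phi>_def bij_betw_def inv_into_into)
lemma \<psi>V: "u \<in> g \<Longrightarrow> \<psi> u \<in> V" using bij by (auto simp: bij_betw_def)
lemma \<phi>\<psi>: "u \<in> g \<Longrightarrow> \<phi> (\<psi> u) = u" using bij by (simp add: \<phi>_def bij_betw_def)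
lemma \<psi>\<phi>: "u \<in> V \<Longrightarrow> \<psi> (\<phi> u) = u" using bij by (auto simp: \<phi>_def bij_betw_def f_inv_into_f)

lemma lin\<phi>: "lin_on V \<phi>"
  unfolding lin_on_def
proof (intro ballI allI)
  fix u w x y assume uw: "u \<in> V" "w \<in> V"
  have "\<phi> (x *\<^sub>R u + y *\<^sub>R w) = \<phi> (\<psi> (x *\<^sub>R \<phi> u + y *\<^sub>R \<phi> w))" using uw by (simp add: lin \<phi>g \<psi>\<phi>)
  also have "\<dots> = x *\<^sub>R \<phi> u + y *\<^sub>R \<phi> w"
    using uw gsub by (intro \<phi>\<psi>) (simp add: \<phi>g subspace_add subspace_scale)
  finally show "\<phi> (x *\<^sub>R u + y *\<^sub>R w) = x *\<^sub>R \<phi> u + y *\<^sub>R \<phi> w" .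
qed

lemma c_basis: "is_basis r c g"
proof (rule is_basisI[OF gsub])
  interpret V: findim V r b by (rule findim.intro[OF b])
  show "c i \<in> g" if "i < r" for i using that by (simp add: c_def \<phi>g V.bV)
  have sc: "\<psi> (\<Sum>i<r. v i *\<^sub>R c i) = (\<Sum>i<r. v i *\<^sub>R b i)" for v
    using lin_on_sum[OF lin\<psi> gsub, of "{..<r}" c v] by (simp add: c_def \<phi>g \<psi>\<phi> V.bV)
  show "v i = 0" if "(\<Sum>i<r. v i *\<^sub>R c i) = 0" "i < r" for v i
    using is_basis_indep[OF b _ that(2), of v] sc[of v] lin_on_zero[OF lin\<psi> gsub] that(1) by simp
  show "\<exists>v. u = (\<Sum>i<r. v i *\<^sub>R c i)" if u: "u \<in> g" for u
  proof (rule exI[of _ "\<lambda>i. V.cr i (\<psi> u)"])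
    have "u = \<phi> (\<Sum>i<r. V.cr i (\<psi> u) *\<^sub>R b i)" using u by (simp add: V.expand \<psi>V \<phi>\<psi>)
    also have "\<dots> = (\<Sum>i<r. V.cr i (\<psi> u) *\<^sub>R c i)"
      using lin_on_sum[OF lin\<phi> V.subV, of "{..<r}" b] by (simp add: c_def V.bV)
    finally show "u = (\<Sum>i<r. V.cr i (\<psi> u) *\<^sub>R c i)" .
  qed
qed

sublocale g: findim_lie g r c br0
  using findim_lieI[OF c_basis] ss by (simp add: semisimple_lie_algebra_def)

lemma iso_centre: assumes "z \<in> V" "\<And>u. u \<in> V \<Longrightarrow> fb z u = 0" shows "z = 0"
proof -
  have "\<phi> z = 0"
  proof (rule g.centre_trivial[OF ss \<phi>g[OF assms(1)]])
    fix u assume u: "u \<in> g"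
    have "\<psi> (br0 (\<phi> z) u) = 0" using assms u by (simp add: hom \<phi>g \<psi>\<phi> \<psi>V)
    then have "\<phi> (\<psi> (br0 (\<phi> z) u)) = \<phi> (\<psi> 0)" by (simp add: lin_on_zero[OF lin\<psi> gsub])
    then show "br0 (\<phi> z) u = 0" using u assms(1) by (simp add: \<phi>\<psi> \<phi>g g.br_in subspace_0[OF gsub])
  qed
  then show ?thesis using \<psi>\<phi>[OF assms(1)] lin_on_zero[OF lin\<psi> gsub] by simp
qed

lemma iso_derivation_inner:
  assumes \<tau>: "lin_on V \<tau>" "\<And>u. u \<in> V \<Longrightarrow> \<tau> u \<in> V"
    and d: "\<And>u w. u \<in> V \<Longrightarrow> w \<in> V \<Longrightarrow> \<tau> (fb u w) = fb (\<tau> u) w + fb u (\<tau> w)"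
  obtains z where "z \<in> V" "\<And>u. u \<in> V \<Longrightarrow> \<tau> u = fb z u"
proof -
  have fbV: "fb u w \<in> V" if "u \<in> V" "w \<in> V" for u w
    using hom[OF \<phi>g[OF that(1)] \<phi>g[OF that(2)]] \<psi>V[OF g.br_in[OF \<phi>g[OF that(1)] \<phi>g[OF that(2)]]] that
    by (simp add: \<psi>\<phi>)
  have \<phi>fb: "\<phi> (fb u w) = br0 (\<phi> u) (\<phi> w)" if "u \<in> V" "w \<in> V" for u w
    using that hom[OF \<phi>g \<phi>g, of u w] \<phi>\<psi>[OF g.br_in[OF \<phi>g \<phi>g], of u w] by (simp add: \<psi>\<phi>)
  define t where "t u = \<phi> (\<tau> (\<psi> u))" for u
  have "g.deriv t"
    unfolding g.deriv_def g.endo_def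
  proof (intro conjI ballI)
    show "lin_on g t"
      using lin_onD[OF lin\<psi>] lin_onD[OF \<tau>(1)] lin_onD[OF lin\<phi>] \<psi>V \<tau>(2)
      unfolding lin_on_def t_def by simp
    show "t u \<in> g" if "u \<in> g" for u using that by (simp add: t_def \<phi>g \<tau>(2) \<psi>V)
    fix u w assume uw: "u \<in> g" "w \<in> g"
    then show "t (br0 u w) = br0 (t u) w + br0 u (t w)"
      by (simp add: t_def hom d \<psi>V \<tau>(2) fbV lin_on_add[OF lin\<phi>] \<phi>fb \<phi>\<psi>)
  qed
  then obtain x where x: "x \<in> g" "\<And>u. u \<in> g \<Longrightarrow> t u = br0 x u" using g.derivation_inner[OF ss] by blast
  show thesis
  proof (rule that[of "\<psi> x"])
    show "\<psi> x \<in> V" by (rule \<psi>V[OF x(1)])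
    fix u assume u: "u \<in> V"
    have "\<tau> u = \<psi> (t (\<phi> u))" using u by (simp add: t_def \<psi>\<phi> \<tau>(2))
    also have "\<dots> = fb (\<psi> x) u" using u x by (simp add: \<phi>g hom \<psi>\<phi>)
    finally show "\<tau> u = fb (\<psi> x) u" .
  qed
qed

end

section \<open>Vector fields\<close>

context smooth_mfd
begin

abbreviation "VF \<equiv> vector_fields M"

lemma vf_lin: "X \<in> VF \<Longrightarrow> f \<in> Cinf M \<Longrightarrow> g \<in> Cinf M \<Longrightarrow> X p (\<lambda>x. a * f x + b * g x) = a * X p f + b * X p g"
  and vf_prod: "X \<in> VF \<Longrightarrow> f \<in> Cinf M \<Longrightarrow> g \<in> Cinf M \<Longrightarrow> X p (\<lambda>x. f x * g x) = f p * X p g + g p * X p f"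
  and vf_nonsmooth: "X \<in> VF \<Longrightarrow> f \<notin> Cinf M \<Longrightarrow> X p f = 0"
  and vf_Cinf: "X \<in> VF \<Longrightarrow> f \<in> Cinf M \<Longrightarrow> (\<lambda>p. X p f) \<in> Cinf M"
  unfolding vector_fields_def tangent_space_def by blast+

lemma vfI:
  assumes "\<And>p f g a b. f \<in> Cinf M \<Longrightarrow> g \<in> Cinf M \<Longrightarrow> X p (\<lambda>x. a * f x + b * g x) = a * X p f + b * X p g"
    and "\<And>p f g. f \<in> Cinf M \<Longrightarrow> g \<in> Cinf M \<Longrightarrow> X p (\<lambda>x. f x * g x) = f p * X p g + g p * X p f"
    and "\<And>p f. f \<notin> Cinf M \<Longrightarrow> X p f = 0"
    and "\<And>f. f \<in> Cinf M \<Longrightarrow> (\<lambda>p. X p f) \<in> Cinf M"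
  shows "X \<in> VF"
  using assms unfolding vector_fields_def tangent_space_def by blast

lemma vf_add: "X \<in> VF \<Longrightarrow> f \<in> Cinf M \<Longrightarrow> g \<in> Cinf M \<Longrightarrow> X p (\<lambda>x. f x + g x) = X p f + X p g"
  using vf_lin[of X f g p 1 1] by simp

lemma vf_diff: "X \<in> VF \<Longrightarrow> f \<in> Cinf M \<Longrightarrow> g \<in> Cinf M \<Longrightarrow> X p (\<lambda>x. f x - g x) = X p f - X p g"
  using vf_lin[of X f g p 1 "-1"] by simp

lemma vf_comb:
  assumes "f \<in> Cinf M" "g \<in> Cinf M" "X \<in> VF" "Y \<in> VF"
  shows "(\<lambda>p h. f p * X p h + g p * Y p h) \<in> VF"
proof (rule vfI)
  show "(\<lambda>p. f p * X p h + g p * Y p h) \<in> Cinf M" if "h \<in> Cinf M" for h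
    by (rule Cinf_add[OF Cinf_mult[OF assms(1) vf_Cinf[OF assms(3) that]]
          Cinf_mult[OF assms(2) vf_Cinf[OF assms(4) that]]])
qed (simp_all add: vf_lin[OF assms(3)] vf_lin[OF assms(4)] vf_prod[OF assms(3)] vf_prod[OF assms(4)]
    vf_nonsmooth[OF assms(3)] vf_nonsmooth[OF assms(4)] algebra_simps)

lemma vf_zero: "(\<lambda>p h. 0) \<in> VF"
  by (rule vfI) (auto simp: Cinf_const)

lemma vf_bracket_vf:
  assumes X: "X \<in> VF" and Y: "Y \<in> VF"
  shows "vf_bracket M X Y \<in> VF"
proof (rule vfI)
  fix p f g a b assume fg: "f \<in> Cinf M" "g \<in> Cinf M"
  have c: "(\<lambda>x. a * f x + b * g x) \<in> Cinf M" by (intro Cinf_add Cinf_mult Cinf_const fg)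
  show "vf_bracket M X Y p (\<lambda>x. a * f x + b * g x) = a * vf_bracket M X Y p f + b * vf_bracket M X Y p g"
    using fg c by (simp add: vf_bracket_def vf_lin[OF X] vf_lin[OF Y] vf_Cinf[OF X] vf_Cinf[OF Y])
      (simp add: algebra_simps)
next
  fix p f g assume fg: "f \<in> Cinf M" "g \<in> Cinf M"
  show "vf_bracket M X Y p (\<lambda>x. f x * g x) = f p * vf_bracket M X Y p g + g p * vf_bracket M X Y p f"
    using fg by (simp add: vf_bracket_def vf_prod[OF X] vf_prod[OF Y] vf_add[OF X] vf_add[OF Y]
        vf_Cinf[OF X] vf_Cinf[OF Y] Cinf_mult) (simp add: algebra_simps)
next
  show "(\<lambda>p. vf_bracket M X Y p f) \<in> Cinf M" if "f \<in> Cinf M" for f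
    using Cinf_diff[OF vf_Cinf[OF X vf_Cinf[OF Y that]] vf_Cinf[OF Y vf_Cinf[OF X that]]] that
    by (simp add: vf_bracket_def)
qed (simp add: vf_bracket_def)

lemma vf_bracket_comb_right:
  assumes "X \<in> VF" "Y \<in> VF" "Z \<in> VF" "f \<in> Cinf M" "g \<in> Cinf M"
  shows "vf_bracket M X (\<lambda>p h. f p * Y p h + g p * Z p h) =
    (\<lambda>p h. f p * vf_bracket M X Y p h + g p * vf_bracket M X Z p h + (X p f * Y p h + X p g * Z p h))"
proof (intro ext)
  fix p h
  show "vf_bracket M X (\<lambda>p h. f p * Y p h + g p * Z p h) p h =
    f p * vf_bracket M X Y p h + g p * vf_bracket M X Z p h + (X p f * Y p h + X p g * Z p h)"
  proof (cases "h \<in> Cinf M")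
    case True
    then show ?thesis using assms(4,5)
      by (simp add: vf_bracket_def vf_add[OF assms(1)] vf_prod[OF assms(1)] vf_Cinf[OF assms(2)]
          vf_Cinf[OF assms(3)] Cinf_mult) (simp add: algebra_simps)
  next
    case False
    then show ?thesis
      by (simp add: vf_bracket_def vf_nonsmooth[OF assms(2)] vf_nonsmooth[OF assms(3)])
  qed
qed

lemma vf_bracket_anti: "vf_bracket M X Y = (\<lambda>p h. - vf_bracket M Y X p h)"
  by (auto simp: vf_bracket_def fun_eq_iff)

lemma vf_bracket_jacobi:
  assumes "X \<in> VF" "Y \<in> VF" "Z \<in> VF"
  shows "vf_bracket M X (vf_bracket M Y Z) p h =
    vf_bracket M (vf_bracket M X Y) Z p h + vf_bracket M Y (vf_bracket M X Z) p h"
proof (cases "h \<in> Cinf M")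
  case True
  then have c: "(\<lambda>p. X p (\<lambda>x. Y x h)) \<in> Cinf M" "(\<lambda>p. Y p (\<lambda>x. X x h)) \<in> Cinf M"
    "(\<lambda>p. X p (\<lambda>x. Z x h)) \<in> Cinf M" "(\<lambda>p. Z p (\<lambda>x. X x h)) \<in> Cinf M"
    "(\<lambda>p. Y p (\<lambda>x. Z x h)) \<in> Cinf M" "(\<lambda>p. Z p (\<lambda>x. Y x h)) \<in> Cinf M"
    "(\<lambda>p. X p h) \<in> Cinf M" "(\<lambda>p. Y p h) \<in> Cinf M" "(\<lambda>p. Z p h) \<in> Cinf M"
    using assms by (simp_all add: vf_Cinf[OF assms(1)] vf_Cinf[OF assms(2)] vf_Cinf[OF assms(3)])
  then show ?thesis using True
    by (simp add: vf_bracket_def vf_diff[OF assms(1)] vf_diff[OF assms(2)] vf_diff[OF assms(3)])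
next
  case False
  then show ?thesis by (simp add: vf_bracket_def)
qed

end


section \<open>Bundles of ideals\<close>

locale ideal_bundle =
  fixes A :: "('m::{t2_space,second_countable_topology}, 'a::real_vector, 'x) algebroid_data_scheme"
    and K :: "'m \<Rightarrow> 'a set"
  assumes la: "lie_algebroid A" and bi: "bundle_of_ideals A K"

sublocale ideal_bundle \<subseteq> vsubbundle A K
  using la bi by unfold_locales (simp_all add: lie_algebroid_def bundle_of_ideals_def)

sublocale ideal_bundle \<subseteq> full: vsubbundle A "fibre A"
  using subbundle_fibre by unfold_locales

context ideal_bundle
begin

abbreviation "S \<equiv> sections A"
abbreviation "br \<equiv> bracket A"

lemma br_S: "\<alpha> \<in> S \<Longrightarrow> \<beta> \<in> S \<Longrightarrow> br \<alpha> \<beta> \<in> S"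
  by (rule la[unfolded lie_algebroid_def, THEN conjunct2, THEN conjunct2, THEN conjunct2, THEN conjunct2, THEN conjunct1, rule_format])

lemma br_rcomb: "\<alpha> \<in> S \<Longrightarrow> \<beta> \<in> S \<Longrightarrow> \<delta> \<in> S \<Longrightarrow>
    br \<alpha> (\<lambda>p. a *\<^sub>R \<beta> p + b *\<^sub>R \<delta> p) = (\<lambda>p. a *\<^sub>R br \<alpha> \<beta> p + b *\<^sub>R br \<alpha> \<delta> p)"
  by (rule la[unfolded lie_algebroid_def, THEN conjunct2, THEN conjunct2, THEN conjunct2, THEN conjunct2, THEN conjunct2, THEN conjunct1, rule_format])

lemma br_anti: "\<alpha> \<in> S \<Longrightarrow> \<beta> \<in> S \<Longrightarrow> br \<alpha> \<beta> = (\<lambda>p. - br \<beta> \<alpha> p)"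
  by (rule la[unfolded lie_algebroid_def, THEN conjunct2, THEN conjunct2, THEN conjunct2, THEN conjunct2, THEN conjunct2, THEN conjunct2, THEN conjunct1, rule_format])

lemma br_jacobi: "\<alpha> \<in> S \<Longrightarrow> \<beta> \<in> S \<Longrightarrow> \<delta> \<in> S \<Longrightarrow>
    br \<alpha> (br \<beta> \<delta>) = (\<lambda>p. br (br \<alpha> \<beta>) \<delta> p + br \<beta> (br \<alpha> \<delta>) p)"
  by (rule la[unfolded lie_algebroid_def, THEN conjunct2, THEN conjunct2, THEN conjunct2, THEN conjunct2, THEN conjunct2, THEN conjunct2, THEN conjunct2, THEN conjunct1, rule_format])

lemma br_leibniz: "\<alpha> \<in> S \<Longrightarrow> \<beta> \<in> S \<Longrightarrow> f \<in> Cinf A \<Longrightarrow>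
    br \<alpha> (\<lambda>p. f p *\<^sub>R \<beta> p) = (\<lambda>p. f p *\<^sub>R br \<alpha> \<beta> p + rho A \<alpha> p f *\<^sub>R \<beta> p)"
  by (rule la[unfolded lie_algebroid_def, THEN conjunct2, THEN conjunct2, THEN conjunct2, THEN conjunct2, THEN conjunct2, THEN conjunct2, THEN conjunct2, THEN conjunct2, rule_format])

lemma rho_VF: "\<alpha> \<in> S \<Longrightarrow> rho A \<alpha> \<in> VF"
  by (rule la[unfolded lie_algebroid_def, THEN conjunct2, THEN conjunct2, THEN conjunct2, THEN conjunct1, rule_format])

lemma anchor_lin: "u \<in> fibre A p \<Longrightarrow> w \<in> fibre A p \<Longrightarrow>
    anchor A p (a *\<^sub>R u + b *\<^sub>R w) h = a * anchor A p u h + b * anchor A p w h"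
  by (rule la[unfolded lie_algebroid_def, THEN conjunct2, THEN conjunct2, THEN conjunct1, rule_format])

lemma br_\<Gamma>: "\<alpha> \<in> S \<Longrightarrow> \<xi> \<in> \<Gamma> \<Longrightarrow> br \<alpha> \<xi> \<in> \<Gamma>"
  and anchor_K: "u \<in> K p \<Longrightarrow> anchor A p u h = 0"
  using bi unfolding bundle_of_ideals_def by blast+

lemma \<Gamma>S: "\<xi> \<in> \<Gamma> \<Longrightarrow> \<xi> \<in> S" by (rule \<Gamma>_sections)

lemma br_\<Gamma>': assumes "\<xi> \<in> \<Gamma>" "\<alpha> \<in> S" shows "br \<xi> \<alpha> \<in> \<Gamma>"
  using \<Gamma>_minus[OF br_\<Gamma>[OF assms(2,1)]] br_anti[OF \<Gamma>S[OF assms(1)] assms(2)] by simp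

lemma rho_\<Gamma>: "\<xi> \<in> \<Gamma> \<Longrightarrow> rho A \<xi> = (\<lambda>p h. 0)"
  by (intro ext) (simp add: rho_def anchor_K \<Gamma>_K)

lemma rho_comb: "\<alpha> \<in> S \<Longrightarrow> \<beta> \<in> S \<Longrightarrow>
    rho A (\<lambda>p. f p *\<^sub>R \<alpha> p + g p *\<^sub>R \<beta> p) = (\<lambda>p h. f p * rho A \<alpha> p h + g p * rho A \<beta> p h)"
  by (intro ext) (simp add: rho_def anchor_lin sections_fibre)

lemma S_comb: "f \<in> Cinf A \<Longrightarrow> g \<in> Cinf A \<Longrightarrow> \<alpha> \<in> S \<Longrightarrow> \<beta> \<in> S \<Longrightarrow> (\<lambda>p. f p *\<^sub>R \<alpha> p + g p *\<^sub>R \<beta> p) \<in> S"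
  by (rule sections_comb)

lemma S_scale: "f \<in> Cinf A \<Longrightarrow> \<alpha> \<in> S \<Longrightarrow> (\<lambda>p. f p *\<^sub>R \<alpha> p) \<in> S"
  using full.\<Gamma>_scale by (simp add: sub_sections_fibre)

lemma S_add: "\<alpha> \<in> S \<Longrightarrow> \<beta> \<in> S \<Longrightarrow> (\<lambda>p. \<alpha> p + \<beta> p) \<in> S"
  and S_diff: "\<alpha> \<in> S \<Longrightarrow> \<beta> \<in> S \<Longrightarrow> (\<lambda>p. \<alpha> p - \<beta> p) \<in> S"
  and S_zero: "(\<lambda>p. 0) \<in> S"
  using full.\<Gamma>_add full.\<Gamma>_diff full.\<Gamma>_zero by (simp_all add: sub_sections_fibre)

lemma br_add: "\<alpha> \<in> S \<Longrightarrow> \<beta> \<in> S \<Longrightarrow> \<delta> \<in> S \<Longrightarrow> br \<alpha> (\<lambda>p. \<beta> p + \<delta> p) = (\<lambda>p. br \<alpha> \<beta> p + br \<alpha> \<delta> p)"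
  using br_rcomb[of \<alpha> \<beta> \<delta> 1 1] by simp

lemma br_diff: "\<alpha> \<in> S \<Longrightarrow> \<beta> \<in> S \<Longrightarrow> \<delta> \<in> S \<Longrightarrow> br \<alpha> (\<lambda>p. \<beta> p - \<delta> p) = (\<lambda>p. br \<alpha> \<beta> p - br \<alpha> \<delta> p)"
  using br_rcomb[of \<alpha> \<beta> \<delta> 1 "-1"] by simp

lemma br_zero: "\<alpha> \<in> S \<Longrightarrow> br \<alpha> (\<lambda>p. 0) = (\<lambda>p. 0)"
  using br_rcomb[of \<alpha> \<alpha> \<alpha> 0 0] by simp

lemma br_minus: "\<alpha> \<in> S \<Longrightarrow> \<beta> \<in> S \<Longrightarrow> br \<alpha> (\<lambda>p. - \<beta> p) = (\<lambda>p. - br \<alpha> \<beta> p)"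
  using br_rcomb[of \<alpha> \<beta> \<beta> "-1" 0] by simp

lemma br_add': "\<alpha> \<in> S \<Longrightarrow> \<beta> \<in> S \<Longrightarrow> \<delta> \<in> S \<Longrightarrow> br (\<lambda>p. \<beta> p + \<delta> p) \<alpha> = (\<lambda>p. br \<beta> \<alpha> p + br \<delta> \<alpha> p)"
  using br_anti[of "\<lambda>p. \<beta> p + \<delta> p" \<alpha>] br_add[of \<alpha> \<beta> \<delta>] br_anti[of \<beta> \<alpha>] br_anti[of \<delta> \<alpha>]
  by (simp add: S_add)

lemma br_diff': "\<alpha> \<in> S \<Longrightarrow> \<beta> \<in> S \<Longrightarrow> \<delta> \<in> S \<Longrightarrow> br (\<lambda>p. \<beta> p - \<delta> p) \<alpha> = (\<lambda>p. br \<beta> \<alpha> p - br \<delta> \<alpha> p)"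
  using br_anti[of "\<lambda>p. \<beta> p - \<delta> p" \<alpha>] br_diff[of \<alpha> \<beta> \<delta>] br_anti[of \<beta> \<alpha>] br_anti[of \<delta> \<alpha>]
  by (simp add: S_diff)

lemma br_minus': "\<alpha> \<in> S \<Longrightarrow> \<beta> \<in> S \<Longrightarrow> br (\<lambda>p. - \<beta> p) \<alpha> = (\<lambda>p. - br \<beta> \<alpha> p)"
  using br_diff'[of \<alpha> "\<lambda>p. 0" \<beta>] br_diff'[of \<alpha> \<beta> \<beta>] by (simp add: S_zero)

lemma br_comb_right:
  assumes "\<alpha> \<in> S" "\<beta> \<in> S" "\<delta> \<in> S" "f \<in> Cinf A" "g \<in> Cinf A"
  shows "br \<alpha> (\<lambda>p. f p *\<^sub>R \<beta> p + g p *\<^sub>R \<delta> p) =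
    (\<lambda>p. f p *\<^sub>R br \<alpha> \<beta> p + g p *\<^sub>R br \<alpha> \<delta> p + (rho A \<alpha> p f *\<^sub>R \<beta> p + rho A \<alpha> p g *\<^sub>R \<delta> p))"
  using assms by (simp add: br_add S_scale br_leibniz add_ac)

lemma br_\<Gamma>_comb_right:
  assumes "\<xi> \<in> \<Gamma>" "\<beta> \<in> S" "\<delta> \<in> S" "f \<in> Cinf A" "g \<in> Cinf A"
  shows "br \<xi> (\<lambda>p. f p *\<^sub>R \<beta> p + g p *\<^sub>R \<delta> p) = (\<lambda>p. f p *\<^sub>R br \<xi> \<beta> p + g p *\<^sub>R br \<xi> \<delta> p)"
  using br_comb_right[OF \<Gamma>S[OF assms(1)] assms(2-5)] rho_\<Gamma>[OF assms(1)] by simp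

lemma br_\<Gamma>_comb_left:
  assumes "\<xi> \<in> \<Gamma>" "\<beta> \<in> S" "\<delta> \<in> S" "f \<in> Cinf A" "g \<in> Cinf A"
  shows "br (\<lambda>p. f p *\<^sub>R \<beta> p + g p *\<^sub>R \<delta> p) \<xi> = (\<lambda>p. f p *\<^sub>R br \<beta> \<xi> p + g p *\<^sub>R br \<delta> \<xi> p)"
  using br_\<Gamma>_comb_right[OF assms] br_anti[OF S_comb[OF assms(4,5,2,3)] \<Gamma>S[OF assms(1)]]
    br_anti[OF assms(2) \<Gamma>S[OF assms(1)]] br_anti[OF assms(3) \<Gamma>S[OF assms(1)]]
  by simp

lemma br_local:
  assumes "\<xi> \<in> \<Gamma>" "\<xi>' \<in> \<Gamma>" "\<eta> \<in> \<Gamma>" "\<eta>' \<in> \<Gamma>" "\<xi> p = \<xi>' p" "\<eta> p = \<eta>' p"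
  shows "br \<xi> \<eta> p = br \<xi>' \<eta>' p"
proof -
  have "br \<xi> \<eta> p = br \<xi> \<eta>' p"
    by (rule tensorial[of "br \<xi>"]) (use assms br_\<Gamma>_comb_right \<Gamma>S in auto)
  also have "\<dots> = br \<xi>' \<eta>' p"
    by (rule tensorial[of "\<lambda>\<xi>. br \<xi> \<eta>'"]) (use assms br_\<Gamma>_comb_left \<Gamma>S in auto)
  finally show ?thesis .
qed

lemma fibre_bracket_eq:
  assumes "\<xi> \<in> \<Gamma>" "\<eta> \<in> \<Gamma>"
  shows "fibre_bracket A K p (\<xi> p) (\<eta> p) = br \<xi> \<eta> p"
proof -
  have s: "(SOME \<zeta>. \<zeta> \<in> \<Gamma> \<and> \<zeta> p = \<xi> p) \<in> \<Gamma> \<and> (SOME \<zeta>. \<zeta> \<in> \<Gamma> \<and> \<zeta> p = \<xi> p) p = \<xi> p" if "\<xi> \<in> \<Gamma>" for \<xi>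
    by (rule someI[of "\<lambda>\<zeta>. \<zeta> \<in> \<Gamma> \<and> \<zeta> p = \<xi> p"]) (use that in simp)
  show ?thesis unfolding fibre_bracket_def
    using s[OF assms(1)] s[OF assms(2)] assms by (intro br_local) auto
qed

text \<open>Compatibility of the anchor with brackets follows from the Jacobi identity and the
  Leibniz rule: expand the Jacobi identity for two sections and a third one multiplied by a function
  \<open>h\<close>, and compare the coefficients of the third section.\<close>

lemma anchor_bracket:
  assumes \<alpha>: "\<alpha> \<in> S" and \<beta>: "\<beta> \<in> S"
  shows "rho A (br \<alpha> \<beta>) = vf_bracket A (rho A \<alpha>) (rho A \<beta>)"
proof (intro ext)
  fix p h
  note ab = br_S[OF \<alpha> \<beta>]
  show "rho A (br \<alpha> \<beta>) p h = vf_bracket A (rho A \<alpha>) (rho A \<beta>) p h"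
  proof (cases "h \<in> Cinf A")
    case False
    then show ?thesis using vf_nonsmooth[OF rho_VF[OF ab]] by (simp add: vf_bracket_def)
  next
    case h: True
    show ?thesis
    proof (cases "fibre A p = {0}")
      case True
      \<comment> \<open>In rank zero there is no section with nonzero value at \<open>p\<close> to
        compare coefficients of, but all anchors at \<open>p\<close> vanish.\<close>
      have z: "anchor A p 0 f = 0" for f
        using anchor_lin[of 0 p 0 0 0 f] fibre_subspace by (simp add: subspace_0)
      have "\<alpha> p = 0" "\<beta> p = 0" "br \<alpha> \<beta> p = 0" using True sections_fibre \<alpha> \<beta> ab by blast+
      then show ?thesis using h z by (simp add: vf_bracket_def rho_def)
    next
      case False
      then obtain u where u: "u \<in> fibre A p" "u \<noteq> 0" using fibre_subspace subspace_0 by blast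
      obtain \<delta> where \<delta>: "\<delta> \<in> S" "\<delta> p = u" using full.section_through[OF u(1)] sub_sections_fibre by auto
      let ?a = "rho A \<alpha>" and ?b = "rho A \<beta>"
      have c: "(\<lambda>p. ?a p h) \<in> Cinf A" "(\<lambda>p. ?b p h) \<in> Cinf A"
        using vf_Cinf[OF rho_VF[OF \<alpha>] h] vf_Cinf[OF rho_VF[OF \<beta>] h] .
      have d: "br \<alpha> \<delta> \<in> S" "br \<beta> \<delta> \<in> S" using br_S \<alpha> \<beta> \<delta> by auto
      have e1: "br \<alpha> (br \<beta> (\<lambda>p. h p *\<^sub>R \<delta> p)) = (\<lambda>p. h p *\<^sub>R br \<alpha> (br \<beta> \<delta>) p + ?a p h *\<^sub>R br \<beta> \<delta> p
          + (?b p h *\<^sub>R br \<alpha> \<delta> p + ?a p (\<lambda>x. ?b x h) *\<^sub>R \<delta> p))"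
        using \<alpha> \<beta> \<delta> h c d by (simp add: br_leibniz br_add S_scale)
      have e2: "br \<beta> (br \<alpha> (\<lambda>p. h p *\<^sub>R \<delta> p)) = (\<lambda>p. h p *\<^sub>R br \<beta> (br \<alpha> \<delta>) p + ?b p h *\<^sub>R br \<alpha> \<delta> p
          + (?a p h *\<^sub>R br \<beta> \<delta> p + ?b p (\<lambda>x. ?a x h) *\<^sub>R \<delta> p))"
        using \<alpha> \<beta> \<delta> h c d by (simp add: br_leibniz br_add S_scale)
      have e3: "br (br \<alpha> \<beta>) (\<lambda>p. h p *\<^sub>R \<delta> p) = (\<lambda>p. h p *\<^sub>R br (br \<alpha> \<beta>) \<delta> p + rho A (br \<alpha> \<beta>) p h *\<^sub>R \<delta> p)"
        using ab \<delta> h by (simp add: br_leibniz)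
      have j1: "br \<alpha> (br \<beta> (\<lambda>p. h p *\<^sub>R \<delta> p)) p =
          br (br \<alpha> \<beta>) (\<lambda>p. h p *\<^sub>R \<delta> p) p + br \<beta> (br \<alpha> (\<lambda>p. h p *\<^sub>R \<delta> p)) p"
        using br_jacobi[OF \<alpha> \<beta> S_scale[OF h \<delta>(1)]] by simp
      have j2: "br \<alpha> (br \<beta> \<delta>) p = br (br \<alpha> \<beta>) \<delta> p + br \<beta> (br \<alpha> \<delta>) p"
        using br_jacobi[OF \<alpha> \<beta> \<delta>(1)] by simp
      \<comment> \<open>The mixed first-order terms occur on both sides, and the Jacobi identity for
        \<delta> itself removes the terms multiplied by \<open>h p\<close>.\<close>
      have "?a p (\<lambda>x. ?b x h) *\<^sub>R u = (rho A (br \<alpha> \<beta>) p h + ?b p (\<lambda>x. ?a x h)) *\<^sub>R u"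
        using j1 unfolding e1 e2 e3 j2 \<delta>(2) by (simp add: algebra_simps)
      then have "?a p (\<lambda>x. ?b x h) = rho A (br \<alpha> \<beta>) p h + ?b p (\<lambda>x. ?a x h)"
        using u(2) by (simp only: scaleR_right_imp_eq)
      then show ?thesis using h by (simp add: vf_bracket_def)
    qed
  qed
qed

end

section \<open>Inner derivations of the sections of a semisimple bundle of ideals\<close>

locale semisimple_ideal_bundle = ideal_bundle A K
  for A :: "('m::{t2_space,second_countable_topology}, 'a::real_vector, 'x) algebroid_data_scheme"
    and K :: "'m \<Rightarrow> 'a set" +
  assumes ssb: "semisimple_bundle A K"
begin

abbreviation "fb \<equiv> fibre_bracket A K"

definition iso_at :: "'a set \<Rightarrow> ('a \<Rightarrow> 'a \<Rightarrow> 'a) \<Rightarrow> 'm \<Rightarrow> ('a \<Rightarrow> 'a) \<Rightarrow> bool" where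
  "iso_at g br0 x f \<longleftrightarrow> bij_betw f g (K x) \<and>
     (\<forall>u\<in>g. \<forall>w\<in>g. \<forall>a b. f (a *\<^sub>R u + b *\<^sub>R w) = a *\<^sub>R f u + b *\<^sub>R f w) \<and>
     (\<forall>u\<in>g. \<forall>w\<in>g. f (br0 u w) = fb x (f u) (f w))"

lemma trivialisations:
  obtains g :: "'a set" and br0 where "semisimple_lie_algebra g br0"
    "\<forall>p. \<exists>U \<psi>. open U \<and> p \<in> U \<and> (\<forall>u\<in>g. smooth_section_on A U (\<lambda>x. \<psi> x u)) \<and> (\<forall>x\<in>U. iso_at g br0 x (\<psi> x))"
  using ssb unfolding semisimple_bundle_def iso_at_def[symmetric] by (elim exE conjE) (rule that)

lemma iso_at_semisimple_iso:
  "semisimple_lie_algebra g br0 \<Longrightarrow> is_basis r b (K x) \<Longrightarrow> iso_at g br0 x f \<Longrightarrow>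
    semisimple_iso g br0 (K x) (fb x) r b f"
  by unfold_locales (simp_all add: iso_at_def)

text \<open>Pointwise this is the theorem that all derivations of a semisimple Lie algebra are inner; the
  section obtained is smooth since its components solve an overdetermined injective linear system
  with smooth coefficients.\<close>

lemma inner_derivation:
  assumes T\<Gamma>: "\<And>\<xi>. \<xi> \<in> \<Gamma> \<Longrightarrow> T \<xi> \<in> \<Gamma>"
    and Tlin: "\<And>\<xi> \<eta> f g. \<xi> \<in> \<Gamma> \<Longrightarrow> \<eta> \<in> \<Gamma> \<Longrightarrow> f \<in> Cinf A \<Longrightarrow> g \<in> Cinf A \<Longrightarrow>
      T (\<lambda>p. f p *\<^sub>R \<xi> p + g p *\<^sub>R \<eta> p) = (\<lambda>p. f p *\<^sub>R T \<xi> p + g p *\<^sub>R T \<eta> p)"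
    and Tder: "\<And>\<xi> \<eta>. \<xi> \<in> \<Gamma> \<Longrightarrow> \<eta> \<in> \<Gamma> \<Longrightarrow> T (br \<xi> \<eta>) = (\<lambda>p. br (T \<xi>) \<eta> p + br \<xi> (T \<eta>) p)"
  obtains \<zeta> where "\<zeta> \<in> \<Gamma>" "\<And>\<xi>. \<xi> \<in> \<Gamma> \<Longrightarrow> T \<xi> = br \<zeta> \<xi>"
proof -
  obtain g br0 where g: "semisimple_lie_algebra g br0" and triv:
    "\<forall>p. \<exists>U \<psi>. open U \<and> p \<in> U \<and> (\<forall>u\<in>g. smooth_section_on A U (\<lambda>x. \<psi> x u)) \<and> (\<forall>x\<in>U. iso_at g br0 x (\<psi> x))"
    by (rule trivialisations)
  define sec where "sec p u = (SOME \<xi>. \<xi> \<in> \<Gamma> \<and> \<xi> p = u)" for p u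
  have sec: "sec p u \<in> \<Gamma> \<and> sec p u p = u" if u: "u \<in> K p" for p u
  proof -
    obtain \<xi> where "\<xi> \<in> \<Gamma>" "\<xi> p = u" using section_through[OF u] by blast
    then show ?thesis unfolding sec_def by (intro someI[of "\<lambda>\<xi>. \<xi> \<in> \<Gamma> \<and> \<xi> p = u" \<xi>]) simp
  qed
  \<comment> \<open>The map induced by \<open>T\<close> on the fibre at \<open>p\<close>; it is
    independent of the chosen sections by tensoriality.\<close>
  define \<tau> where "\<tau> p u = T (sec p u) p" for p u
  have \<tau>: "\<tau> p (\<xi> p) = T \<xi> p" if \<xi>: "\<xi> \<in> \<Gamma>" for p \<xi>
    unfolding \<tau>_def using sec[OF \<Gamma>_K[OF \<xi>]] \<xi> by (intro tensorial[of T]) (auto intro: Tlin)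
  have fbK: "fb p u w = br (sec p u) (sec p w) p" if "u \<in> K p" "w \<in> K p" for p u w
    using fibre_bracket_eq[of "sec p u" "sec p w" p] sec that by simp
  have \<tau>lin: "lin_on (K p) (\<tau> p)" for p
    unfolding lin_on_def
  proof (intro ballI allI)
    fix u w a b assume u: "u \<in> K p" and w: "w \<in> K p"
    have "\<tau> p (a *\<^sub>R sec p u p + b *\<^sub>R sec p w p) = T (\<lambda>x. a *\<^sub>R sec p u x + b *\<^sub>R sec p w x) p"
      using \<tau>[OF \<Gamma>_rcomb, of "sec p u" "sec p w" p a b] sec u w by simp
    also have "\<dots> = a *\<^sub>R \<tau> p u + b *\<^sub>R \<tau> p w"
      using Tlin[of "sec p u" "sec p w" "\<lambda>x. a" "\<lambda>x. b"] sec[OF u] sec[OF w] Cinf_const by (simp add: \<tau>_def)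
    finally show "\<tau> p (a *\<^sub>R u + b *\<^sub>R w) = a *\<^sub>R \<tau> p u + b *\<^sub>R \<tau> p w" using sec[OF u] sec[OF w] by simp
  qed
  have \<tau>K: "\<tau> p u \<in> K p" if "u \<in> K p" for p u
    unfolding \<tau>_def using sec[OF that] T\<Gamma> \<Gamma>_K by blast
  have \<tau>der: "\<tau> p (fb p u w) = fb p (\<tau> p u) w + fb p u (\<tau> p w)" if u: "u \<in> K p" and w: "w \<in> K p" for p u w
  proof -
    let ?u = "sec p u" and ?w = "sec p w"
    have s: "?u \<in> \<Gamma>" "?w \<in> \<Gamma>" "?u p = u" "?w p = w" using sec[OF u] sec[OF w] by auto
    have "\<tau> p (fb p u w) = T (br ?u ?w) p" using \<tau>[OF br_\<Gamma>[OF \<Gamma>S[OF s(1)] s(2)], of p] fbK[OF u w] by simp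
    also have "\<dots> = br (T ?u) ?w p + br ?u (T ?w) p" using Tder[OF s(1,2)] by simp
    also have "\<dots> = fb p (T ?u p) (?w p) + fb p (?u p) (T ?w p)"
      using fibre_bracket_eq[OF T\<Gamma>[OF s(1)] s(2), of p] fibre_bracket_eq[OF s(1) T\<Gamma>[OF s(2)], of p] by simp
    finally show ?thesis using s by (simp add: \<tau>_def)
  qed
  have "\<exists>z. z \<in> K p \<and> (\<forall>u\<in>K p. \<tau> p u = fb p z u)" for p
  proof -
    obtain U \<psi> where U: "p \<in> U" "\<forall>x\<in>U. iso_at g br0 x (\<psi> x)"
      using spec[OF triv, of p] by blast
    obtain r W e where W: "open W" "p \<in> W" "\<And>i. i < r \<Longrightarrow> smooth_section_on A W (e i)"
      "\<And>x. x \<in> W \<Longrightarrow> is_basis r (\<lambda>i. e i x) (K x)" by (rule sub_frame[of p]) blast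
    interpret semisimple_iso g br0 "K p" "fb p" r "\<lambda>i. e i p" "\<psi> p"
      by (rule iso_at_semisimple_iso[OF g W(4)[OF W(2)]]) (use U in blast)
    obtain z where "z \<in> K p" "\<And>u. u \<in> K p \<Longrightarrow> \<tau> p u = fb p z u"
      by (rule iso_derivation_inner[OF \<tau>lin[of p] \<tau>K \<tau>der]) blast+
    then show ?thesis by (intro exI[of _ z]) simp
  qed
  then obtain \<zeta> where \<zeta>: "\<And>p. \<zeta> p \<in> K p" "\<And>p u. u \<in> K p \<Longrightarrow> \<tau> p u = fb p (\<zeta> p) u" by metis
  have "smooth_section_on A UNIV \<zeta>"
  proof (rule smooth_section_on_local)
    fix p0
    obtain U \<psi> where U: "open U" "p0 \<in> U" "\<And>u. u \<in> g \<Longrightarrow> smooth_section_on A U (\<lambda>x. \<psi> x u)"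
      and \<psi>: "\<forall>x\<in>U. iso_at g br0 x (\<psi> x)"
      using spec[OF triv, of p0] by blast
    obtain r W e where W: "open W" "p0 \<in> W" "\<And>i. i < r \<Longrightarrow> smooth_section_on A W (e i)"
      "\<And>x. x \<in> W \<Longrightarrow> is_basis r (\<lambda>i. e i x) (K x)" by (rule sub_frame[of p0]) blast
    interpret I: semisimple_iso g br0 "K p0" "fb p0" r "\<lambda>i. e i p0" "\<psi> p0"
      by (rule iso_at_semisimple_iso[OF g W(4)[OF W(2)]]) (use U \<psi> in blast)
    \<comment> \<open>A basis of \<open>g\<close> obtained from the fibre at \<open>p0\<close>
      alone. It stays fixed over the whole neighbourhood, where only \<psi> varies.\<close>
    let ?c = "I.c"
    have cg: "?c i \<in> g" if "i < r" for i using that by (rule I.g.bV)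
    have psiK: "\<psi> x u \<in> K x" if "x \<in> U" "u \<in> g" for x u
      using bspec[OF \<psi> that(1)] that by (auto simp: iso_at_def bij_betw_def)
    have psilin: "lin_on g (\<psi> x)" if "x \<in> U" for x using bspec[OF \<psi> that] by (simp add: lin_on_def iso_at_def)
    have psihom: "\<psi> x (br0 u w) = fb x (\<psi> x u) (\<psi> x w)" if "x \<in> U" "u \<in> g" "w \<in> g" for x u w
      using bspec[OF \<psi> that(1)] that by (simp add: iso_at_def)
    have psi0: "u = 0" if "x \<in> U" "u \<in> g" "\<psi> x u = 0" for x u
    proof -
      have "inj_on (\<psi> x) g" using bspec[OF \<psi> that(1)] that by (auto simp: iso_at_def bij_betw_def)
      moreover have "\<psi> x 0 = 0" by (rule lin_on_zero[OF psilin[OF that(1)] I.gsub])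
      ultimately show ?thesis using that subspace_0[OF I.gsub] by (metis inj_onD)
    qed
    obtain \<eta> N C where \<eta>: "\<eta> \<in> Cinf A" "open N" "p0 \<in> N" "closed C" "N \<subseteq> C" "C \<subseteq> U"
      "\<And>x. x \<in> N \<Longrightarrow> \<eta> x = 1" "\<And>x. x \<notin> C \<Longrightarrow> \<eta> x = 0" by (rule bump[OF U(1,2)]) blast
    have NU: "N \<subseteq> U" using \<eta> by blast
    \<comment> \<open>\<open>T\<close> takes global sections only; these coincide on
      \<open>N\<close> with the local frame given by the trivialisation.\<close>
    define \<xi> where "\<xi> i = ext0 \<eta> U (\<lambda>x. \<psi> x (?c i))" for i
    have \<xi>: "\<xi> i \<in> \<Gamma>" if "i < r" for i
      unfolding \<xi>_def using that by (intro ext0_\<Gamma>[OF \<eta>(1,4,6) U(1) \<eta>(8)] U(3) psiK cg)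
    have \<xi>N: "\<xi> i x = \<psi> x (?c i)" if "x \<in> N" for i x
      using that NU \<eta>(7) by (auto simp: \<xi>_def ext0_def)
    define z where "z k x = I.g.cr k (inv_into g (\<psi> x) (\<zeta> x))" for k x
    have zx: "inv_into g (\<psi> x) (\<zeta> x) \<in> g" "\<psi> x (inv_into g (\<psi> x) (\<zeta> x)) = \<zeta> x" if "x \<in> U" for x
      using bspec[OF \<psi> that] \<zeta>(1)[of x] by (auto simp: iso_at_def bij_betw_def inv_into_into f_inv_into_f)
    have \<zeta>z: "\<zeta> x = (\<Sum>k<r. z k x *\<^sub>R \<psi> x (?c k))" if x: "x \<in> U" for x
    proof -
      have "\<zeta> x = \<psi> x (\<Sum>k<r. z k x *\<^sub>R ?c k)"
        unfolding z_def using I.g.expand[OF zx(1)[OF x]] zx(2)[OF x] by simp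
      also have "\<dots> = (\<Sum>k<r. z k x *\<^sub>R \<psi> x (?c k))"
        by (rule lin_on_sum[OF psilin[OF x] I.gsub]) (auto intro: cg)
      finally show ?thesis .
    qed
    \<comment> \<open>The linear system for the components of \<zeta>: the left-hand sides and the
      sections on the right are smooth on \<open>N\<close>, because \<open>br0\<close> of two fixed
      elements of \<open>g\<close> is again a fixed element.\<close>
    have Tz: "T (\<xi> i) x = (\<Sum>k<r. z k x *\<^sub>R \<psi> x (br0 (?c k) (?c i)))" if i: "i < r" and xN: "x \<in> N" for i x
    proof -
      have x: "x \<in> U" using xN NU by blast
      let ?z = "inv_into g (\<psi> x) (\<zeta> x)"
      have "T (\<xi> i) x = fb x (\<zeta> x) (\<psi> x (?c i))"
        using \<tau>[OF \<xi>[OF i], of x] \<zeta>(2)[OF psiK[OF x cg[OF i]]] \<xi>N[OF xN] by simp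
      also have "\<dots> = \<psi> x (br0 ?z (?c i))" using psihom[OF x zx(1)[OF x] cg[OF i]] zx(2)[OF x] by simp
      also have "br0 ?z (?c i) = (\<Sum>k<r. z k x *\<^sub>R br0 (?c k) (?c i))"
        unfolding z_def by (rule I.g.lin_on_expand[OF I.g.br_left[OF cg[OF i]] zx(1)[OF x]])
      also have "\<psi> x \<dots> = (\<Sum>k<r. z k x *\<^sub>R \<psi> x (br0 (?c k) (?c i)))"
        by (rule lin_on_sum[OF psilin[OF x] I.gsub]) (auto intro: cg i I.g.br_in)
      finally show ?thesis .
    qed
    have zs: "smooth_on A N (z k)" if k: "k < r" for k
    proof (rule smooth_coefficients[where m = r and S = "\<lambda>i. T (\<xi> i)" and r = r and z = z
          and P = "\<lambda>i k x. \<psi> x (br0 (?c k) (?c i))", OF \<eta>(2) _ _ _ _ k])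
      show "smooth_section_on A N (T (\<xi> j))" if "j < r" for j
        using T\<Gamma>[OF \<xi>[OF that]] \<Gamma>_sections sections_smooth by blast
      show "smooth_section_on A N (\<lambda>x. \<psi> x (br0 (?c k) (?c j)))" if "j < r" "k < r" for j k
        using that by (intro smooth_section_on_subset[OF U(3) NU] I.g.br_in cg)
      \<comment> \<open>Injectivity of the system: a solution of the homogeneous equations is an
        element of \<open>g\<close> commuting with a basis, hence central, hence zero.\<close>
      fix x v k assume xN: "x \<in> N" and v: "\<And>j. j < r \<Longrightarrow> (\<Sum>k<r. v k *\<^sub>R \<psi> x (br0 (?c k) (?c j))) = 0" and k: "k < r"
      have x: "x \<in> U" using xN NU by blast
      let ?v = "\<Sum>k<r. v k *\<^sub>R ?c k"
      have vg: "?v \<in> g" by (rule I.g.sum_in)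
      have "br0 ?v (?c j) = 0" if j: "j < r" for j
      proof (rule psi0[OF x])
        show "br0 ?v (?c j) \<in> g" by (rule I.g.br_in[OF vg cg[OF j]])
        have "br0 ?v (?c j) = (\<Sum>k<r. v k *\<^sub>R br0 (?c k) (?c j))"
          by (rule lin_on_sum[OF I.g.br_left[OF cg[OF j]] I.gsub]) (auto intro: cg)
        also have "\<psi> x \<dots> = (\<Sum>k<r. v k *\<^sub>R \<psi> x (br0 (?c k) (?c j)))"
          by (rule lin_on_sum[OF psilin[OF x] I.gsub]) (auto intro: cg j I.g.br_in)
        finally show "\<psi> x (br0 ?v (?c j)) = 0" using v[OF j] by simp
      qed
      then have "br0 ?v u = 0" if "u \<in> g" for u
        using I.g.lin_on_expand[OF I.g.br_right[OF vg] that] by simp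
      then have "?v = 0" by (rule I.g.centre_trivial[OF g vg])
      then show "v k = 0" by (rule is_basis_indep[OF I.c_basis _ k])
    qed (use Tz in auto)
    have "smooth_section_on A N (\<lambda>x. \<Sum>k<r. z k x *\<^sub>R \<psi> x (?c k))"
      by (intro smooth_section_on_sum zs smooth_section_on_subset[OF U(3) NU] cg) auto
    then have "smooth_section_on A N \<zeta>"
      by (rule smooth_section_on_cong) (use \<zeta>z NU in auto)
    then show "\<exists>V. open V \<and> p0 \<in> V \<and> smooth_section_on A V \<zeta>" using \<eta> by blast
  qed simp
  then have \<zeta>\<Gamma>: "\<zeta> \<in> \<Gamma>" using \<zeta>(1) by (simp add: sub_sections_def sections_iff)
  have "T \<xi> = br \<zeta> \<xi>" if "\<xi> \<in> \<Gamma>" for \<xi>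
    using \<tau>[OF that] \<zeta>(2)[OF \<Gamma>_K[OF that]] fibre_bracket_eq[OF \<zeta>\<Gamma> that] by (intro ext) simp
  then show thesis using that \<zeta>\<Gamma> by blast
qed

lemma centre_zero:
  assumes \<zeta>: "\<zeta> \<in> \<Gamma>" and z: "\<And>\<xi>. \<xi> \<in> \<Gamma> \<Longrightarrow> br \<zeta> \<xi> = (\<lambda>p. 0)"
  shows "\<zeta> = (\<lambda>p. 0)"
proof
  fix p
  obtain g br0 where g: "semisimple_lie_algebra g br0" and triv:
    "\<forall>p. \<exists>U \<psi>. open U \<and> p \<in> U \<and> (\<forall>u\<in>g. smooth_section_on A U (\<lambda>x. \<psi> x u)) \<and> (\<forall>x\<in>U. iso_at g br0 x (\<psi> x))"
    by (rule trivialisations)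
  obtain U \<psi> where U: "p \<in> U" "\<forall>x\<in>U. iso_at g br0 x (\<psi> x)"
    using spec[OF triv, of p] by blast
  obtain r W e where W: "open W" "p \<in> W" "\<And>i. i < r \<Longrightarrow> smooth_section_on A W (e i)"
    "\<And>x. x \<in> W \<Longrightarrow> is_basis r (\<lambda>i. e i x) (K x)" by (rule sub_frame[of p]) blast
  interpret semisimple_iso g br0 "K p" "fb p" r "\<lambda>i. e i p" "\<psi> p"
    by (rule iso_at_semisimple_iso[OF g W(4)[OF W(2)]]) (use U in blast)
  show "\<zeta> p = 0"
  proof (rule iso_centre[OF \<Gamma>_K[OF \<zeta>]])
    fix u assume "u \<in> K p"
    then obtain \<xi> where \<xi>: "\<xi> \<in> \<Gamma>" "\<xi> p = u" using section_through by blast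
    then show "fb p (\<zeta> p) u = 0" using fibre_bracket_eq[OF \<zeta> \<xi>(1), of p] z[OF \<xi>(1)] by simp
  qed
qed

lemma br_eqI:
  assumes "\<zeta> \<in> \<Gamma>" "\<zeta>' \<in> \<Gamma>" "\<And>\<xi>. \<xi> \<in> \<Gamma> \<Longrightarrow> br \<zeta> \<xi> = br \<zeta>' \<xi>"
  shows "\<zeta> = \<zeta>'"
proof -
  have "(\<lambda>p. \<zeta> p - \<zeta>' p) = (\<lambda>p. 0)"
    by (rule centre_zero[OF \<Gamma>_diff[OF assms(1,2)]])
      (use assms in \<open>simp add: br_diff' \<Gamma>S\<close>)
  then show ?thesis by (simp add: fun_eq_iff)
qed

end

context smooth_mfd
begin

lemma vf_const: assumes "X \<in> VF" shows "X p (\<lambda>x. c) = 0"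
proof -
  have "X p (\<lambda>x. 1) = 0" using vf_prod[OF assms Cinf_const[of 1] Cinf_const[of 1], of p] by simp
  then show ?thesis using vf_lin[OF assms Cinf_const[of 1] Cinf_const[of 1], of p c 0] by simp
qed

lemma vf_bracket_comb_left:
  assumes "X \<in> VF" "Y \<in> VF" "Z \<in> VF" "f \<in> Cinf M" "g \<in> Cinf M"
  shows "vf_bracket M (\<lambda>p h. f p * Y p h + g p * Z p h) X =
    (\<lambda>p h. f p * vf_bracket M Y X p h + g p * vf_bracket M Z X p h - (X p f * Y p h + X p g * Z p h))"
  unfolding vf_bracket_anti[of "\<lambda>p h. f p * Y p h + g p * Z p h" X] vf_bracket_comb_right[OF assms]
    vf_bracket_anti[of Y X] vf_bracket_anti[of Z X] by (intro ext) simp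

lemma vf_bracket_zero_left: "X \<in> VF \<Longrightarrow> vf_bracket M (\<lambda>p h. 0) X = (\<lambda>p h. 0)"
  by (intro ext) (simp add: vf_bracket_def vf_const)

lemma vf_bracket_self: "vf_bracket M X X = (\<lambda>p h. 0)"
  by (intro ext) (simp add: vf_bracket_def)

end

section \<open>Forms with values in a bundle of ideals\<close>

lemma omit_simps: "omit 0 (x # xs) = xs" "omit (Suc i) (x # xs) = x # omit i xs"
  by (simp_all add: omit_def)

lemma length_omit: "i < length xs \<Longrightarrow> length (omit i xs) = length xs - 1"
  by (simp add: omit_def)

context ideal_bundle
begin

definition good :: "nat \<Rightarrow> 'm vfield list \<Rightarrow> bool" where
  "good q Xs \<longleftrightarrow> set Xs \<subseteq> VF \<and> length Xs = q"

lemma good_nth: "good q Xs \<Longrightarrow> i < q \<Longrightarrow> Xs ! i \<in> VF"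
  by (auto simp: good_def)

lemma good_update: "good q Xs \<Longrightarrow> X \<in> VF \<Longrightarrow> good q (Xs[i := X])"
  using set_update_subset_insert[of Xs i X] by (auto simp: good_def)

lemma good_Cons: "good (Suc q) (X # Xs) \<longleftrightarrow> X \<in> VF \<and> good q Xs"
  by (auto simp: good_def)

lemma forms_bad: "\<gamma> \<in> forms A K q \<Longrightarrow> \<not> good q Xs \<Longrightarrow> \<gamma> Xs = (\<lambda>p. 0)"
  unfolding forms_def good_def by blast

lemma forms_good:
  assumes "\<gamma> \<in> forms A K q" "good q Xs"
  shows "\<gamma> Xs \<in> \<Gamma>"
    and "i < q \<Longrightarrow> X \<in> VF \<Longrightarrow> Y \<in> VF \<Longrightarrow> f \<in> Cinf A \<Longrightarrow> g \<in> Cinf A \<Longrightarrow>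
      \<gamma> (Xs[i := (\<lambda>p h. f p * X p h + g p * Y p h)]) = (\<lambda>p. f p *\<^sub>R \<gamma> (Xs[i := X]) p + g p *\<^sub>R \<gamma> (Xs[i := Y]) p)"
    and "i < q \<Longrightarrow> j < q \<Longrightarrow> i \<noteq> j \<Longrightarrow> Xs ! i = Xs ! j \<Longrightarrow> \<gamma> Xs = (\<lambda>p. 0)"
proof -
  have *: "\<gamma> Xs \<in> \<Gamma> \<and>
        (\<forall>i<q. \<forall>X\<in>VF. \<forall>Y\<in>VF. \<forall>f\<in>Cinf A. \<forall>g\<in>Cinf A.
           \<gamma> (Xs[i := (\<lambda>p h. f p * X p h + g p * Y p h)])
             = (\<lambda>p. f p *\<^sub>R \<gamma> (Xs[i := X]) p + g p *\<^sub>R \<gamma> (Xs[i := Y]) p)) \<and>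
        (\<forall>i<q. \<forall>j<q. i \<noteq> j \<and> Xs ! i = Xs ! j \<longrightarrow> \<gamma> Xs = (\<lambda>p. 0))"
    using assms unfolding forms_def good_def by blast
  show "\<gamma> Xs \<in> \<Gamma>" using * by (rule conjunct1)
  show "\<gamma> (Xs[i := (\<lambda>p h. f p * X p h + g p * Y p h)]) = (\<lambda>p. f p *\<^sub>R \<gamma> (Xs[i := X]) p + g p *\<^sub>R \<gamma> (Xs[i := Y]) p)"
    if "i < q" "X \<in> VF" "Y \<in> VF" "f \<in> Cinf A" "g \<in> Cinf A"
    using that by (rule *[THEN conjunct2, THEN conjunct1, rule_format])
  show "\<gamma> Xs = (\<lambda>p. 0)" if "i < q" "j < q" "i \<noteq> j" "Xs ! i = Xs ! j"
    by (rule *[THEN conjunct2, THEN conjunct2, rule_format, OF that(1,2)]) (use that in simp)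
qed

lemma formsI:
  assumes "\<And>Xs. \<not> good q Xs \<Longrightarrow> \<gamma> Xs = (\<lambda>p. 0)"
    and "\<And>Xs. good q Xs \<Longrightarrow> \<gamma> Xs \<in> \<Gamma>"
    and "\<And>Xs i X Y f g. good q Xs \<Longrightarrow> i < q \<Longrightarrow> X \<in> VF \<Longrightarrow> Y \<in> VF \<Longrightarrow> f \<in> Cinf A \<Longrightarrow> g \<in> Cinf A \<Longrightarrow>
      \<gamma> (Xs[i := (\<lambda>p h. f p * X p h + g p * Y p h)]) = (\<lambda>p. f p *\<^sub>R \<gamma> (Xs[i := X]) p + g p *\<^sub>R \<gamma> (Xs[i := Y]) p)"
    and "\<And>Xs i j. good q Xs \<Longrightarrow> i < q \<Longrightarrow> j < q \<Longrightarrow> i \<noteq> j \<Longrightarrow> Xs ! i = Xs ! j \<Longrightarrow> \<gamma> Xs = (\<lambda>p. 0)"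
  shows "\<gamma> \<in> forms A K q"
  unfolding forms_def
proof (intro CollectI conjI allI impI ballI)
  fix Xs assume g: "set Xs \<subseteq> VF \<and> length Xs = q"
  then have g': "good q Xs" by (simp add: good_def)
  show "\<gamma> Xs \<in> \<Gamma>" by (rule assms(2)[OF g'])
  show "\<gamma> (Xs[i := (\<lambda>p h. f p * X p h + g p * Y p h)]) = (\<lambda>p. f p *\<^sub>R \<gamma> (Xs[i := X]) p + g p *\<^sub>R \<gamma> (Xs[i := Y]) p)"
    if "i < q" "X \<in> VF" "Y \<in> VF" "f \<in> Cinf A" "g \<in> Cinf A" for i X Y f g
    by (rule assms(3)[OF g' that])
  show "\<gamma> Xs = (\<lambda>p. 0)" if "i < q" "j < q" "i \<noteq> j \<and> Xs ! i = Xs ! j" for i j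
    by (rule assms(4)[OF g' that(1,2)]) (use that in auto)
qed (use assms(1) in \<open>auto simp: good_def\<close>)

lemma forms_\<Gamma>: "\<gamma> \<in> forms A K q \<Longrightarrow> \<gamma> Xs \<in> \<Gamma>"
  using forms_good(1)[of \<gamma> q Xs] forms_bad[of \<gamma> q Xs] \<Gamma>_zero by (cases "good q Xs") auto

lemma forms_add:
  assumes "\<gamma> \<in> forms A K q" "good q Xs" "i < q" "X \<in> VF" "Y \<in> VF"
  shows "\<gamma> (Xs[i := (\<lambda>p h. X p h + Y p h)]) p = \<gamma> (Xs[i := X]) p + \<gamma> (Xs[i := Y]) p"
  using forms_good(2)[OF assms Cinf_const[of 1] Cinf_const[of 1]] by simp

lemma forms_diff:
  assumes "\<gamma> \<in> forms A K q" "good q Xs" "i < q" "X \<in> VF" "Y \<in> VF"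
  shows "\<gamma> (Xs[i := (\<lambda>p h. X p h - Y p h)]) p = \<gamma> (Xs[i := X]) p - \<gamma> (Xs[i := Y]) p"
  using forms_good(2)[OF assms Cinf_const[of 1] Cinf_const[of "-1"]] by simp

lemma forms_zero:
  assumes "\<gamma> \<in> forms A K q" "good q Xs" "i < q"
  shows "\<gamma> (Xs[i := (\<lambda>p h. 0)]) = (\<lambda>p. 0)"
  using forms_good(2)[OF assms vf_zero vf_zero Cinf_const[of 0] Cinf_const[of 0]] by simp

text \<open>Polarisation: expand the vanishing value with the sum of \<open>X\<close> and
  \<open>Y\<close> in both slots.\<close>

lemma forms_swap:
  assumes \<gamma>: "\<gamma> \<in> forms A K q" and Xs: "good q Xs" and ij: "i < q" "j < q" "i \<noteq> j" and X: "X \<in> VF" and Y: "Y \<in> VF"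
  shows "\<gamma> (Xs[i := X, j := Y]) p = - \<gamma> (Xs[i := Y, j := X]) p"
proof -
  let ?Z = "\<lambda>p h. X p h + Y p h"
  have Z: "?Z \<in> VF" using vf_comb[OF Cinf_const[of 1] Cinf_const[of 1] X Y] by simp
  have len: "length Xs = q" using Xs by (simp add: good_def)
  have same: "\<gamma> (Xs[i := V, j := V]) p = 0" if "V \<in> VF" for V
    using forms_good(3)[OF \<gamma> good_update[OF good_update[OF Xs that] that] ij] ij len by simp
  have l: "\<gamma> (Xs[i := U, j := ?Z]) p = \<gamma> (Xs[i := U, j := X]) p + \<gamma> (Xs[i := U, j := Y]) p" if "U \<in> VF" for U
    by (rule forms_add[OF \<gamma> good_update[OF Xs that] ij(2) X Y])
  have r: "\<gamma> (Xs[i := ?Z, j := U]) p = \<gamma> (Xs[i := X, j := U]) p + \<gamma> (Xs[i := Y, j := U]) p" if "U \<in> VF" for U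
    using forms_add[OF \<gamma> good_update[OF Xs that] ij(1) X Y, of j] ij(3) by (simp add: list_update_swap)
  have "0 = \<gamma> (Xs[i := ?Z, j := ?Z]) p" using same[OF Z] by simp
  also have "\<dots> = \<gamma> (Xs[i := X, j := X]) p + \<gamma> (Xs[i := X, j := Y]) p + (\<gamma> (Xs[i := Y, j := X]) p + \<gamma> (Xs[i := Y, j := Y]) p)"
    by (simp add: r[OF Z] l[OF X] l[OF Y])
  finally show ?thesis using same[OF X] same[OF Y] by (simp add: eq_neg_iff_add_eq_0)
qed

text \<open>Adjacent swaps carry the new entry to the front, each costing a sign. In this way the
  correction terms of a Lie derivative acquire the signs of \<open>d_wedge\<close>.\<close>

lemma forms_move:
  assumes \<gamma>: "\<gamma> \<in> forms A K q" and Xs: "good q Xs" and j: "j < q" and X: "X \<in> VF"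
  shows "\<gamma> (Xs[j := X]) p = (-1) ^ j *\<^sub>R \<gamma> (X # omit j Xs) p"
  using j Xs
proof (induction j arbitrary: Xs)
  case 0
  then obtain Y Ys where "Xs = Y # Ys" by (cases Xs) (auto simp: good_def)
  then show ?case by (simp add: omit_simps)
next
  case (Suc j)
  have len: "length Xs = q" using Suc.prems by (simp add: good_def)
  let ?Ys = "Xs[Suc j := Xs ! j]"
  have Xj: "Xs ! j \<in> VF" using good_nth[OF Suc.prems(2)] Suc.prems(1) by simp
  have "\<gamma> (Xs[Suc j := X]) p = \<gamma> (Xs[j := Xs ! j, Suc j := X]) p" by simp
  also have "\<dots> = - \<gamma> (Xs[j := X, Suc j := Xs ! j]) p"
    using Suc.prems by (intro forms_swap[OF \<gamma> Suc.prems(2) _ _ _ Xj X]) auto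
  also have "Xs[j := X, Suc j := Xs ! j] = ?Ys[j := X]" by (simp add: list_update_swap)
  also have "\<gamma> \<dots> p = (-1) ^ j *\<^sub>R \<gamma> (X # omit j ?Ys) p"
    using Suc.prems by (intro Suc.IH good_update Xj) auto
  also have "omit j ?Ys = omit (Suc j) Xs"
    using Suc.prems(1) len
    by (simp add: omit_def drop_update_cancel drop_update_swap[of _ "Suc j"] Cons_nth_drop_Suc[symmetric] take_Suc_conv_app_nth)
  finally show ?case by simp
qed

lemma zero_forms: "zero_form \<in> forms A K q"
  by (rule formsI) (auto simp: zero_form_def \<Gamma>_zero)

lemma forms_pred_\<Gamma>: "\<gamma> \<in> forms_pred A K q \<Longrightarrow> \<gamma> Xs \<in> \<Gamma>"
  using forms_\<Gamma> zero_forms by (auto simp: forms_pred_def split: nat.splits)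

lemma forms_pred_bad: "\<gamma> \<in> forms_pred A K q \<Longrightarrow> \<not> (set Xs \<subseteq> VF \<and> Suc (length Xs) = q) \<Longrightarrow> \<gamma> Xs = (\<lambda>p. 0)"
  using forms_bad[of \<gamma> _ Xs] by (auto simp: forms_pred_def zero_form_def good_def split: nat.splits)

lemma contract_forms:
  assumes \<gamma>: "\<gamma> \<in> forms A K q" and Z: "Z \<in> VF"
  shows "contract Z \<gamma> \<in> forms_pred A K q"
proof (cases q)
  case 0
  then show ?thesis using forms_bad[OF \<gamma>] by (auto simp: forms_pred_def zero_form_def contract_def good_def)
next
  case (Suc m)
  have g: "good q (Z # Xs)" if "good m Xs" for Xs using that Z by (simp add: Suc good_Cons)
  have "contract Z \<gamma> \<in> forms A K m"
  proof (rule formsI)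
    show "contract Z \<gamma> Xs = (\<lambda>p. 0)" if "\<not> good m Xs" for Xs
      unfolding contract_def by (rule forms_bad[OF \<gamma>]) (use that in \<open>simp add: Suc good_Cons\<close>)
    show "contract Z \<gamma> Xs \<in> \<Gamma>" for Xs unfolding contract_def by (rule forms_\<Gamma>[OF \<gamma>])
    show "contract Z \<gamma> (Xs[i := (\<lambda>p h. f p * X p h + k p * Y p h)]) =
        (\<lambda>p. f p *\<^sub>R contract Z \<gamma> (Xs[i := X]) p + k p *\<^sub>R contract Z \<gamma> (Xs[i := Y]) p)"
      if "good m Xs" "i < m" "X \<in> VF" "Y \<in> VF" "f \<in> Cinf A" "k \<in> Cinf A" for Xs i X Y f k
      using forms_good(2)[OF \<gamma> g[OF that(1)], of "Suc i", OF _ that(3-6)] that(2) by (simp add: contract_def Suc)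
    show "contract Z \<gamma> Xs = (\<lambda>p. 0)" if "good m Xs" "i < m" "j < m" "i \<noteq> j" "Xs ! i = Xs ! j" for Xs i j
      using forms_good(3)[OF \<gamma> g[OF that(1)], of "Suc i" "Suc j"] that(2-5) by (simp add: contract_def Suc)
  qed
  then show ?thesis by (simp add: forms_pred_def Suc)
qed

abbreviation "L \<alpha> X \<equiv> vf_bracket A (rho A \<alpha>) X"

lemma L_VF: "\<alpha> \<in> S \<Longrightarrow> X \<in> VF \<Longrightarrow> L \<alpha> X \<in> VF"
  by (rule vf_bracket_vf[OF rho_VF])

lemma lie_der_good:
  assumes "set Xs \<subseteq> VF"
  shows "lie_der A \<alpha> \<gamma> Xs = (\<lambda>p. br \<alpha> (\<gamma> Xs) p - (\<Sum>j<length Xs. \<gamma> (Xs[j := L \<alpha> (Xs ! j)]) p))"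
  using assms by (intro ext) (simp add: lie_der_def)

lemma lie_der_bad:
  assumes \<gamma>: "\<gamma> \<in> forms A K q" and \<alpha>: "\<alpha> \<in> S" and Xs: "\<not> good q Xs"
  shows "lie_der A \<alpha> \<gamma> Xs = (\<lambda>p. 0)"
proof (cases "set Xs \<subseteq> VF")
  case True
  then have "length Xs \<noteq> q" using Xs by (simp add: good_def)
  then have "\<gamma> Ys = (\<lambda>p. 0)" if "length Ys = length Xs" for Ys
    using that by (intro forms_bad[OF \<gamma>]) (simp add: good_def)
  then show ?thesis using True br_zero[OF \<alpha>] by (simp add: lie_der_good)
qed (auto simp: lie_der_def)

text \<open>The anchor kills \<open>K\<close>, so all terms that change an argument drop out. Thanks
  to this, the IM equations turn into identities between brackets when tested on sections of
  \<open>K\<close>.\<close>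

lemma lie_der_\<Gamma>_section:
  assumes \<gamma>: "\<gamma> \<in> forms A K q" and \<xi>: "\<xi> \<in> \<Gamma>" and Xs: "good q Xs"
  shows "lie_der A \<xi> \<gamma> Xs = br \<xi> (\<gamma> Xs)"
proof -
  have len: "length Xs = q" "set Xs \<subseteq> VF" using Xs by (auto simp: good_def)
  have "\<gamma> (Xs[j := L \<xi> (Xs ! j)]) = (\<lambda>p. 0)" if "j < q" for j
    unfolding rho_\<Gamma>[OF \<xi>] vf_bracket_zero_left[OF good_nth[OF Xs that]] by (rule forms_zero[OF \<gamma> Xs that])
  then show ?thesis using len by (simp add: lie_der_good)
qed

lemma lie_der_in_\<Gamma>:
  assumes \<gamma>: "\<gamma> \<in> forms A K q" and \<alpha>: "\<alpha> \<in> S"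
  shows "lie_der A \<alpha> \<gamma> Xs \<in> \<Gamma>"
proof (cases "set Xs \<subseteq> VF")
  case True
  then show ?thesis unfolding lie_der_good[OF True]
    by (intro \<Gamma>_diff br_\<Gamma>[OF \<alpha>] \<Gamma>_sum forms_\<Gamma>[OF \<gamma>]) auto
next
  case False
  then show ?thesis using \<Gamma>_zero by (simp add: lie_der_def)
qed

text \<open>For linearity, the derivatives of the coefficients coming from the bracket of sections
  cancel those coming from the bracket of vector fields in the same slot. For alternation, only the
  two terms that change one of the equal arguments survive, and they are opposite.\<close>

lemma lie_der_forms:
  assumes \<gamma>: "\<gamma> \<in> forms A K q" and \<alpha>: "\<alpha> \<in> S"
  shows "lie_der A \<alpha> \<gamma> \<in> forms A K q"
proof (rule formsI)
  show "lie_der A \<alpha> \<gamma> Xs = (\<lambda>p. 0)" if "\<not> good q Xs" for Xs by (rule lie_der_bad[OF \<gamma> \<alpha> that])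
  show "lie_der A \<alpha> \<gamma> Xs \<in> \<Gamma>" for Xs by (rule lie_der_in_\<Gamma>[OF \<gamma> \<alpha>])
next
  fix Xs i X Y f g
  assume Xs: "good q Xs" and i: "i < q" and X: "X \<in> VF" and Y: "Y \<in> VF" and f: "f \<in> Cinf A" and g: "g \<in> Cinf A"
  let ?Z = "\<lambda>p h. f p * X p h + g p * Y p h" and ?a = "rho A \<alpha>"
  have Z: "?Z \<in> VF" by (rule vf_comb[OF f g X Y])
  have len: "length Xs = q" using Xs by (simp add: good_def)
  have split: "(\<Sum>j<q. \<gamma> (Xs[i := V, j := L \<alpha> (Xs[i := V] ! j)]) p) =
      \<gamma> (Xs[i := L \<alpha> V]) p + (\<Sum>j\<in>{..<q} - {i}. \<gamma> (Xs[j := L \<alpha> (Xs ! j), i := V]) p)" for V p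
  proof -
    have "(\<Sum>j<q. \<gamma> (Xs[i := V, j := L \<alpha> (Xs[i := V] ! j)]) p) = \<gamma> (Xs[i := V, i := L \<alpha> (Xs[i := V] ! i)]) p
       + (\<Sum>j\<in>{..<q} - {i}. \<gamma> (Xs[i := V, j := L \<alpha> (Xs[i := V] ! j)]) p)"
      using i by (intro sum.remove) auto
    also have "\<gamma> (Xs[i := V, i := L \<alpha> (Xs[i := V] ! i)]) p = \<gamma> (Xs[i := L \<alpha> V]) p" using i len by simp
    also have "(\<Sum>j\<in>{..<q} - {i}. \<gamma> (Xs[i := V, j := L \<alpha> (Xs[i := V] ! j)]) p) =
       (\<Sum>j\<in>{..<q} - {i}. \<gamma> (Xs[j := L \<alpha> (Xs ! j), i := V]) p)"
      by (rule sum.cong) (auto simp: list_update_swap)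
    finally show ?thesis .
  qed
  have ld: "lie_der A \<alpha> \<gamma> (Xs[i := V]) p = br \<alpha> (\<gamma> (Xs[i := V])) p - \<gamma> (Xs[i := L \<alpha> V]) p
      - (\<Sum>j\<in>{..<q} - {i}. \<gamma> (Xs[j := L \<alpha> (Xs ! j), i := V]) p)" if "V \<in> VF" for V p
    using good_update[OF Xs that, of i] split[of V p] len by (simp add: lie_der_good good_def)
  have rest: "\<gamma> (Xs[j := L \<alpha> (Xs ! j), i := ?Z]) p =
      f p *\<^sub>R \<gamma> (Xs[j := L \<alpha> (Xs ! j), i := X]) p + g p *\<^sub>R \<gamma> (Xs[j := L \<alpha> (Xs ! j), i := Y]) p" if "j < q" for j p
    using forms_good(2)[OF \<gamma> good_update[OF Xs L_VF[OF \<alpha> good_nth[OF Xs that]]] i X Y f g] by simp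
  have main: "\<gamma> (Xs[i := L \<alpha> ?Z]) p = f p *\<^sub>R \<gamma> (Xs[i := L \<alpha> X]) p + g p *\<^sub>R \<gamma> (Xs[i := L \<alpha> Y]) p
      + (?a p f *\<^sub>R \<gamma> (Xs[i := X]) p + ?a p g *\<^sub>R \<gamma> (Xs[i := Y]) p)" for p
  proof -
    have af: "(\<lambda>p. ?a p f) \<in> Cinf A" "(\<lambda>p. ?a p g) \<in> Cinf A"
      using vf_Cinf[OF rho_VF[OF \<alpha>] f] vf_Cinf[OF rho_VF[OF \<alpha>] g] .
    show ?thesis
      unfolding vf_bracket_comb_right[OF rho_VF[OF \<alpha>] X Y f g]
      using forms_add[OF \<gamma> Xs i vf_comb[OF f g L_VF[OF \<alpha> X] L_VF[OF \<alpha> Y]] vf_comb[OF af X Y], of p]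
        forms_good(2)[OF \<gamma> Xs i L_VF[OF \<alpha> X] L_VF[OF \<alpha> Y] f g] forms_good(2)[OF \<gamma> Xs i X Y af] by simp
  qed
  have brZ: "br \<alpha> (\<gamma> (Xs[i := ?Z])) p = f p *\<^sub>R br \<alpha> (\<gamma> (Xs[i := X])) p + g p *\<^sub>R br \<alpha> (\<gamma> (Xs[i := Y])) p
      + (?a p f *\<^sub>R \<gamma> (Xs[i := X]) p + ?a p g *\<^sub>R \<gamma> (Xs[i := Y]) p)" for p
    unfolding forms_good(2)[OF \<gamma> Xs i X Y f g]
    using br_comb_right[OF \<alpha> \<Gamma>S[OF forms_\<Gamma>[OF \<gamma>]] \<Gamma>S[OF forms_\<Gamma>[OF \<gamma>]] f g] by simp
  show "lie_der A \<alpha> \<gamma> (Xs[i := ?Z]) = (\<lambda>p. f p *\<^sub>R lie_der A \<alpha> \<gamma> (Xs[i := X]) p + g p *\<^sub>R lie_der A \<alpha> \<gamma> (Xs[i := Y]) p)"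
    unfolding ld[OF Z] ld[OF X] ld[OF Y] brZ main
    by (simp add: rest sum.distrib scaleR_sum_right algebra_simps)
next
  fix Xs a b
  assume Xs: "good q Xs" and ab: "a < q" "b < q" "a \<noteq> b" and eq: "Xs ! a = Xs ! b"
  have len: "length Xs = q" "set Xs \<subseteq> VF" using Xs by (auto simp: good_def)
  have "(\<Sum>j<q. \<gamma> (Xs[j := L \<alpha> (Xs ! j)]) p) = 0" for p
  proof -
    let ?t = "\<lambda>j. \<gamma> (Xs[j := L \<alpha> (Xs ! j)]) p" and ?X = "Xs ! a"
    have "(\<Sum>j<q. ?t j) = (\<Sum>j\<in>{a, b}. ?t j)"
    proof (rule sum.mono_neutral_right)
      show "\<forall>j\<in>{..<q} - {a, b}. ?t j = 0"
      proof
        fix j assume j: "j \<in> {..<q} - {a, b}"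
        then have "L \<alpha> (Xs ! j) \<in> VF" using L_VF[OF \<alpha> good_nth[OF Xs]] by simp
        from forms_good(3)[OF \<gamma> good_update[OF Xs this, of j] ab] show "?t j = 0" using j eq by simp
      qed
    qed (use ab in auto)
    also have "\<dots> = ?t a + ?t b" using ab by simp
    also have "?t a = \<gamma> (Xs[a := L \<alpha> ?X, b := ?X]) p" using eq ab(3) by (simp add: list_update_swap)
    also have "\<dots> = - \<gamma> (Xs[a := ?X, b := L \<alpha> ?X]) p"
      by (rule forms_swap[OF \<gamma> Xs ab L_VF[OF \<alpha>]]) (use good_nth[OF Xs ab(1)] in auto)
    also have "Xs[a := ?X, b := L \<alpha> ?X] = Xs[b := L \<alpha> (Xs ! b)]" by (simp only: list_update_id eq[symmetric])
    finally show ?thesis by simp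
  qed
  then show "lie_der A \<alpha> \<gamma> Xs = (\<lambda>p. 0)"
    using forms_good(3)[OF \<gamma> Xs ab eq] br_zero[OF \<alpha>] len by (simp add: lie_der_good)
qed

lemma d_wedge_good:
  "set Xs \<subseteq> VF \<Longrightarrow> d_wedge A f \<gamma> Xs p = (\<Sum>i<length Xs. ((-1) ^ i * (Xs ! i) p f) *\<^sub>R \<gamma> (omit i Xs) p)"
  by (simp add: d_wedge_def)

text \<open>The bracket of a multiple of \<rho>(\<alpha>) with a field X has the extra term -X(f)
  \<rho>(\<alpha>). Moving \<rho>(\<alpha>) to the front of the argument list assembles these terms
  into the wedge of df with a contraction.\<close>

lemma lie_der_comb:
  assumes \<gamma>: "\<gamma> \<in> forms A K q" and \<alpha>: "\<alpha> \<in> S" and \<beta>: "\<beta> \<in> S" and f: "f \<in> Cinf A" and g: "g \<in> Cinf A"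
  shows "lie_der A (\<lambda>p. f p *\<^sub>R \<alpha> p + g p *\<^sub>R \<beta> p) \<gamma> Xs p =
    f p *\<^sub>R lie_der A \<alpha> \<gamma> Xs p + g p *\<^sub>R lie_der A \<beta> \<gamma> Xs p
    + (d_wedge A f (contract (rho A \<alpha>) \<gamma>) Xs p + d_wedge A g (contract (rho A \<beta>) \<gamma>) Xs p)"
proof (cases "good q Xs")
  case Xs: True
  let ?a = "rho A \<alpha>" and ?b = "rho A \<beta>" and ?c = "\<lambda>p. f p *\<^sub>R \<alpha> p + g p *\<^sub>R \<beta> p"
  have len: "length Xs = q" "set Xs \<subseteq> VF" using Xs by (auto simp: good_def)
  have trm: "\<gamma> (Xs[j := L ?c (Xs ! j)]) p = f p *\<^sub>R \<gamma> (Xs[j := L \<alpha> (Xs ! j)]) p + g p *\<^sub>R \<gamma> (Xs[j := L \<beta> (Xs ! j)]) p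
      - (((-1) ^ j * (Xs ! j) p f) *\<^sub>R \<gamma> (?a # omit j Xs) p + ((-1) ^ j * (Xs ! j) p g) *\<^sub>R \<gamma> (?b # omit j Xs) p)"
    if j: "j < q" for j
  proof -
    let ?X = "Xs ! j"
    have X: "?X \<in> VF" by (rule good_nth[OF Xs j])
    note a = rho_VF[OF \<alpha>] and b = rho_VF[OF \<beta>]
    have Xf: "(\<lambda>p. ?X p f) \<in> Cinf A" "(\<lambda>p. ?X p g) \<in> Cinf A" using vf_Cinf[OF X f] vf_Cinf[OF X g] .
    have 1: "\<gamma> (Xs[j := L ?c ?X]) p = \<gamma> (Xs[j := (\<lambda>p h. f p * L \<alpha> ?X p h + g p * L \<beta> ?X p h)]) p
       - \<gamma> (Xs[j := (\<lambda>p h. ?X p f * ?a p h + ?X p g * ?b p h)]) p"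
      unfolding rho_comb[OF \<alpha> \<beta>] vf_bracket_comb_left[OF X a b f g]
      by (rule forms_diff[OF \<gamma> Xs j vf_comb[OF f g L_VF[OF \<alpha> X] L_VF[OF \<beta> X]] vf_comb[OF Xf a b]])
    show ?thesis
      unfolding 1 forms_good(2)[OF \<gamma> Xs j L_VF[OF \<alpha> X] L_VF[OF \<beta> X] f g] forms_good(2)[OF \<gamma> Xs j a b Xf]
        forms_move[OF \<gamma> Xs j a] forms_move[OF \<gamma> Xs j b] by (simp add: mult.commute)
  qed
  have "br ?c (\<gamma> Xs) p = f p *\<^sub>R br \<alpha> (\<gamma> Xs) p + g p *\<^sub>R br \<beta> (\<gamma> Xs) p"
    using br_\<Gamma>_comb_left[OF forms_\<Gamma>[OF \<gamma>] \<alpha> \<beta> f g] by simp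
  then show ?thesis
    using len by (simp add: lie_der_good d_wedge_good trm contract_def sum.distrib sum_subtractf scaleR_sum_right algebra_simps)
next
  case False
  have "d_wedge A f (contract (rho A \<alpha>) \<gamma>) Xs p = 0" for f \<alpha>
  proof (cases "set Xs \<subseteq> VF")
    case True
    then have "length Xs \<noteq> q" using False by (simp add: good_def)
    then have "\<gamma> (rho A \<alpha> # omit i Xs) = (\<lambda>p. 0)" if "i < length Xs" for i
      using length_omit[OF that] that by (intro forms_bad[OF \<gamma>]) (auto simp: good_def)
    then show ?thesis using True by (simp add: d_wedge_good contract_def)
  qed (simp add: d_wedge_def)
  then show ?thesis
    using lie_der_bad[OF \<gamma> \<alpha> False] lie_der_bad[OF \<gamma> \<beta> False] lie_der_bad[OF \<gamma> S_comb[OF f g \<alpha> \<beta>] False] by simp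
qed

lemma d_wedge_const: "d_wedge A (\<lambda>x. c) \<gamma> Xs p = 0"
proof (cases "set Xs \<subseteq> VF")
  case True
  have "(Xs ! i) p (\<lambda>x. c) = 0" if "i < length Xs" for i
    by (rule vf_const[OF subsetD[OF True nth_mem[OF that]]])
  then show ?thesis unfolding d_wedge_good[OF True] by (intro sum.neutral) simp
qed (simp add: d_wedge_def)

lemma br_sum:
  assumes "\<delta> \<in> S" "finite J" "\<And>j. s j \<in> \<Gamma>"
  shows "br \<delta> (\<lambda>p. \<Sum>j\<in>J. s j p) = (\<lambda>p. \<Sum>j\<in>J. br \<delta> (s j) p)"
  using assms(2)
proof (induction J rule: finite_induct)
  case (insert j J)
  then show ?case using br_add[OF assms(1) \<Gamma>S[OF assms(3)] \<Gamma>S[OF \<Gamma>_sum[OF insert(1) assms(3)]]] by simp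
qed (simp add: br_zero[OF assms(1)])

lemma br_lie_der:
  assumes \<gamma>: "\<gamma> \<in> forms A K q" and \<alpha>: "\<alpha> \<in> S" and \<delta>: "\<delta> \<in> S" and Xs: "set Xs \<subseteq> VF"
  shows "br \<delta> (lie_der A \<alpha> \<gamma> Xs) =
    (\<lambda>p. br \<delta> (br \<alpha> (\<gamma> Xs)) p - (\<Sum>j<length Xs. br \<delta> (\<gamma> (Xs[j := L \<alpha> (Xs ! j)])) p))"
  unfolding lie_der_good[OF Xs]
  using br_diff[OF \<delta> br_S[OF \<alpha> \<Gamma>S[OF forms_\<Gamma>[OF \<gamma>]]] \<Gamma>S[OF \<Gamma>_sum], of "{..<length Xs}" "\<lambda>j. \<gamma> (Xs[j := L \<alpha> (Xs ! j)])"]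
    br_sum[OF \<delta>, of "{..<length Xs}" "\<lambda>j. \<gamma> (Xs[j := L \<alpha> (Xs ! j)])"] forms_\<Gamma>[OF \<gamma>] by simp

text \<open>Terms that change two different arguments are symmetric and cancel. Those that change
  one argument twice combine by the Jacobi identity for vector fields, and the remaining ones by the
  Jacobi identity for sections.\<close>

lemma lie_der_bracket:
  assumes \<gamma>: "\<gamma> \<in> forms A K q" and \<alpha>: "\<alpha> \<in> S" and \<beta>: "\<beta> \<in> S"
  shows "lie_der A (br \<alpha> \<beta>) \<gamma> Xs p = lie_der A \<alpha> (lie_der A \<beta> \<gamma>) Xs p - lie_der A \<beta> (lie_der A \<alpha> \<gamma>) Xs p"
proof (cases "good q Xs")
  case False
  then show ?thesis
    using lie_der_bad[OF lie_der_forms[OF \<gamma> \<beta>] \<alpha> False] lie_der_bad[OF lie_der_forms[OF \<gamma> \<alpha>] \<beta> False]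
      lie_der_bad[OF \<gamma> br_S[OF \<alpha> \<beta>] False] by simp
next
  case Xs: True
  have len: "length Xs = q" "set Xs \<subseteq> VF" using Xs by (auto simp: good_def)
  note \<gamma>S = \<Gamma>S[OF forms_\<Gamma>[OF \<gamma>]]
  \<comment> \<open>The second entry is looked up in the updated list, so that for equal indices the
    same argument is changed twice.\<close>
  define D where "D \<alpha> \<beta> i j = \<gamma> (Xs[i := L \<alpha> (Xs ! i), j := L \<beta> (Xs[i := L \<alpha> (Xs ! i)] ! j)]) p" for \<alpha> \<beta> i j
  have expand: "lie_der A \<alpha> (lie_der A \<beta> \<gamma>) Xs p = br \<alpha> (br \<beta> (\<gamma> Xs)) p
      - (\<Sum>j<q. br \<alpha> (\<gamma> (Xs[j := L \<beta> (Xs ! j)])) p) - (\<Sum>i<q. br \<beta> (\<gamma> (Xs[i := L \<alpha> (Xs ! i)])) p)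
      + (\<Sum>i<q. \<Sum>j<q. D \<alpha> \<beta> i j)" if \<alpha>: "\<alpha> \<in> S" and \<beta>: "\<beta> \<in> S" for \<alpha> \<beta>
  proof -
    have 1: "br \<alpha> (lie_der A \<beta> \<gamma> Xs) p = br \<alpha> (br \<beta> (\<gamma> Xs)) p - (\<Sum>j<q. br \<alpha> (\<gamma> (Xs[j := L \<beta> (Xs ! j)])) p)"
      using br_lie_der[OF \<gamma> \<beta> \<alpha> len(2)] len by simp
    have 2: "lie_der A \<beta> \<gamma> (Xs[i := L \<alpha> (Xs ! i)]) p = br \<beta> (\<gamma> (Xs[i := L \<alpha> (Xs ! i)])) p - (\<Sum>j<q. D \<alpha> \<beta> i j)"
      if "i < q" for i
      using good_update[OF Xs L_VF[OF \<alpha> good_nth[OF Xs that]], of i] len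
      by (simp add: lie_der_good good_def D_def)
    show ?thesis
      unfolding lie_der_good[OF len(2), of \<alpha> "lie_der A \<beta> \<gamma>"] 1 len(1) by (simp add: 2 sum_subtractf)
  qed
  have sym: "D \<alpha> \<beta> i j - D \<beta> \<alpha> j i = (if i = j then - \<gamma> (Xs[i := L (br \<alpha> \<beta>) (Xs ! i)]) p else 0)"
    if i: "i < q" and j: "j < q" for i j
  proof (cases "i = j")
    case False
    then show ?thesis by (simp add: D_def list_update_swap)
  next
    case True
    let ?X = "Xs ! i"
    have X: "?X \<in> VF" by (rule good_nth[OF Xs i])
    have "L (br \<alpha> \<beta>) ?X = (\<lambda>p h. L \<alpha> (L \<beta> ?X) p h - L \<beta> (L \<alpha> ?X) p h)"
      unfolding anchor_bracket[OF \<alpha> \<beta>]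
      using vf_bracket_jacobi[OF rho_VF[OF \<alpha>] rho_VF[OF \<beta>] X] by (intro ext) simp
    then have "\<gamma> (Xs[i := L (br \<alpha> \<beta>) ?X]) p = \<gamma> (Xs[i := L \<alpha> (L \<beta> ?X)]) p - \<gamma> (Xs[i := L \<beta> (L \<alpha> ?X)]) p"
      using forms_diff[OF \<gamma> Xs i L_VF[OF \<alpha> L_VF[OF \<beta> X]] L_VF[OF \<beta> L_VF[OF \<alpha> X]], of p] by simp
    then show ?thesis using True i len by (simp add: D_def)
  qed
  have "(\<Sum>i<q. \<Sum>j<q. D \<alpha> \<beta> i j) - (\<Sum>i<q. \<Sum>j<q. D \<beta> \<alpha> i j) = (\<Sum>i<q. \<Sum>j<q. D \<alpha> \<beta> i j - D \<beta> \<alpha> j i)"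
    by (subst (2) sum.swap) (simp add: sum_subtractf)
  also have "\<dots> = (\<Sum>i<q. \<Sum>j<q. if i = j then - \<gamma> (Xs[i := L (br \<alpha> \<beta>) (Xs ! i)]) p else 0)"
    by (intro sum.cong refl sym) auto
  also have "\<dots> = - (\<Sum>i<q. \<gamma> (Xs[i := L (br \<alpha> \<beta>) (Xs ! i)]) p)"
    by (simp add: sum_negf)
  finally have DD: "(\<Sum>i<q. \<Sum>j<q. D \<alpha> \<beta> i j) - (\<Sum>i<q. \<Sum>j<q. D \<beta> \<alpha> i j) =
      - (\<Sum>i<q. \<gamma> (Xs[i := L (br \<alpha> \<beta>) (Xs ! i)]) p)" .
  have jac: "br \<alpha> (br \<beta> (\<gamma> Xs)) p = br (br \<alpha> \<beta>) (\<gamma> Xs) p + br \<beta> (br \<alpha> (\<gamma> Xs)) p"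
    using br_jacobi[OF \<alpha> \<beta> \<gamma>S] by simp
  have "lie_der A (br \<alpha> \<beta>) \<gamma> Xs p = br (br \<alpha> \<beta>) (\<gamma> Xs) p - (\<Sum>i<q. \<gamma> (Xs[i := L (br \<alpha> \<beta>) (Xs ! i)]) p)"
    using len by (simp add: lie_der_good)
  also have "\<dots> = br (br \<alpha> \<beta>) (\<gamma> Xs) p + ((\<Sum>i<q. \<Sum>j<q. D \<alpha> \<beta> i j) - (\<Sum>i<q. \<Sum>j<q. D \<beta> \<alpha> i j))"
    unfolding DD by simp
  finally show ?thesis unfolding expand[OF \<alpha> \<beta>] expand[OF \<beta> \<alpha>] jac by simp
qed

text \<open>In the Lie derivative of \<gamma> with \<rho>(\<beta>) as first argument, the term that
  changes this argument is the contraction with [\<rho>(\<alpha>), \<rho>(\<beta>)], which is the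
  anchor of [\<alpha>, \<beta>].\<close>

lemma lie_der_contract:
  assumes \<gamma>: "\<gamma> \<in> forms A K q" and \<alpha>: "\<alpha> \<in> S" and \<beta>: "\<beta> \<in> S"
  shows "contract (rho A (br \<alpha> \<beta>)) \<gamma> Xs p =
    lie_der A \<alpha> (contract (rho A \<beta>) \<gamma>) Xs p - contract (rho A \<beta>) (lie_der A \<alpha> \<gamma>) Xs p"
proof (cases "set Xs \<subseteq> VF")
  case True
  then have t: "set (rho A \<beta> # Xs) \<subseteq> VF" using rho_VF[OF \<beta>] by simp
  show ?thesis
    unfolding contract_def lie_der_good[OF t] anchor_bracket[OF \<alpha> \<beta>]
    unfolding lie_der_good[OF True] length_Cons sum.lessThan_Suc_shift by simp
next
  case False
  then show ?thesis
    using forms_bad[OF \<gamma>, of "rho A (br \<alpha> \<beta>) # Xs"] by (simp add: contract_def lie_der_def good_def)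
qed

lemma W1I:
  assumes "\<And>\<alpha>. \<alpha> \<notin> S \<Longrightarrow> c0 \<alpha> = zero_form" "\<And>\<alpha>. \<alpha> \<notin> S \<Longrightarrow> c1 \<alpha> = zero_form"
    "\<And>\<alpha>. \<alpha> \<in> S \<Longrightarrow> c0 \<alpha> \<in> forms A K q" "\<And>\<alpha>. \<alpha> \<in> S \<Longrightarrow> c1 \<alpha> \<in> forms_pred A K q"
    "\<And>\<alpha> \<beta> a b Xs p. \<alpha> \<in> S \<Longrightarrow> \<beta> \<in> S \<Longrightarrow>
      c0 (\<lambda>p. a *\<^sub>R \<alpha> p + b *\<^sub>R \<beta> p) Xs p = a *\<^sub>R c0 \<alpha> Xs p + b *\<^sub>R c0 \<beta> Xs p"
    "\<And>\<alpha> \<beta> f g Xs p. \<alpha> \<in> S \<Longrightarrow> \<beta> \<in> S \<Longrightarrow> f \<in> Cinf A \<Longrightarrow> g \<in> Cinf A \<Longrightarrow>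
      c1 (\<lambda>p. f p *\<^sub>R \<alpha> p + g p *\<^sub>R \<beta> p) Xs p = f p *\<^sub>R c1 \<alpha> Xs p + g p *\<^sub>R c1 \<beta> Xs p"
    "\<And>\<alpha> f Xs p. \<alpha> \<in> S \<Longrightarrow> f \<in> Cinf A \<Longrightarrow>
      c0 (\<lambda>p. f p *\<^sub>R \<alpha> p) Xs p = f p *\<^sub>R c0 \<alpha> Xs p + d_wedge A f (c1 \<alpha>) Xs p"
  shows "(c0, c1) \<in> W1 A K q"
  unfolding W1_def mem_Collect_eq prod.case
proof (intro conjI ballI allI impI)
  show "c0 (\<lambda>p. a *\<^sub>R \<alpha> p + b *\<^sub>R \<beta> p) = form_comb a (c0 \<alpha>) b (c0 \<beta>)" if "\<alpha> \<in> S" "\<beta> \<in> S" for \<alpha> \<beta> a b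
    unfolding form_comb_def by (intro ext) (rule assms(5)[OF that])
  show "c1 (\<lambda>p. f p *\<^sub>R \<alpha> p + g p *\<^sub>R \<beta> p) = (\<lambda>Xs p. f p *\<^sub>R c1 \<alpha> Xs p + g p *\<^sub>R c1 \<beta> Xs p)"
    if "\<alpha> \<in> S" "\<beta> \<in> S" "f \<in> Cinf A" "g \<in> Cinf A" for \<alpha> \<beta> f g
    by (intro ext) (rule assms(6)[OF that])
  show "c0 (\<lambda>p. f p *\<^sub>R \<alpha> p) = (\<lambda>Xs p. f p *\<^sub>R c0 \<alpha> Xs p + d_wedge A f (c1 \<alpha>) Xs p)"
    if "\<alpha> \<in> S" "f \<in> Cinf A" for \<alpha> f
    by (intro ext) (rule assms(7)[OF that])
qed (rule assms, assumption)+

lemma W1D: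
  assumes "(c0, c1) \<in> W1 A K q"
  shows "\<alpha> \<notin> S \<Longrightarrow> c0 \<alpha> = zero_form" "\<alpha> \<notin> S \<Longrightarrow> c1 \<alpha> = zero_form"
    "\<alpha> \<in> S \<Longrightarrow> c0 \<alpha> \<in> forms A K q" "\<alpha> \<in> S \<Longrightarrow> c1 \<alpha> \<in> forms_pred A K q"
    "\<alpha> \<in> S \<Longrightarrow> \<beta> \<in> S \<Longrightarrow>
      c0 (\<lambda>p. a *\<^sub>R \<alpha> p + b *\<^sub>R \<beta> p) Xs p = a *\<^sub>R c0 \<alpha> Xs p + b *\<^sub>R c0 \<beta> Xs p"
    "\<alpha> \<in> S \<Longrightarrow> \<beta> \<in> S \<Longrightarrow> f \<in> Cinf A \<Longrightarrow> g \<in> Cinf A \<Longrightarrow>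
      c1 (\<lambda>p. f p *\<^sub>R \<alpha> p + g p *\<^sub>R \<beta> p) Xs p = f p *\<^sub>R c1 \<alpha> Xs p + g p *\<^sub>R c1 \<beta> Xs p"
    "\<alpha> \<in> S \<Longrightarrow> f \<in> Cinf A \<Longrightarrow>
      c0 (\<lambda>p. f p *\<^sub>R \<alpha> p) Xs p = f p *\<^sub>R c0 \<alpha> Xs p + d_wedge A f (c1 \<alpha>) Xs p"
proof -
  note w = assms[unfolded W1_def mem_Collect_eq prod.case]
  show "\<alpha> \<notin> S \<Longrightarrow> c0 \<alpha> = zero_form" "\<alpha> \<notin> S \<Longrightarrow> c1 \<alpha> = zero_form"
    using w[THEN conjunct1] by auto
  show "\<alpha> \<in> S \<Longrightarrow> c0 \<alpha> \<in> forms A K q" "\<alpha> \<in> S \<Longrightarrow> c1 \<alpha> \<in> forms_pred A K q"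
    using w[THEN conjunct2, THEN conjunct1] by auto
  show "\<alpha> \<in> S \<Longrightarrow> \<beta> \<in> S \<Longrightarrow>
      c0 (\<lambda>p. a *\<^sub>R \<alpha> p + b *\<^sub>R \<beta> p) Xs p = a *\<^sub>R c0 \<alpha> Xs p + b *\<^sub>R c0 \<beta> Xs p"
    using w[THEN conjunct2, THEN conjunct2, THEN conjunct1, rule_format, of \<alpha> \<beta> a b] by (simp add: form_comb_def)
  show "\<alpha> \<in> S \<Longrightarrow> \<beta> \<in> S \<Longrightarrow> f \<in> Cinf A \<Longrightarrow> g \<in> Cinf A \<Longrightarrow>
      c1 (\<lambda>p. f p *\<^sub>R \<alpha> p + g p *\<^sub>R \<beta> p) Xs p = f p *\<^sub>R c1 \<alpha> Xs p + g p *\<^sub>R c1 \<beta> Xs p"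
    using w[THEN conjunct2, THEN conjunct2, THEN conjunct2, THEN conjunct1, rule_format, of \<alpha> \<beta> f g] by simp
  show "\<alpha> \<in> S \<Longrightarrow> f \<in> Cinf A \<Longrightarrow>
      c0 (\<lambda>p. f p *\<^sub>R \<alpha> p) Xs p = f p *\<^sub>R c0 \<alpha> Xs p + d_wedge A f (c1 \<alpha>) Xs p"
    using w[THEN conjunct2, THEN conjunct2, THEN conjunct2, THEN conjunct2, rule_format, of \<alpha> f] by simp
qed

lemma IM_formsI:
  assumes "(c0, c1) \<in> W1 A K q"
    "\<And>\<alpha> \<beta> Xs p. \<alpha> \<in> S \<Longrightarrow> \<beta> \<in> S \<Longrightarrow>
      c0 (br \<alpha> \<beta>) Xs p = lie_der A \<alpha> (c0 \<beta>) Xs p - lie_der A \<beta> (c0 \<alpha>) Xs p"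
    "\<And>\<alpha> \<beta> Xs p. \<alpha> \<in> S \<Longrightarrow> \<beta> \<in> S \<Longrightarrow>
      c1 (br \<alpha> \<beta>) Xs p = lie_der A \<alpha> (c1 \<beta>) Xs p - c0 \<alpha> (rho A \<beta> # Xs) p"
    "\<And>\<alpha> \<beta> Xs p. \<alpha> \<in> S \<Longrightarrow> \<beta> \<in> S \<Longrightarrow> c1 \<beta> (rho A \<alpha> # Xs) p = - c1 \<alpha> (rho A \<beta> # Xs) p"
  shows "(c0, c1) \<in> IM_forms A K q"
  unfolding IM_forms_def mem_Collect_eq prod.case contract_def
  using assms(1) by (intro conjI ballI ext assms(2-4))

lemma IM_formsD:
  assumes "(c0, c1) \<in> IM_forms A K q"
  shows "(c0, c1) \<in> W1 A K q"
    "\<alpha> \<in> S \<Longrightarrow> \<beta> \<in> S \<Longrightarrow>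
      c0 (br \<alpha> \<beta>) Xs p = lie_der A \<alpha> (c0 \<beta>) Xs p - lie_der A \<beta> (c0 \<alpha>) Xs p"
    "\<alpha> \<in> S \<Longrightarrow> \<beta> \<in> S \<Longrightarrow>
      c1 (br \<alpha> \<beta>) Xs p = lie_der A \<alpha> (c1 \<beta>) Xs p - c0 \<alpha> (rho A \<beta> # Xs) p"
proof -
  note w = assms[unfolded IM_forms_def mem_Collect_eq prod.case contract_def]
  show "(c0, c1) \<in> W1 A K q" by (rule w[THEN conjunct1])
  show "c0 (br \<alpha> \<beta>) Xs p = lie_der A \<alpha> (c0 \<beta>) Xs p - lie_der A \<beta> (c0 \<alpha>) Xs p" if "\<alpha> \<in> S" "\<beta> \<in> S"
    using w[THEN conjunct2, rule_format, OF that, THEN conjunct1] by (rule fun_cong[OF fun_cong])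
  show "c1 (br \<alpha> \<beta>) Xs p = lie_der A \<alpha> (c1 \<beta>) Xs p - c0 \<alpha> (rho A \<beta> # Xs) p" if "\<alpha> \<in> S" "\<beta> \<in> S"
    using w[THEN conjunct2, rule_format, OF that, THEN conjunct2, THEN conjunct1] by (rule fun_cong[OF fun_cong])
qed

text \<open>The three IM equations are \<open>lie_der_bracket\<close>,
  \<open>lie_der_contract\<close> and antisymmetry in the first two arguments. Horizontality is the
  vanishing of the anchor on \<open>K\<close>.\<close>

lemma delta0_IM_hor:
  assumes \<gamma>: "\<gamma> \<in> forms A K q"
  shows "delta0 A \<gamma> \<in> IM_forms_hor A K q"
proof -
  define c0 where "c0 \<alpha> = (if \<alpha> \<in> S then lie_der A \<alpha> \<gamma> else zero_form)" for \<alpha>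
  define c1 where "c1 \<alpha> = (if \<alpha> \<in> S then contract (rho A \<alpha>) \<gamma> else zero_form)" for \<alpha>
  have c0: "c0 \<alpha> = lie_der A \<alpha> \<gamma>" and c1: "c1 \<alpha> = contract (rho A \<alpha>) \<gamma>" if "\<alpha> \<in> S" for \<alpha>
    using that by (simp_all add: c0_def c1_def)
  \<comment> \<open>Linearity in the first slot holds for lists of any kind, since off the proper
    domain both sides are zero.\<close>
  have front: "\<gamma> ((\<lambda>p h. f p * X p h + g p * Y p h) # Xs) p = f p *\<^sub>R \<gamma> (X # Xs) p + g p *\<^sub>R \<gamma> (Y # Xs) p"
    if "X \<in> VF" "Y \<in> VF" "f \<in> Cinf A" "g \<in> Cinf A" for X Y f g Xs p
  proof (cases "good q (X # Xs)")
    case True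
    then have "0 < q" by (auto simp: good_def)
    from forms_good(2)[OF \<gamma> True this that] show ?thesis by simp
  next
    case False
    then have "\<not> good q (Z # Xs)" if "Z \<in> VF" for Z using that \<open>X \<in> VF\<close> by (auto simp: good_def)
    then show ?thesis using forms_bad[OF \<gamma>] that vf_comb[OF that(3,4,1,2)] by simp
  qed
  have w: "(c0, c1) \<in> W1 A K q"
  proof (rule W1I)
    show "c0 \<alpha> = zero_form" "c1 \<alpha> = zero_form" if "\<alpha> \<notin> S" for \<alpha> using that by (simp_all add: c0_def c1_def)
    show "c0 \<alpha> \<in> forms A K q" "c1 \<alpha> \<in> forms_pred A K q" if "\<alpha> \<in> S" for \<alpha>
      unfolding c0[OF that] c1[OF that] by (rule lie_der_forms[OF \<gamma> that], rule contract_forms[OF \<gamma> rho_VF[OF that]])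
    show "c0 (\<lambda>p. a *\<^sub>R \<alpha> p + b *\<^sub>R \<beta> p) Xs p = a *\<^sub>R c0 \<alpha> Xs p + b *\<^sub>R c0 \<beta> Xs p"
      if "\<alpha> \<in> S" "\<beta> \<in> S" for \<alpha> \<beta> a b Xs p
      unfolding c0[OF that(1)] c0[OF that(2)] c0[OF S_comb[OF Cinf_const Cinf_const that]]
        lie_der_comb[OF \<gamma> that Cinf_const Cinf_const] d_wedge_const by simp
    show "c1 (\<lambda>p. f p *\<^sub>R \<alpha> p + g p *\<^sub>R \<beta> p) Xs p = f p *\<^sub>R c1 \<alpha> Xs p + g p *\<^sub>R c1 \<beta> Xs p"
      if \<alpha>: "\<alpha> \<in> S" and \<beta>: "\<beta> \<in> S" and f: "f \<in> Cinf A" "g \<in> Cinf A" for \<alpha> \<beta> f g Xs p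
      unfolding c1[OF \<alpha>] c1[OF \<beta>] c1[OF S_comb[OF f \<alpha> \<beta>]] rho_comb[OF \<alpha> \<beta>] contract_def
      by (rule front[OF rho_VF[OF \<alpha>] rho_VF[OF \<beta>] f])
    show "c0 (\<lambda>p. f p *\<^sub>R \<alpha> p) Xs p = f p *\<^sub>R c0 \<alpha> Xs p + d_wedge A f (c1 \<alpha>) Xs p"
      if \<alpha>: "\<alpha> \<in> S" and f: "f \<in> Cinf A" for \<alpha> f Xs p
      unfolding c0[OF \<alpha>] c1[OF \<alpha>] c0[OF S_scale[OF f \<alpha>]]
      using lie_der_comb[OF \<gamma> \<alpha> \<alpha> f Cinf_const[of 0], of Xs p] by (simp add: d_wedge_const)
  qed
  have "(c0, c1) \<in> IM_forms A K q"
  proof (rule IM_formsI[OF w])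
    fix \<alpha> \<beta> Xs p assume \<alpha>: "\<alpha> \<in> S" and \<beta>: "\<beta> \<in> S"
    show "c0 (br \<alpha> \<beta>) Xs p = lie_der A \<alpha> (c0 \<beta>) Xs p - lie_der A \<beta> (c0 \<alpha>) Xs p"
      unfolding c0[OF \<alpha>] c0[OF \<beta>] c0[OF br_S[OF \<alpha> \<beta>]] by (rule lie_der_bracket[OF \<gamma> \<alpha> \<beta>])
    show "c1 (br \<alpha> \<beta>) Xs p = lie_der A \<alpha> (c1 \<beta>) Xs p - c0 \<alpha> (rho A \<beta> # Xs) p"
      unfolding c0[OF \<alpha>] c1[OF \<beta>] c1[OF br_S[OF \<alpha> \<beta>]] lie_der_contract[OF \<gamma> \<alpha> \<beta>] by (simp add: contract_def)
    show "c1 \<beta> (rho A \<alpha> # Xs) p = - c1 \<alpha> (rho A \<beta> # Xs) p"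
    proof (cases "good q (rho A \<beta> # rho A \<alpha> # Xs)")
      case True
      then have "0 < q" "1 < q" by (auto simp: good_def)
      from forms_swap[OF \<gamma> True this _ rho_VF[OF \<beta>] rho_VF[OF \<alpha>], of p]
      show ?thesis by (simp add: c1 \<alpha> \<beta> contract_def)
    next
      case False
      then have "\<not> good q (rho A \<alpha> # rho A \<beta> # Xs)" by (auto simp: good_def)
      then show ?thesis using False forms_bad[OF \<gamma>] by (simp add: c1 \<alpha> \<beta> contract_def)
    qed
  qed
  moreover have "c1 \<xi> = zero_form" if \<xi>: "\<xi> \<in> \<Gamma>" for \<xi>
    unfolding c1[OF \<Gamma>S[OF \<xi>]] rho_\<Gamma>[OF \<xi>] contract_def zero_form_def
    using front[OF vf_zero vf_zero Cinf_const[of 0] Cinf_const[of 0]] by (intro ext) simp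
  ultimately have "(c0, c1) \<in> IM_forms_hor A K q" by (simp add: IM_forms_hor_def)
  then show ?thesis by (simp add: delta0_def c0_def[abs_def] c1_def[abs_def])
qed

lemma delta0_linear:
  assumes \<gamma>: "\<gamma> \<in> forms A K q" and \<eta>: "\<eta> \<in> forms A K q"
  shows "delta0 A (form_comb a \<gamma> b \<eta>) = cochain_comb a (delta0 A \<gamma>) b (delta0 A \<eta>)"
proof -
  have "lie_der A \<alpha> (form_comb a \<gamma> b \<eta>) Xs p = form_comb a (lie_der A \<alpha> \<gamma>) b (lie_der A \<alpha> \<eta>) Xs p" if \<alpha>: "\<alpha> \<in> S" for \<alpha> Xs p
  proof (cases "set Xs \<subseteq> VF")
    case True
    have "br \<alpha> (\<lambda>p. a *\<^sub>R \<gamma> Xs p + b *\<^sub>R \<eta> Xs p) p = a *\<^sub>R br \<alpha> (\<gamma> Xs) p + b *\<^sub>R br \<alpha> (\<eta> Xs) p"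
      using br_rcomb[OF \<alpha> \<Gamma>S[OF forms_\<Gamma>[OF \<gamma>]] \<Gamma>S[OF forms_\<Gamma>[OF \<eta>]]] by simp
    then show ?thesis
      by (simp add: form_comb_def lie_der_good[OF True] sum.distrib scaleR_sum_right algebra_simps)
  qed (simp add: lie_der_def form_comb_def)
  then show ?thesis
    by (auto simp: delta0_def cochain_comb_def fun_eq_iff) (simp_all add: form_comb_def zero_form_def contract_def)
qed

end

section \<open>The isomorphism between forms and horizontal IM forms\<close>

context semisimple_ideal_bundle
begin

lemma br_eqI_right:
  assumes "\<zeta> \<in> \<Gamma>" "\<zeta>' \<in> \<Gamma>" "\<And>\<xi>. \<xi> \<in> \<Gamma> \<Longrightarrow> br \<xi> \<zeta> = br \<xi> \<zeta>'"
  shows "\<zeta> = \<zeta>'"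
proof (rule br_eqI[OF assms(1,2)])
  fix \<xi> assume \<xi>: "\<xi> \<in> \<Gamma>"
  show "br \<zeta> \<xi> = br \<zeta>' \<xi>"
    using assms(3)[OF \<xi>] br_anti[OF \<Gamma>S[OF assms(1)] \<Gamma>S[OF \<xi>]] br_anti[OF \<Gamma>S[OF assms(2)] \<Gamma>S[OF \<xi>]] by simp
qed

text \<open>For each argument list the section is furnished by \<open>inner_derivation\<close>. Its
  uniqueness carries multilinearity and alternation over from \<open>T\<close>. All forms of the
  development that are not given in advance arise in this way.\<close>

lemma form_exists:
  fixes T :: "'m vfield list \<Rightarrow> ('m \<Rightarrow> 'a) \<Rightarrow> 'm \<Rightarrow> 'a"
  assumes T\<Gamma>: "\<And>Xs \<xi>. good q Xs \<Longrightarrow> \<xi> \<in> \<Gamma> \<Longrightarrow> T Xs \<xi> \<in> \<Gamma>"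
    and Tlin: "\<And>Xs \<xi> \<eta> f g. good q Xs \<Longrightarrow> \<xi> \<in> \<Gamma> \<Longrightarrow> \<eta> \<in> \<Gamma> \<Longrightarrow> f \<in> Cinf A \<Longrightarrow> g \<in> Cinf A \<Longrightarrow>
      T Xs (\<lambda>p. f p *\<^sub>R \<xi> p + g p *\<^sub>R \<eta> p) = (\<lambda>p. f p *\<^sub>R T Xs \<xi> p + g p *\<^sub>R T Xs \<eta> p)"
    and Tder: "\<And>Xs \<xi> \<eta>. good q Xs \<Longrightarrow> \<xi> \<in> \<Gamma> \<Longrightarrow> \<eta> \<in> \<Gamma> \<Longrightarrow>
      T Xs (br \<xi> \<eta>) = (\<lambda>p. br (T Xs \<xi>) \<eta> p + br \<xi> (T Xs \<eta>) p)"
    and Tmult: "\<And>Xs i X Y f g \<xi>. good q Xs \<Longrightarrow> i < q \<Longrightarrow> X \<in> VF \<Longrightarrow> Y \<in> VF \<Longrightarrow> f \<in> Cinf A \<Longrightarrow> g \<in> Cinf A \<Longrightarrow> \<xi> \<in> \<Gamma> \<Longrightarrow>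
      T (Xs[i := (\<lambda>p h. f p * X p h + g p * Y p h)]) \<xi> = (\<lambda>p. f p *\<^sub>R T (Xs[i := X]) \<xi> p + g p *\<^sub>R T (Xs[i := Y]) \<xi> p)"
    and Talt: "\<And>Xs i j \<xi>. good q Xs \<Longrightarrow> i < q \<Longrightarrow> j < q \<Longrightarrow> i \<noteq> j \<Longrightarrow> Xs ! i = Xs ! j \<Longrightarrow> \<xi> \<in> \<Gamma> \<Longrightarrow> T Xs \<xi> = (\<lambda>p. 0)"
  obtains \<gamma> where "\<gamma> \<in> forms A K q" "\<And>Xs \<xi>. good q Xs \<Longrightarrow> \<xi> \<in> \<Gamma> \<Longrightarrow> br (\<gamma> Xs) \<xi> = T Xs \<xi>"
proof -
  have "\<exists>\<zeta>. \<zeta> \<in> \<Gamma> \<and> (\<forall>\<xi>\<in>\<Gamma>. br \<zeta> \<xi> = T Xs \<xi>)" if gd: "good q Xs" for Xs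
  proof -
    obtain \<zeta> where "\<zeta> \<in> \<Gamma>" "\<And>\<xi>. \<xi> \<in> \<Gamma> \<Longrightarrow> T Xs \<xi> = br \<zeta> \<xi>"
      by (rule inner_derivation[where T = "T Xs", OF T\<Gamma>[OF gd] Tlin[OF gd] Tder[OF gd]]) blast+
    then show ?thesis by (intro exI[of _ \<zeta>]) simp
  qed
  then obtain \<zeta> where \<zeta>: "\<And>Xs. good q Xs \<Longrightarrow> \<zeta> Xs \<in> \<Gamma>" "\<And>Xs \<xi>. good q Xs \<Longrightarrow> \<xi> \<in> \<Gamma> \<Longrightarrow> br (\<zeta> Xs) \<xi> = T Xs \<xi>"
    by metis
  define \<gamma> where "\<gamma> Xs = (if good q Xs then \<zeta> Xs else (\<lambda>p. 0))" for Xs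
  have \<gamma>: "\<gamma> Xs = \<zeta> Xs" if "good q Xs" for Xs using that by (simp add: \<gamma>_def)
  have "\<gamma> \<in> forms A K q"
  proof (rule formsI)
    show "\<gamma> Xs = (\<lambda>p. 0)" if "\<not> good q Xs" for Xs using that by (simp add: \<gamma>_def)
    show "\<gamma> Xs \<in> \<Gamma>" if "good q Xs" for Xs using \<zeta>(1)[OF that] \<gamma>[OF that] by simp
  next
    fix Xs i X Y f g
    assume Xs: "good q Xs" and i: "i < q" and X: "X \<in> VF" and Y: "Y \<in> VF" and f: "f \<in> Cinf A" and g: "g \<in> Cinf A"
    note gX = good_update[OF Xs X] and gY = good_update[OF Xs Y] and gZ = good_update[OF Xs vf_comb[OF f g X Y]]
    show "\<gamma> (Xs[i := (\<lambda>p h. f p * X p h + g p * Y p h)]) = (\<lambda>p. f p *\<^sub>R \<gamma> (Xs[i := X]) p + g p *\<^sub>R \<gamma> (Xs[i := Y]) p)"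
      unfolding \<gamma>[OF gX] \<gamma>[OF gY] \<gamma>[OF gZ]
    proof (rule br_eqI)
      fix \<xi> assume \<xi>: "\<xi> \<in> \<Gamma>"
      show "br (\<zeta> (Xs[i := (\<lambda>p h. f p * X p h + g p * Y p h)])) \<xi> = br (\<lambda>p. f p *\<^sub>R \<zeta> (Xs[i := X]) p + g p *\<^sub>R \<zeta> (Xs[i := Y]) p) \<xi>"
        unfolding \<zeta>(2)[OF gZ \<xi>] br_\<Gamma>_comb_left[OF \<xi> \<Gamma>S[OF \<zeta>(1)[OF gX]] \<Gamma>S[OF \<zeta>(1)[OF gY]] f g]
          \<zeta>(2)[OF gX \<xi>] \<zeta>(2)[OF gY \<xi>] by (rule Tmult[OF Xs i X Y f g \<xi>])
    qed (intro \<Gamma>_comb f g \<zeta> gX gY gZ)+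
  next
    fix Xs i j assume Xs: "good q Xs" "i < q" "j < q" "i \<noteq> j" "Xs ! i = Xs ! j"
    show "\<gamma> Xs = (\<lambda>p. 0)"
      unfolding \<gamma>[OF Xs(1)]
      by (rule centre_zero[OF \<zeta>(1)[OF Xs(1)]]) (simp add: \<zeta>(2)[OF Xs(1)] Talt[OF Xs])
  qed
  then show thesis by (rule that) (simp add: \<gamma> \<zeta>)
qed

text \<open>On sections of \<open>K\<close> the Lie derivative is the bracket with the value of the
  form, and these brackets determine that value.\<close>

lemma delta0_inj: "inj_on (delta0 A) (forms A K q)"
proof (rule inj_onI)
  fix \<gamma> \<gamma>' assume \<gamma>: "\<gamma> \<in> forms A K q" and \<gamma>': "\<gamma>' \<in> forms A K q" and eq: "delta0 A \<gamma> = delta0 A \<gamma>'"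
  show "\<gamma> = \<gamma>'"
  proof
    fix Xs
    show "\<gamma> Xs = \<gamma>' Xs"
    proof (cases "good q Xs")
      case True
      show ?thesis
      proof (rule br_eqI_right[OF forms_\<Gamma>[OF \<gamma>] forms_\<Gamma>[OF \<gamma>']])
        fix \<xi> assume \<xi>: "\<xi> \<in> \<Gamma>"
        have "fst (delta0 A \<gamma>) \<xi> = fst (delta0 A \<gamma>') \<xi>" using eq by simp
        then have "lie_der A \<xi> \<gamma> = lie_der A \<xi> \<gamma>'" using \<Gamma>S[OF \<xi>] by (simp add: delta0_def)
        then show "br \<xi> (\<gamma> Xs) = br \<xi> (\<gamma>' Xs)"
          using lie_der_\<Gamma>_section[OF \<gamma> \<xi> True] lie_der_\<Gamma>_section[OF \<gamma>' \<xi> True] by simp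
      qed
    next
      case False
      then show ?thesis using forms_bad[OF \<gamma>] forms_bad[OF \<gamma>'] by simp
    qed
  qed
qed

text \<open>Horizontality removes the wedge term, so \<open>c0\<close> is linear over functions on
  sections of \<open>K\<close> and determines \<gamma>. Agreement on all sections of
  \<open>A\<close> then follows from the IM equations for a pair consisting of an arbitrary section
  and a test section of \<open>K\<close>.\<close>

lemma delta0_surj:
  assumes c: "(c0, c1) \<in> IM_forms_hor A K q"
  obtains \<gamma> where "\<gamma> \<in> forms A K q" "delta0 A \<gamma> = (c0, c1)"
proof -
  have im: "(c0, c1) \<in> IM_forms A K q" and hor: "\<And>\<xi>. \<xi> \<in> \<Gamma> \<Longrightarrow> c1 \<xi> = zero_form"
    using c by (auto simp: IM_forms_hor_def)
  note w = W1D[OF IM_formsD(1)[OF im]] and IM = IM_formsD(2,3)[OF im]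
  have c0f: "c0 \<alpha> \<in> forms A K q" if "\<alpha> \<in> S" for \<alpha> by (rule w(3)[OF that])
  have c0\<Gamma>: "c0 \<alpha> Xs \<in> \<Gamma>" if "\<alpha> \<in> S" for \<alpha> Xs by (rule forms_\<Gamma>[OF c0f[OF that]])
  have c0lin: "c0 (\<lambda>p. f p *\<^sub>R \<xi> p + g p *\<^sub>R \<eta> p) Xs p = f p *\<^sub>R c0 \<xi> Xs p + g p *\<^sub>R c0 \<eta> Xs p"
    if \<xi>: "\<xi> \<in> \<Gamma>" and \<eta>: "\<eta> \<in> \<Gamma>" and f: "f \<in> Cinf A" and g: "g \<in> Cinf A" for \<xi> \<eta> f g Xs p
  proof -
    have z: "d_wedge A f zero_form Xs p = 0" for f by (simp add: d_wedge_def zero_form_def)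
    show ?thesis
      using w(5)[OF S_scale[OF f \<Gamma>S[OF \<xi>]] S_scale[OF g \<Gamma>S[OF \<eta>]], of 1 1 Xs p]
        w(7)[OF \<Gamma>S[OF \<xi>] f, of Xs p] w(7)[OF \<Gamma>S[OF \<eta>] g, of Xs p] by (simp add: hor \<xi> \<eta> z)
  qed
  \<comment> \<open>The target is \<open>c0\<close> of \<xi> equal to [\<xi>, \<gamma>];
    \<open>form_exists\<close> places the form on the left of the bracket, hence the minus
    sign.\<close>
  obtain \<gamma> where \<gamma>: "\<gamma> \<in> forms A K q" and \<gamma>c: "\<And>Xs \<xi>. good q Xs \<Longrightarrow> \<xi> \<in> \<Gamma> \<Longrightarrow> br (\<gamma> Xs) \<xi> = (\<lambda>p. - c0 \<xi> Xs p)"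
  proof (rule form_exists[where T = "\<lambda>Xs \<xi> p. - c0 \<xi> Xs p" and q = q])
    show "(\<lambda>p. - c0 \<xi> Xs p) \<in> \<Gamma>" if "\<xi> \<in> \<Gamma>" for Xs \<xi> by (rule \<Gamma>_minus[OF c0\<Gamma>[OF \<Gamma>S[OF that]]])
    show "(\<lambda>p. - c0 (\<lambda>p. f p *\<^sub>R \<xi> p + g p *\<^sub>R \<eta> p) Xs p) = (\<lambda>p. f p *\<^sub>R - c0 \<xi> Xs p + g p *\<^sub>R - c0 \<eta> Xs p)"
      if "\<xi> \<in> \<Gamma>" "\<eta> \<in> \<Gamma>" "f \<in> Cinf A" "g \<in> Cinf A" for Xs \<xi> \<eta> f g
      by (intro ext) (simp add: c0lin[OF that])
    show "(\<lambda>p. - c0 (br \<xi> \<eta>) Xs p) = (\<lambda>p. br (\<lambda>p. - c0 \<xi> Xs p) \<eta> p + br \<xi> (\<lambda>p. - c0 \<eta> Xs p) p)"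
      if Xs: "good q Xs" and \<xi>: "\<xi> \<in> \<Gamma>" and \<eta>: "\<eta> \<in> \<Gamma>" for Xs \<xi> \<eta>
    proof
      fix p
      note \<xi>S = \<Gamma>S[OF \<xi>] and \<eta>S = \<Gamma>S[OF \<eta>]
      show "- c0 (br \<xi> \<eta>) Xs p = br (\<lambda>p. - c0 \<xi> Xs p) \<eta> p + br \<xi> (\<lambda>p. - c0 \<eta> Xs p) p"
        unfolding IM(1)[OF \<xi>S \<eta>S] lie_der_\<Gamma>_section[OF c0f[OF \<eta>S] \<xi> Xs] lie_der_\<Gamma>_section[OF c0f[OF \<xi>S] \<eta> Xs]
          br_minus[OF \<xi>S \<Gamma>S[OF c0\<Gamma>[OF \<eta>S]]] br_minus'[OF \<eta>S \<Gamma>S[OF c0\<Gamma>[OF \<xi>S]]]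
          br_anti[OF \<eta>S \<Gamma>S[OF c0\<Gamma>[OF \<xi>S]]] by simp
    qed
    show "(\<lambda>p. - c0 \<xi> (Xs[i := (\<lambda>p h. f p * X p h + g p * Y p h)]) p) =
        (\<lambda>p. f p *\<^sub>R - c0 \<xi> (Xs[i := X]) p + g p *\<^sub>R - c0 \<xi> (Xs[i := Y]) p)"
      if "good q Xs" "i < q" "X \<in> VF" "Y \<in> VF" "f \<in> Cinf A" "g \<in> Cinf A" "\<xi> \<in> \<Gamma>" for Xs i X Y f g \<xi>
      unfolding forms_good(2)[OF c0f[OF \<Gamma>S[OF that(7)]] that(1-6)] by simp
    show "(\<lambda>p. - c0 \<xi> Xs p) = (\<lambda>p. 0)"
      if "good q Xs" "i < q" "j < q" "i \<noteq> j" "Xs ! i = Xs ! j" "\<xi> \<in> \<Gamma>" for Xs i j \<xi>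
      unfolding forms_good(3)[OF c0f[OF \<Gamma>S[OF that(6)]] that(1-5)] by simp
  qed blast
  have \<gamma>c': "c0 \<xi> Xs = br \<xi> (\<gamma> Xs)" if "good q Xs" "\<xi> \<in> \<Gamma>" for Xs \<xi>
    using \<gamma>c[OF that] br_anti[OF \<Gamma>S[OF that(2)] \<Gamma>S[OF forms_\<Gamma>[OF \<gamma>]], of Xs] by simp
  have "c0 \<alpha> Xs = lie_der A \<alpha> \<gamma> Xs" if \<alpha>: "\<alpha> \<in> S" for \<alpha> Xs
  proof (cases "good q Xs")
    case False
    then show ?thesis using forms_bad[OF c0f[OF \<alpha>]] lie_der_bad[OF \<gamma> \<alpha>] by simp
  next
    case Xs: True
    then have sXs: "set Xs \<subseteq> VF" "length Xs = q" by (auto simp: good_def)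
    show ?thesis
    proof (rule br_eqI_right[OF c0\<Gamma>[OF \<alpha>] lie_der_in_\<Gamma>[OF \<gamma> \<alpha>]])
      fix \<xi> assume \<xi>: "\<xi> \<in> \<Gamma>"
      note \<xi>S = \<Gamma>S[OF \<xi>]
      have good: "good q (Xs[j := L \<alpha> (Xs ! j)])" if "j < q" for j
        by (rule good_update[OF Xs L_VF[OF \<alpha> good_nth[OF Xs that]]])
      \<comment> \<open>The first IM equation, with \<open>c0\<close> on sections of
        \<open>K\<close> already expressed through \<gamma>; comparison with the Jacobi identity
        isolates [\<xi>, c0(\<alpha>)].\<close>
      have 1: "br (br \<alpha> \<xi>) (\<gamma> Xs) p = br \<alpha> (br \<xi> (\<gamma> Xs)) p - (\<Sum>j<q. br \<xi> (\<gamma> (Xs[j := L \<alpha> (Xs ! j)])) p) - br \<xi> (c0 \<alpha> Xs) p" for p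
        using IM(1)[OF \<alpha> \<xi>S, of Xs p]
        unfolding lie_der_\<Gamma>_section[OF c0f[OF \<alpha>] \<xi> Xs] lie_der_good[OF sXs(1), of \<alpha>] \<gamma>c'[OF Xs br_\<Gamma>[OF \<alpha> \<xi>]] \<gamma>c'[OF Xs \<xi>]
        using sXs(2) \<gamma>c'[OF good \<xi>] by simp
      have 2: "br \<alpha> (br \<xi> (\<gamma> Xs)) p = br (br \<alpha> \<xi>) (\<gamma> Xs) p + br \<xi> (br \<alpha> (\<gamma> Xs)) p" for p
        using br_jacobi[OF \<alpha> \<xi>S \<Gamma>S[OF forms_\<Gamma>[OF \<gamma>]]] by simp
      show "br \<xi> (c0 \<alpha> Xs) = br \<xi> (lie_der A \<alpha> \<gamma> Xs)"
        unfolding br_lie_der[OF \<gamma> \<alpha> \<xi>S sXs(1)] sXs(2)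
        using 1 2 by (intro ext) (simp add: algebra_simps)
    qed
  qed
  moreover have "c1 \<alpha> Xs = contract (rho A \<alpha>) \<gamma> Xs" if \<alpha>: "\<alpha> \<in> S" for \<alpha> Xs
  proof (cases "good q (rho A \<alpha> # Xs)")
    case False
    then have "\<not> (set Xs \<subseteq> VF \<and> Suc (length Xs) = q)" using rho_VF[OF \<alpha>] by (auto simp: good_def)
    then show ?thesis
      unfolding contract_def forms_bad[OF \<gamma> False] by (rule forms_pred_bad[OF w(4)[OF \<alpha>]])
  next
    case True
    then obtain m where m: "q = Suc m" by (cases q) (auto simp: good_def)
    have Xs: "good m Xs" using True by (simp add: m good_Cons)
    have f: "c1 \<alpha> \<in> forms A K m" using w(4)[OF \<alpha>] by (simp add: m forms_pred_def)
    show ?thesis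
    proof (rule br_eqI_right)
      show "c1 \<alpha> Xs \<in> \<Gamma>" "contract (rho A \<alpha>) \<gamma> Xs \<in> \<Gamma>"
        using forms_\<Gamma>[OF f] forms_\<Gamma>[OF \<gamma>] by (simp_all add: contract_def)
      fix \<xi> assume \<xi>: "\<xi> \<in> \<Gamma>"
      \<comment> \<open>The left side of the second IM equation vanishes, because [\<xi>, \<alpha>]
        is a section of \<open>K\<close> and \<open>c1\<close> is horizontal.\<close>
      have "0 = lie_der A \<xi> (c1 \<alpha>) Xs p - c0 \<xi> (rho A \<alpha> # Xs) p" for p
        using IM(2)[OF \<Gamma>S[OF \<xi>] \<alpha>, of Xs p] hor[OF br_\<Gamma>'[OF \<xi> \<alpha>]] by (simp add: zero_form_def)
      then show "br \<xi> (c1 \<alpha> Xs) = br \<xi> (contract (rho A \<alpha>) \<gamma> Xs)"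
        unfolding lie_der_\<Gamma>_section[OF f \<xi> Xs] \<gamma>c'[OF True \<xi>] contract_def by (intro ext) simp
    qed
  qed
  ultimately have "delta0 A \<gamma> = (c0, c1)"
    using w(1,2) by (auto simp: delta0_def fun_eq_iff)
  then show thesis by (rule that[OF \<gamma>])
qed

lemma delta0_bij: "bij_betw (delta0 A) (forms A K q) (IM_forms_hor A K q)"
  unfolding bij_betw_def
proof (intro conjI delta0_inj equalityI subsetI)
  fix c assume "c \<in> IM_forms_hor A K q"
  moreover obtain c0 c1 where "c = (c0, c1)" by force
  ultimately obtain \<gamma> where "\<gamma> \<in> forms A K q" "delta0 A \<gamma> = c" using delta0_surj by metis
  then show "c \<in> delta0 A ` forms A K q" by blast
qed (use delta0_IM_hor in blast)

end

section \<open>Curvature of bracket-preserving connections\<close>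

lemma (in ideal_bundle) good_1: "good 1 Xs \<longleftrightarrow> (\<exists>X\<in>VF. Xs = [X])"
  by (auto simp: good_def length_Suc_conv)

lemma (in ideal_bundle) good_2: "good 2 Xs \<longleftrightarrow> (\<exists>X\<in>VF. \<exists>Y\<in>VF. Xs = [X, Y])"
  by (auto simp: good_def length_Suc_conv numeral_2_eq_2)

lemma (in ideal_bundle) good_3: "good 3 Xs \<longleftrightarrow> (\<exists>X\<in>VF. \<exists>Y\<in>VF. \<exists>Z\<in>VF. Xs = [X, Y, Z])"
  by (auto simp: good_def length_Suc_conv numeral_3_eq_3)

locale ideal_connection = semisimple_ideal_bundle A K
  for A :: "('m::{t2_space,second_countable_topology}, 'a::real_vector, 'x) algebroid_data_scheme"
    and K :: "'m \<Rightarrow> 'a set" +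
  fixes D :: "('m, 'a) connection"
  assumes lc: "linear_connection A K D" and bp: "bracket_preserving A K D"
begin

lemma D_bad: "\<not> (X \<in> VF \<and> \<xi> \<in> \<Gamma>) \<Longrightarrow> D X \<xi> = (\<lambda>p. 0)"
  by (rule lc[unfolded linear_connection_def, THEN conjunct1, rule_format])

lemma D_\<Gamma>: "D X \<xi> \<in> \<Gamma>"
proof (cases "X \<in> VF \<and> \<xi> \<in> \<Gamma>")
  case True
  then show ?thesis
    using lc[unfolded linear_connection_def, THEN conjunct2, THEN conjunct1, rule_format] by blast
next
  case False
  then show ?thesis using D_bad[OF False] \<Gamma>_zero by simp
qed

lemma D_comb_left: "X \<in> VF \<Longrightarrow> Y \<in> VF \<Longrightarrow> f \<in> Cinf A \<Longrightarrow> g \<in> Cinf A \<Longrightarrow> \<xi> \<in> \<Gamma> \<Longrightarrow>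
    D (\<lambda>p h. f p * X p h + g p * Y p h) \<xi> = (\<lambda>p. f p *\<^sub>R D X \<xi> p + g p *\<^sub>R D Y \<xi> p)"
  by (rule lc[unfolded linear_connection_def, THEN conjunct2, THEN conjunct2, THEN conjunct1, rule_format])

lemma D_add: "X \<in> VF \<Longrightarrow> \<xi> \<in> \<Gamma> \<Longrightarrow> \<eta> \<in> \<Gamma> \<Longrightarrow> D X (\<lambda>p. \<xi> p + \<eta> p) = (\<lambda>p. D X \<xi> p + D X \<eta> p)"
  by (rule lc[unfolded linear_connection_def, THEN conjunct2, THEN conjunct2, THEN conjunct2, THEN conjunct1, rule_format])

lemma D_leibniz: "X \<in> VF \<Longrightarrow> \<xi> \<in> \<Gamma> \<Longrightarrow> f \<in> Cinf A \<Longrightarrow>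
    D X (\<lambda>p. f p *\<^sub>R \<xi> p) = (\<lambda>p. f p *\<^sub>R D X \<xi> p + X p f *\<^sub>R \<xi> p)"
  by (rule lc[unfolded linear_connection_def, THEN conjunct2, THEN conjunct2, THEN conjunct2, THEN conjunct2, rule_format])

lemma D_br: "X \<in> VF \<Longrightarrow> \<xi> \<in> \<Gamma> \<Longrightarrow> \<eta> \<in> \<Gamma> \<Longrightarrow> D X (br \<xi> \<eta>) = (\<lambda>p. br (D X \<xi>) \<eta> p + br \<xi> (D X \<eta>) p)"
  by (rule bp[unfolded bracket_preserving_def, rule_format])

lemma D_comb_right:
  assumes "X \<in> VF" "\<xi> \<in> \<Gamma>" "\<eta> \<in> \<Gamma>" "f \<in> Cinf A" "g \<in> Cinf A"
  shows "D X (\<lambda>p. f p *\<^sub>R \<xi> p + g p *\<^sub>R \<eta> p) =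
    (\<lambda>p. f p *\<^sub>R D X \<xi> p + g p *\<^sub>R D X \<eta> p + (X p f *\<^sub>R \<xi> p + X p g *\<^sub>R \<eta> p))"
  using assms by (simp add: D_add \<Gamma>_scale D_leibniz add_ac)

lemma D_minus: assumes "X \<in> VF" "\<xi> \<in> \<Gamma>" shows "D X (\<lambda>p. - \<xi> p) = (\<lambda>p. - D X \<xi> p)"
  using D_leibniz[OF assms Cinf_const[of "-1"]] by (simp add: vf_const[OF assms(1)])

lemma D_zero: assumes "X \<in> VF" shows "D X (\<lambda>p. 0) = (\<lambda>p. 0)"
  using D_leibniz[OF assms \<Gamma>_zero Cinf_const[of 0]] by (simp add: vf_const[OF assms])

lemma D_diff: assumes "X \<in> VF" "\<xi> \<in> \<Gamma>" "\<eta> \<in> \<Gamma>"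
  shows "D X (\<lambda>p. \<xi> p - \<eta> p) = (\<lambda>p. D X \<xi> p - D X \<eta> p)"
  using D_add[OF assms(1,2) \<Gamma>_minus[OF assms(3)]] D_minus[OF assms(1,3)] by simp

lemma D_left_add: "X \<in> VF \<Longrightarrow> Y \<in> VF \<Longrightarrow> \<xi> \<in> \<Gamma> \<Longrightarrow> D (\<lambda>p h. X p h + Y p h) \<xi> = (\<lambda>p. D X \<xi> p + D Y \<xi> p)"
  using D_comb_left[OF _ _ Cinf_const[of 1] Cinf_const[of 1]] by simp

lemma D_left_diff: "X \<in> VF \<Longrightarrow> Y \<in> VF \<Longrightarrow> \<xi> \<in> \<Gamma> \<Longrightarrow> D (\<lambda>p h. X p h - Y p h) \<xi> = (\<lambda>p. D X \<xi> p - D Y \<xi> p)"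
  using D_comb_left[OF _ _ Cinf_const[of 1] Cinf_const[of "-1"]] by simp

lemma D_left_minus: "X \<in> VF \<Longrightarrow> \<xi> \<in> \<Gamma> \<Longrightarrow> D (\<lambda>p h. - X p h) \<xi> = (\<lambda>p. - D X \<xi> p)"
  using D_comb_left[OF _ _ Cinf_const[of "-1"] Cinf_const[of 0], of X X] by simp

lemma D_left_zero: "\<xi> \<in> \<Gamma> \<Longrightarrow> D (\<lambda>p h. 0) \<xi> = (\<lambda>p. 0)"
  using D_comb_left[OF vf_zero vf_zero Cinf_const[of 0] Cinf_const[of 0]] by simp

abbreviation "vb \<equiv> vf_bracket A"

definition R :: "'m vfield \<Rightarrow> 'm vfield \<Rightarrow> ('m \<Rightarrow> 'a) \<Rightarrow> 'm \<Rightarrow> 'a" where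
  "R X Y \<xi> = (\<lambda>p. D X (D Y \<xi>) p - D Y (D X \<xi>) p - D (vb X Y) \<xi> p)"

text \<open>The operator that is to be ad C(\<alpha>)(X). The commutator of \<open>D X\<close> with
  the bracket by \<alpha> differentiates along [X, \<rho>(\<alpha>)]; the last term compensates for
  this, so the result is linear over functions in \<xi>.\<close>

definition E :: "('m \<Rightarrow> 'a) \<Rightarrow> 'm vfield \<Rightarrow> ('m \<Rightarrow> 'a) \<Rightarrow> 'm \<Rightarrow> 'a" where
  "E \<alpha> X \<xi> = (\<lambda>p. D X (br \<alpha> \<xi>) p - br \<alpha> (D X \<xi>) p + D (L \<alpha> X) \<xi> p)"

lemmas closed = \<Gamma>_add \<Gamma>_diff \<Gamma>_minus D_\<Gamma> br_\<Gamma> \<Gamma>S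

lemma R_\<Gamma>: "R X Y \<xi> \<in> \<Gamma>" unfolding R_def by (intro \<Gamma>_diff D_\<Gamma>)

lemma E_\<Gamma>: "\<alpha> \<in> S \<Longrightarrow> \<xi> \<in> \<Gamma> \<Longrightarrow> E \<alpha> X \<xi> \<in> \<Gamma>"
  unfolding E_def by (intro \<Gamma>_diff \<Gamma>_add D_\<Gamma> br_\<Gamma>)

lemma R_anti: assumes "X \<in> VF" "Y \<in> VF" "\<xi> \<in> \<Gamma>" shows "R X Y \<xi> = (\<lambda>p. - R Y X \<xi> p)"
  unfolding R_def vf_bracket_anti[of X Y] D_left_minus[OF vf_bracket_vf[OF assms(2,1)] assms(3)] by (intro ext) simp

lemma R_self: "\<xi> \<in> \<Gamma> \<Longrightarrow> R X X \<xi> = (\<lambda>p. 0)"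
  by (simp add: R_def vf_bracket_self D_left_zero)

lemma R_comb_left:
  assumes X: "X \<in> VF" and Y: "Y \<in> VF" and Z: "Z \<in> VF" and f: "f \<in> Cinf A" and g: "g \<in> Cinf A" and \<xi>: "\<xi> \<in> \<Gamma>"
  shows "R (\<lambda>p h. f p * X p h + g p * Y p h) Z \<xi> = (\<lambda>p. f p *\<^sub>R R X Z \<xi> p + g p *\<^sub>R R Y Z \<xi> p)"
proof -
  have Zf: "(\<lambda>p. Z p f) \<in> Cinf A" "(\<lambda>p. Z p g) \<in> Cinf A" using vf_Cinf[OF Z f] vf_Cinf[OF Z g] .
  note XZ = vf_bracket_vf[OF X Z] and YZ = vf_bracket_vf[OF Y Z]
  show ?thesis
    unfolding R_def vf_bracket_comb_left[OF Z X Y f g] D_comb_left[OF X Y f g \<xi>] D_comb_left[OF X Y f g D_\<Gamma>]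
      D_comb_right[OF Z D_\<Gamma> D_\<Gamma> f g] D_left_diff[OF vf_comb[OF f g XZ YZ] vf_comb[OF Zf X Y] \<xi>]
      D_comb_left[OF XZ YZ f g \<xi>] D_comb_left[OF X Y Zf \<xi>]
    by (intro ext) (simp add: algebra_simps)
qed

lemma R_comb_right:
  assumes X: "X \<in> VF" and Y: "Y \<in> VF" and f: "f \<in> Cinf A" and g: "g \<in> Cinf A" and \<xi>: "\<xi> \<in> \<Gamma>" and \<eta>: "\<eta> \<in> \<Gamma>"
  shows "R X Y (\<lambda>p. f p *\<^sub>R \<xi> p + g p *\<^sub>R \<eta> p) = (\<lambda>p. f p *\<^sub>R R X Y \<xi> p + g p *\<^sub>R R X Y \<eta> p)"
proof -
  have two: "D X (D Y (\<lambda>p. f p *\<^sub>R \<xi> p + g p *\<^sub>R \<eta> p)) = (\<lambda>p. f p *\<^sub>R D X (D Y \<xi>) p + g p *\<^sub>R D X (D Y \<eta>) p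
      + (X p f *\<^sub>R D Y \<xi> p + X p g *\<^sub>R D Y \<eta> p) + (Y p f *\<^sub>R D X \<xi> p + Y p g *\<^sub>R D X \<eta> p
      + (X p (\<lambda>p. Y p f) *\<^sub>R \<xi> p + X p (\<lambda>p. Y p g) *\<^sub>R \<eta> p)))" if X: "X \<in> VF" and Y: "Y \<in> VF" for X Y
  proof -
    have Yf: "(\<lambda>p. Y p f) \<in> Cinf A" "(\<lambda>p. Y p g) \<in> Cinf A" using vf_Cinf[OF Y f] vf_Cinf[OF Y g] .
    show ?thesis
      unfolding D_comb_right[OF Y \<xi> \<eta> f g] D_add[OF X \<Gamma>_comb[OF f g D_\<Gamma> D_\<Gamma>] \<Gamma>_comb[OF Yf \<xi> \<eta>]]
        D_comb_right[OF X D_\<Gamma> D_\<Gamma> f g] D_comb_right[OF X \<xi> \<eta> Yf] ..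
  qed
  show ?thesis
    unfolding R_def two[OF X Y] two[OF Y X] D_comb_right[OF vf_bracket_vf[OF X Y] \<xi> \<eta> f g]
    using f g by (intro ext) (simp add: vf_bracket_def algebra_simps)
qed

lemma R_br:
  assumes X: "X \<in> VF" and Y: "Y \<in> VF" and \<xi>: "\<xi> \<in> \<Gamma>" and \<eta>: "\<eta> \<in> \<Gamma>"
  shows "R X Y (br \<xi> \<eta>) = (\<lambda>p. br (R X Y \<xi>) \<eta> p + br \<xi> (R X Y \<eta>) p)"
  using assms
  by (intro ext) (simp add: R_def D_br D_add br_add br_add' br_diff br_diff' closed vf_bracket_vf algebra_simps)

text \<open>First-order terms cancel in pairs, and the two second derivatives of a coefficient
  differ by its derivative along [X, \<rho>(\<alpha>)], which the third summand of \<open>E\<close>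
  removes.\<close>

lemma E_comb_right:
  assumes \<alpha>: "\<alpha> \<in> S" and X: "X \<in> VF" and f: "f \<in> Cinf A" and g: "g \<in> Cinf A" and \<xi>: "\<xi> \<in> \<Gamma>" and \<eta>: "\<eta> \<in> \<Gamma>"
  shows "E \<alpha> X (\<lambda>p. f p *\<^sub>R \<xi> p + g p *\<^sub>R \<eta> p) = (\<lambda>p. f p *\<^sub>R E \<alpha> X \<xi> p + g p *\<^sub>R E \<alpha> X \<eta> p)"
proof -
  let ?a = "rho A \<alpha>"
  have af: "(\<lambda>p. ?a p f) \<in> Cinf A" "(\<lambda>p. ?a p g) \<in> Cinf A"
    using vf_Cinf[OF rho_VF[OF \<alpha>] f] vf_Cinf[OF rho_VF[OF \<alpha>] g] .
  have Xf: "(\<lambda>p. X p f) \<in> Cinf A" "(\<lambda>p. X p g) \<in> Cinf A" using vf_Cinf[OF X f] vf_Cinf[OF X g] .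
  note \<xi>S = \<Gamma>S[OF \<xi>] and \<eta>S = \<Gamma>S[OF \<eta>] and a\<xi> = br_\<Gamma>[OF \<alpha> \<xi>] and a\<eta> = br_\<Gamma>[OF \<alpha> \<eta>]
  have 1: "D X (br \<alpha> (\<lambda>p. f p *\<^sub>R \<xi> p + g p *\<^sub>R \<eta> p)) = (\<lambda>p. f p *\<^sub>R D X (br \<alpha> \<xi>) p + g p *\<^sub>R D X (br \<alpha> \<eta>) p
      + (X p f *\<^sub>R br \<alpha> \<xi> p + X p g *\<^sub>R br \<alpha> \<eta> p) + (?a p f *\<^sub>R D X \<xi> p + ?a p g *\<^sub>R D X \<eta> p
      + (X p (\<lambda>p. ?a p f) *\<^sub>R \<xi> p + X p (\<lambda>p. ?a p g) *\<^sub>R \<eta> p)))"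
    unfolding br_comb_right[OF \<alpha> \<xi>S \<eta>S f g] D_add[OF X \<Gamma>_comb[OF f g a\<xi> a\<eta>] \<Gamma>_comb[OF af \<xi> \<eta>]]
      D_comb_right[OF X a\<xi> a\<eta> f g] D_comb_right[OF X \<xi> \<eta> af] ..
  have 2: "br \<alpha> (D X (\<lambda>p. f p *\<^sub>R \<xi> p + g p *\<^sub>R \<eta> p)) = (\<lambda>p. f p *\<^sub>R br \<alpha> (D X \<xi>) p + g p *\<^sub>R br \<alpha> (D X \<eta>) p
      + (?a p f *\<^sub>R D X \<xi> p + ?a p g *\<^sub>R D X \<eta> p) + (X p f *\<^sub>R br \<alpha> \<xi> p + X p g *\<^sub>R br \<alpha> \<eta> p
      + (?a p (\<lambda>p. X p f) *\<^sub>R \<xi> p + ?a p (\<lambda>p. X p g) *\<^sub>R \<eta> p)))"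
    unfolding D_comb_right[OF X \<xi> \<eta> f g]
      br_add[OF \<alpha> \<Gamma>S[OF \<Gamma>_comb[OF f g D_\<Gamma> D_\<Gamma>]] \<Gamma>S[OF \<Gamma>_comb[OF Xf \<xi> \<eta>]]]
      br_comb_right[OF \<alpha> \<Gamma>S[OF D_\<Gamma>] \<Gamma>S[OF D_\<Gamma>] f g] br_comb_right[OF \<alpha> \<xi>S \<eta>S Xf] ..
  show ?thesis
    unfolding E_def 1 2 D_comb_right[OF L_VF[OF \<alpha> X] \<xi> \<eta> f g]
    using f g by (intro ext) (simp add: vf_bracket_def algebra_simps)
qed

lemma E_br:
  assumes \<alpha>: "\<alpha> \<in> S" and X: "X \<in> VF" and \<xi>: "\<xi> \<in> \<Gamma>" and \<eta>: "\<eta> \<in> \<Gamma>"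
  shows "E \<alpha> X (br \<xi> \<eta>) = (\<lambda>p. br (E \<alpha> X \<xi>) \<eta> p + br \<xi> (E \<alpha> X \<eta>) p)"
proof -
  have j: "br \<alpha> (br \<xi> \<eta>) = (\<lambda>p. br (br \<alpha> \<xi>) \<eta> p + br \<xi> (br \<alpha> \<eta>) p)" if "\<xi> \<in> \<Gamma>" "\<eta> \<in> \<Gamma>" for \<xi> \<eta>
    by (rule br_jacobi[OF \<alpha> \<Gamma>S[OF that(1)] \<Gamma>S[OF that(2)]])
  show ?thesis
    using assms
    by (intro ext) (simp add: E_def j D_br D_add br_add br_add' br_diff br_diff' closed L_VF algebra_simps)
qed

lemma E_comb_vf:
  assumes \<alpha>: "\<alpha> \<in> S" and X: "X \<in> VF" and Y: "Y \<in> VF" and f: "f \<in> Cinf A" and g: "g \<in> Cinf A" and \<xi>: "\<xi> \<in> \<Gamma>"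
  shows "E \<alpha> (\<lambda>p h. f p * X p h + g p * Y p h) \<xi> = (\<lambda>p. f p *\<^sub>R E \<alpha> X \<xi> p + g p *\<^sub>R E \<alpha> Y \<xi> p)"
proof -
  let ?a = "rho A \<alpha>"
  have af: "(\<lambda>p. ?a p f) \<in> Cinf A" "(\<lambda>p. ?a p g) \<in> Cinf A"
    using vf_Cinf[OF rho_VF[OF \<alpha>] f] vf_Cinf[OF rho_VF[OF \<alpha>] g] .
  note LX = L_VF[OF \<alpha> X] and LY = L_VF[OF \<alpha> Y]
  show ?thesis
    unfolding E_def vf_bracket_comb_right[OF rho_VF[OF \<alpha>] X Y f g] D_comb_left[OF X Y f g br_\<Gamma>[OF \<alpha> \<xi>]]
      D_comb_left[OF X Y f g \<xi>] br_comb_right[OF \<alpha> \<Gamma>S[OF D_\<Gamma>] \<Gamma>S[OF D_\<Gamma>] f g]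
      D_left_add[OF vf_comb[OF f g LX LY] vf_comb[OF af X Y] \<xi>] D_comb_left[OF LX LY f g \<xi>] D_comb_left[OF X Y af \<xi>]
    by (intro ext) (simp add: algebra_simps)
qed

text \<open>The correction is the defect of compatibility. For a compatible splitting it equals the
  bracket of v(\<alpha>) with \<xi>, so the lemma becomes the Leibniz rule of \<open>C\<close> with
  symbol \<open>v\<close>.\<close>

lemma E_comb_section:
  assumes \<alpha>: "\<alpha> \<in> S" and \<beta>: "\<beta> \<in> S" and X: "X \<in> VF" and f: "f \<in> Cinf A" and g: "g \<in> Cinf A" and \<xi>: "\<xi> \<in> \<Gamma>"
  shows "E (\<lambda>p. f p *\<^sub>R \<alpha> p + g p *\<^sub>R \<beta> p) X \<xi> p = f p *\<^sub>R E \<alpha> X \<xi> p + g p *\<^sub>R E \<beta> X \<xi> p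
    + (X p f *\<^sub>R (br \<alpha> \<xi> p - D (rho A \<alpha>) \<xi> p) + X p g *\<^sub>R (br \<beta> \<xi> p - D (rho A \<beta>) \<xi> p))"
proof -
  have Xf: "(\<lambda>p. X p f) \<in> Cinf A" "(\<lambda>p. X p g) \<in> Cinf A" using vf_Cinf[OF X f] vf_Cinf[OF X g] .
  note a = rho_VF[OF \<alpha>] and b = rho_VF[OF \<beta>]
  note LX = L_VF[OF \<alpha> X] and LY = L_VF[OF \<beta> X]
  show ?thesis
    unfolding E_def rho_comb[OF \<alpha> \<beta>] vf_bracket_comb_left[OF X a b f g] br_\<Gamma>_comb_left[OF \<xi> \<alpha> \<beta> f g]
      br_\<Gamma>_comb_left[OF D_\<Gamma> \<alpha> \<beta> f g] D_comb_right[OF X br_\<Gamma>[OF \<alpha> \<xi>] br_\<Gamma>[OF \<beta> \<xi>] f g]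
      D_left_diff[OF vf_comb[OF f g LX LY] vf_comb[OF Xf a b] \<xi>] D_comb_left[OF LX LY f g \<xi>] D_comb_left[OF a b Xf \<xi>]
    by (simp add: algebra_simps)
qed

text \<open>Here bracket preservation enters. It is the reason why the connection induced by the
  reconstructed \<open>C\<close> is again \<open>D\<close>.\<close>

lemma E_\<Gamma>_section:
  assumes "\<zeta> \<in> \<Gamma>" "X \<in> VF" "\<xi> \<in> \<Gamma>"
  shows "E \<zeta> X \<xi> = br (D X \<zeta>) \<xi>"
  using assms by (simp add: E_def rho_\<Gamma> vf_bracket_zero_left D_left_zero D_br)

text \<open>The first IM equation for \<open>C\<close>, seen through the adjoint
  representation.\<close>

lemma E_bracket:
  assumes \<alpha>: "\<alpha> \<in> S" and \<beta>: "\<beta> \<in> S" and X: "X \<in> VF" and \<xi>: "\<xi> \<in> \<Gamma>"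
  shows "E (br \<alpha> \<beta>) X \<xi> p = (br \<alpha> (E \<beta> X \<xi>) p - E \<beta> X (br \<alpha> \<xi>) p - E \<beta> (L \<alpha> X) \<xi> p)
    - (br \<beta> (E \<alpha> X \<xi>) p - E \<alpha> X (br \<beta> \<xi>) p - E \<alpha> (L \<beta> X) \<xi> p)"
proof -
  have j: "br (br \<alpha> \<beta>) \<eta> = (\<lambda>p. br \<alpha> (br \<beta> \<eta>) p - br \<beta> (br \<alpha> \<eta>) p)" if "\<eta> \<in> \<Gamma>" for \<eta>
    using br_jacobi[OF \<alpha> \<beta> \<Gamma>S[OF that]] by (intro ext) simp
  have l: "L (br \<alpha> \<beta>) X = (\<lambda>p h. L \<alpha> (L \<beta> X) p h - L \<beta> (L \<alpha> X) p h)"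
    unfolding anchor_bracket[OF \<alpha> \<beta>]
    using vf_bracket_jacobi[OF rho_VF[OF \<alpha>] rho_VF[OF \<beta>] X] by (intro ext) simp
  have "D (L (br \<alpha> \<beta>) X) \<xi> = (\<lambda>p. D (L \<alpha> (L \<beta> X)) \<xi> p - D (L \<beta> (L \<alpha> X)) \<xi> p)"
    unfolding l by (intro D_left_diff L_VF \<alpha> \<beta> X \<xi>)
  then show ?thesis
    unfolding E_def j[OF \<xi>] j[OF D_\<Gamma>]
    using assms by (simp add: D_diff br_add br_diff closed L_VF algebra_simps)
qed

text \<open>The first component of the equation between curvature and \<delta>F, seen through the
  adjoint representation. Both sides expand into the same triple compositions; the Jacobi identity
  matches the derivatives along double brackets.\<close>

lemma curvature_identity:
  assumes \<alpha>: "\<alpha> \<in> S" and X: "X \<in> VF" and Y: "Y \<in> VF" and \<xi>: "\<xi> \<in> \<Gamma>"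
  shows "(D X (E \<alpha> Y \<xi>) p - E \<alpha> Y (D X \<xi>) p) - (D Y (E \<alpha> X \<xi>) p - E \<alpha> X (D Y \<xi>) p) - E \<alpha> (vb X Y) \<xi> p
    = R X Y (br \<alpha> \<xi>) p - br \<alpha> (R X Y \<xi>) p + R (L \<alpha> X) Y \<xi> p + R X (L \<alpha> Y) \<xi> p"
proof -
  note LX = L_VF[OF \<alpha> X] and LY = L_VF[OF \<alpha> Y] and XY = vf_bracket_vf[OF X Y]
  have l: "L \<alpha> (vb X Y) = (\<lambda>p h. vb (L \<alpha> X) Y p h + vb X (L \<alpha> Y) p h)"
    using vf_bracket_jacobi[OF rho_VF[OF \<alpha>] X Y] by (intro ext)
  have "D (L \<alpha> (vb X Y)) \<xi> = (\<lambda>p. D (vb (L \<alpha> X) Y) \<xi> p + D (vb X (L \<alpha> Y)) \<xi> p)"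
    unfolding l by (rule D_left_add[OF vf_bracket_vf[OF LX Y] vf_bracket_vf[OF X LY] \<xi>])
  then show ?thesis
    unfolding E_def R_def
    using assms by (simp add: D_diff D_add br_add br_diff closed algebra_simps)
qed

text \<open>The Jacobi identity for the operators \<open>D X\<close>, \<open>D Y\<close>,
  \<open>D Z\<close>, with order and signs as produced by the Koszul formula on a 2-form.\<close>

lemma bianchi_identity:
  assumes X: "X \<in> VF" and Y: "Y \<in> VF" and Z: "Z \<in> VF" and \<xi>: "\<xi> \<in> \<Gamma>"
  shows "(D X (R Y Z \<xi>) p - R Y Z (D X \<xi>) p) - (D Y (R X Z \<xi>) p - R X Z (D Y \<xi>) p)
    + (D Z (R X Y \<xi>) p - R X Y (D Z \<xi>) p) - R (vb X Y) Z \<xi> p + R (vb X Z) Y \<xi> p - R (vb Y Z) X \<xi> p = 0"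
proof -
  note XY = vf_bracket_vf[OF X Y] and XZ = vf_bracket_vf[OF X Z] and YZ = vf_bracket_vf[OF Y Z]
  have "vb (vb Y Z) X = (\<lambda>p h. - vb X (vb Y Z) p h)" "vb (vb X Z) Y = (\<lambda>p h. - vb Y (vb X Z) p h)"
    by (rule vf_bracket_anti)+
  moreover have "vb X (vb Y Z) = (\<lambda>p h. vb (vb X Y) Z p h + vb Y (vb X Z) p h)"
    using vf_bracket_jacobi[OF X Y Z] by (intro ext)
  ultimately have "D (vb (vb Y Z) X) \<xi> = (\<lambda>p. - D (vb (vb X Y) Z) \<xi> p - D (vb Y (vb X Z)) \<xi> p)"
    "D (vb (vb X Z) Y) \<xi> = (\<lambda>p. - D (vb Y (vb X Z)) \<xi> p)"
    using D_left_minus[OF vf_bracket_vf[OF Y XZ] \<xi>] D_left_minus[OF vf_bracket_vf[OF X YZ] \<xi>]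
      D_left_add[OF vf_bracket_vf[OF XY Z] vf_bracket_vf[OF Y XZ] \<xi>] by simp_all
  then show ?thesis
    unfolding R_def using assms by (simp add: D_diff D_add closed algebra_simps)
qed

lemma E_form_exists:
  assumes \<alpha>: "\<alpha> \<in> S"
  obtains \<gamma> where "\<gamma> \<in> forms A K 1" "\<And>X \<xi>. X \<in> VF \<Longrightarrow> \<xi> \<in> \<Gamma> \<Longrightarrow> br (\<gamma> [X]) \<xi> = E \<alpha> X \<xi>"
proof -
  have g: "Xs ! 0 \<in> VF" if "good 1 Xs" for Xs using that unfolding good_1 by auto
  obtain \<gamma> where \<gamma>: "\<gamma> \<in> forms A K 1" "\<And>Xs \<xi>. good 1 Xs \<Longrightarrow> \<xi> \<in> \<Gamma> \<Longrightarrow> br (\<gamma> Xs) \<xi> = E \<alpha> (Xs ! 0) \<xi>"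
  proof (rule form_exists[where T = "\<lambda>Xs. E \<alpha> (Xs ! 0)" and q = 1])
    fix Xs X Y f g \<xi> and i :: nat assume "good 1 Xs" "i < 1" and a: "X \<in> VF" "Y \<in> VF" "f \<in> Cinf A" "g \<in> Cinf A" "\<xi> \<in> \<Gamma>"
    then have "Xs[i := Z] ! 0 = Z" for Z unfolding good_1 by auto
    then show "E \<alpha> (Xs[i := (\<lambda>p h. f p * X p h + g p * Y p h)] ! 0) \<xi> =
        (\<lambda>p. f p *\<^sub>R E \<alpha> (Xs[i := X] ! 0) \<xi> p + g p *\<^sub>R E \<alpha> (Xs[i := Y] ! 0) \<xi> p)"
      using E_comb_vf[OF \<alpha> a] by simp
  qed (use E_\<Gamma>[OF \<alpha>] E_comb_right[OF \<alpha> g] E_br[OF \<alpha> g] in auto)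
  show thesis by (rule that[OF \<gamma>(1)]) (use \<gamma>(2)[of "[_]", unfolded good_1] in auto)
qed

lemma R_form_exists:
  obtains F where "F \<in> forms A K 2"
    "\<And>X Y \<xi>. X \<in> VF \<Longrightarrow> Y \<in> VF \<Longrightarrow> \<xi> \<in> \<Gamma> \<Longrightarrow> br (F [X, Y]) \<xi> = (\<lambda>p. - R X Y \<xi> p)"
proof -
  have g: "Xs ! 0 \<in> VF" "Xs ! 1 \<in> VF" if "good 2 Xs" for Xs using that by (auto simp: good_2)
  obtain F where F: "F \<in> forms A K 2"
    "\<And>Xs \<xi>. good 2 Xs \<Longrightarrow> \<xi> \<in> \<Gamma> \<Longrightarrow> br (F Xs) \<xi> = (\<lambda>p. - R (Xs ! 0) (Xs ! 1) \<xi> p)"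
  proof (rule form_exists[where T = "\<lambda>Xs \<xi> p. - R (Xs ! 0) (Xs ! 1) \<xi> p" and q = 2])
    show "(\<lambda>p. - R (Xs ! 0) (Xs ! 1) \<xi> p) \<in> \<Gamma>" for Xs \<xi> by (rule \<Gamma>_minus[OF R_\<Gamma>])
    show "(\<lambda>p. - R (Xs ! 0) (Xs ! 1) (\<lambda>p. f p *\<^sub>R \<xi> p + k p *\<^sub>R \<eta> p) p) =
        (\<lambda>p. f p *\<^sub>R - R (Xs ! 0) (Xs ! 1) \<xi> p + k p *\<^sub>R - R (Xs ! 0) (Xs ! 1) \<eta> p)"
      if "good 2 Xs" "\<xi> \<in> \<Gamma>" "\<eta> \<in> \<Gamma>" "f \<in> Cinf A" "k \<in> Cinf A" for Xs \<xi> \<eta> f k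
      unfolding R_comb_right[OF g[OF that(1)] that(4,5,2,3)] by simp
    show "(\<lambda>p. - R (Xs ! 0) (Xs ! 1) (br \<xi> \<eta>) p) =
        (\<lambda>p. br (\<lambda>p. - R (Xs ! 0) (Xs ! 1) \<xi> p) \<eta> p + br \<xi> (\<lambda>p. - R (Xs ! 0) (Xs ! 1) \<eta> p) p)"
      if "good 2 Xs" "\<xi> \<in> \<Gamma>" "\<eta> \<in> \<Gamma>" for Xs \<xi> \<eta>
      unfolding R_br[OF g[OF that(1)] that(2,3)] br_minus[OF \<Gamma>S[OF that(2)] \<Gamma>S[OF R_\<Gamma>]]
        br_minus'[OF \<Gamma>S[OF that(3)] \<Gamma>S[OF R_\<Gamma>]] by simp
    fix Xs X Y f k \<xi> and i :: nat assume gd: "good 2 Xs" "i < 2" and a: "X \<in> VF" "Y \<in> VF" and f: "f \<in> Cinf A" "k \<in> Cinf A" and \<xi>: "\<xi> \<in> \<Gamma>"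
    obtain U V where U: "U \<in> VF" "V \<in> VF" "Xs = [U, V]" using gd by (auto simp: good_2)
    have "i = 0 \<or> i = 1" using gd(2) by auto
    then show "(\<lambda>p. - R (Xs[i := (\<lambda>p h. f p * X p h + k p * Y p h)] ! 0) (Xs[i := (\<lambda>p h. f p * X p h + k p * Y p h)] ! 1) \<xi> p) =
        (\<lambda>p. f p *\<^sub>R - R (Xs[i := X] ! 0) (Xs[i := X] ! 1) \<xi> p + k p *\<^sub>R - R (Xs[i := Y] ! 0) (Xs[i := Y] ! 1) \<xi> p)"
    proof
      assume "i = 0"
      then show ?thesis using R_comb_left[OF a U(2) f \<xi>] by (simp add: U(3))
    next
      assume "i = 1"
      then show ?thesis
        using R_comb_left[OF a U(1) f \<xi>] R_anti[OF U(1) vf_comb[OF f a] \<xi>] R_anti[OF U(1) a(1) \<xi>] R_anti[OF U(1) a(2) \<xi>]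
        by (simp add: U(3) add.commute)
    qed
  next
    fix Xs \<xi> and i j :: nat assume "good 2 Xs" "i < 2" "j < 2" "i \<noteq> j" "Xs ! i = Xs ! j" and \<xi>: "\<xi> \<in> \<Gamma>"
    then have "Xs ! 0 = Xs ! 1" by (auto simp: less_2_cases_iff)
    then show "(\<lambda>p. - R (Xs ! 0) (Xs ! 1) \<xi> p) = (\<lambda>p. 0)" using R_self[OF \<xi>] by simp
  qed blast
  show thesis by (rule that[OF F(1)]) (use F(2)[of "[_, _]"] in \<open>auto simp: good_2\<close>)
qed

end

context ideal_bundle
begin

lemma lie_der_1: "X \<in> VF \<Longrightarrow> lie_der A \<alpha> \<gamma> [X] p = br \<alpha> (\<gamma> [X]) p - \<gamma> [L \<alpha> X] p"
  using lie_der_good[of "[X]" \<alpha> \<gamma>] by simp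

lemma lie_der_2: "X \<in> VF \<Longrightarrow> Y \<in> VF \<Longrightarrow>
    lie_der A \<alpha> \<gamma> [X, Y] p = br \<alpha> (\<gamma> [X, Y]) p - (\<gamma> [L \<alpha> X, Y] p + \<gamma> [X, L \<alpha> Y] p)"
  using lie_der_good[of "[X, Y]" \<alpha> \<gamma>] by (simp add: lessThan_Suc add.commute)

lemma forms_1_bad: "\<gamma> \<in> forms A K 1 \<Longrightarrow> (\<And>X. X \<in> VF \<Longrightarrow> Xs \<noteq> [X]) \<Longrightarrow> \<gamma> Xs = (\<lambda>p. 0)"
  by (rule forms_bad[of \<gamma> 1]) (auto simp only: good_1)

lemma forms_0: "\<gamma> \<in> forms_pred A K 1 \<longleftrightarrow> \<gamma> [] \<in> \<Gamma> \<and> (\<forall>Xs. Xs \<noteq> [] \<longrightarrow> \<gamma> Xs = (\<lambda>p. 0))"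
proof
  assume "\<gamma> \<in> forms_pred A K 1"
  then have "\<gamma> \<in> forms A K 0" by (simp add: forms_pred_def)
  then show "\<gamma> [] \<in> \<Gamma> \<and> (\<forall>Xs. Xs \<noteq> [] \<longrightarrow> \<gamma> Xs = (\<lambda>p. 0))"
    using forms_\<Gamma> forms_bad[of \<gamma> 0] by (auto simp: good_def)
next
  assume "\<gamma> [] \<in> \<Gamma> \<and> (\<forall>Xs. Xs \<noteq> [] \<longrightarrow> \<gamma> Xs = (\<lambda>p. 0))"
  moreover have "good 0 Xs \<longleftrightarrow> Xs = []" for Xs by (auto simp: good_def)
  ultimately have "\<gamma> \<in> forms A K 0" by (intro formsI) auto
  then show "\<gamma> \<in> forms_pred A K 1" by (simp add: forms_pred_def)
qed

lemma bundle_map_of_eq: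
  assumes v: "\<And>\<alpha> \<beta> f g. \<alpha> \<in> S \<Longrightarrow> \<beta> \<in> S \<Longrightarrow> f \<in> Cinf A \<Longrightarrow> g \<in> Cinf A \<Longrightarrow>
      v (\<lambda>p. f p *\<^sub>R \<alpha> p + g p *\<^sub>R \<beta> p) [] = (\<lambda>p. f p *\<^sub>R v \<alpha> [] p + g p *\<^sub>R v \<beta> [] p)"
    and \<alpha>: "\<alpha> \<in> S"
  shows "bundle_map_of A v p (\<alpha> p) = v \<alpha> [] p"
proof -
  let ?\<beta> = "SOME \<beta>. \<beta> \<in> S \<and> \<beta> p = \<alpha> p"
  have \<beta>: "?\<beta> \<in> S \<and> ?\<beta> p = \<alpha> p" by (rule someI[of "\<lambda>\<beta>. \<beta> \<in> S \<and> \<beta> p = \<alpha> p" \<alpha>]) (simp add: \<alpha>)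
  have "v ?\<beta> [] p = v \<alpha> [] p"
    by (rule full.tensorial[of "\<lambda>\<alpha>. v \<alpha> []"]) (use v \<alpha> \<beta> in \<open>simp_all add: sub_sections_fibre\<close>)
  then show ?thesis using sections_fibre[OF \<alpha>] by (simp add: bundle_map_of_def)
qed

end

context ideal_connection
begin

lemma d_conn_1:
  assumes "X \<in> VF" "Y \<in> VF"
  shows "d_conn A D \<gamma> [X, Y] p = D X (\<gamma> [Y]) p - D Y (\<gamma> [X]) p - \<gamma> [vb X Y] p"
  using assms by (simp add: d_conn_def lessThan_Suc omit_def)

lemma d_conn_2:
  assumes "X \<in> VF" "Y \<in> VF" "Z \<in> VF"
  shows "d_conn A D \<gamma> [X, Y, Z] p = D X (\<gamma> [Y, Z]) p - D Y (\<gamma> [X, Z]) p + D Z (\<gamma> [X, Y]) p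
    - \<gamma> [vb X Y, Z] p + \<gamma> [vb X Z, Y] p - \<gamma> [vb Y Z, X] p"
  using assms by (simp add: d_conn_def lessThan_Suc omit_def algebra_simps)

lemma d_conn_bad:
  assumes \<gamma>: "\<gamma> \<in> forms A K q" and Xs: "\<not> good (Suc q) Xs"
  shows "d_conn A D \<gamma> Xs = (\<lambda>p. 0)"
proof (cases "set Xs \<subseteq> VF")
  case True
  then have len: "length Xs \<noteq> Suc q" using Xs by (simp add: good_def)
  have 1: "D (Xs ! i) (\<gamma> (omit i Xs)) p = 0" if "i < length Xs" for i p
  proof -
    have "\<gamma> (omit i Xs) = (\<lambda>p. 0)"
      using that len by (intro forms_bad[OF \<gamma>]) (auto simp: good_def length_omit)
    then show ?thesis using D_zero[OF subsetD[OF True nth_mem[OF that]]] by simp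
  qed
  have 2: "\<gamma> (vb (Xs ! i) (Xs ! j) # omit i (omit j Xs)) p = 0" if "j < length Xs" "i < j" for i j p
  proof -
    have "length (omit i (omit j Xs)) = length Xs - 2" using that by (simp add: length_omit)
    then have "\<gamma> (vb (Xs ! i) (Xs ! j) # omit i (omit j Xs)) = (\<lambda>p. 0)"
      using that len by (intro forms_bad[OF \<gamma>]) (auto simp: good_def)
    then show ?thesis by simp
  qed
  show ?thesis using True 1 2 by (intro ext) (simp add: d_conn_def)
qed (auto simp: d_conn_def)

text \<open>\<open>F\<close> is minus the curvature tensor, viewed as a section of \<open>K\<close> through the adjoint representation.\<close>

lemma d_conn_eq_lie_der:
  assumes F: "F \<in> forms A K 2"
    and FR: "\<And>X Y \<xi>. X \<in> VF \<Longrightarrow> Y \<in> VF \<Longrightarrow> \<xi> \<in> \<Gamma> \<Longrightarrow> br (F [X, Y]) \<xi> = (\<lambda>p. - R X Y \<xi> p)"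
    and C: "C \<in> forms A K 1" and CE: "\<And>X \<xi>. X \<in> VF \<Longrightarrow> \<xi> \<in> \<Gamma> \<Longrightarrow> br (C [X]) \<xi> = E \<alpha> X \<xi>"
    and \<alpha>: "\<alpha> \<in> S"
  shows "d_conn A D C = lie_der A \<alpha> F"
proof
  fix Xs
  show "d_conn A D C Xs = lie_der A \<alpha> F Xs"
  proof (cases "good 2 Xs")
    case False
    then have "\<not> good (Suc 1) Xs" by (simp add: numeral_2_eq_2)
    then show ?thesis using d_conn_bad[OF C] lie_der_bad[OF F \<alpha> False] by simp
  next
    case True
    then obtain X Y where X: "X \<in> VF" and Y: "Y \<in> VF" and Xs: "Xs = [X, Y]" by (auto simp: good_2)
    note C\<Gamma> = forms_\<Gamma>[OF C] and F\<Gamma> = forms_\<Gamma>[OF F]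
    note LX = L_VF[OF \<alpha> X] and LY = L_VF[OF \<alpha> Y] and XY = vf_bracket_vf[OF X Y]
    have l: "d_conn A D C [X, Y] = (\<lambda>p. D X (C [Y]) p - D Y (C [X]) p - C [vb X Y] p)"
      using d_conn_1[OF X Y] by (intro ext)
    have r: "lie_der A \<alpha> F [X, Y] = (\<lambda>p. br \<alpha> (F [X, Y]) p - (F [L \<alpha> X, Y] p + F [X, L \<alpha> Y] p))"
      using lie_der_2[OF X Y] by (intro ext)
    show ?thesis
      unfolding Xs l r
    proof (rule br_eqI)
      show "(\<lambda>p. D X (C [Y]) p - D Y (C [X]) p - C [vb X Y] p) \<in> \<Gamma>" by (intro \<Gamma>_diff D_\<Gamma> C\<Gamma>)
      show "(\<lambda>p. br \<alpha> (F [X, Y]) p - (F [L \<alpha> X, Y] p + F [X, L \<alpha> Y] p)) \<in> \<Gamma>" by (intro \<Gamma>_diff \<Gamma>_add br_\<Gamma> \<alpha> F\<Gamma>)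
      fix \<xi> assume \<xi>: "\<xi> \<in> \<Gamma>"
      note \<xi>S = \<Gamma>S[OF \<xi>]
      \<comment> \<open>Since \<open>D\<close> preserves brackets, bracketing with
        \<open>D X (C [Y])\<close> is the commutator of \<open>D X\<close> with bracketing by
        \<open>C [Y]\<close>.\<close>
      have DC: "br (D X (C [Y])) \<xi> p = D X (E \<alpha> Y \<xi>) p - E \<alpha> Y (D X \<xi>) p" if "X \<in> VF" "Y \<in> VF" for X Y p
        using D_br[OF that(1) C\<Gamma>[of "[Y]"] \<xi>] CE[OF that(2) \<xi>] CE[OF that(2) D_\<Gamma>, of X \<xi>] by simp
      have BF: "br (br \<alpha> (F [X, Y])) \<xi> p = R X Y (br \<alpha> \<xi>) p - br \<alpha> (R X Y \<xi>) p" for p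
        using fun_cong[OF br_jacobi[OF \<alpha> \<Gamma>S[OF F\<Gamma>[of "[X, Y]"]] \<xi>S], of p]
        unfolding FR[OF X Y \<xi>] FR[OF X Y br_\<Gamma>[OF \<alpha> \<xi>]] br_minus[OF \<alpha> \<Gamma>S[OF R_\<Gamma>]]
        by (simp add: algebra_simps)
      have "br (\<lambda>p. D X (C [Y]) p - D Y (C [X]) p - C [vb X Y] p) \<xi> =
          (\<lambda>p. br (D X (C [Y])) \<xi> p - br (D Y (C [X])) \<xi> p - br (C [vb X Y]) \<xi> p)"
        by (simp add: br_diff' closed C\<Gamma> \<xi> \<xi>S)
      also have "\<dots> = (\<lambda>p. br (br \<alpha> (F [X, Y])) \<xi> p - (br (F [L \<alpha> X, Y]) \<xi> p + br (F [X, L \<alpha> Y]) \<xi> p))"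
        unfolding DC[OF X Y] DC[OF Y X] CE[OF XY \<xi>] BF FR[OF LX Y \<xi>] FR[OF X LY \<xi>]
        using curvature_identity[OF \<alpha> X Y \<xi>] by (intro ext) simp
      also have "\<dots> = br (\<lambda>p. br \<alpha> (F [X, Y]) p - (F [L \<alpha> X, Y] p + F [X, L \<alpha> Y] p)) \<xi>"
        by (simp add: br_diff' br_add' closed F\<Gamma> \<xi> \<xi>S \<alpha>)
      finally show "br (\<lambda>p. D X (C [Y]) p - D Y (C [X]) p - C [vb X Y] p) \<xi> =
          br (\<lambda>p. br \<alpha> (F [X, Y]) p - (F [L \<alpha> X, Y] p + F [X, L \<alpha> Y] p)) \<xi>" .
    qed
  qed
qed

lemma d_conn_curvature:
  assumes F: "F \<in> forms A K 2"
    and FR: "\<And>X Y \<xi>. X \<in> VF \<Longrightarrow> Y \<in> VF \<Longrightarrow> \<xi> \<in> \<Gamma> \<Longrightarrow> br (F [X, Y]) \<xi> = (\<lambda>p. - R X Y \<xi> p)"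
  shows "d_conn A D F = zero_form"
proof
  fix Xs
  show "d_conn A D F Xs = zero_form Xs"
  proof (cases "good 3 Xs")
    case False
    then have "\<not> good (Suc 2) Xs" by (simp add: numeral_3_eq_3)
    then show ?thesis using d_conn_bad[OF F] by (simp add: zero_form_def)
  next
    case True
    then obtain X Y Z where X: "X \<in> VF" and Y: "Y \<in> VF" and Z: "Z \<in> VF" and Xs: "Xs = [X, Y, Z]" by (auto simp: good_3)
    note F\<Gamma> = forms_\<Gamma>[OF F]
    note XY = vf_bracket_vf[OF X Y] and XZ = vf_bracket_vf[OF X Z] and YZ = vf_bracket_vf[OF Y Z]
    let ?d = "\<lambda>p. D X (F [Y, Z]) p - D Y (F [X, Z]) p + D Z (F [X, Y]) p - F [vb X Y, Z] p + F [vb X Z, Y] p - F [vb Y Z, X] p"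
    have d: "d_conn A D F [X, Y, Z] = ?d" using d_conn_2[OF X Y Z] by (intro ext)
    have "?d = (\<lambda>p. 0)"
    proof (rule centre_zero)
      show "?d \<in> \<Gamma>" by (intro \<Gamma>_diff \<Gamma>_add D_\<Gamma> F\<Gamma>)
      fix \<xi> assume \<xi>: "\<xi> \<in> \<Gamma>"
      note \<xi>S = \<Gamma>S[OF \<xi>]
      \<comment> \<open>The same commutator rule, now for the bracket with \<open>F [Y, Z]\<close>,
        which is minus the curvature operator.\<close>
      have DF: "br (D X (F [Y, Z])) \<xi> p = - (D X (R Y Z \<xi>) p - R Y Z (D X \<xi>) p)"
        if "X \<in> VF" "Y \<in> VF" "Z \<in> VF" for X Y Z p
        using D_br[OF that(1) F\<Gamma>[of "[Y, Z]"] \<xi>] FR[OF that(2,3) \<xi>] FR[OF that(2,3) D_\<Gamma>, of X \<xi>]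
          D_minus[OF that(1) R_\<Gamma>[of Y Z \<xi>]] by (simp add: fun_eq_iff algebra_simps)
      have "br ?d \<xi> = (\<lambda>p. br (D X (F [Y, Z])) \<xi> p - br (D Y (F [X, Z])) \<xi> p + br (D Z (F [X, Y])) \<xi> p
          - br (F [vb X Y, Z]) \<xi> p + br (F [vb X Z, Y]) \<xi> p - br (F [vb Y Z, X]) \<xi> p)"
        by (simp add: br_diff' br_add' closed F\<Gamma> \<xi> \<xi>S)
      also have "\<dots> = (\<lambda>p. 0)"
        unfolding DF[OF X Y Z] DF[OF Y X Z] DF[OF Z X Y] FR[OF XY Z \<xi>] FR[OF XZ Y \<xi>] FR[OF YZ X \<xi>]
        using bianchi_identity[OF X Y Z \<xi>] by (intro ext) (simp add: algebra_simps)
      finally show "br ?d \<xi> = (\<lambda>p. 0)" .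
    qed
    then show ?thesis by (simp add: Xs d zero_form_def)
  qed
qed

end

section \<open>IM connections: curvings and the correspondence with pairs\<close>

context semisimple_ideal_bundle
begin

context
  fixes C v :: "('m \<Rightarrow> 'a) \<Rightarrow> ('m, 'a) form"
  assumes Cv: "(C, v) \<in> IM_connections A K"
begin

lemma IMc: "(C, v) \<in> IM_forms A K 1" and v_id: "\<xi> \<in> \<Gamma> \<Longrightarrow> v \<xi> [] = \<xi>"
  using Cv by (auto simp: IM_connections_def)

lemmas IMc_W = W1D[OF IM_formsD(1)[OF IMc]]
lemmas IMc_IM = IM_formsD(2,3)[OF IMc]

lemma C_\<Gamma>: "\<alpha> \<in> S \<Longrightarrow> C \<alpha> Xs \<in> \<Gamma>"
  by (rule forms_\<Gamma>[OF IMc_W(3)])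

lemma v_\<Gamma>: "\<alpha> \<in> S \<Longrightarrow> v \<alpha> [] \<in> \<Gamma>"
  by (rule forms_pred_\<Gamma>[OF IMc_W(4)])

lemma v_comb: "\<alpha> \<in> S \<Longrightarrow> \<beta> \<in> S \<Longrightarrow> f \<in> Cinf A \<Longrightarrow> g \<in> Cinf A \<Longrightarrow>
    v (\<lambda>p. f p *\<^sub>R \<alpha> p + g p *\<^sub>R \<beta> p) [] = (\<lambda>p. f p *\<^sub>R v \<alpha> [] p + g p *\<^sub>R v \<beta> [] p)"
  by (intro ext IMc_W(6))

abbreviation "Dc \<equiv> induced_connection A K C"

lemma Dc: "\<xi> \<in> \<Gamma> \<Longrightarrow> Dc X \<xi> = C \<xi> [X]"
  by (simp add: induced_connection_def)

text \<open>The Leibniz rule of the connection is that of \<open>C\<close>: on sections of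
  \<open>K\<close> the symbol \<open>v\<close> is the identity, so the wedge term becomes X(f)
  \<xi>.\<close>

lemma induced_linear: "linear_connection A K Dc"
  unfolding linear_connection_def
proof (intro conjI ballI allI impI)
  fix X \<xi> assume "\<not> (X \<in> VF \<and> \<xi> \<in> \<Gamma>)"
  then show "Dc X \<xi> = (\<lambda>p. 0)"
    using forms_1_bad[OF IMc_W(3)[OF \<Gamma>S], of \<xi> "[X]"] by (auto simp: induced_connection_def)
next
  fix X \<xi> assume \<xi>: "\<xi> \<in> \<Gamma>"
  show "Dc X \<xi> \<in> \<Gamma>" unfolding Dc[OF \<xi>] by (rule C_\<Gamma>[OF \<Gamma>S[OF \<xi>]])
next
  fix X Y f g \<xi> assume X: "X \<in> VF" "Y \<in> VF" "f \<in> Cinf A" "g \<in> Cinf A" and \<xi>: "\<xi> \<in> \<Gamma>"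
  have "good 1 [X]" using X by (simp add: good_def)
  from forms_good(2)[OF IMc_W(3)[OF \<Gamma>S[OF \<xi>]] this _ X, of 0]
  show "Dc (\<lambda>p h. f p * X p h + g p * Y p h) \<xi> = (\<lambda>p. f p *\<^sub>R Dc X \<xi> p + g p *\<^sub>R Dc Y \<xi> p)"
    by (simp add: Dc[OF \<xi>])
next
  fix X \<xi> \<eta> assume \<xi>: "\<xi> \<in> \<Gamma>" and \<eta>: "\<eta> \<in> \<Gamma>"
  show "Dc X (\<lambda>p. \<xi> p + \<eta> p) = (\<lambda>p. Dc X \<xi> p + Dc X \<eta> p)"
    unfolding Dc[OF \<xi>] Dc[OF \<eta>] Dc[OF \<Gamma>_add[OF \<xi> \<eta>]]
    using IMc_W(5)[OF \<Gamma>S[OF \<xi>] \<Gamma>S[OF \<eta>], of 1 1 "[X]"] by (intro ext) simp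
next
  fix X \<xi> f assume X: "X \<in> VF" and \<xi>: "\<xi> \<in> \<Gamma>" and f: "f \<in> Cinf A"
  show "Dc X (\<lambda>p. f p *\<^sub>R \<xi> p) = (\<lambda>p. f p *\<^sub>R Dc X \<xi> p + X p f *\<^sub>R \<xi> p)"
    unfolding Dc[OF \<xi>] Dc[OF \<Gamma>_scale[OF f \<xi>]]
    using IMc_W(7)[OF \<Gamma>S[OF \<xi>] f, of "[X]"] X v_id[OF \<xi>] by (intro ext) (simp add: d_wedge_def omit_def)
qed

lemma induced_bracket_preserving: "bracket_preserving A K Dc"
  unfolding bracket_preserving_def
proof (intro ballI ext)
  fix X \<xi> \<eta> p assume X: "X \<in> VF" and \<xi>: "\<xi> \<in> \<Gamma>" and \<eta>: "\<eta> \<in> \<Gamma>"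
  have g: "good 1 [X]" using X by (simp add: good_def)
  note \<xi>S = \<Gamma>S[OF \<xi>] and \<eta>S = \<Gamma>S[OF \<eta>]
  show "Dc X (br \<xi> \<eta>) p = br (Dc X \<xi>) \<eta> p + br \<xi> (Dc X \<eta>) p"
    unfolding Dc[OF \<xi>] Dc[OF \<eta>] Dc[OF br_\<Gamma>[OF \<xi>S \<eta>]] IMc_IM(1)[OF \<xi>S \<eta>S]
      lie_der_\<Gamma>_section[OF IMc_W(3)[OF \<eta>S] \<xi> g] lie_der_\<Gamma>_section[OF IMc_W(3)[OF \<xi>S] \<eta> g]
      br_anti[OF \<eta>S \<Gamma>S[OF C_\<Gamma>[OF \<xi>S]]] by simp
qed

interpretation Dc: ideal_connection A K Dc
  by unfold_locales (rule induced_linear, rule induced_bracket_preserving)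

text \<open>The first IM equation for \<alpha> and a section \<xi> of \<open>K\<close>, solved for
  the bracket of C(\<alpha>)(X) with \<xi>.\<close>

lemma C_E:
  assumes \<alpha>: "\<alpha> \<in> S" and X: "X \<in> VF" and \<xi>: "\<xi> \<in> \<Gamma>"
  shows "br (C \<alpha> [X]) \<xi> = Dc.E \<alpha> X \<xi>"
proof
  fix p
  have g: "good 1 [X]" using X by (simp add: good_def)
  note \<xi>S = \<Gamma>S[OF \<xi>]
  have "C (br \<alpha> \<xi>) [X] p = (br \<alpha> (C \<xi> [X]) p - C \<xi> [L \<alpha> X] p) - br \<xi> (C \<alpha> [X]) p"
    unfolding IMc_IM(1)[OF \<alpha> \<xi>S] lie_der_1[OF X] lie_der_\<Gamma>_section[OF IMc_W(3)[OF \<alpha>] \<xi> g] ..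
  then show "br (C \<alpha> [X]) \<xi> p = Dc.E \<alpha> X \<xi> p"
    unfolding Dc.E_def Dc[OF \<xi>] Dc[OF br_\<Gamma>[OF \<alpha> \<xi>]] br_anti[OF \<Gamma>S[OF C_\<Gamma>[OF \<alpha>]] \<xi>S] by simp
qed

text \<open>The second IM equation for \<xi> in \<open>K\<close> and \<alpha>, where
  \<open>v\<close> fixes [\<xi>, \<alpha>] because this bracket lies in \<open>K\<close>.\<close>

lemma C_compat:
  assumes \<alpha>: "\<alpha> \<in> S" and \<xi>: "\<xi> \<in> \<Gamma>"
  shows "br (\<lambda>p. \<alpha> p - v \<alpha> [] p) \<xi> = Dc (rho A \<alpha>) \<xi>"
proof
  fix p
  note \<xi>S = \<Gamma>S[OF \<xi>] and vS = \<Gamma>S[OF v_\<Gamma>[OF \<alpha>]]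
  have "lie_der A \<xi> (v \<alpha>) [] p = br \<xi> (v \<alpha> []) p" by (simp add: lie_der_def)
  then have "br \<xi> \<alpha> p = br \<xi> (v \<alpha> []) p - C \<xi> [rho A \<alpha>] p"
    using IMc_IM(2)[OF \<xi>S \<alpha>, of "[]" p] v_id[OF br_\<Gamma>'[OF \<xi> \<alpha>]] by simp
  then show "br (\<lambda>p. \<alpha> p - v \<alpha> [] p) \<xi> p = Dc (rho A \<alpha>) \<xi> p"
    unfolding Dc[OF \<xi>] br_diff'[OF \<xi>S \<alpha> vS] br_anti[OF \<alpha> \<xi>S] br_anti[OF vS \<xi>S] by simp
qed

lemma curving_exists:
  obtains F where "is_curving A K (C, v) F" "three_curvature A K (C, v) F = zero_form"
proof -
  obtain F where F: "F \<in> forms A K 2"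
    and FR: "\<And>X Y \<xi>. X \<in> VF \<Longrightarrow> Y \<in> VF \<Longrightarrow> \<xi> \<in> \<Gamma> \<Longrightarrow> br (F [X, Y]) \<xi> = (\<lambda>p. - Dc.R X Y \<xi> p)"
    using Dc.R_form_exists by blast
  have 1: "d_conn A Dc (C \<alpha>) = lie_der A \<alpha> F" if "\<alpha> \<in> S" for \<alpha>
    by (rule Dc.d_conn_eq_lie_der[OF F FR IMc_W(3)[OF that] C_E[OF that] that])
  have 2: "C (\<lambda>p. \<alpha> p - v \<alpha> [] p) = contract (rho A \<alpha>) F" if \<alpha>: "\<alpha> \<in> S" for \<alpha>
  proof
    fix Xs
    let ?h = "\<lambda>p. \<alpha> p - v \<alpha> [] p"
    have h: "?h \<in> S" by (rule S_diff[OF \<alpha> \<Gamma>S[OF v_\<Gamma>[OF \<alpha>]]])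
    note a = rho_VF[OF \<alpha>]
    have rh: "rho A ?h = rho A \<alpha>"
      using rho_comb[OF \<alpha> \<Gamma>S[OF v_\<Gamma>[OF \<alpha>]], of "\<lambda>p. 1" "\<lambda>p. -1"] rho_\<Gamma>[OF v_\<Gamma>[OF \<alpha>]] by simp
    show "C ?h Xs = contract (rho A \<alpha>) F Xs"
    proof (cases "good 1 Xs")
      case False
      then have "\<not> good 2 (rho A \<alpha> # Xs)" by (auto simp: good_def)
      then show ?thesis using forms_bad[OF F] forms_bad[OF IMc_W(3)[OF h] False] by (simp add: contract_def)
    next
      case True
      then obtain X where X: "X \<in> VF" and Xs: "Xs = [X]" unfolding good_1 by blast
      show ?thesis
        unfolding Xs contract_def
      proof (rule br_eqI[OF C_\<Gamma>[OF h] forms_\<Gamma>[OF F]])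
        fix \<xi> assume \<xi>: "\<xi> \<in> \<Gamma>"
        \<comment> \<open>On horizontal sections the bracket with \<xi> is the covariant derivative
          along \<rho>(\<alpha>), which turns the commutator in \<open>E\<close> into curvature. The
          order of the arguments accounts for the sign of \<open>F\<close>.\<close>
        have "Dc.E ?h X \<xi> = Dc.R X (rho A \<alpha>) \<xi>"
          unfolding Dc.E_def Dc.R_def rh C_compat[OF \<alpha> \<xi>] C_compat[OF \<alpha> Dc.D_\<Gamma>]
            vf_bracket_anti[of X "rho A \<alpha>"] Dc.D_left_minus[OF L_VF[OF \<alpha> X] \<xi>] by simp
        then show "br (C ?h [X]) \<xi> = br (F [rho A \<alpha>, X]) \<xi>"
          unfolding C_E[OF h X \<xi>] FR[OF a X \<xi>] using Dc.R_anti[OF X a \<xi>] by simp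
      qed
    qed
  qed
  have "is_curving A K (C, v) F"
    using F 1 2 by (auto simp: is_curving_def IM_curvature_def delta0_def fun_eq_iff)
  moreover have "three_curvature A K (C, v) F = zero_form"
    unfolding three_curvature_def fst_conv by (rule Dc.d_conn_curvature[OF F FR])
  ultimately show thesis by (rule that)
qed

lemma curving_unique: "is_curving A K (C, v) F \<Longrightarrow> is_curving A K (C, v) F' \<Longrightarrow> F = F'"
  using inj_onD[OF delta0_inj[of 2]] by (auto simp: is_curving_def)

lemma bm: "\<alpha> \<in> S \<Longrightarrow> bundle_map_of A v p (\<alpha> p) = v \<alpha> [] p"
  by (rule bundle_map_of_eq[of v, OF v_comb])

lemma bundle_map_splitting: "splitting A K (bundle_map_of A v)"
  unfolding splitting_def
proof (intro conjI allI impI ballI)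
  let ?w = "bundle_map_of A v"
  have sec: "\<exists>\<alpha>\<in>S. \<alpha> p = u" if "u \<in> fibre A p" for p u
    using full.section_through[OF that] sub_sections_fibre by metis
  show "?w p u = 0" if "u \<notin> fibre A p" for p u using that by (simp add: bundle_map_of_def)
  show "?w p u \<in> K p" if "u \<in> fibre A p" for p u
    using sec[OF that] bm \<Gamma>_K[OF v_\<Gamma>] by metis
  show "?w p (a *\<^sub>R u + b *\<^sub>R w) = a *\<^sub>R ?w p u + b *\<^sub>R ?w p w" if u: "u \<in> fibre A p" and w: "w \<in> fibre A p" for p u w a b
  proof -
    obtain \<alpha> \<beta> where \<alpha>: "\<alpha> \<in> S" "\<alpha> p = u" and \<beta>: "\<beta> \<in> S" "\<beta> p = w" using sec[OF u] sec[OF w] by blast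
    have "?w p ((\<lambda>p. a *\<^sub>R \<alpha> p + b *\<^sub>R \<beta> p) p) = a *\<^sub>R v \<alpha> [] p + b *\<^sub>R v \<beta> [] p"
      unfolding bm[OF S_comb[OF Cinf_const Cinf_const \<alpha>(1) \<beta>(1)]] v_comb[OF \<alpha>(1) \<beta>(1) Cinf_const Cinf_const] ..
    then show ?thesis using bm[OF \<alpha>(1), of p] bm[OF \<beta>(1), of p] \<alpha>(2) \<beta>(2) by simp
  qed
  show "(\<lambda>p. ?w p (\<alpha> p)) \<in> \<Gamma>" if "\<alpha> \<in> S" for \<alpha> using bm[OF that] v_\<Gamma>[OF that] by simp
  show "?w p u = u" if u: "u \<in> K p" for p u
  proof -
    obtain \<xi> where "\<xi> \<in> \<Gamma>" "\<xi> p = u" using section_through[OF u] by blast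
    then show ?thesis using bm[OF \<Gamma>S, of \<xi> p] v_id by simp
  qed
qed

lemma induced_compatible: "compatible A K (bundle_map_of A v) Dc"
  unfolding compatible_def using C_compat by (simp add: bm)

end

text \<open>By \<open>C_E\<close> the adjoint action of C(\<alpha>)(X) depends on the induced
  connection only, and an element of \<open>K\<close> is determined by its adjoint action. The
  0-forms v(\<alpha>) are read off the bundle map.\<close>

lemma IM_connection_determined:
  assumes C: "(C, v) \<in> IM_connections A K" and C': "(C', v') \<in> IM_connections A K"
    and bmeq: "bundle_map_of A v = bundle_map_of A v'" and D: "induced_connection A K C = induced_connection A K C'"
  shows "C = C' \<and> v = v'"
proof -
  interpret Dc: ideal_connection A K "induced_connection A K C"
    by unfold_locales (rule induced_linear[OF C], rule induced_bracket_preserving[OF C])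
  note w = IMc_W[OF C] and w' = IMc_W[OF C']
  have CE': "br (C' \<alpha> [X]) \<xi> = Dc.E \<alpha> X \<xi>" if "\<alpha> \<in> S" "X \<in> VF" "\<xi> \<in> \<Gamma>" for \<alpha> X \<xi>
    using C_E[OF C' that] unfolding D .
  have "C \<alpha> = C' \<alpha>" for \<alpha>
  proof (cases "\<alpha> \<in> S")
    case \<alpha>: True
    show ?thesis
    proof
      fix Xs
      show "C \<alpha> Xs = C' \<alpha> Xs"
      proof (cases "good 1 Xs")
        case True
        then obtain X where X: "X \<in> VF" "Xs = [X]" unfolding good_1 by blast
        show ?thesis unfolding X(2)
          by (rule br_eqI[OF C_\<Gamma>[OF C \<alpha>] C_\<Gamma>[OF C' \<alpha>]]) (simp add: C_E[OF C \<alpha> X(1)] CE'[OF \<alpha> X(1)])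
      next
        case False
        then show ?thesis using forms_bad[OF w(3)[OF \<alpha>]] forms_bad[OF w'(3)[OF \<alpha>]] by simp
      qed
    qed
  qed (simp add: w w')
  moreover have "v \<alpha> = v' \<alpha>" for \<alpha>
  proof (cases "\<alpha> \<in> S")
    case \<alpha>: True
    show ?thesis
    proof
      fix Xs
      have "v \<alpha> [] p = v' \<alpha> [] p" for p using bmeq[THEN fun_cong, THEN fun_cong, of p "\<alpha> p"] by (simp add: bm[OF C \<alpha>] bm[OF C' \<alpha>])
      then show "v \<alpha> Xs = v' \<alpha> Xs"
        using w(4)[OF \<alpha>] w'(4)[OF \<alpha>] unfolding forms_0 by (cases "Xs = []") auto
    qed
  qed (simp add: w w')
  ultimately show ?thesis by (simp add: fun_eq_iff)
qed

text \<open>Everything is verified after bracketing with sections of \<open>K\<close>: the Leibniz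
  rule by \<open>E_comb_section\<close> and compatibility, the first IM equation by
  \<open>E_bracket\<close>, the second by compatibility. The third holds for degree reasons, as
  v(\<alpha>) is a 0-form.\<close>

lemma IM_connection_exists:
  assumes v: "splitting A K v" and D: "linear_connection A K D" "bracket_preserving A K D"
    and comp: "compatible A K v D"
  obtains C v' where "(C, v') \<in> IM_connections A K" "bundle_map_of A v' = v" "induced_connection A K C = D"
proof -
  interpret ideal_connection A K D by unfold_locales (rule D)+
  have v0: "v p u = 0" if "u \<notin> fibre A p" for p u
    by (rule v[unfolded splitting_def, THEN conjunct1, rule_format, OF that])
  have vlin: "v p (a *\<^sub>R u + b *\<^sub>R w) = a *\<^sub>R v p u + b *\<^sub>R v p w" if "u \<in> fibre A p" "w \<in> fibre A p" for p u w a b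
    by (rule v[unfolded splitting_def, THEN conjunct2, THEN conjunct2, THEN conjunct1, rule_format, OF that])
  have v\<Gamma>: "(\<lambda>p. v p (\<alpha> p)) \<in> \<Gamma>" if "\<alpha> \<in> S" for \<alpha>
    by (rule v[unfolded splitting_def, THEN conjunct2, THEN conjunct2, THEN conjunct2, THEN conjunct1, rule_format, OF that])
  have vK: "v p u = u" if "u \<in> K p" for p u
    by (rule v[unfolded splitting_def, THEN conjunct2, THEN conjunct2, THEN conjunct2, THEN conjunct2, rule_format, OF that])
  have cmp: "D (rho A \<alpha>) \<xi> = (\<lambda>p. br \<alpha> \<xi> p - br (\<lambda>p. v p (\<alpha> p)) \<xi> p)" if \<alpha>: "\<alpha> \<in> S" and \<xi>: "\<xi> \<in> \<Gamma>" for \<alpha> \<xi>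
    using comp[unfolded compatible_def, rule_format, OF \<alpha> \<xi>] br_diff'[OF \<Gamma>S[OF \<xi>] \<alpha> \<Gamma>S[OF v\<Gamma>[OF \<alpha>]]] by simp
  have "\<exists>\<gamma>. \<gamma> \<in> forms A K 1 \<and> (\<forall>X\<in>VF. \<forall>\<xi>\<in>\<Gamma>. br (\<gamma> [X]) \<xi> = E \<alpha> X \<xi>)" if \<alpha>: "\<alpha> \<in> S" for \<alpha>
    using E_form_exists[OF \<alpha>] by metis
  then obtain C0 where C0: "\<And>\<alpha>. \<alpha> \<in> S \<Longrightarrow> C0 \<alpha> \<in> forms A K 1"
    "\<And>\<alpha> X \<xi>. \<alpha> \<in> S \<Longrightarrow> X \<in> VF \<Longrightarrow> \<xi> \<in> \<Gamma> \<Longrightarrow> br (C0 \<alpha> [X]) \<xi> = E \<alpha> X \<xi>" by metis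
  define C where "C \<alpha> = (if \<alpha> \<in> S then C0 \<alpha> else zero_form)" for \<alpha>
  define v' where "v' \<alpha> = (if \<alpha> \<in> S then (\<lambda>Xs. if Xs = [] then (\<lambda>p. v p (\<alpha> p)) else (\<lambda>p. 0)) else zero_form)" for \<alpha>
  have Cf: "C \<alpha> \<in> forms A K 1" and CE: "\<And>X \<xi>. X \<in> VF \<Longrightarrow> \<xi> \<in> \<Gamma> \<Longrightarrow> br (C \<alpha> [X]) \<xi> = E \<alpha> X \<xi>" if "\<alpha> \<in> S" for \<alpha>
    using that C0 by (simp_all add: C_def)
  have C\<Gamma>: "C \<alpha> Xs \<in> \<Gamma>" if "\<alpha> \<in> S" for \<alpha> Xs by (rule forms_\<Gamma>[OF Cf[OF that]])
  have v'0: "v' \<alpha> [] = (\<lambda>p. v p (\<alpha> p))" if "\<alpha> \<in> S" for \<alpha> using that by (simp add: v'_def)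
  have v'f: "v' \<alpha> \<in> forms_pred A K 1" if "\<alpha> \<in> S" for \<alpha>
    unfolding forms_0 using that v\<Gamma>[OF that] by (simp add: v'_def)
  have v'1: "v' \<alpha> Xs = (\<lambda>p. 0)" if "Xs \<noteq> []" for \<alpha> Xs using that by (simp add: v'_def zero_form_def)
  have Ccomb: "C (\<lambda>p. f p *\<^sub>R \<alpha> p + g p *\<^sub>R \<beta> p) Xs p = f p *\<^sub>R C \<alpha> Xs p + g p *\<^sub>R C \<beta> Xs p
      + (d_wedge A f (v' \<alpha>) Xs p + d_wedge A g (v' \<beta>) Xs p)"
    if \<alpha>: "\<alpha> \<in> S" and \<beta>: "\<beta> \<in> S" and f: "f \<in> Cinf A" and g: "g \<in> Cinf A" for \<alpha> \<beta> f g Xs p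
  proof (cases "good 1 Xs")
    case False
    have "d_wedge A f (v' \<alpha>) Xs p = 0" for f \<alpha>
    proof (cases "set Xs \<subseteq> VF")
      case True
      then have "length Xs \<noteq> 1" using False by (simp add: good_def)
      then have "omit i Xs \<noteq> []" if "i < length Xs" for i using length_omit[OF that] that by auto
      then show ?thesis using True by (simp add: d_wedge_good v'1)
    qed (simp add: d_wedge_def)
    then show ?thesis
      using forms_bad[OF Cf[OF \<alpha>] False] forms_bad[OF Cf[OF \<beta>] False] forms_bad[OF Cf[OF S_comb[OF f g \<alpha> \<beta>]] False] by simp
  next
    case True
    then obtain X where X: "X \<in> VF" "Xs = [X]" unfolding good_1 by blast
    note Xf = vf_Cinf[OF X(1) f] vf_Cinf[OF X(1) g]
    note c = S_comb[OF f g \<alpha> \<beta>]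
    \<comment> \<open>The wedge of df with the 0-form v(\<alpha>) is X(f) v(\<alpha>), which is what
      the defect term of \<open>E_comb_section\<close> provides.\<close>
    have "C (\<lambda>p. f p *\<^sub>R \<alpha> p + g p *\<^sub>R \<beta> p) [X] = (\<lambda>p. (f p *\<^sub>R C \<alpha> [X] p + g p *\<^sub>R C \<beta> [X] p)
        + (X p f *\<^sub>R v p (\<alpha> p) + X p g *\<^sub>R v p (\<beta> p)))"
    proof (rule br_eqI[OF C\<Gamma>[OF c] \<Gamma>_add[OF \<Gamma>_comb[OF f g C\<Gamma>[OF \<alpha>] C\<Gamma>[OF \<beta>]] \<Gamma>_comb[OF Xf v\<Gamma>[OF \<alpha>] v\<Gamma>[OF \<beta>]]]])
      fix \<xi> assume \<xi>: "\<xi> \<in> \<Gamma>"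
      show "br (C (\<lambda>p. f p *\<^sub>R \<alpha> p + g p *\<^sub>R \<beta> p) [X]) \<xi> =
        br (\<lambda>p. (f p *\<^sub>R C \<alpha> [X] p + g p *\<^sub>R C \<beta> [X] p) + (X p f *\<^sub>R v p (\<alpha> p) + X p g *\<^sub>R v p (\<beta> p))) \<xi>"
        unfolding br_add'[OF \<Gamma>S[OF \<xi>] \<Gamma>S[OF \<Gamma>_comb[OF f g C\<Gamma>[OF \<alpha>] C\<Gamma>[OF \<beta>]]] \<Gamma>S[OF \<Gamma>_comb[OF Xf v\<Gamma>[OF \<alpha>] v\<Gamma>[OF \<beta>]]]]
          br_\<Gamma>_comb_left[OF \<xi> \<Gamma>S[OF C\<Gamma>[OF \<alpha>]] \<Gamma>S[OF C\<Gamma>[OF \<beta>]] f g]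
          br_\<Gamma>_comb_left[OF \<xi> \<Gamma>S[OF v\<Gamma>[OF \<alpha>]] \<Gamma>S[OF v\<Gamma>[OF \<beta>]] Xf]
          CE[OF c X(1) \<xi>] CE[OF \<alpha> X(1) \<xi>] CE[OF \<beta> X(1) \<xi>]
        by (intro ext) (simp add: E_comb_section[OF \<alpha> \<beta> X(1) f g \<xi>] cmp \<alpha> \<beta> \<xi>)
    qed
    then show ?thesis using X by (simp add: d_wedge_def omit_def v'0 \<alpha> \<beta>)
  qed
  have w: "(C, v') \<in> W1 A K 1"
  proof (rule W1I)
    show "C \<alpha> = zero_form" "v' \<alpha> = zero_form" if "\<alpha> \<notin> S" for \<alpha> using that by (simp_all add: C_def v'_def)
    show "C \<alpha> \<in> forms A K 1" "v' \<alpha> \<in> forms_pred A K 1" if "\<alpha> \<in> S" for \<alpha> using Cf[OF that] v'f[OF that] .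
    show "C (\<lambda>p. a *\<^sub>R \<alpha> p + b *\<^sub>R \<beta> p) Xs p = a *\<^sub>R C \<alpha> Xs p + b *\<^sub>R C \<beta> Xs p" if "\<alpha> \<in> S" "\<beta> \<in> S" for \<alpha> \<beta> a b Xs p
      using Ccomb[OF that Cinf_const Cinf_const, of a b] by (simp add: d_wedge_const)
    show "v' (\<lambda>p. f p *\<^sub>R \<alpha> p + g p *\<^sub>R \<beta> p) Xs p = f p *\<^sub>R v' \<alpha> Xs p + g p *\<^sub>R v' \<beta> Xs p"
      if "\<alpha> \<in> S" "\<beta> \<in> S" "f \<in> Cinf A" "g \<in> Cinf A" for \<alpha> \<beta> f g Xs p
      using that S_comb[OF that(3,4,1,2)] vlin[OF sections_fibre[OF that(1)] sections_fibre[OF that(2)]]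
      by (simp add: v'_def)
    show "C (\<lambda>p. f p *\<^sub>R \<alpha> p) Xs p = f p *\<^sub>R C \<alpha> Xs p + d_wedge A f (v' \<alpha>) Xs p"
      if "\<alpha> \<in> S" "f \<in> Cinf A" for \<alpha> f Xs p
      using Ccomb[OF that(1,1,2) Cinf_const[of 0]] by (simp add: d_wedge_const)
  qed
  have "(C, v') \<in> IM_forms A K 1"
  proof (rule IM_formsI[OF w])
    fix \<alpha> \<beta> Xs p assume \<alpha>: "\<alpha> \<in> S" and \<beta>: "\<beta> \<in> S"
    note ab = br_S[OF \<alpha> \<beta>]
    show "C (br \<alpha> \<beta>) Xs p = lie_der A \<alpha> (C \<beta>) Xs p - lie_der A \<beta> (C \<alpha>) Xs p"
    proof (cases "good 1 Xs")
      case False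
      then show ?thesis
        using forms_bad[OF Cf[OF ab]] lie_der_bad[OF Cf[OF \<beta>] \<alpha>] lie_der_bad[OF Cf[OF \<alpha>] \<beta>] by simp
    next
      case True
      then obtain X where X: "X \<in> VF" and Xs: "Xs = [X]" unfolding good_1 by blast
      note LX = L_VF[OF \<alpha> X] L_VF[OF \<beta> X]
      have "C (br \<alpha> \<beta>) [X] = (\<lambda>p. (br \<alpha> (C \<beta> [X]) p - C \<beta> [L \<alpha> X] p) - (br \<beta> (C \<alpha> [X]) p - C \<alpha> [L \<beta> X] p))"
      proof (rule br_eqI[OF C\<Gamma>[OF ab]])
        show "(\<lambda>p. (br \<alpha> (C \<beta> [X]) p - C \<beta> [L \<alpha> X] p) - (br \<beta> (C \<alpha> [X]) p - C \<alpha> [L \<beta> X] p)) \<in> \<Gamma>"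
          by (intro \<Gamma>_diff br_\<Gamma> C\<Gamma> \<alpha> \<beta>)
        fix \<xi> assume \<xi>: "\<xi> \<in> \<Gamma>"
        have j: "br (br \<alpha> (C \<beta> [X])) \<xi> = (\<lambda>p. br \<alpha> (E \<beta> X \<xi>) p - E \<beta> X (br \<alpha> \<xi>) p)" if \<alpha>: "\<alpha> \<in> S" and \<beta>: "\<beta> \<in> S" for \<alpha> \<beta>
          using br_jacobi[OF \<alpha> \<Gamma>S[OF C\<Gamma>[OF \<beta>]] \<Gamma>S[OF \<xi>], of "[X]"] CE[OF \<beta> X \<xi>] CE[OF \<beta> X br_\<Gamma>[OF \<alpha> \<xi>]] by (simp add: fun_eq_iff)
        have "br (\<lambda>p. (br \<alpha> (C \<beta> [X]) p - C \<beta> [L \<alpha> X] p) - (br \<beta> (C \<alpha> [X]) p - C \<alpha> [L \<beta> X] p)) \<xi> =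
            (\<lambda>p. (br (br \<alpha> (C \<beta> [X])) \<xi> p - br (C \<beta> [L \<alpha> X]) \<xi> p) - (br (br \<beta> (C \<alpha> [X])) \<xi> p - br (C \<alpha> [L \<beta> X]) \<xi> p))"
          by (simp add: br_diff' closed C\<Gamma> \<alpha> \<beta> \<xi>)
        also have "\<dots> = br (C (br \<alpha> \<beta>) [X]) \<xi>"
          unfolding j[OF \<alpha> \<beta>] j[OF \<beta> \<alpha>] CE[OF \<beta> LX(1) \<xi>] CE[OF \<alpha> LX(2) \<xi>] CE[OF ab X \<xi>]
          by (intro ext) (simp add: E_bracket[OF \<alpha> \<beta> X \<xi>])
        finally show "br (C (br \<alpha> \<beta>) [X]) \<xi> =
            br (\<lambda>p. (br \<alpha> (C \<beta> [X]) p - C \<beta> [L \<alpha> X] p) - (br \<beta> (C \<alpha> [X]) p - C \<alpha> [L \<beta> X] p)) \<xi>" ..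
      qed
      then show ?thesis unfolding Xs lie_der_1[OF X] by simp
    qed
    show "v' (br \<alpha> \<beta>) Xs p = lie_der A \<alpha> (v' \<beta>) Xs p - C \<alpha> (rho A \<beta> # Xs) p"
    proof (cases "Xs = []")
      case False
      have "v' \<beta> \<in> forms A K 0" using v'f[OF \<beta>] by (simp add: forms_pred_def)
      then have "lie_der A \<alpha> (v' \<beta>) Xs = (\<lambda>p. 0)" by (rule lie_der_bad[OF _ \<alpha>]) (use False in \<open>simp add: good_def\<close>)
      moreover have "C \<alpha> (rho A \<beta> # Xs) = (\<lambda>p. 0)" by (rule forms_bad[OF Cf[OF \<alpha>]]) (use False in \<open>simp add: good_def\<close>)
      ultimately show ?thesis using v'1[OF False] by simp
    next
      case True
      let ?vb = "\<lambda>p. v p (\<beta> p)" and ?vab = "\<lambda>p. v p (br \<alpha> \<beta> p)"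
      note vb = v\<Gamma>[OF \<beta>] and vab = v\<Gamma>[OF ab] and b = rho_VF[OF \<beta>]
      \<comment> \<open>Compatibility for \<beta> and for [\<alpha>, \<beta>] replaces every
        covariant derivative in \<open>E\<close> by brackets; the Jacobi identity then leaves only
        the terms with \<open>v\<close>.\<close>
      have "C \<alpha> [rho A \<beta>] = (\<lambda>p. br \<alpha> ?vb p - ?vab p)"
      proof (rule br_eqI[OF C\<Gamma>[OF \<alpha>] \<Gamma>_diff[OF br_\<Gamma>[OF \<alpha> vb] vab]])
        fix \<xi> assume \<xi>: "\<xi> \<in> \<Gamma>"
        note \<xi>S = \<Gamma>S[OF \<xi>] and a\<xi> = br_\<Gamma>[OF \<alpha> \<xi>]
        have 1: "br \<alpha> (\<lambda>p. br \<beta> \<xi> p - br ?vb \<xi> p) = (\<lambda>p. br \<alpha> (br \<beta> \<xi>) p - br \<alpha> (br ?vb \<xi>) p)"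
          by (rule br_diff[OF \<alpha> br_S[OF \<beta> \<xi>S] br_S[OF \<Gamma>S[OF vb] \<xi>S]])
        have "E \<alpha> (rho A \<beta>) \<xi> = (\<lambda>p. br (br \<alpha> ?vb) \<xi> p - br ?vab \<xi> p)"
          unfolding E_def anchor_bracket[OF \<alpha> \<beta>, symmetric] cmp[OF \<beta> \<xi>] cmp[OF \<beta> a\<xi>] cmp[OF ab \<xi>] 1
            br_jacobi[OF \<alpha> \<beta> \<xi>S] br_jacobi[OF \<alpha> \<Gamma>S[OF vb] \<xi>S] by (intro ext) simp
        then show "br (C \<alpha> [rho A \<beta>]) \<xi> = br (\<lambda>p. br \<alpha> ?vb p - ?vab p) \<xi>"
          unfolding CE[OF \<alpha> b \<xi>] br_diff'[OF \<xi>S \<Gamma>S[OF br_\<Gamma>[OF \<alpha> vb]] \<Gamma>S[OF vab]] .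
      qed
      then show ?thesis using True by (simp add: v'0 \<beta> ab lie_der_def)
    qed
    show "v' \<beta> (rho A \<alpha> # Xs) p = - v' \<alpha> (rho A \<beta> # Xs) p" by (simp add: v'1)
  qed
  then have IM: "(C, v') \<in> IM_connections A K"
    unfolding IM_connections_def using v'0[OF \<Gamma>S] vK[OF \<Gamma>_K] by auto
  moreover have "bundle_map_of A v' = v"
  proof (intro ext)
    fix p u
    show "bundle_map_of A v' p u = v p u"
    proof (cases "u \<in> fibre A p")
      case True
      then obtain \<alpha> where \<alpha>: "\<alpha> \<in> S" "\<alpha> p = u" using full.section_through[OF True] sub_sections_fibre by metis
      show ?thesis using bm[OF IM \<alpha>(1), of p] v'0[OF \<alpha>(1)] \<alpha>(2) by simp
    qed (simp add: v0 bundle_map_of_def)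
  qed
  moreover have "induced_connection A K C = D"
  proof (intro ext)
    fix X \<xi> p
    have "C \<xi> [X] = D X \<xi>" if \<xi>: "\<xi> \<in> \<Gamma>" and X: "X \<in> VF"
      by (rule br_eqI[OF C\<Gamma>[OF \<Gamma>S[OF \<xi>]] D_\<Gamma>]) (simp add: CE[OF \<Gamma>S[OF \<xi>] X] E_\<Gamma>_section[OF \<xi> X])
    \<comment> \<open>The value zero off the proper domain is fixed for forms and for connections
      alike, so equality holds as total functions.\<close>
    moreover have "C \<xi> [X] = D X \<xi>" if \<xi>: "\<xi> \<in> \<Gamma>" and X: "X \<notin> VF"
      using forms_1_bad[OF Cf[OF \<Gamma>S[OF \<xi>]], of "[X]"] D_bad[of X \<xi>] X by auto
    ultimately show "induced_connection A K C X \<xi> p = D X \<xi> p"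
      using D_bad[of X \<xi>] by (cases "X \<in> VF") (auto simp: induced_connection_def)
  qed
  ultimately show thesis by (rule that)
qed

end

theorem proposition5p33:
  fixes A :: "('m::{t2_space,second_countable_topology}, 'a::real_vector) algebroid_data"
    and K :: "'m \<Rightarrow> 'a set"
  assumes "lie_algebroid A"
    and "bundle_of_ideals A K"
    and "semisimple_bundle A K"
  shows "(\<forall>q. bij_betw (delta0 A) (forms A K q) (IM_forms_hor A K q) \<and>
              (\<forall>\<gamma>\<in>forms A K q. \<forall>\<eta>\<in>forms A K q. \<forall>a b.
                 delta0 A (form_comb a \<gamma> b \<eta>) = cochain_comb a (delta0 A \<gamma>) b (delta0 A \<eta>)))
       \<and> (\<forall>c\<in>IM_connections A K.
              (\<exists>!F. is_curving A K c F) \<and>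
              (\<forall>F. is_curving A K c F \<longrightarrow> three_curvature A K c F = zero_form))
       \<and> bij_betw (\<lambda>(C, v). (bundle_map_of A v, induced_connection A K C))
              (IM_connections A K)
              {(v, D). splitting A K v \<and> linear_connection A K D \<and>
                       bracket_preserving A K D \<and> compatible A K v D}"
proof -
  interpret semisimple_ideal_bundle A K by unfold_locales (rule assms)+
  show ?thesis
  proof (intro conjI allI ballI impI)
    show "bij_betw (delta0 A) (forms A K q) (IM_forms_hor A K q)" for q by (rule delta0_bij)
    show "delta0 A (form_comb a \<gamma> b \<eta>) = cochain_comb a (delta0 A \<gamma>) b (delta0 A \<eta>)"
      if "\<gamma> \<in> forms A K q" "\<eta> \<in> forms A K q" for q \<gamma> \<eta> a b by (rule delta0_linear[OF that])
    fix c assume "c \<in> IM_connections A K"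
    then obtain C v where c: "c = (C, v)" and Cv: "(C, v) \<in> IM_connections A K" by (cases c) auto
    obtain F where F: "is_curving A K c F" "three_curvature A K c F = zero_form"
      using curving_exists[OF Cv] unfolding c by blast
    have uniq: "F' = F" if "is_curving A K c F'" for F'
      using curving_unique[OF Cv] F(1) that unfolding c by blast
    show "\<exists>!F. is_curving A K c F" using F(1) uniq by blast
    show "three_curvature A K c F' = zero_form" if "is_curving A K c F'" for F' using uniq[OF that] F(2) by simp
  next
    show "bij_betw (\<lambda>(C, v). (bundle_map_of A v, induced_connection A K C)) (IM_connections A K)
      {(v, D). splitting A K v \<and> linear_connection A K D \<and> bracket_preserving A K D \<and> compatible A K v D}"
      (is "bij_betw ?f _ ?P")
      unfolding bij_betw_def
    proof (intro conjI equalityI subsetI)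
      show "inj_on ?f (IM_connections A K)"
      proof (rule inj_onI, clarify)
        fix C v C' v' assume "(C, v) \<in> IM_connections A K" "(C', v') \<in> IM_connections A K"
          "bundle_map_of A v = bundle_map_of A v'" "induced_connection A K C = induced_connection A K C'"
        then show "C = C' \<and> v = v'" by (rule IM_connection_determined)
      qed
      fix x assume "x \<in> ?f ` IM_connections A K"
      then obtain C v where Cv: "(C, v) \<in> IM_connections A K" and x: "x = (bundle_map_of A v, induced_connection A K C)" by auto
      show "x \<in> ?P"
        unfolding x using bundle_map_splitting[OF Cv] induced_linear[OF Cv] induced_bracket_preserving[OF Cv]
          induced_compatible[OF Cv] by simp
    next
      fix x assume "x \<in> ?P"
      then obtain v D where x: "x = (v, D)" and vD: "splitting A K v" "linear_connection A K D" "bracket_preserving A K D" "compatible A K v D"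
        by auto
      obtain C v' where "(C, v') \<in> IM_connections A K" "bundle_map_of A v' = v" "induced_connection A K C = D"
        by (rule IM_connection_exists[OF vD])
      then show "x \<in> ?f ` IM_connections A K" unfolding x by (intro image_eqI[of _ _ "(C, v')"]) auto
    qed
  qed
qed

end
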